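(* Let $E_H:\hat S_H\to H^1_0(\Omega)$ be a linear operator such that, for all $\hat\sigma=(\sigma_{\mathcal M},\sigma_\Sigma)\in\hat S_H$, $$\int_K q\,(E_H\hat\sigma)=\int_K q\,\sigma_{\mathcal M}\qquad\text{and}\qquad\int_F r\,(E_H\hat\sigma)=\int_F r\,\sigma_\Sigma$$ for all $K\in\mathcal M$, $q\in\mathbb{P}_{p-1}(K)$ and all $F\in\mathcal F^i$, $r\in\mathbb{P}_p(F)$. Let $f\in H^{-1}(\Omega)$, let $u\in H^1_0(\Omega)$ be the solution of $\int_\Omega\nabla u\cdot\nabla w=\langle f,w\rangle_{H^{-1}(\Omega)\times H^1_0(\Omega)}$ for all $w\in H^1_0(\Omega)$, put $\hat u:=(u,u_{|\Sigma})\in\hat V$, and let $\hat U\in\hat S_H$ be the solution of $b_H(\hat U,\hat\sigma)=\langle f,E_H\hat\sigma\rangle_{H^{-1}(\Omega)\times H^1_0(\Omega)}$ for all $\hat\sigma\in\hat S_H$. Then $$|\hat u-\hat U|_{\tilde a_H}\le\sqrt{1+C_H^2}\ \inf_{\hat s\in\hat S_H}|\hat u-\hat s|_{\tilde a_H},$$ where $C_H$ is the smallest constant such that $$\|\nabla_{\mathcal M}(\mathcal R\hat\sigma-E_H\hat\sigma)\|_{L^2(\Omega)}\le C_H|\hat\sigma|_{\tilde a_H}\qquad\text{for all }\hat\sigma\in\hat S_H .$$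
   Context: **Mesh.** $\Omega\subseteq\mathbb{R}^d$, $d\in\{2,3\}$, is an open bounded polygonal/polyhedral set with Lipschitz boundary. $\mathcal M$ is a matching simplicial mesh of $\Omega$: a finite set of closed $d$-simplices covering $\overline\Omega$, such that the intersection of two distinct simplices is either empty or the convex hull of a set of common vertices. $\mathcal F^i$ is the set of interfaces ($F=K_1\cap K_2$ a full face of both $K_1,K_2\in\mathcal M$), $\mathcal F^b$ the set of boundary faces (faces of some $K\in\mathcal M$ contained in $\partial\Omega$), $\mathcal F=\mathcal F^i\cup\mathcal F^b$, $\Sigma=\bigcup_{F\in\mathcal F}F$ the skeleton, $\mathcal F_K$ the set of faces of $K$; $h_F$ is the diameter of $F$, $n_K$ the outer unit normal of $K$. $\nabla_{\mathcal M}$ is the element-wise (broken) gradient. **HHO space.** Let $p\in\mathbb{N}_0$. $\mathbb{P}_p(K)$, $\mathbb{P}_p(F)$ are polynomials of total degree $\le p$ ($\mathbb{P}_{-1}=\{0\}$); $\mathbb{P}_p(\mathcal M)$ is the space of functions on $\Omega$ that are in $\mathbb{P}_p(K)$ on each $K\in\mathcal M$; $\mathbb{P}_p(\Sigma)$ is the space of functions on $\Sigma$ that are in $\mathbb{P}_p(F)$ on each $F\in\mathcal F$ and vanish on each $F\in\mathcal F^b$. $\hat S_H:=\mathbb{P}_p(\mathcal M)\times\mathbb{P}_p(\Sigma)$, with elements $\hat s=(s_{\mathcal M},s_\Sigma)$. $\Pi_{\mathcal M}$ is the $L^2$-orthogonal projection onto $\mathbb{P}_p(\mathcal M)$; $\Pi_\Sigma$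 is the face-wise $L^2(F)$-orthogonal projection onto $\mathbb{P}_p(F)$. **Reconstruction, stabilization, bilinear form.** $\mathcal R:\hat S_H\to\mathbb{P}_{p+1}(\mathcal M)$ is defined, for all $K\in\mathcal M$, by $\int_K\nabla\mathcal R\hat s\cdot\nabla q=-\int_K s_{\mathcal M}\Delta q+\int_{\partial K}s_\Sigma\nabla q\cdot n_K$ for all $q\in\mathbb{P}_{p+1}(K)$, and $\int_K\mathcal R\hat s=\int_K s_{\mathcal M}$. Set $\mathcal S\hat s:=s_{\mathcal M}+(\mathrm{Id}-\Pi_{\mathcal M})\mathcal R\hat s$, $$\theta(\hat s,\hat\sigma):=\sum_{K\in\mathcal M}\sum_{F\in\mathcal F_K}h_F^{-1}\int_F\Pi_\Sigma(s_\Sigma-(\mathcal S\hat s)_{|K})\,\Pi_\Sigma(\sigma_\Sigma-(\mathcal S\hat\sigma)_{|K}),$$ $$b_H(\hat s,\hat\sigma):=\int_\Omega\nabla_{\mathcal M}\mathcal R\hat s\cdot\nabla_{\mathcal M}\mathcal R\hat\sigma+\theta(\hat s,\hat\sigma).$$ It is known that $b_H$ is positive definite on $\hat S_H$, so the discrete problem is uniquely solvable. **Extended form.** $\hat V:=\{\hat v=(v_{\mathcal M},v_\Sigma): v_{\mathcal M}\in H^1_0(\Omega),\ v_\Sigma=(v_{\mathcal M})_{|\Sigma}\}$. On $\hat V+\hat S_H$ (a sum of subspaces of $L^2(\Omega)\times L^2(\Sigma)$) the following symmetric bilinear form is well defined: $$\tilde a_H(\hat v+\hat s,\hat w+\hat\sigma):=\int_\Omega\nabla_{\mathcal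 M}(v_{\mathcal M}+\mathcal R\hat s)\cdot\nabla_{\mathcal M}(w_{\mathcal M}+\mathcal R\hat\sigma)+\theta(\hat s,\hat\sigma),\qquad\hat v,\hat w\in\hat V,\ \hat s,\hat\sigma\in\hat S_H,$$ and $|\cdot|_{\tilde a_H}:=\sqrt{\tilde a_H(\cdot,\cdot)}$ is the induced semi-norm. *)

theory Defs
  imports "HOL-Analysis.Analysis" "HOL-Library.Function_Algebras"
begin

section \<open>Lebesgue and Sobolev spaces\<close>

text \<open>
  Elements of the function spaces below are represented by functions on the whole of
  \<open>real^'d\<close>; only their values on the set in question, up to null sets, matter.
\<close>

definition L2 :: "'a measure \<Rightarrow> ('a \<Rightarrow> 'b::euclidean_space) \<Rightarrow> bool" where
  "L2 N v \<longleftrightarrow> v \<in> borel_measurable N \<and> integrable N (\<lambda>x. (norm (v x))\<^sup>2)"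

definition L2_norm :: "'a measure \<Rightarrow> ('a \<Rightarrow> 'b::euclidean_space) \<Rightarrow> real" where
  "L2_norm N v = sqrt (\<integral>x. (norm (v x))\<^sup>2 \<partial>N)"

text \<open>The projection of \<open>v\<close> onto \<open>W\<close>: the element of \<open>W\<close> whose residual is orthogonal to \<open>W\<close>.\<close>

definition L2_proj :: "'a measure \<Rightarrow> ('a \<Rightarrow> real) set \<Rightarrow> ('a \<Rightarrow> real) \<Rightarrow> 'a \<Rightarrow> real" where
  "L2_proj N W v = (THE r. r \<in> W \<and> (\<forall>q\<in>W. (\<integral>x. (v x - r x) * q x \<partial>N) = 0))"

definition gradient :: "(real^'d \<Rightarrow> real) \<Rightarrow> real^'d \<Rightarrow> real^'d" where
  "gradient v x = (THE g. gderiv v x g)"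

definition laplacian :: "(real^'d \<Rightarrow> real) \<Rightarrow> real^'d \<Rightarrow> real" where
  "laplacian v x = (\<Sum>i\<in>UNIV. gradient (\<lambda>y. gradient v y $ i) x $ i)"

primrec Ck :: "nat \<Rightarrow> (real^'d \<Rightarrow> real) \<Rightarrow> bool" where
  "Ck 0 v \<longleftrightarrow> continuous_on UNIV v"
| "Ck (Suc k) v \<longleftrightarrow>
     (\<exists>g :: real^'d \<Rightarrow> real^'d. (\<forall>x. gderiv v x (g x)) \<and> (\<forall>i. Ck k (\<lambda>x. g x $ i)))"

definition test_functions :: "(real^'d) set \<Rightarrow> (real^'d \<Rightarrow> real) set" where
  "test_functions \<Omega> =
     {\<phi>. (\<forall>k. Ck k \<phi>) \<and> compact (closure {x. \<phi> x \<noteq> 0}) \<and> closure {x. \<phi> x \<noteq> 0} \<subseteq> \<Omega>}"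

definition is_weak_grad ::
  "(real^'d) set \<Rightarrow> (real^'d \<Rightarrow> real) \<Rightarrow> (real^'d \<Rightarrow> real^'d) \<Rightarrow> bool" where
  "is_weak_grad \<Omega> v g \<longleftrightarrow> L2 (lebesgue_on \<Omega>) g \<and>
     (\<forall>\<phi>\<in>test_functions \<Omega>.
        (\<integral>x. v x *\<^sub>R gradient \<phi> x \<partial>lebesgue_on \<Omega>) = - (\<integral>x. \<phi> x *\<^sub>R g x \<partial>lebesgue_on \<Omega>))"

text \<open>The weak gradient is unique up to null sets; this picks a representative.\<close>

definition weak_grad :: "(real^'d) set \<Rightarrow> (real^'d \<Rightarrow> real) \<Rightarrow> real^'d \<Rightarrow> real^'d" where
  "weak_grad \<Omega> v = (SOME g. is_weak_grad \<Omega> v g)"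

definition H1 :: "(real^'d) set \<Rightarrow> (real^'d \<Rightarrow> real) set" where
  "H1 \<Omega> = {v. L2 (lebesgue_on \<Omega>) v \<and> (\<exists>g. is_weak_grad \<Omega> v g)}"

definition H1_norm :: "(real^'d) set \<Rightarrow> (real^'d \<Rightarrow> real) \<Rightarrow> real" where
  "H1_norm \<Omega> v =
     sqrt ((L2_norm (lebesgue_on \<Omega>) v)\<^sup>2 + (L2_norm (lebesgue_on \<Omega>) (weak_grad \<Omega> v))\<^sup>2)"

text \<open>The closure of the test functions in \<open>H1 \<Omega>\<close>.\<close>

definition H10 :: "(real^'d) set \<Rightarrow> (real^'d \<Rightarrow> real) set" where
  "H10 \<Omega> = {v \<in> H1 \<Omega>. \<exists>\<phi>. (\<forall>n. \<phi> n \<in> test_functions \<Omega>) \<and>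
                          (\<lambda>n::nat. H1_norm \<Omega> (v - \<phi> n)) \<longlonglongrightarrow> 0}"

text \<open>\<open>H\<^sup>-\<^sup>1\<close>, the bounded linear functionals on \<open>H10 \<Omega>\<close>.\<close>

definition Hm1 :: "(real^'d) set \<Rightarrow> ((real^'d \<Rightarrow> real) \<Rightarrow> real) set" where
  "Hm1 \<Omega> = {f.
     (\<forall>v\<in>H10 \<Omega>. \<forall>w\<in>H10 \<Omega>. f (v + w) = f v + f w) \<and>
     (\<forall>c. \<forall>v\<in>H10 \<Omega>. f (\<lambda>x. c * v x) = c * f v) \<and>
     (\<exists>C. \<forall>v\<in>H10 \<Omega>. \<bar>f v\<bar> \<le> C * H1_norm \<Omega> v)}"

section \<open>Domain and mesh\<close>

text \<open>
  Near each boundary point the domain is, in the direction of some unit vector \<open>e\<close>, the strict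
  epigraph of a Lipschitz function of the coordinates orthogonal to \<open>e\<close>.
\<close>

definition lipschitz_boundary :: "(real^'d) set \<Rightarrow> bool" where
  "lipschitz_boundary \<Omega> \<longleftrightarrow>
     (\<forall>x\<in>frontier \<Omega>. \<exists>U e L \<gamma>. open U \<and> x \<in> U \<and> norm e = 1 \<and> L-lipschitz_on UNIV \<gamma> \<and>
        \<Omega> \<inter> U = {y\<in>U. \<gamma> (y - (y \<bullet> e) *\<^sub>R e) < y \<bullet> e})"

definition polyhedral :: "(real^'d) set \<Rightarrow> bool" where
  "polyhedral \<Omega> \<longleftrightarrow> (\<exists>P. finite P \<and> (\<forall>Q\<in>P. polytope Q) \<and> closure \<Omega> = \<Union>P)"

definition polyhedral_domain :: "(real^'d) set \<Rightarrow> bool" where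
  "polyhedral_domain \<Omega> \<longleftrightarrow> open \<Omega> \<and> bounded \<Omega> \<and> polyhedral \<Omega> \<and> lipschitz_boundary \<Omega>"

definition matching_mesh :: "(real^'d) set \<Rightarrow> (real^'d) set set \<Rightarrow> bool" where
  "matching_mesh \<Omega> M \<longleftrightarrow> finite M \<and> (\<forall>K\<in>M. (int CARD('d)) simplex K) \<and> \<Union>M = closure \<Omega> \<and>
     (\<forall>K1\<in>M. \<forall>K2\<in>M. K1 \<noteq> K2 \<longrightarrow>
        K1 \<inter> K2 = {} \<or>
        (\<exists>V. V \<subseteq> {v. v extreme_point_of K1} \<inter> {v. v extreme_point_of K2} \<and>
             K1 \<inter> K2 = convex hull V))"

definition faces_of :: "(real^'d) set \<Rightarrow> (real^'d) set set" where
  "faces_of K = {F. F facet_of K}"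

definition interfaces :: "(real^'d) set set \<Rightarrow> (real^'d) set set" where
  "interfaces M = {F. \<exists>K1\<in>M. \<exists>K2\<in>M. K1 \<noteq> K2 \<and> F = K1 \<inter> K2 \<and>
                       F \<in> faces_of K1 \<and> F \<in> faces_of K2}"

definition boundary_faces :: "(real^'d) set \<Rightarrow> (real^'d) set set \<Rightarrow> (real^'d) set set" where
  "boundary_faces \<Omega> M = {F. \<exists>K\<in>M. F \<in> faces_of K \<and> F \<subseteq> frontier \<Omega>}"

definition mesh_faces :: "(real^'d) set \<Rightarrow> (real^'d) set set \<Rightarrow> (real^'d) set set" where
  "mesh_faces \<Omega> M = interfaces M \<union> boundary_faces \<Omega> M"

text \<open>
  The \<open>(d-1)\<close>-dimensional Lebesgue measure on a flat face \<open>F\<close>: the measure of \<open>A \<subseteq> F\<close> is the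
  \<open>d\<close>-dimensional volume of the right prism of height one over \<open>A\<close>. Neither the orientation of
  the chosen normal nor the chosen point of \<open>F\<close> matters.
\<close>

definition face_normal :: "(real^'d) set \<Rightarrow> real^'d" where
  "face_normal F = (SOME n. norm n = 1 \<and> (\<forall>x\<in>F. \<forall>y\<in>F. (y - x) \<bullet> n = 0))"

definition face_measure :: "(real^'d) set \<Rightarrow> (real^'d) measure" where
  "face_measure F =
     (let n = face_normal F; a = (SOME a. a \<in> F)
      in distr (lebesgue_on {x + t *\<^sub>R n |x t. x \<in> F \<and> 0 \<le> t \<and> t \<le> 1})
               (restrict_space borel F)
               (\<lambda>y. y - ((y - a) \<bullet> n) *\<^sub>R n))"

definition outer_normal :: "(real^'d) set \<Rightarrow> (real^'d) set \<Rightarrow> real^'d" where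
  "outer_normal K F = (THE n. norm n = 1 \<and> (\<forall>x\<in>F. \<forall>y\<in>F. (y - x) \<bullet> n = 0) \<and>
                              (\<forall>x\<in>F. \<forall>y\<in>K. (y - x) \<bullet> n \<le> 0))"

text \<open>The element-wise gradient; its (irrelevant) value on the skeleton is set to zero.\<close>

definition broken_grad :: "(real^'d) set set \<Rightarrow> (real^'d \<Rightarrow> real) \<Rightarrow> real^'d \<Rightarrow> real^'d" where
  "broken_grad M v x =
     (if \<exists>K\<in>M. x \<in> interior K then weak_grad (interior (THE K. K \<in> M \<and> x \<in> interior K)) v x else 0)"

text \<open>
  Traces on the skeleton of functions in \<open>H10 \<Omega>\<close>: the continuous extension, from the test
  functions to \<open>H10 \<Omega>\<close>, of the restriction to the skeleton, with values in \<open>L\<^sup>2\<close> of the skeleton.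
\<close>

definition is_trace ::
  "(real^'d) set \<Rightarrow> (real^'d) set set \<Rightarrow> (real^'d \<Rightarrow> real) \<Rightarrow> (real^'d \<Rightarrow> real) \<Rightarrow> bool" where
  "is_trace \<Omega> M v g \<longleftrightarrow> (\<forall>F\<in>mesh_faces \<Omega> M. L2 (face_measure F) g) \<and>
     (\<exists>\<phi>. (\<forall>n. \<phi> n \<in> test_functions \<Omega>) \<and> (\<lambda>n::nat. H1_norm \<Omega> (v - \<phi> n)) \<longlonglongrightarrow> 0 \<and>
          (\<forall>F\<in>mesh_faces \<Omega> M. (\<lambda>n. L2_norm (face_measure F) (g - \<phi> n)) \<longlonglongrightarrow> 0))"

definition skeleton_trace ::
  "(real^'d) set \<Rightarrow> (real^'d) set set \<Rightarrow> (real^'d \<Rightarrow> real) \<Rightarrow> real^'d \<Rightarrow> real" where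
  "skeleton_trace \<Omega> M v = (SOME g. is_trace \<Omega> M v g)"

section \<open>Polynomials and the HHO space\<close>

text \<open>
  Polynomials of total degree at most \<open>k\<close>; the degree is an integer so that \<open>poly_space (- 1)\<close>
  is the zero space.
\<close>

definition poly_space :: "int \<Rightarrow> (real^'d \<Rightarrow> real) set" where
  "poly_space k = {q. \<exists>c. q = (\<lambda>x. \<Sum>\<alpha>\<in>{\<alpha> :: 'd \<Rightarrow> nat. int (\<Sum>i\<in>UNIV. \<alpha> i) \<le> k}.
                                  c \<alpha> * (\<Prod>i\<in>UNIV. x $ i ^ \<alpha> i))}"

definition poly_on :: "(real^'d) set \<Rightarrow> int \<Rightarrow> (real^'d \<Rightarrow> real) set" where
  "poly_on A k = {r. \<exists>q\<in>poly_space k. r = (\<lambda>x. if x \<in> A then q x else 0)}"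

text \<open>
  Piecewise polynomials are only determined up to null sets. The representatives used here vanish
  outside the interiors of the elements and outside the relative interiors of the faces,
  respectively, so that equality in the space is equality of functions.
\<close>

definition broken_poly :: "(real^'d) set set \<Rightarrow> int \<Rightarrow> (real^'d \<Rightarrow> real) set" where
  "broken_poly M k = {v. (\<forall>K\<in>M. \<exists>q\<in>poly_space k. \<forall>x\<in>interior K. v x = q x) \<and>
                         (\<forall>x. x \<notin> (\<Union>K\<in>M. interior K) \<longrightarrow> v x = 0)}"

definition skeleton_poly ::
  "(real^'d) set \<Rightarrow> (real^'d) set set \<Rightarrow> int \<Rightarrow> (real^'d \<Rightarrow> real) set" where
  "skeleton_poly \<Omega> M k =
     {v. (\<forall>F\<in>mesh_faces \<Omega> M. \<exists>q\<in>poly_space k. \<forall>x\<in>rel_interior F. v x = q x) \<and>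
         (\<forall>F\<in>boundary_faces \<Omega> M. \<forall>x\<in>rel_interior F. v x = 0) \<and>
         (\<forall>x. x \<notin> (\<Union>F\<in>mesh_faces \<Omega> M. rel_interior F) \<longrightarrow> v x = 0)}"

type_synonym 'd hybrid = "(real^'d \<Rightarrow> real) \<times> (real^'d \<Rightarrow> real)"

definition hho_space :: "(real^'d) set \<Rightarrow> (real^'d) set set \<Rightarrow> nat \<Rightarrow> 'd hybrid set" where
  "hho_space \<Omega> M p = broken_poly M (int p) \<times> skeleton_poly \<Omega> M (int p)"

definition hscale :: "real \<Rightarrow> 'd hybrid \<Rightarrow> 'd hybrid" where
  "hscale c s = (\<lambda>x. c * fst s x, \<lambda>x. c * snd s x)"

definition hho_reconstruction ::
  "(real^'d) set set \<Rightarrow> nat \<Rightarrow> 'd hybrid \<Rightarrow> real^'d \<Rightarrow> real" where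
  "hho_reconstruction M p s = (THE r. r \<in> broken_poly M (int p + 1) \<and>
     (\<forall>K\<in>M.
        (\<forall>q\<in>poly_space (int p + 1).
           (\<integral>x. gradient r x \<bullet> gradient q x \<partial>lebesgue_on K) =
             - (\<integral>x. fst s x * laplacian q x \<partial>lebesgue_on K)
             + (\<Sum>F\<in>faces_of K. \<integral>x. snd s x * (gradient q x \<bullet> outer_normal K F) \<partial>face_measure F)) \<and>
        (\<integral>x. r x \<partial>lebesgue_on K) = (\<integral>x. fst s x \<partial>lebesgue_on K)))"

definition hho_S ::
  "(real^'d) set \<Rightarrow> (real^'d) set set \<Rightarrow> nat \<Rightarrow> 'd hybrid \<Rightarrow> real^'d \<Rightarrow> real" where
  "hho_S \<Omega> M p s = (let r = hho_reconstruction M p s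
     in fst s + (r - L2_proj (lebesgue_on \<Omega>) (broken_poly M (int p)) r))"

text \<open>The trace from inside \<open>K\<close> of a piecewise continuous function.\<close>

definition trace_from :: "(real^'d) set \<Rightarrow> (real^'d \<Rightarrow> real) \<Rightarrow> real^'d \<Rightarrow> real" where
  "trace_from K v x = Lim (at x within interior K) v"

definition hho_residual ::
  "(real^'d) set \<Rightarrow> (real^'d) set set \<Rightarrow> nat \<Rightarrow> (real^'d) set \<Rightarrow> (real^'d) set \<Rightarrow> 'd hybrid
     \<Rightarrow> real^'d \<Rightarrow> real" where
  "hho_residual \<Omega> M p K F s =
     L2_proj (face_measure F) (poly_on F (int p)) (snd s - trace_from K (hho_S \<Omega> M p s))"

definition hho_theta ::
  "(real^'d) set \<Rightarrow> (real^'d) set set \<Rightarrow> nat \<Rightarrow> 'd hybrid \<Rightarrow> 'd hybrid \<Rightarrow> real" where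
  "hho_theta \<Omega> M p s t = (\<Sum>K\<in>M. \<Sum>F\<in>faces_of K.
     inverse (diameter F) *
     (\<integral>x. hho_residual \<Omega> M p K F s x * hho_residual \<Omega> M p K F t x \<partial>face_measure F))"

definition hho_form ::
  "(real^'d) set \<Rightarrow> (real^'d) set set \<Rightarrow> nat \<Rightarrow> 'd hybrid \<Rightarrow> 'd hybrid \<Rightarrow> real" where
  "hho_form \<Omega> M p s t =
     (\<integral>x. broken_grad M (hho_reconstruction M p s) x \<bullet>
          broken_grad M (hho_reconstruction M p t) x \<partial>lebesgue_on \<Omega>)
     + hho_theta \<Omega> M p s t"

section \<open>The extended form\<close>

definition V_hat :: "(real^'d) set \<Rightarrow> (real^'d) set set \<Rightarrow> 'd hybrid set" where
  "V_hat \<Omega> M = {(v, skeleton_trace \<Omega> M v) |v. v \<in> H10 \<Omega>}"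

text \<open>Equality in \<open>L\<^sup>2\<close> of the domain times \<open>L\<^sup>2\<close> of the skeleton.\<close>

definition hybrid_eq ::
  "(real^'d) set \<Rightarrow> (real^'d) set set \<Rightarrow> 'd hybrid \<Rightarrow> 'd hybrid \<Rightarrow> bool" where
  "hybrid_eq \<Omega> M x y \<longleftrightarrow> (AE z in lebesgue_on \<Omega>. fst x z = fst y z) \<and>
     (\<forall>F\<in>mesh_faces \<Omega> M. AE z in face_measure F. snd x z = snd y z)"

text \<open>
  On the sum of \<open>V_hat\<close> and \<open>hho_space\<close>: the value computed from any decompositions of the two
  arguments, on which it does not depend.
\<close>

definition ext_form ::
  "(real^'d) set \<Rightarrow> (real^'d) set set \<Rightarrow> nat \<Rightarrow> 'd hybrid \<Rightarrow> 'd hybrid \<Rightarrow> real" where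
  "ext_form \<Omega> M p x y = (THE c.
     \<exists>v\<in>V_hat \<Omega> M. \<exists>s\<in>hho_space \<Omega> M p. \<exists>w\<in>V_hat \<Omega> M. \<exists>t\<in>hho_space \<Omega> M p.
       hybrid_eq \<Omega> M x (v + s) \<and> hybrid_eq \<Omega> M y (w + t) \<and>
       c = (\<integral>z. broken_grad M (fst v + hho_reconstruction M p s) z \<bullet>
                broken_grad M (fst w + hho_reconstruction M p t) z \<partial>lebesgue_on \<Omega>)
           + hho_theta \<Omega> M p s t)"

definition ext_norm ::
  "(real^'d) set \<Rightarrow> (real^'d) set set \<Rightarrow> nat \<Rightarrow> 'd hybrid \<Rightarrow> real" where
  "ext_norm \<Omega> M p x = sqrt (ext_form \<Omega> M p x x)"

section \<open>The smoothing operator\<close>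

text \<open>Linearity is understood in \<open>H10 \<Omega>\<close>, that is, up to null sets.\<close>

definition linear_smoother ::
  "(real^'d) set \<Rightarrow> (real^'d) set set \<Rightarrow> nat \<Rightarrow> ('d hybrid \<Rightarrow> real^'d \<Rightarrow> real) \<Rightarrow> bool" where
  "linear_smoother \<Omega> M p E \<longleftrightarrow>
     (\<forall>s\<in>hho_space \<Omega> M p. E s \<in> H10 \<Omega>) \<and>
     (\<forall>s\<in>hho_space \<Omega> M p. \<forall>t\<in>hho_space \<Omega> M p.
        AE x in lebesgue_on \<Omega>. E (s + t) x = E s x + E t x) \<and>
     (\<forall>c. \<forall>s\<in>hho_space \<Omega> M p. AE x in lebesgue_on \<Omega>. E (hscale c s) x = c * E s x)"

definition preserves_moments ::
  "(real^'d) set \<Rightarrow> (real^'d) set set \<Rightarrow> nat \<Rightarrow> ('d hybrid \<Rightarrow> real^'d \<Rightarrow> real) \<Rightarrow> bool" where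
  "preserves_moments \<Omega> M p E \<longleftrightarrow> (\<forall>s\<in>hho_space \<Omega> M p.
     (\<forall>K\<in>M. \<forall>q\<in>poly_space (int p - 1).
        (\<integral>x. q x * E s x \<partial>lebesgue_on K) = (\<integral>x. q x * fst s x \<partial>lebesgue_on K)) \<and>
     (\<forall>F\<in>interfaces M. \<forall>r\<in>poly_on F (int p).
        (\<integral>x. r x * skeleton_trace \<Omega> M (E s) x \<partial>face_measure F) = (\<integral>x. r x * snd s x \<partial>face_measure F)))"

definition consistency_bounds ::
  "(real^'d) set \<Rightarrow> (real^'d) set set \<Rightarrow> nat \<Rightarrow> ('d hybrid \<Rightarrow> real^'d \<Rightarrow> real) \<Rightarrow> real set" where
  "consistency_bounds \<Omega> M p E = {C. 0 \<le> C \<and> (\<forall>s\<in>hho_space \<Omega> M p.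
     L2_norm (lebesgue_on \<Omega>) (broken_grad M (hho_reconstruction M p s - E s))
       \<le> C * ext_norm \<Omega> M p s)}"

end

theory Submission
  imports Defs
begin

text \<open>
  Put \<open>\<sigma> = s - U\<close>. Since \<open>E\<close> preserves moments, Green's formula shows that \<open>R \<sigma>\<close> is the elliptic
  projection of \<open>E \<sigma>\<close>, so that \<open>\<nabla>(R \<sigma> - E \<sigma>)\<close> is orthogonal to all broken gradients of polynomials of
  degree \<open>p + 1\<close>. Together with the two variational problems this turns the cross term in
  \<open>|u - U|\<^sup>2 = |u - s|\<^sup>2 + 2 X - |\<sigma>|\<^sup>2\<close> into \<open>X = (\<nabla>(u - R s), \<nabla>(R \<sigma> - E \<sigma>))\<close>, which is at most
  \<open>C |u - s| |\<sigma>|\<close>; completing the square gives the factor \<open>1 + C\<^sup>2\<close>.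

  The extended form is well defined because an element of the HHO space that coincides with a conforming
  function and its trace is reproduced by the reconstruction and is not seen by the stabilization. This
  rests on Green's formula for traces on polytopes, which is derived from the divergence theorem;
  the latter follows by integrating the gradient of \<open>\<psi> \<chi>\<close> for a Lipschitz cut-off \<open>\<chi>\<close> of \<open>K\<close> whose
  boundary layer shrinks to \<open>the boundary\<close>.
\<close>

text \<open>The orthogonality is what makes this a best-approximation estimate. The two problems
  alone give X = (\<nabla>u, \<nabla>(R \<sigma> - E \<sigma>)), a term of the size of u; as R s is
  itself a broken polynomial of degree p + 1, it may be subtracted from u at no cost, and the error
  of s appears instead. The bulk of the work lies elsewhere. The extended form, the reconstruction,
  the projections and the traces are definite descriptions or choices, so each must be shown to
  denote. The delicate case is the form, whose conforming and discrete summands overlap in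
  conforming piecewise polynomials. For those the stabilization has to vanish, which requires that
  the Sobolev trace on a face be the limit of the polynomial from inside the element; this forces a
  trace theory. Surface measure is the volume of a prism of height one. Accordingly a boundary layer
  of width \<epsilon> is stretched in the normal direction until it becomes such a prism, which
  needs a change of variables along an arbitrary direction and hence rotation invariance of Lebesgue
  measure.\<close>

section \<open>Square integrable functions\<close>

text \<open>A quadratic bounded below cannot have negative \<open>c\<close>; for
  \<open>c = 0\<close> it is affine and must be constant, and otherwise its value at the minimiser
  \<open>- b / c\<close> is \<open>a - b\<^sup>2 / c\<close>. Since no definiteness is assumed, the
  same Cauchy-Schwarz argument serves semidefinite forms later.\<close>

lemma discriminant_nonpos:
  fixes a b c :: real
  assumes nonneg: "\<And>t. 0 \<le> a + 2 * t * b + t\<^sup>2 * c"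
  shows "b\<^sup>2 \<le> a * c"
proof (cases "c = 0")
  case True
  have "b = 0"
  proof (rule ccontr)
    assume "b \<noteq> 0"
    then have "a + 2 * (- (a + 1) / (2 * b)) * b = -1" by (simp add: field_simps)
    with nonneg[of "- (a + 1) / (2 * b)"] True show False by simp
  qed
  with True show ?thesis by simp
next
  case False
  have "c > 0"
  proof (rule ccontr)
    assume "\<not> c > 0"
    with False have "c < 0" by simp
    \<comment> \<open>Large enough that \<open>t * \<bar>c\<bar>\<close> dominates the other
      coefficients; the final summand secures \<open>t \<ge> 1\<close>, so that the negative
      quadratic term outweighs the rest.\<close>
    define t where "t = (\<bar>a\<bar> + 2 * \<bar>b\<bar> + 1) / \<bar>c\<bar> + 1"
    have t: "t \<ge> 1" by (simp add: t_def)
    have "t * \<bar>c\<bar> \<ge> \<bar>a\<bar> + 2 * \<bar>b\<bar> + 1" using \<open>c < 0\<close> by (simp add: t_def field_simps)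
    then have "t * (t * \<bar>c\<bar>) \<ge> t * (\<bar>a\<bar> + 2 * \<bar>b\<bar> + 1)" using t by (intro mult_left_mono) auto
    moreover have "t * (\<bar>a\<bar> + 2 * \<bar>b\<bar> + 1) \<ge> \<bar>a\<bar> + 1 + 2 * t * \<bar>b\<bar>"
    proof -
      have "t * (\<bar>a\<bar> + 1) \<ge> \<bar>a\<bar> + 1" using t by (simp add: mult_le_cancel_right1)
      then show ?thesis by (simp add: algebra_simps)
    qed
    moreover have "2 * t * b \<le> 2 * t * \<bar>b\<bar>" using t by (intro mult_left_mono) auto
    ultimately show False using nonneg[of t] \<open>c < 0\<close> by (simp add: power2_eq_square algebra_simps)
  qed
  then have "a + 2 * (- b / c) * b + (- b / c)\<^sup>2 * c = a - b\<^sup>2 / c"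
    by (simp add: field_simps power2_eq_square)
  with nonneg[of "- b / c"] have "b\<^sup>2 / c \<le> a" by simp
  with \<open>c > 0\<close> show ?thesis by (simp add: field_simps)
qed

lemma L2_measurable: "L2 N f \<Longrightarrow> f \<in> borel_measurable N"
  by (simp add: L2_def)

lemma L2_integrable_sq: "L2 N f \<Longrightarrow> integrable N (\<lambda>x. (norm (f x))\<^sup>2)"
  by (simp add: L2_def)

lemma L2_integrable_norm_mult:
  assumes "L2 N f" "L2 N g"
  shows "integrable N (\<lambda>x. norm (f x) * norm (g x))"
proof (rule Bochner_Integration.integrable_bound)
  show "integrable N (\<lambda>x. (norm (f x))\<^sup>2 + (norm (g x))\<^sup>2)"
    using assms by (intro Bochner_Integration.integrable_add L2_integrable_sq)
  show "(\<lambda>x. norm (f x) * norm (g x)) \<in> borel_measurable N"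
    using assms[THEN L2_measurable] by measurable
  have "\<bar>a * b\<bar> \<le> a\<^sup>2 + b\<^sup>2" for a b :: real
  proof -
    have "0 \<le> \<bar>a\<bar> * \<bar>b\<bar>" by simp
    then show ?thesis using sum_squares_bound[of "\<bar>a\<bar>" "\<bar>b\<bar>"] unfolding abs_mult power2_abs by linarith
  qed
  from this[of "norm (f _)" "norm (g _)"]
  show "AE x in N. norm (norm (f x) * norm (g x)) \<le> norm ((norm (f x))\<^sup>2 + (norm (g x))\<^sup>2)"
    by (intro AE_I2) simp
qed

lemma L2_integrable_inner:
  assumes "L2 N f" "L2 N g"
  shows "integrable N (\<lambda>x. f x \<bullet> g x)"
  by (rule Bochner_Integration.integrable_bound[OF L2_integrable_norm_mult[OF assms]])
     (use assms[THEN L2_measurable] Cauchy_Schwarz_ineq2 in \<open>auto simp: abs_mult\<close>)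

lemma L2_integrable_scaleR:
  fixes f :: "'a \<Rightarrow> real"
  assumes "L2 N f" "L2 N g"
  shows "integrable N (\<lambda>x. f x *\<^sub>R g x)"
  by (rule Bochner_Integration.integrable_bound[OF L2_integrable_norm_mult[OF assms]])
     (use assms[THEN L2_measurable] in \<open>auto simp: abs_mult\<close>)

lemma L2_integrable_mult:
  fixes f g :: "'a \<Rightarrow> real"
  assumes "L2 N f" "L2 N g"
  shows "integrable N (\<lambda>x. f x * g x)"
  using L2_integrable_inner[OF assms] by simp

lemma L2_scaleR [intro]: "L2 N f \<Longrightarrow> L2 N (\<lambda>x. c *\<^sub>R f x)"
  by (auto simp: L2_def power_mult_distrib)

lemma L2_add [intro]:
  assumes "L2 N f" "L2 N g"
  shows "L2 N (\<lambda>x. f x + g x)"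
  unfolding L2_def
proof
  show m: "(\<lambda>x. f x + g x) \<in> borel_measurable N"
    using assms[THEN L2_measurable] by measurable
  have "integrable N (\<lambda>x. (norm (f x))\<^sup>2 + 2 * (f x \<bullet> g x) + (norm (g x))\<^sup>2)"
    using assms L2_integrable_inner[OF assms]
    by (intro Bochner_Integration.integrable_add L2_integrable_sq integrable_mult_right) auto
  then show "integrable N (\<lambda>x. (norm (f x + g x))\<^sup>2)"
    by (simp add: power2_norm_eq_inner algebra_simps inner_commute)
qed

lemma L2_mult_left [intro]: "L2 N f \<Longrightarrow> L2 N (\<lambda>x. c * f x :: real)"
  using L2_scaleR[of N f c] by simp

lemma L2_minus [intro]: "L2 N f \<Longrightarrow> L2 N (\<lambda>x. - f x)"
  by (auto simp: L2_def)

lemma L2_diff [intro]: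
  assumes "L2 N f" "L2 N g"
  shows "L2 N (\<lambda>x. f x - g x)"
  using L2_add[OF assms(1) L2_minus[OF assms(2)]] by simp

lemma L2_zero [intro, simp]: "L2 N (\<lambda>x. 0)"
  by (simp add: L2_def)

lemma L2_plus_fun: "L2 N f \<Longrightarrow> L2 N g \<Longrightarrow> L2 N (f + g)"
  using L2_add[of N f g] by (simp add: plus_fun_def)

lemma L2_minus_fun: "L2 N f \<Longrightarrow> L2 N g \<Longrightarrow> L2 N (f - g)"
  using L2_diff[of N f g] by (simp add: fun_diff_def)

lemma L2_inner_const: "L2 N f \<Longrightarrow> L2 N (\<lambda>x. f x \<bullet> e)"
proof -
  assume f: "L2 N f"
  show ?thesis unfolding L2_def
  proof
    show m: "(\<lambda>x. f x \<bullet> e) \<in> borel_measurable N"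
      using L2_measurable[OF f] by measurable
    show "integrable N (\<lambda>x. (norm (f x \<bullet> e))\<^sup>2)"
    proof (rule Bochner_Integration.integrable_bound)
      show "integrable N (\<lambda>x. (norm (f x))\<^sup>2 * (norm e)\<^sup>2)"
        using f by (intro integrable_mult_left L2_integrable_sq) auto
      show "(\<lambda>x. (norm (f x \<bullet> e))\<^sup>2) \<in> borel_measurable N" using m by measurable
      show "AE x in N. norm ((norm (f x \<bullet> e))\<^sup>2) \<le> norm ((norm (f x))\<^sup>2 * (norm e)\<^sup>2)"
      proof (rule AE_I2)
        fix x
        have "\<bar>f x \<bullet> e\<bar>\<^sup>2 \<le> (norm (f x) * norm e)\<^sup>2"
          by (intro power_mono Cauchy_Schwarz_ineq2) simp
        then show "norm ((norm (f x \<bullet> e))\<^sup>2) \<le> norm ((norm (f x))\<^sup>2 * (norm e)\<^sup>2)"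
          by (simp add: power_mult_distrib)
      qed
    qed
  qed
qed

lemma L2_integrable_finite:
  fixes f :: "'a \<Rightarrow> 'b :: euclidean_space"
  assumes "finite_measure N" "L2 N f"
  shows "integrable N f"
proof -
  interpret finite_measure N by fact
  have "L2 N (\<lambda>x. 1 :: real)" by (simp add: L2_def)
  from L2_integrable_scaleR[OF this assms(2)] show ?thesis by simp
qed

lemma L2_bounded:
  fixes f :: "'a \<Rightarrow> 'b :: euclidean_space"
  assumes "finite_measure N" "f \<in> borel_measurable N" "AE x in N. norm (f x) \<le> B"
  shows "L2 N f"
proof -
  interpret finite_measure N by fact
  have "integrable N (\<lambda>x. (norm (f x))\<^sup>2)"
  proof (rule integrable_const_bound[where B = "B\<^sup>2"])
    show "AE x in N. norm ((norm (f x))\<^sup>2) \<le> B\<^sup>2"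
      using assms(3) by eventually_elim (simp add: power_mono)
    show "(\<lambda>x. (norm (f x))\<^sup>2) \<in> borel_measurable N" using assms(2) by measurable
  qed
  then show ?thesis using assms by (simp add: L2_def)
qed

lemma L2_bounded_mult:
  fixes f :: "'a \<Rightarrow> 'b :: euclidean_space" and g :: "'a \<Rightarrow> real"
  assumes "L2 N f" "g \<in> borel_measurable N" "AE x in N. \<bar>g x\<bar> \<le> B"
  shows "L2 N (\<lambda>x. g x *\<^sub>R f x)"
  unfolding L2_def
proof
  show m: "(\<lambda>x. g x *\<^sub>R f x) \<in> borel_measurable N"
    using L2_measurable[OF assms(1)] assms(2) by measurable
  show "integrable N (\<lambda>x. (norm (g x *\<^sub>R f x))\<^sup>2)"
  proof (rule Bochner_Integration.integrable_bound)
    show "integrable N (\<lambda>x. B\<^sup>2 * (norm (f x))\<^sup>2)"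
      using assms by (intro integrable_mult_right L2_integrable_sq) auto
    show "(\<lambda>x. (norm (g x *\<^sub>R f x))\<^sup>2) \<in> borel_measurable N" using m by measurable
    show "AE x in N. norm ((norm (g x *\<^sub>R f x))\<^sup>2) \<le> norm (B\<^sup>2 * (norm (f x))\<^sup>2)"
      using assms(3)
    proof eventually_elim
      case (elim x)
      then have "(g x)\<^sup>2 \<le> B\<^sup>2" by (metis abs_ge_zero power2_abs power_mono)
      then show ?case by (simp add: power_mult_distrib mult_right_mono)
    qed
  qed
qed

lemma L2_cong_AE:
  assumes "L2 N f" "g \<in> borel_measurable N" "AE x in N. f x = g x"
  shows "L2 N g"
proof -
  have f: "f \<in> borel_measurable N" using assms(1) by (rule L2_measurable)
  have "integrable N (\<lambda>x. (norm (f x))\<^sup>2) \<longleftrightarrow> integrable N (\<lambda>x. (norm (g x))\<^sup>2)"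
    using assms(2,3) f by (intro integrable_cong_AE) auto
  with assms show ?thesis by (simp add: L2_def)
qed

lemma L2_norm_sq: "(L2_norm N f)\<^sup>2 = (\<integral>x. (norm (f x))\<^sup>2 \<partial>N)"
  by (simp add: L2_norm_def)

lemma L2_norm_nonneg [simp]: "0 \<le> L2_norm N f"
  by (simp add: L2_norm_def)

lemma L2_norm_sq_add:
  assumes "L2 N f" "L2 N g"
  shows "(L2_norm N (\<lambda>x. f x + g x))\<^sup>2 =
    (L2_norm N f)\<^sup>2 + 2 * (\<integral>x. f x \<bullet> g x \<partial>N) + (L2_norm N g)\<^sup>2"
proof -
  have "(\<integral>x. (norm (f x + g x))\<^sup>2 \<partial>N) =
    (\<integral>x. (norm (f x))\<^sup>2 + 2 * (f x \<bullet> g x) + (norm (g x))\<^sup>2 \<partial>N)"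
    by (simp add: power2_norm_eq_inner algebra_simps inner_commute)
  also have "\<dots> = (\<integral>x. (norm (f x))\<^sup>2 \<partial>N) + 2 * (\<integral>x. f x \<bullet> g x \<partial>N) + (\<integral>x. (norm (g x))\<^sup>2 \<partial>N)"
    using assms L2_integrable_inner[OF assms] by (simp add: L2_integrable_sq)
  finally show ?thesis by (simp add: L2_norm_sq)
qed

lemma L2_norm_scaleR: "L2_norm N (\<lambda>x. c *\<^sub>R f x) = \<bar>c\<bar> * L2_norm N f"
  by (simp add: L2_norm_def power_mult_distrib real_sqrt_mult)

lemma L2_Cauchy_Schwarz:
  assumes "L2 N f" "L2 N g"
  shows "\<bar>\<integral>x. f x \<bullet> g x \<partial>N\<bar> \<le> L2_norm N f * L2_norm N g"
proof -
  have "0 \<le> (L2_norm N f)\<^sup>2 + 2 * t * (\<integral>x. f x \<bullet> g x \<partial>N) + t\<^sup>2 * (L2_norm N g)\<^sup>2" for t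
  proof -
    have "(\<integral>x. f x \<bullet> t *\<^sub>R g x \<partial>N) = t * (\<integral>x. f x \<bullet> g x \<partial>N)" by simp
    with L2_norm_sq_add[OF assms(1) L2_scaleR[OF assms(2)], of t]
    have "(L2_norm N f)\<^sup>2 + 2 * t * (\<integral>x. f x \<bullet> g x \<partial>N) + t\<^sup>2 * (L2_norm N g)\<^sup>2
        = (L2_norm N (\<lambda>x. f x + t *\<^sub>R g x))\<^sup>2"
      by (simp add: L2_norm_scaleR power_mult_distrib)
    then show ?thesis by simp
  qed
  then have "(\<integral>x. f x \<bullet> g x \<partial>N)\<^sup>2 \<le> (L2_norm N f)\<^sup>2 * (L2_norm N g)\<^sup>2"
    by (rule discriminant_nonpos)
  then have "\<bar>\<integral>x. f x \<bullet> g x \<partial>N\<bar>\<^sup>2 \<le> (L2_norm N f * L2_norm N g)\<^sup>2"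
    by (simp add: power_mult_distrib)
  then show ?thesis by (rule power2_le_imp_le) simp
qed

lemma L2_norm_triangle:
  assumes "L2 N f" "L2 N g"
  shows "L2_norm N (\<lambda>x. f x + g x) \<le> L2_norm N f + L2_norm N g"
proof (rule power2_le_imp_le)
  show "(L2_norm N (\<lambda>x. f x + g x))\<^sup>2 \<le> (L2_norm N f + L2_norm N g)\<^sup>2"
    using L2_Cauchy_Schwarz[OF assms] unfolding L2_norm_sq_add[OF assms]
    by (simp add: power2_sum)
qed auto

lemma L2_norm_diff_commute: "L2_norm N (\<lambda>x. f x - g x) = L2_norm N (\<lambda>x. g x - f x)"
  by (simp add: L2_norm_def norm_minus_commute)

lemma L2_norm_triangle_diff:
  assumes "L2 N f" "L2 N g" "L2 N h"
  shows "L2_norm N (\<lambda>x. f x - h x) \<le> L2_norm N (\<lambda>x. f x - g x) + L2_norm N (\<lambda>x. g x - h x)"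
  using L2_norm_triangle[of N "\<lambda>x. f x - g x" "\<lambda>x. g x - h x"] assms by (auto simp: L2_diff)

lemma L2_norm_eq_0_AE:
  assumes "L2 N f" "L2_norm N f = 0"
  shows "AE x in N. f x = 0"
proof -
  have "(\<integral>x. (norm (f x))\<^sup>2 \<partial>N) = 0" using assms(2) by (simp add: L2_norm_def)
  then have "AE x in N. (norm (f x))\<^sup>2 = 0"
    using integral_nonneg_eq_0_iff_AE[OF L2_integrable_sq[OF assms(1)]] by simp
  then show ?thesis by simp
qed

text \<open>Cauchy-Schwarz applied to \<open>f - fn n\<close>. This is how integral identities valid
  for test functions pass to Sobolev functions and their traces.\<close>

lemma tendsto_integral_inner:
  assumes f: "L2 N f" and fn: "\<And>n. L2 N (fn n)" and g: "L2 N g"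
    and lim: "(\<lambda>n. L2_norm N (\<lambda>x. f x - fn n x)) \<longlonglongrightarrow> 0"
  shows "(\<lambda>n. \<integral>x. fn n x \<bullet> g x \<partial>N) \<longlonglongrightarrow> (\<integral>x. f x \<bullet> g x \<partial>N)"
proof -
  have "(\<lambda>n. (\<integral>x. f x \<bullet> g x \<partial>N) - (\<integral>x. fn n x \<bullet> g x \<partial>N)) \<longlonglongrightarrow> 0"
  proof (rule tendsto_rabs_zero_cancel, rule tendsto_sandwich[OF _ _ tendsto_const])
    show "(\<lambda>n. L2_norm N (\<lambda>x. f x - fn n x) * L2_norm N g) \<longlonglongrightarrow> 0"
      using tendsto_mult_right[OF lim, of "L2_norm N g"] by simp
    have "\<bar>(\<integral>x. f x \<bullet> g x \<partial>N) - (\<integral>x. fn n x \<bullet> g x \<partial>N)\<bar> \<le> L2_norm N (\<lambda>x. f x - fn n x) * L2_norm N g" for n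
    proof -
      have "(\<integral>x. f x \<bullet> g x \<partial>N) - (\<integral>x. fn n x \<bullet> g x \<partial>N) = (\<integral>x. (f x - fn n x) \<bullet> g x \<partial>N)"
        using f fn g by (simp add: inner_diff_left L2_integrable_inner)
      then show ?thesis using L2_Cauchy_Schwarz[OF L2_diff[OF f fn] g] by simp
    qed
    then show "\<forall>\<^sub>F n in sequentially. \<bar>(\<integral>x. f x \<bullet> g x \<partial>N) - (\<integral>x. fn n x \<bullet> g x \<partial>N)\<bar> \<le> L2_norm N (\<lambda>x. f x - fn n x) * L2_norm N g"
      by simp
  qed auto
  from tendsto_diff[OF tendsto_const[of "\<integral>x. f x \<bullet> g x \<partial>N"] this] show ?thesis by simp
qed

lemma tendsto_integral_mult:
  fixes f g :: "'a \<Rightarrow> real"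
  assumes "L2 N f" "\<And>n. L2 N (fn n)" "L2 N g"
    and "(\<lambda>n. L2_norm N (\<lambda>x. f x - fn n x)) \<longlonglongrightarrow> 0"
  shows "(\<lambda>n. \<integral>x. fn n x * g x \<partial>N) \<longlonglongrightarrow> (\<integral>x. f x * g x \<partial>N)"
  using tendsto_integral_inner[OF assms] by simp

section \<open>Null sets of Lebesgue measure\<close>

text \<open>Lebesgue measure is complete, so measurability survives a change on a null set. The
  restriction to \<open>S\<close> is undone by multiplying with the indicator.\<close>

lemma borel_measurable_lebesgue_on_cong_AE:
  fixes f g :: "'a::euclidean_space \<Rightarrow> 'b::euclidean_space"
  assumes S: "S \<in> sets lebesgue" and f: "f \<in> borel_measurable (lebesgue_on S)"
    and eq: "AE x in lebesgue_on S. f x = g x"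
  shows "g \<in> borel_measurable (lebesgue_on S)"
proof -
  have S': "S \<inter> space lebesgue \<in> sets lebesgue" using S by simp
  have "(\<lambda>x. indicator S x *\<^sub>R f x) \<in> borel_measurable lebesgue"
    using f borel_measurable_restrict_space_iff[OF S', of f] by simp
  moreover have "AE x in lebesgue. indicator S x *\<^sub>R f x = indicator S x *\<^sub>R g x"
    using eq unfolding AE_restrict_space_iff[OF S'] by eventually_elim (auto simp: indicator_def)
  ultimately have "(\<lambda>x. indicator S x *\<^sub>R g x) \<in> borel_measurable lebesgue"
    by (rule borel_measurable_AE)
  then show ?thesis using borel_measurable_restrict_space_iff[OF S', of g] by simp
qed

text \<open>No measurability is assumed: by completeness both functions are measurable or neither
  is, and in the second case both integrals have the default value 0. Representatives of weak
  gradients can therefore be exchanged without side conditions.\<close>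

lemma integral_lebesgue_on_cong_AE:
  fixes f g :: "'a::euclidean_space \<Rightarrow> 'b::euclidean_space"
  assumes S: "S \<in> sets lebesgue" and eq: "AE x in lebesgue_on S. f x = g x"
  shows "(\<integral>x. f x \<partial>lebesgue_on S) = (\<integral>x. g x \<partial>lebesgue_on S)"
proof (cases "f \<in> borel_measurable (lebesgue_on S)")
  case True
  then have "g \<in> borel_measurable (lebesgue_on S)"
    using borel_measurable_lebesgue_on_cong_AE assms by blast
  show ?thesis by (rule integral_cong_AE[OF True \<open>g \<in> _\<close> eq])
next
  case False
  have "AE x in lebesgue_on S. g x = f x" using eq by eventually_elim simp
  with False have "g \<notin> borel_measurable (lebesgue_on S)"
    using borel_measurable_lebesgue_on_cong_AE[OF S, of g f] by blast
  with False show ?thesis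
    using borel_measurable_integrable not_integrable_integral_eq by metis
qed

lemma L2_lebesgue_on_cong_AE:
  fixes f g :: "'a::euclidean_space \<Rightarrow> 'b::euclidean_space"
  assumes "S \<in> sets lebesgue" "L2 (lebesgue_on S) f" "AE x in lebesgue_on S. f x = g x"
  shows "L2 (lebesgue_on S) g"
  by (rule L2_cong_AE[OF assms(2) borel_measurable_lebesgue_on_cong_AE[OF assms(1) L2_measurable[OF assms(2)] assms(3)] assms(3)])

lemma L2_norm_lebesgue_on_cong_AE:
  fixes f g :: "'a::euclidean_space \<Rightarrow> 'b::euclidean_space"
  assumes "S \<in> sets lebesgue" "AE x in lebesgue_on S. f x = g x"
  shows "L2_norm (lebesgue_on S) f = L2_norm (lebesgue_on S) g"
proof -
  have "(\<integral>x. (norm (f x))\<^sup>2 \<partial>lebesgue_on S) = (\<integral>x. (norm (g x))\<^sup>2 \<partial>lebesgue_on S)"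
    by (rule integral_lebesgue_on_cong_AE[OF assms(1)], rule AE_mp[OF assms(2)]) simp
  then show ?thesis by (simp add: L2_norm_def)
qed

lemma AE_lebesgue_on_mono:
  assumes "T \<in> sets lebesgue" "S \<in> sets lebesgue" "T \<subseteq> S" "AE x in lebesgue_on S. P x"
  shows "AE x in lebesgue_on T. P x"
  using assms by (auto simp: AE_restrict_space_iff elim!: AE_mp)

lemma AE_lebesgue_on_negligible:
  assumes "S \<in> sets lebesgue" "negligible N" "\<And>x. x \<in> S \<Longrightarrow> x \<notin> N \<Longrightarrow> P x"
  shows "AE x in lebesgue_on S. P x"
proof -
  have "AE x in lebesgue. x \<notin> N" using assms(2) by (simp add: negligible_iff_null_sets AE_not_in)
  then show ?thesis using assms by (auto simp: AE_restrict_space_iff elim!: AE_mp)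
qed

lemma integrable_lebesgue_on_subset:
  fixes f :: "'a::euclidean_space \<Rightarrow> 'b::euclidean_space"
  assumes "T \<in> sets lebesgue" "S \<in> sets lebesgue" "T \<subseteq> S" "integrable (lebesgue_on S) f"
  shows "integrable (lebesgue_on T) f"
proof -
  have "integrable lebesgue (\<lambda>x. indicator S x *\<^sub>R f x)"
    using assms by (simp add: integrable_restrict_space)
  then have "integrable lebesgue (\<lambda>x. indicator T x *\<^sub>R indicator S x *\<^sub>R f x)"
    using assms(1) by (intro integrable_mult_indicator[of T lebesgue "\<lambda>x. indicator S x *\<^sub>R f x"])
  also have "(\<lambda>x. indicator T x *\<^sub>R indicator S x *\<^sub>R f x) = (\<lambda>x. indicator T x *\<^sub>R f x)"
    using assms(3) by (auto simp: indicator_def fun_eq_iff)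
  finally show ?thesis using assms by (simp add: integrable_restrict_space)
qed

lemma L2_lebesgue_on_subset:
  fixes f :: "'a::euclidean_space \<Rightarrow> 'b::euclidean_space"
  assumes "T \<in> sets lebesgue" "S \<in> sets lebesgue" "T \<subseteq> S" "L2 (lebesgue_on S) f"
  shows "L2 (lebesgue_on T) f"
proof -
  have [simp]: "T \<inter> S = T" using assms(3) by auto
  have 1: "f \<in> borel_measurable (lebesgue_on T)"
    using measurable_restrict_mono[OF L2_measurable[OF assms(4)] assms(3)] .
  have "integrable (lebesgue_on T) (\<lambda>x. (norm (f x))\<^sup>2)"
    by (rule integrable_lebesgue_on_subset[OF assms(1-3) L2_integrable_sq[OF assms(4)]])
  with 1 show ?thesis by (simp add: L2_def)
qed

lemma L2_norm_lebesgue_on_subset: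
  fixes f :: "'a::euclidean_space \<Rightarrow> 'b::euclidean_space"
  assumes "T \<in> sets lebesgue" "S \<in> sets lebesgue" "T \<subseteq> S" "L2 (lebesgue_on S) f"
  shows "L2_norm (lebesgue_on T) f \<le> L2_norm (lebesgue_on S) f"
proof -
  have i: "integrable lebesgue (\<lambda>x. indicator S x *\<^sub>R (norm (f x))\<^sup>2)"
    using L2_integrable_sq[OF assms(4)] assms(2) by (simp add: integrable_restrict_space)
  have iT: "integrable lebesgue (\<lambda>x. indicator T x *\<^sub>R (norm (f x))\<^sup>2)"
    using L2_integrable_sq[OF L2_lebesgue_on_subset[OF assms]] assms(1) by (simp add: integrable_restrict_space)
  have "(\<integral>x. (norm (f x))\<^sup>2 \<partial>lebesgue_on T) \<le> (\<integral>x. (norm (f x))\<^sup>2 \<partial>lebesgue_on S)"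
  proof -
    have "indicator T x *\<^sub>R (norm (f x))\<^sup>2 \<le> indicator S x *\<^sub>R (norm (f x))\<^sup>2" for x
      using assms(3) by (cases "x \<in> T") (auto simp: subset_iff)
    then show ?thesis
      using assms(1,2) integral_mono[OF iT i] by (simp add: integral_restrict_space)
  qed
  then show ?thesis by (simp add: L2_norm_def)
qed

lemma integral_lebesgue_on_cong_set:
  fixes f :: "'a::euclidean_space \<Rightarrow> 'b::euclidean_space"
  assumes "S \<in> sets lebesgue" "T \<in> sets lebesgue" "negligible (sym_diff S T)"
  shows "(\<integral>x. f x \<partial>lebesgue_on S) = (\<integral>x. f x \<partial>lebesgue_on T)"
proof -
  have "AE x in lebesgue_on UNIV. indicator S x *\<^sub>R f x = indicator T x *\<^sub>R f x"
    by (rule AE_lebesgue_on_negligible[OF _ assms(3)]) (auto simp: indicator_def)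
  then have "(\<integral>x. indicator S x *\<^sub>R f x \<partial>lebesgue_on UNIV) = (\<integral>x. indicator T x *\<^sub>R f x \<partial>lebesgue_on UNIV)"
    by (rule integral_lebesgue_on_cong_AE[rotated]) auto
  then show ?thesis using assms by (simp add: integral_restrict_space)
qed

lemma finite_measure_lebesgue_on_bounded:
  "bounded S \<Longrightarrow> S \<in> sets lebesgue \<Longrightarrow> finite_measure (lebesgue_on S)"
  by (rule finite_measure_lebesgue_on) (rule bounded_set_imp_lmeasurable)

section \<open>Continuously differentiable functions\<close>

lemma gderiv_unique:
  assumes "gderiv v x g" "gderiv v x g'"
  shows "g = g'"
proof -
  have "(\<lambda>h. h \<bullet> g) = (\<lambda>h. h \<bullet> g')"
    using assms unfolding gderiv_def by (rule has_derivative_unique)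
  then have "(g - g') \<bullet> g = (g - g') \<bullet> g'" by (rule fun_cong)
  then have "(g - g') \<bullet> (g - g') = 0" by (simp add: inner_diff_right)
  then show ?thesis by simp
qed

lemma gradient_eq: "gderiv v x g \<Longrightarrow> gradient v x = g"
  unfolding gradient_def using gderiv_unique by (intro the_equality) auto

text \<open>Smoothness is demanded on the whole space. Polynomials, test functions and their
  products satisfy it, so no domain has to be tracked.\<close>

definition C1 :: "(real^'d \<Rightarrow> real) \<Rightarrow> bool" where
  "C1 v \<longleftrightarrow> (\<forall>x. gderiv v x (gradient v x)) \<and> continuous_on UNIV (gradient v)"

lemma C1I:
  assumes "\<And>x. gderiv v x (g x)" "continuous_on UNIV g"
  shows "C1 v" "gradient v = g"
proof -
  show "gradient v = g" using assms(1) by (auto simp: gradient_eq)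
  with assms show "C1 v" by (simp add: C1_def)
qed

lemma C1_gderiv: "C1 v \<Longrightarrow> gderiv v x (gradient v x)"
  by (simp add: C1_def)

lemma C1_continuous_gradient: "C1 v \<Longrightarrow> continuous_on S (gradient v)"
  unfolding C1_def using continuous_on_subset by blast

lemma C1_continuous: "C1 v \<Longrightarrow> continuous_on S v"
  unfolding C1_def gderiv_def
  by (meson has_derivative_continuous continuous_at_imp_continuous_on)

lemma C1_measurable: "C1 v \<Longrightarrow> v \<in> borel_measurable borel"
  using C1_continuous borel_measurable_continuous_onI by blast

lemma C1_gradient_measurable: "C1 v \<Longrightarrow> gradient v \<in> borel_measurable borel"
  using C1_continuous_gradient borel_measurable_continuous_onI by blast

lemma
  shows C1_const [intro]: "C1 (\<lambda>x. c)" and gradient_const [simp]: "gradient (\<lambda>x. c) x = 0"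
  using C1I[of "\<lambda>x. c" "\<lambda>x. 0"] GDERIV_const by (auto intro: gradient_eq)

lemma
  assumes "C1 v" "C1 w"
  shows C1_add [intro]: "C1 (\<lambda>x. v x + w x)"
    and gradient_add: "gradient (\<lambda>x. v x + w x) x = gradient v x + gradient w x"
  using C1I[of "\<lambda>x. v x + w x" "\<lambda>x. gradient v x + gradient w x"] assms
  by (auto intro!: GDERIV_add C1_gderiv continuous_intros C1_continuous_gradient gradient_eq)

lemma
  assumes "C1 v" "C1 w"
  shows C1_diff [intro]: "C1 (\<lambda>x. v x - w x)"
    and gradient_diff: "gradient (\<lambda>x. v x - w x) x = gradient v x - gradient w x"
  using C1I[of "\<lambda>x. v x - w x" "\<lambda>x. gradient v x - gradient w x"] assms
  by (auto intro!: GDERIV_diff C1_gderiv continuous_intros C1_continuous_gradient gradient_eq)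

lemma
  assumes "C1 v" "C1 w"
  shows C1_mult [intro]: "C1 (\<lambda>x. v x * w x)"
    and gradient_mult: "gradient (\<lambda>x. v x * w x) x = v x *\<^sub>R gradient w x + w x *\<^sub>R gradient v x"
proof -
  have d: "gderiv (\<lambda>x. v x * w x) x (v x *\<^sub>R gradient w x + w x *\<^sub>R gradient v x)" for x
    by (intro GDERIV_mult C1_gderiv assms)
  have c: "continuous_on UNIV (\<lambda>x. v x *\<^sub>R gradient w x + w x *\<^sub>R gradient v x)"
    by (intro continuous_intros C1_continuous C1_continuous_gradient assms)
  show "C1 (\<lambda>x. v x * w x)" by (rule C1I(1)[OF d c])
  show "gradient (\<lambda>x. v x * w x) x = v x *\<^sub>R gradient w x + w x *\<^sub>R gradient v x"
    by (rule gradient_eq[OF d])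
qed

lemma gradient_cmult: "C1 v \<Longrightarrow> gradient (\<lambda>x. c * v x) x = c *\<^sub>R gradient v x"
  using gradient_mult[OF C1_const[of c], of v x] by simp

lemma
  shows C1_inner [intro]: "C1 (\<lambda>x. x \<bullet> e)" and gradient_inner: "gradient (\<lambda>x. x \<bullet> e) x = e"
proof -
  have "gderiv (\<lambda>x. x \<bullet> e) x e" for x
    unfolding gderiv_def by (rule has_derivative_inner_left) (rule has_derivative_ident)
  then show "C1 (\<lambda>x. x \<bullet> e)" "gradient (\<lambda>x. x \<bullet> e) x = e"
    using C1I[of "\<lambda>x. x \<bullet> e" "\<lambda>x. e"] by (auto intro: gradient_eq)
qed

lemma
  shows C1_component [intro]: "C1 (\<lambda>x. x $ i)"
    and gradient_component: "gradient (\<lambda>x. x $ i) x = axis i 1"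
  using C1_inner[of "axis i 1"] gradient_inner[of "axis i 1"]
  by (simp_all add: cart_eq_inner_axis)

lemma C1_sum [intro]: "(\<And>i. i \<in> I \<Longrightarrow> C1 (v i)) \<Longrightarrow> C1 (\<lambda>x. \<Sum>i\<in>I. v i x)"
  by (induction I rule: infinite_finite_induct) auto

lemma gradient_sum:
  "(\<And>i. i \<in> I \<Longrightarrow> C1 (v i)) \<Longrightarrow> gradient (\<lambda>x. \<Sum>i\<in>I. v i x) x = (\<Sum>i\<in>I. gradient (v i) x)"
  by (induction I rule: infinite_finite_induct) (auto simp: gradient_add C1_sum)

lemma C1_prod [intro]: "(\<And>i. i \<in> I \<Longrightarrow> C1 (v i)) \<Longrightarrow> C1 (\<lambda>x. \<Prod>i\<in>I. v i x)"
  by (induction I rule: infinite_finite_induct) auto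

lemma C1_lipschitz_on:
  assumes v: "C1 v" and S: "compact S" "convex S"
  obtains L where "L-lipschitz_on S v"
proof -
  have "bounded (gradient v ` S)"
    using S(1) C1_continuous_gradient[OF v] compact_continuous_image compact_imp_bounded by blast
  then obtain L where L: "L > 0" "\<And>x. x \<in> S \<Longrightarrow> norm (gradient v x) \<le> L"
    unfolding bounded_pos by auto
  have "L-lipschitz_on S v"
  proof (rule bounded_derivative_imp_lipschitz)
    show "(v has_derivative (\<lambda>h. h \<bullet> gradient v x)) (at x within S)" for x
      using C1_gderiv[OF v, of x] unfolding gderiv_def by (rule has_derivative_at_withinI)
    show "onorm (\<lambda>h. h \<bullet> gradient v x) \<le> L" if "x \<in> S" for x
    proof (rule onorm_le)
      fix h :: "real^'a"
      have "\<bar>h \<bullet> gradient v x\<bar> \<le> norm h * norm (gradient v x)" by (rule Cauchy_Schwarz_ineq2)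
      also have "\<dots> \<le> L * norm h"
        using mult_right_mono[OF L(2)[OF that], of "norm h"] by (simp add: mult.commute)
      finally show "norm (h \<bullet> gradient v x) \<le> L * norm h" by simp
    qed
  qed (use L S in auto)
  then show ?thesis by (rule that)
qed

lemma gradient_zero_outside:
  assumes "x \<notin> closure {x. v x \<noteq> 0}"
  shows "gderiv v x 0"
proof -
  have "((\<lambda>x. 0) has_derivative (\<lambda>h. h \<bullet> 0)) (at x)" by simp
  then show ?thesis unfolding gderiv_def
  proof (rule has_derivative_transform_within_open[where s = "- closure {x. v x \<noteq> 0}"])
    show "0 = v y" if "y \<in> - closure {x. v x \<noteq> 0}" for y
      using that closure_subset[of "{x. v x \<noteq> 0}"] by auto
  qed (use assms in auto)
qed

lemma Ck_continuous: "Ck k v \<Longrightarrow> continuous_on UNIV v"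
proof (cases k)
  case (Suc m)
  assume "Ck k v"
  with Suc obtain g where "\<forall>x. gderiv v x (g x)" by auto
  then show ?thesis
    unfolding gderiv_def by (meson has_derivative_continuous continuous_at_imp_continuous_on)
qed auto

lemma Ck_imp_C1:
  assumes "Ck (Suc k) v"
  shows "C1 v"
proof -
  obtain g where g: "\<And>x. gderiv v x (g x)" "\<And>i. Ck k (\<lambda>x. g x $ i)"
    using assms by auto
  have "continuous_on UNIV (\<lambda>x. \<chi> i. g x $ i)"
    using g(2)[THEN Ck_continuous] by (rule continuous_on_vec_lambda)
  then have "continuous_on UNIV g" by simp
  then show ?thesis using C1I(1) g(1) by blast
qed

lemma Ck_SucD: "Ck (Suc k) v \<Longrightarrow> Ck k v"
proof (induction k arbitrary: v)
  case 0
  then have "continuous_on UNIV v" by (rule Ck_continuous)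
  then show ?case by simp
next
  case (Suc k)
  then obtain g where "\<forall>x. gderiv v x (g x)" "\<forall>i. Ck (Suc k) (\<lambda>x. g x $ i)" by auto
  with Suc.IH show ?case by auto
qed

lemma Ck_const: "Ck k (\<lambda>x. c)"
proof (induction k arbitrary: c)
  case (Suc k)
  then show ?case using GDERIV_const[of c] by (auto intro!: exI[of _ "\<lambda>x. 0"])
qed auto

lemma Ck_add: "Ck k v \<Longrightarrow> Ck k w \<Longrightarrow> Ck k (\<lambda>x. v x + w x)"
proof (induction k arbitrary: v w)
  case (Suc k)
  obtain g where g: "\<forall>x. gderiv v x (g x)" "\<forall>i. Ck k (\<lambda>x. g x $ i)" using Suc.prems by auto
  obtain h where h: "\<forall>x. gderiv w x (h x)" "\<forall>i. Ck k (\<lambda>x. h x $ i)" using Suc.prems by auto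
  have "gderiv (\<lambda>x. v x + w x) x (g x + h x)" for x
    using g h by (intro GDERIV_add) auto
  moreover have "Ck k (\<lambda>x. (g x + h x) $ i)" for i
    using g h by (simp add: Suc.IH)
  ultimately show ?case unfolding Ck.simps by (intro exI[of _ "\<lambda>x. g x + h x"]) blast
qed (auto intro: continuous_intros)

lemma Ck_mult: "Ck k v \<Longrightarrow> Ck k w \<Longrightarrow> Ck k (\<lambda>x. v x * w x)"
proof (induction k arbitrary: v w)
  case (Suc k)
  obtain g where g: "\<forall>x. gderiv v x (g x)" "\<forall>i. Ck k (\<lambda>x. g x $ i)" using Suc.prems by auto
  obtain h where h: "\<forall>x. gderiv w x (h x)" "\<forall>i. Ck k (\<lambda>x. h x $ i)" using Suc.prems by auto
  have "Ck k v" "Ck k w" using Suc.prems Ck_SucD by blast+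
  then have "Ck k (\<lambda>x. (v x *\<^sub>R h x + w x *\<^sub>R g x) $ i)" for i
    using g h by (simp add: Suc.IH Ck_add)
  moreover have "gderiv (\<lambda>x. v x * w x) x (v x *\<^sub>R h x + w x *\<^sub>R g x)" for x
    using g h by (intro GDERIV_mult) auto
  ultimately show ?case
    unfolding Ck.simps by (intro exI[of _ "\<lambda>x. v x *\<^sub>R h x + w x *\<^sub>R g x"]) blast
qed (auto intro: continuous_intros)

lemma Ck_prod: "(\<And>i. i \<in> I \<Longrightarrow> Ck k (v i)) \<Longrightarrow> Ck k (\<lambda>x. \<Prod>i\<in>I. v i x)"
  by (induction I rule: infinite_finite_induct) (auto intro: Ck_mult Ck_const)

section \<open>Smooth bump functions\<close>

text \<open>This family contains the standard smooth cut-off (for \<open>m = 0\<close>) and its derivatives are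
  linear combinations of its members.\<close>

definition flat_exp :: "nat \<Rightarrow> real \<Rightarrow> real" where
  "flat_exp m t = (if t > 0 then inverse t ^ m * exp (- inverse t) else 0)"

lemma flat_exp_tendsto_0: "(flat_exp m \<longlongrightarrow> 0) (at_right 0)"
proof -
  have "((\<lambda>t. inverse t ^ m / exp (inverse t)) \<longlongrightarrow> (0::real)) (at_right 0)"
    by (rule filterlim_compose[OF tendsto_power_div_exp_0 filterlim_inverse_at_top_right])
  moreover have "\<forall>\<^sub>F t in at_right 0. inverse t ^ m / exp (inverse t) = flat_exp m t"
    unfolding eventually_at_right_field
    by (rule exI[of _ 1]) (auto simp: flat_exp_def exp_minus divide_inverse)
  ultimately show ?thesis by (rule Lim_transform_eventually)
qed

text \<open>At 0 the right difference quotient of \<open>flat_exp m\<close> is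
  \<open>flat_exp (Suc m)\<close>, which tends to 0 because the exponential beats every power;
  elsewhere this is the product rule.\<close>

lemma flat_exp_DERIV:
  "(flat_exp m has_real_derivative - real m * flat_exp (Suc m) t + flat_exp (Suc (Suc m)) t) (at t)"
proof -
  consider "t < 0" | "t = 0" | "t > 0" by linarith
  then show ?thesis
  proof cases
    case 1
    have "((\<lambda>t. 0) has_real_derivative 0) (at t)" by simp
    then have "(flat_exp m has_real_derivative 0) (at t)"
      by (rule has_field_derivative_transform_within_open[where S = "{..<0}"])
         (use 1 in \<open>auto simp: flat_exp_def\<close>)
    then show ?thesis using 1 by (simp add: flat_exp_def)
  next
    case 2
    have "((\<lambda>h. flat_exp m h / h) \<longlongrightarrow> 0) (at 0)"
    proof (rule filterlim_split_at)
      show "((\<lambda>h. flat_exp m h / h) \<longlongrightarrow> 0) (at_left 0)"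
        by (rule Lim_transform_eventually[OF tendsto_const])
           (auto simp: eventually_at_left_field flat_exp_def intro!: exI[of _ "-1"])
      show "((\<lambda>h. flat_exp m h / h) \<longlongrightarrow> 0) (at_right 0)"
        by (rule Lim_transform_eventually[OF flat_exp_tendsto_0[of "Suc m"]])
           (auto simp: eventually_at_right_field flat_exp_def divide_inverse intro!: exI[of _ 1])
    qed
    then have "(flat_exp m has_real_derivative 0) (at 0)"
      unfolding DERIV_def by (simp add: flat_exp_def)
    then show ?thesis using 2 by (simp add: flat_exp_def)
  next
    case 3
    have p: "((\<lambda>t. inverse t ^ m) has_real_derivative - real m * inverse t ^ Suc m) (at t)"
    proof (cases m)
      case (Suc k)
      have "((\<lambda>t. inverse t) has_real_derivative (- (inverse t ^ 2))) (at t)"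
        using 3 DERIV_inverse[of t UNIV] by (simp add: numeral_2_eq_2)
      from DERIV_power[OF this, of m]
      have "((\<lambda>t. inverse t ^ m) has_real_derivative real m * inverse t ^ k * (- (inverse t ^ 2))) (at t)"
        using Suc by (simp add: algebra_simps)
      then show ?thesis using Suc by (simp add: power2_eq_square algebra_simps)
    qed simp
    have e: "((\<lambda>t. exp (- inverse t)) has_real_derivative exp (- inverse t) * inverse t ^ 2) (at t)"
      using 3 by (auto intro!: derivative_eq_intros simp: power2_eq_square)
    have "((\<lambda>t. inverse t ^ m * exp (- inverse t)) has_real_derivative
       - real m * flat_exp (Suc m) t + flat_exp (Suc (Suc m)) t) (at t)"
      using DERIV_mult[OF p e] 3 by (simp add: flat_exp_def power2_eq_square algebra_simps)
    then show ?thesis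
      by (rule has_field_derivative_transform_within_open[where S = "{0<..}"])
         (use 3 in \<open>auto simp: flat_exp_def\<close>)
  qed
qed

text \<open>Differentiation raises the index, hence the induction on \<open>k\<close> with
  \<open>m\<close> arbitrary. The affine argument covers both orientations that occur in a bump on a
  box.\<close>

lemma Ck_flat_exp: "Ck k (\<lambda>x. flat_exp m (a * x $ i + b))"
proof (induction k arbitrary: m)
  case 0
  have "continuous_on UNIV (flat_exp m)"
    by (rule DERIV_continuous_on[where D = "\<lambda>t. - real m * flat_exp (Suc m) t + flat_exp (Suc (Suc m)) t"])
       (simp add: flat_exp_DERIV[simplified])
  then show ?case
    by (auto intro!: continuous_on_compose2[of UNIV "flat_exp m"] continuous_intros)
next
  case (Suc k)
  define D where "D t = - real m * flat_exp (Suc m) t + flat_exp (Suc (Suc m)) t" for t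
  have 1: "gderiv (\<lambda>x. a * x $ i + b) x (a *\<^sub>R axis i 1)" for x
  proof -
    have "C1 (\<lambda>x. a * x $ i + b)" by (intro C1_add C1_mult C1_const C1_component)
    moreover have "gradient (\<lambda>x. a * x $ i + b) x = a *\<^sub>R axis i 1"
      by (simp add: gradient_add C1_mult C1_component C1_const gradient_cmult gradient_component)
    ultimately show ?thesis by (metis C1_gderiv)
  qed
  have 2: "gderiv (\<lambda>x. flat_exp m (a * x $ i + b)) x (D (a * x $ i + b) *\<^sub>R a *\<^sub>R axis i 1)" for x
    unfolding D_def by (rule GDERIV_DERIV_compose[OF 1 flat_exp_DERIV])
  have 3: "Ck k (\<lambda>x. (D (a * x $ i + b) *\<^sub>R a *\<^sub>R axis i 1) $ j)" for j
  proof (cases "i = j")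
    case True
    have "Ck k (\<lambda>x. a * (- real m * flat_exp (Suc m) (a * x $ i + b) + flat_exp (Suc (Suc m)) (a * x $ i + b)))"
      by (intro Ck_mult Ck_add Ck_const Suc.IH)
    with True show ?thesis by (simp add: D_def axis_def mult.commute)
  qed (simp add: axis_def Ck_const)
  show ?case unfolding Ck.simps using 2 3 by (intro exI[of _ "\<lambda>x. D (a * x $ i + b) *\<^sub>R a *\<^sub>R axis i 1"]) blast
qed

text \<open>The factor \<open>Suc n\<close> steepens the profile:
  \<open>exp (- 1 / (Suc n * t))\<close> tends to 1 for every \<open>t > 0\<close>, so these smooth
  functions approximate the indicator of the open box.\<close>

definition bump :: "real^'d \<Rightarrow> real^'d \<Rightarrow> nat \<Rightarrow> real^'d \<Rightarrow> real" where
  "bump a b n x = (\<Prod>i\<in>UNIV. flat_exp 0 (real (Suc n) * (x $ i - a $ i)) *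
                               flat_exp 0 (real (Suc n) * (b $ i - x $ i)))"

lemma Ck_bump: "Ck k (bump a b n)"
proof -
  have "Ck k (\<lambda>x. \<Prod>i\<in>UNIV. flat_exp 0 (real (Suc n) * x $ i + (- real (Suc n) * a $ i)) *
          flat_exp 0 ((- real (Suc n)) * x $ i + real (Suc n) * b $ i))"
    by (intro Ck_prod Ck_mult Ck_flat_exp)
  then show ?thesis
    unfolding bump_def[abs_def] by (simp add: algebra_simps)
qed

lemma bump_nonzero_iff: "bump a b n x \<noteq> 0 \<longleftrightarrow> x \<in> box a b"
  by (auto simp: bump_def flat_exp_def mem_box_cart zero_less_mult_iff split: if_splits)

lemma bump_bounds: "0 \<le> bump a b n x" "bump a b n x \<le> 1"
proof -
  have f: "0 \<le> flat_exp 0 t" "flat_exp 0 t \<le> 1" for t by (auto simp: flat_exp_def)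
  show "0 \<le> bump a b n x" unfolding bump_def by (intro prod_nonneg) (simp add: f)
  show "bump a b n x \<le> 1" unfolding bump_def
    by (intro prod_le_1) (simp add: f mult_le_one)
qed

lemma bump_tendsto: "(\<lambda>n. bump a b n x) \<longlonglongrightarrow> indicator (box a b) x"
proof (cases "x \<in> box a b")
  case True
  have f: "(\<lambda>n. flat_exp 0 (real (Suc n) * s)) \<longlonglongrightarrow> 1" if "s > 0" for s
  proof -
    have "(\<lambda>n. exp (- (inverse (real (Suc n)) * inverse s))) \<longlonglongrightarrow> exp (- (0 * inverse s))"
      by (intro tendsto_intros LIMSEQ_inverse_real_of_nat)
    then show ?thesis using that by (simp add: flat_exp_def zero_less_mult_iff)
  qed
  have "(\<lambda>n. bump a b n x) \<longlonglongrightarrow> (\<Prod>i\<in>(UNIV :: 'a set). 1 * 1)"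
    unfolding bump_def using True by (intro tendsto_prod tendsto_mult f) (auto simp: mem_box_cart)
  with True show ?thesis by simp
next
  case False
  then have "bump a b n x = 0" for n using bump_nonzero_iff by blast
  with False show ?thesis by simp
qed

lemma bump_test_function:
  assumes "cbox a b \<subseteq> \<Omega>"
  shows "bump a b n \<in> test_functions \<Omega>"
proof -
  have eq: "{x. bump a b n x \<noteq> 0} = box a b" by (simp add: bump_nonzero_iff)
  have "closure (box a b) \<subseteq> cbox a b" by (intro closure_minimal box_subset_cbox closed_cbox)
  moreover have "compact (closure (box a b))" using bounded_box[of a b] by simp
  ultimately show ?thesis
    unfolding test_functions_def mem_Collect_eq eq using Ck_bump assms by blast
qed

section \<open>The fundamental lemma of the calculus of variations\<close>

text \<open>The positive and the negative part of \<open>h\<close> are densities of two measures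
  that agree on boxes. Boxes are stable under intersection and generate the Borel sets, so the
  measures agree, and then so do the densities almost everywhere.\<close>

lemma box_integrals_zero_imp_AE_zero:
  fixes h :: "real^'d \<Rightarrow> real"
  assumes h: "integrable lborel h" and z: "\<And>c d. (\<integral>x. indicator (box c d) x * h x \<partial>lborel) = 0"
  shows "AE x in lborel. h x = 0"
proof -
  have [measurable]: "h \<in> borel_measurable lborel" using h by auto
  let ?P = "density lborel (\<lambda>x. ennreal (h x))"
  let ?N = "density lborel (\<lambda>x. ennreal (- h x))"
  have fin: "(\<integral>\<^sup>+x. ennreal (h x) \<partial>lborel) \<noteq> \<infinity>" "(\<integral>\<^sup>+x. ennreal (- h x) \<partial>lborel) \<noteq> \<infinity>"
    using real_integrable_def h by auto
  have eq: "emeasure ?P (box c d) = emeasure ?N (box c d)" for c d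
  proof -
    have i: "integrable lborel (\<lambda>x. indicator (box c d) x * h x)"
      using integrable_mult_indicator[OF _ h, of "box c d"] by simp
    have e: "(\<integral>\<^sup>+x. ennreal (h x) * indicator (box c d) x \<partial>lborel) = (\<integral>\<^sup>+x. ennreal (indicator (box c d) x * h x) \<partial>lborel)"
      "(\<integral>\<^sup>+x. ennreal (- h x) * indicator (box c d) x \<partial>lborel) = (\<integral>\<^sup>+x. ennreal (- (indicator (box c d) x * h x)) \<partial>lborel)"
      by (auto intro!: nn_integral_cong simp: indicator_def)
    have "enn2real (\<integral>\<^sup>+x. ennreal (indicator (box c d) x * h x) \<partial>lborel)
        = enn2real (\<integral>\<^sup>+x. ennreal (- (indicator (box c d) x * h x)) \<partial>lborel)"
      using real_lebesgue_integral_def[OF i] z[of c d] by simp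
    moreover have "(\<integral>\<^sup>+x. ennreal (indicator (box c d) x * h x) \<partial>lborel) \<noteq> \<infinity>"
       "(\<integral>\<^sup>+x. ennreal (- (indicator (box c d) x * h x)) \<partial>lborel) \<noteq> \<infinity>"
      using i real_integrable_def by auto
    ultimately have "(\<integral>\<^sup>+x. ennreal (indicator (box c d) x * h x) \<partial>lborel)
        = (\<integral>\<^sup>+x. ennreal (- (indicator (box c d) x * h x)) \<partial>lborel)"
      by (metis (no_types, lifting) ennreal_enn2real less_top infinity_ennreal_def)
    then show ?thesis by (simp add: emeasure_density e)
  qed
  have "?P = ?N"
  proof (rule measure_eqI_generator_eq)
    let ?E = "range (\<lambda>(a, b). box a b::(real^'d) set)"
    show "Int_stable ?E" by (auto simp: Int_stable_def box_Int_box)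
    show "?E \<subseteq> Pow UNIV" "sets ?P = sigma_sets UNIV ?E" "sets ?N = sigma_sets UNIV ?E"
      by (simp_all add: borel_eq_box)
    let ?A = "\<lambda>n::nat. box (- (real n *\<^sub>R One)) (real n *\<^sub>R One) :: (real^'d) set"
    show "range ?A \<subseteq> ?E" "(\<Union>i. ?A i) = UNIV" unfolding UN_box_eq_UNIV by auto
    show "emeasure ?P (?A i) \<noteq> \<infinity>" for i
    proof -
      have "emeasure ?P (?A i) \<le> (\<integral>\<^sup>+x. ennreal (h x) \<partial>lborel)"
        by (auto simp: emeasure_density indicator_def intro!: nn_integral_mono)
      then show ?thesis using fin(1) by (auto simp: top_unique)
    qed
    show "emeasure ?P X = emeasure ?N X" if "X \<in> ?E" for X using that eq by auto
  qed
  then have "AE x in lborel. ennreal (h x) = ennreal (- h x)"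
    using finite_density_unique[OF _ _ _ _ fin(1), of "\<lambda>x. ennreal (- h x)"] by simp
  then show ?thesis
  proof eventually_elim
    case (elim x)
    \<comment> \<open>\<open>ennreal\<close> truncates negative numbers to 0, so the equation forces
      \<open>h x\<close> to vanish for either sign.\<close>
    then show ?case by (cases "h x \<ge> 0") (auto simp: ennreal_neg dest: sym)
  qed
qed

text \<open>Dominated convergence along bumps gives zero integrals over boxes whose closed hull lies
  in \<Omega>. On one such closed box the truncated function has zero integral over every box,
  because boxes intersect in boxes; countably many closed boxes exhaust \<Omega>.\<close>

lemma fundamental_lemma:
  fixes g :: "real^'d \<Rightarrow> real"
  assumes \<Omega>: "open \<Omega>" and g: "integrable (lebesgue_on \<Omega>) g"
    and z: "\<And>\<phi>. \<phi> \<in> test_functions \<Omega> \<Longrightarrow> (\<integral>x. \<phi> x * g x \<partial>lebesgue_on \<Omega>) = 0"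
  shows "AE x in lebesgue_on \<Omega>. g x = 0"
proof -
  have \<Omega>l [simp]: "\<Omega> \<in> sets lebesgue" using \<Omega> by (simp add: borel_open)
  have small: "(\<integral>x. indicator (box a b) x * g x \<partial>lebesgue_on \<Omega>) = 0" if "cbox a b \<subseteq> \<Omega>" for a b
  proof -
    have "(\<lambda>n. \<integral>x. bump a b n x * g x \<partial>lebesgue_on \<Omega>) \<longlonglongrightarrow> (\<integral>x. indicator (box a b) x * g x \<partial>lebesgue_on \<Omega>)"
    proof (rule integral_dominated_convergence[where w = "\<lambda>x. \<bar>g x\<bar>"])
      have [measurable]: "g \<in> borel_measurable (lebesgue_on \<Omega>)" using g by auto
      have "continuous_on UNIV (bump a b n)" for n using Ck_bump Ck_continuous by blast
      then have [measurable]: "bump a b n \<in> borel_measurable (lebesgue_on \<Omega>)" for n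
        by (intro continuous_imp_measurable_on_sets_lebesgue) (auto intro: continuous_on_subset)
      show "(\<lambda>x. bump a b n x * g x) \<in> borel_measurable (lebesgue_on \<Omega>)" for n by measurable
      have [measurable]: "box a b \<in> sets lebesgue" by simp
      have "(indicator (box a b) :: _ \<Rightarrow> real) \<in> borel_measurable (lebesgue_on \<Omega>)"
        by (intro measurable_restrict_space1) measurable
      then show "(\<lambda>x. indicator (box a b) x * g x) \<in> borel_measurable (lebesgue_on \<Omega>)" by measurable
      show "integrable (lebesgue_on \<Omega>) (\<lambda>x. \<bar>g x\<bar>)" using g by auto
      show "AE x in lebesgue_on \<Omega>. (\<lambda>n. bump a b n x * g x) \<longlonglongrightarrow> indicator (box a b) x * g x"
        by (intro AE_I2 tendsto_mult_right bump_tendsto)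
      show "AE x in lebesgue_on \<Omega>. norm (bump a b n x * g x) \<le> \<bar>g x\<bar>" for n
        using bump_bounds[of a b n] by (intro AE_I2) (simp add: abs_mult mult_left_le_one_le)
    qed
    moreover have "(\<integral>x. bump a b n x * g x \<partial>lebesgue_on \<Omega>) = 0" for n
      using z[OF bump_test_function[OF that]] .
    ultimately show ?thesis by (simp add: LIMSEQ_const_iff)
  qed
  have on_cbox: "AE x in lebesgue. x \<in> cbox a b \<longrightarrow> g x = 0" if ab: "cbox a b \<subseteq> \<Omega>" for a b
  proof -
    have sub: "box a b \<subseteq> \<Omega>" using ab box_subset_cbox by blast
    have i: "integrable lebesgue (\<lambda>x. indicator \<Omega> x * g x)"
      using g by (simp add: integrable_restrict_space)
    have "integrable lebesgue (\<lambda>x. indicator (box a b) x *\<^sub>R (indicator \<Omega> x * g x))"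
      by (rule integrable_mult_indicator[OF _ i]) auto
    moreover have "(\<lambda>x. indicator (box a b) x *\<^sub>R (indicator \<Omega> x * g x)) = (\<lambda>x. indicator (box a b) x * g x)"
      using sub by (auto simp: indicator_def fun_eq_iff)
    ultimately have i: "integrable lebesgue (\<lambda>x. indicator (box a b) x * g x)" by simp
    \<comment> \<open>A Borel representative is needed because the comparison of densities takes
      place in \<open>lborel\<close>, not in its completion.\<close>
    then obtain h where h: "h \<in> borel_measurable lborel"
        "AE x in lborel. indicator (box a b) x * g x = h x"
      using completion_ex_borel_measurable_real[of "\<lambda>x. indicator (box a b) x * g x" lborel] by auto
    have hl: "AE x in lebesgue. indicator (box a b) x * g x = h x"
      using h(2) by (rule AE_completion)
    have "integrable lebesgue h"
    proof (rule integrable_cong_AE_imp[OF i])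
      show "h \<in> borel_measurable lebesgue" using h(1) by (rule measurable_completion)
      show "AE x in lebesgue. indicator (box a b) x * g x = h x" by (rule hl)
    qed
    then have hi: "integrable lborel h"
      using h(1) integrable_completion by blast
    have "AE x in lborel. h x = 0"
    proof (rule box_integrals_zero_imp_AE_zero[OF hi])
      fix c d
      obtain c' d' where cd: "box a b \<inter> box c d = box c' d'" unfolding box_Int_box by blast
      have "(\<integral>x. indicator (box c d) x * h x \<partial>lborel) = (\<integral>x. indicator (box c d) x * h x \<partial>lebesgue)"
        using h(1) by (subst integral_completion) auto
      also have "\<dots> = (\<integral>x. indicator (box c' d') x * g x \<partial>lebesgue)"
      proof (rule integral_cong_AE)
        show "AE x in lebesgue. indicator (box c d) x * h x = indicator (box c' d') x * g x"
          using hl by eventually_elim (auto simp: cd[symmetric] indicator_def split: if_splits)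
        have "(\<lambda>x. indicator (box c d) x * h x) \<in> borel_measurable lborel"
          using h(1) by measurable
        then show m: "(\<lambda>x. indicator (box c d) x * h x) \<in> borel_measurable lebesgue"
          by (rule measurable_completion)
        show "(\<lambda>x. indicator (box c' d') x * g x) \<in> borel_measurable lebesgue"
          by (rule borel_measurable_AE[OF m])
             (use hl in \<open>eventually_elim, auto simp: cd[symmetric] indicator_def split: if_splits\<close>)
      qed
      also have "\<dots> = (\<integral>x. indicator \<Omega> x *\<^sub>R (indicator (box c' d') x * g x) \<partial>lebesgue)"
        using sub cd by (intro Bochner_Integration.integral_cong) (auto simp: indicator_def)
      also have "\<dots> = (\<integral>x. indicator (box c' d') x * g x \<partial>lebesgue_on \<Omega>)"
        by (simp add: integral_restrict_space)
      also have "\<dots> = 0"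
      \<comment> \<open>When the open box is empty, \<open>cbox c' d'\<close> may still be nonempty
        and leave \<Omega>, so it cannot be obtained as a closure.\<close>
      proof (cases "box c' d' = {}")
        case False
        then have "cbox c' d' = closure (box c' d')" by simp
        also have "\<dots> \<subseteq> closure (box a b)" using cd by (intro closure_mono) auto
        also have "\<dots> \<subseteq> cbox a b" by (intro closure_minimal box_subset_cbox closed_cbox)
        finally show ?thesis using ab by (intro small) auto
      qed simp
      finally show "(\<integral>x. indicator (box c d) x * h x \<partial>lborel) = 0" .
    qed
    then have "AE x in lebesgue. h x = 0" by (rule AE_completion)
    moreover have "AE x in lebesgue. x \<notin> cbox a b - box a b"
      using negligible_frontier_interval[of a b] unfolding negligible_iff_null_sets by (rule AE_not_in)
    ultimately show ?thesis using hl by eventually_elim (auto simp: indicator_def)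
  qed
  obtain D where D: "countable D" "D \<subseteq> Pow \<Omega>" "\<And>X. X \<in> D \<Longrightarrow> \<exists>a b. X = cbox a b" "\<Union>D = \<Omega>"
    using open_countable_Union_open_cbox[OF \<Omega>] by blast
  have "AE x in lebesgue. \<forall>X\<in>D. x \<in> X \<longrightarrow> g x = 0"
  proof (rule AE_ball_countable'[OF _ D(1)])
    fix X assume X: "X \<in> D"
    then obtain a b where ab: "X = cbox a b" using D(3) by blast
    show "AE x in lebesgue. x \<in> X \<longrightarrow> g x = 0"
      unfolding ab by (rule on_cbox) (use X D(2) ab in blast)
  qed
  then have "AE x in lebesgue. x \<in> \<Omega> \<longrightarrow> g x = 0"
    by eventually_elim (use D(4) in blast)
  then show ?thesis by (simp add: AE_restrict_space_iff)
qed

section \<open>Integrals of gradients of compactly supported functions\<close>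

text \<open>Difference quotients of a compactly supported function integrate to zero by translation
  invariance, and they are dominated by \<open>L\<close> on a ball, of radius \<open>r + 1\<close>
  because the steps have length at most 1. Differentiability is required only almost everywhere,
  which admits Lipschitz functions with kinks.\<close>

lemma integral_gradient_zero:
  fixes g :: "real^'d \<Rightarrow> real"
  assumes lip: "L-lipschitz_on (cball 0 (r + 1)) g"
    and zero: "\<And>x. norm x > r \<Longrightarrow> g x = 0"
    and meas: "G \<in> borel_measurable borel"
    and deriv: "AE x in lborel. gderiv g x (G x)"
    and e: "norm e = 1"
  shows "integrable lborel (\<lambda>x. G x \<bullet> e)" "(\<integral>x. G x \<bullet> e \<partial>lborel) = 0"
proof -
  define q where "q n x = (g (x + inverse (real (Suc n)) *\<^sub>R e) - g x) * real (Suc n)" for n x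
  have L0: "L \<ge> 0" using lip by (rule lipschitz_on_nonneg)
  have bound: "\<bar>q n x\<bar> \<le> L * indicator (cball 0 (r + 1)) x" for n x
  proof -
    let ?y = "x + inverse (real (Suc n)) *\<^sub>R e"
    have n1: "inverse (real (Suc n)) \<le> 1" by (simp add: field_simps)
    have d: "norm (?y - x) = inverse (real (Suc n))" using e by simp
    have near: "norm x \<le> norm ?y + 1" "norm ?y \<le> norm x + 1"
      using d n1 norm_triangle_ineq2[of x ?y] norm_triangle_ineq2[of ?y x] by (auto simp: norm_minus_commute)
    show ?thesis
    proof (cases "norm x > r \<and> norm ?y > r")
      case True
      then show ?thesis using zero L0 by (simp add: q_def)
    next
      case False
      then have "x \<in> cball 0 (r + 1)" "?y \<in> cball 0 (r + 1)" using near by auto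
      then have "\<bar>g ?y - g x\<bar> \<le> L * inverse (real (Suc n))"
        using lipschitz_onD[OF lip, of ?y x] d by (simp add: dist_norm)
      then have "\<bar>g ?y - g x\<bar> * real (Suc n) \<le> L" by (simp add: field_simps)
      then show ?thesis using \<open>x \<in> cball 0 (r + 1)\<close> by (simp add: q_def abs_mult)
    qed
  qed
  have "continuous_on (cball 0 (r + 1)) g" by (rule lipschitz_on_continuous_on[OF lip])
  then have "(\<lambda>x. if x \<in> cball 0 (r + 1) then g x else 0) \<in> borel_measurable borel"
    by (intro borel_measurable_continuous_on_if) auto
  moreover have "(\<lambda>x. if x \<in> cball 0 (r + 1) then g x else 0) = g" using zero by (auto simp: fun_eq_iff)
  ultimately have gm [measurable]: "g \<in> borel_measurable borel" by simp
  have qm [measurable]: "q n \<in> borel_measurable lborel" for n unfolding q_def by measurable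
  have ind: "integrable lborel (indicator (cball 0 (r + 1)) :: real^'d \<Rightarrow> real)"
    by (rule integrable_real_indicator[OF _ emeasure_lborel_cball_finite]) simp
  have w: "integrable lborel (\<lambda>x::real^'d. L * indicator (cball 0 (r + 1)) x)"
    by (rule integrable_mult_right[OF ind])
  have lim: "AE x in lborel. (\<lambda>n. q n x) \<longlonglongrightarrow> G x \<bullet> e"
    using deriv
  proof eventually_elim
    case (elim x)
    have "((\<lambda>t. g (x + t *\<^sub>R e)) has_derivative (\<lambda>h. (h *\<^sub>R e) \<bullet> G x)) (at 0)"
    proof (rule has_derivative_compose[of "\<lambda>t. x + t *\<^sub>R e" "\<lambda>h. h *\<^sub>R e" 0 UNIV g "\<lambda>h. h \<bullet> G x"])
      show "((\<lambda>t. x + t *\<^sub>R e) has_derivative (\<lambda>h. h *\<^sub>R e)) (at 0)"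
        by (auto intro!: derivative_eq_intros)
      show "(g has_derivative (\<lambda>h. h \<bullet> G x)) (at (x + 0 *\<^sub>R e))" using elim by (simp add: gderiv_def)
    qed
    then have "((\<lambda>t. g (x + t *\<^sub>R e)) has_real_derivative (G x \<bullet> e)) (at 0)"
    proof -
      have "(\<lambda>h. (h *\<^sub>R e) \<bullet> G x) = (*) (G x \<bullet> e)" by (simp add: fun_eq_iff inner_commute mult.commute)
      then show ?thesis
        using \<open>((\<lambda>t. g (x + t *\<^sub>R e)) has_derivative (\<lambda>h. (h *\<^sub>R e) \<bullet> G x)) (at 0)\<close>
        unfolding has_field_derivative_def by simp
    qed
    then have "((\<lambda>h. (g (x + h *\<^sub>R e) - g x) / h) \<longlongrightarrow> G x \<bullet> e) (at 0)"
      unfolding DERIV_def by simp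
    moreover have "filterlim (\<lambda>n. inverse (real (Suc n))) (at 0) sequentially"
      unfolding filterlim_at by (intro conjI LIMSEQ_inverse_real_of_nat) simp
    ultimately have "(\<lambda>n. (g (x + inverse (real (Suc n)) *\<^sub>R e) - g x) / inverse (real (Suc n))) \<longlonglongrightarrow> G x \<bullet> e"
      by (rule filterlim_compose)
    then show ?case by (simp add: q_def divide_inverse)
  qed
  have Gm: "(\<lambda>x. G x \<bullet> e) \<in> borel_measurable lborel" using meas by measurable
  have bd: "AE x in lborel. norm (q n x) \<le> L * indicator (cball 0 (r + 1)) x" for n
    using bound by simp
  show "integrable lborel (\<lambda>x. G x \<bullet> e)"
    by (rule integrable_dominated_convergence[OF Gm qm w lim bd])
  have "(\<lambda>n. \<integral>x. q n x \<partial>lborel) \<longlonglongrightarrow> (\<integral>x. G x \<bullet> e \<partial>lborel)"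
    by (rule integral_dominated_convergence[OF Gm qm w lim bd])
  moreover have "(\<integral>x. q n x \<partial>lborel) = 0" for n
  proof -
    let ?h = "inverse (real (Suc n)) *\<^sub>R e"
    obtain B where B: "\<And>x. \<bar>g x\<bar> \<le> B"
    proof -
      have "compact (g ` cball 0 (r + 1))"
        by (intro compact_continuous_image lipschitz_on_continuous_on[OF lip]) auto
      from compact_imp_bounded[OF this]
      obtain B where "B > 0" "\<And>x. x \<in> cball 0 (r + 1) \<Longrightarrow> \<bar>g x\<bar> \<le> B"
        unfolding bounded_pos by auto
      then have "\<bar>g x\<bar> \<le> B" for x using zero[of x] by (cases "x \<in> cball 0 (r + 1)") auto
      then show ?thesis by (rule that)
    qed
    have gi: "integrable lborel g"
    proof (rule Bochner_Integration.integrable_bound)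
      show "integrable lborel (\<lambda>x::real^'d. B * indicator (cball 0 (r + 1)) x)"
        by (rule integrable_mult_right[OF ind])
      have "\<bar>g x\<bar> \<le> \<bar>B * indicator (cball 0 (r + 1)) x\<bar>" for x
        using B[of x] zero[of x] by (cases "x \<in> cball 0 (r + 1)") auto
      then show "AE x in lborel. norm (g x) \<le> norm (B * indicator (cball 0 (r + 1)) x)" by simp
    qed auto
    have gi2: "integrable (distr lborel borel ((+) ?h)) g" using gi by (simp add: lborel_distr_plus)
    have tr: "integrable lborel (\<lambda>x. g (?h + x))"
      using gi2 by (subst (asm) integrable_distr_eq) auto
    have "(\<integral>x. g x \<partial>lborel) = (\<integral>x. g x \<partial>distr lborel borel ((+) ?h))"
      by (simp add: lborel_distr_plus)
    also have "\<dots> = (\<integral>x. g (?h + x) \<partial>lborel)" by (subst integral_distr) auto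
    finally have "(\<integral>x. g (?h + x) - g x \<partial>lborel) = 0" using tr gi by simp
    then show ?thesis unfolding q_def by (simp add: add.commute)
  qed
  ultimately show "(\<integral>x. G x \<bullet> e \<partial>lborel) = 0" by (simp add: LIMSEQ_const_iff)
qed

section \<open>Geometry of polytopes, surface measure and the theorem of Gauss\<close>

section \<open>Facets of polytopes with interior points\<close>

text \<open>For a facet this is the distance to its hyperplane, counted positively on the side of
  \<open>K\<close>. The normal is orthogonal to the facet, so the chosen point does not
  matter.\<close>

definition facet_dist :: "(real^'d) set \<Rightarrow> (real^'d) set \<Rightarrow> real^'d \<Rightarrow> real" where
  "facet_dist K F x = (SOME y. y \<in> F) \<bullet> outer_normal K F - x \<bullet> outer_normal K F"

locale solid_polytope =
  fixes K :: "(real^'d) set"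
  assumes polytope: "polytope K" and interior_nonempty: "interior K \<noteq> {}"
begin

lemma polyhedron: "polyhedron K"
  using polytope by (rule polytope_imp_polyhedron)

lemma convex: "convex K"
  using polytope by (rule polytope_imp_convex)

lemma compact: "compact K"
  using polytope by (rule polytope_imp_compact)

lemma nonempty: "K \<noteq> {}"
  using interior_nonempty interior_subset by blast

lemma lebesgue_sets [simp, measurable]: "K \<in> sets lebesgue"
  using compact by (simp add: compact_imp_closed borel_closed)

lemma affine_hull: "affine hull K = UNIV"
  by (rule affine_hull_nonempty_interior[OF interior_nonempty])

lemma aff_dim: "aff_dim K = int CARD('d)"
  using aff_dim_affine_hull[of K] by (simp add: affine_hull)

lemma finite_faces: "finite (faces_of K)"
  unfolding faces_of_def by (rule finite_polytope_facets[OF polytope])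

lemma closure_interior: "closure (interior K) = K"
  using convex_closure_interior[OF convex interior_nonempty] compact by (simp add: compact_imp_closed)

lemma negligible_boundary: "negligible (K - interior K)"
  using negligible_convex_frontier[OF convex] compact by (simp add: frontier_def compact_imp_closed)

lemma facet_aff_dim: "F \<in> faces_of K \<Longrightarrow> aff_dim F = int CARD('d) - 1"
  by (simp add: faces_of_def facet_of_def aff_dim)

lemma facet_nonempty: "F \<in> faces_of K \<Longrightarrow> F \<noteq> {}"
  by (simp add: faces_of_def facet_of_def)

lemma facet_subset: "F \<in> faces_of K \<Longrightarrow> F \<subseteq> K"
  by (simp add: faces_of_def facet_of_imp_subset)

lemma facet_polytope: "F \<in> faces_of K \<Longrightarrow> polytope F"
  using face_of_polytope_polytope[OF polytope] by (simp add: faces_of_def facet_of_imp_face_of)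

lemma facet_antimono:
  assumes "F \<in> faces_of K" "G \<in> faces_of K" "F \<subseteq> G"
  shows "F = G"
proof (rule ccontr)
  assume "F \<noteq> G"
  have "F face_of G"
    using face_of_subset[of F K G] assms by (simp add: faces_of_def facet_of_imp_face_of facet_of_imp_subset)
  moreover have "convex G" using facet_polytope[OF assms(2)] by (rule polytope_imp_convex)
  ultimately have "aff_dim F < aff_dim G" using \<open>F \<noteq> G\<close> face_of_aff_dim_lt by blast
  then show False using assms by (simp add: facet_aff_dim)
qed

text \<open>A facet has codimension one, so a hyperplane containing it is its affine hull. Normals
  obtained in different ways are compared through this common hyperplane.\<close>

lemma hyperplane_is_affine_hull:
  assumes F: "F \<in> faces_of K" and n: "n \<noteq> 0" "F \<subseteq> {x. n \<bullet> x = b}"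
  shows "affine hull F = {x. n \<bullet> x = b}"
proof (rule affine_dim_equal)
  show "affine hull F \<subseteq> {x. n \<bullet> x = b}"
    using n by (intro hull_minimal) (auto simp: affine_hyperplane)
  show "aff_dim (affine hull F) = aff_dim {x. n \<bullet> x = b}"
    using n facet_aff_dim[OF F] by (simp add: aff_dim_hyperplane)
qed (use facet_nonempty[OF F] in \<open>auto simp: affine_hyperplane\<close>)

text \<open>The point \<open>x0\<close> of the hyperplane is shifted by the tangential part of
  \<open>n'\<close>. The shifted point stays in the hyperplane, which forces that part to vanish,
  that is \<open>(n' \<bullet> n)\<^sup>2 = 1\<close>.\<close>

lemma parallel_normals:
  fixes n n' :: "real^'d"
  assumes "norm n = 1" "norm n' = 1" and eq: "{x. n \<bullet> x = b} = {x. n' \<bullet> x = b'}"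
  shows "n' = n \<or> n' = - n"
proof -
  define x0 where "x0 = b *\<^sub>R n"
  have nn: "n \<bullet> n = 1" "n' \<bullet> n' = 1" using assms by (simp_all add: norm_eq_1)
  then have "x0 \<in> {x. n \<bullet> x = b}" by (simp add: x0_def)
  then have x0: "n' \<bullet> x0 = b'" using eq by auto
  have "x0 + (n' - (n' \<bullet> n) *\<^sub>R n) \<in> {x. n \<bullet> x = b}"
    using nn by (simp add: x0_def inner_add_right inner_diff_right inner_commute)
  then have "n' \<bullet> (x0 + (n' - (n' \<bullet> n) *\<^sub>R n)) = b'" using eq by auto
  then have "(n' \<bullet> n)\<^sup>2 = 1" using x0 nn by (simp add: inner_add_right inner_diff_right power2_eq_square)
  then consider "n' \<bullet> n = 1" | "n' \<bullet> n = -1" by (auto simp: power2_eq_1_iff)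
  then show ?thesis
  proof cases
    case 1
    then have "(n' - n) \<bullet> (n' - n) = 0" using nn by (simp add: inner_diff_left inner_diff_right inner_commute)
    then show ?thesis by simp
  next
    case 2
    then have "(n' + n) \<bullet> (n' + n) = 0" using nn by (simp add: inner_add_left inner_add_right inner_commute)
    then show ?thesis by (simp add: add_eq_0_iff)
  qed
qed

text \<open>Resolves the definite description: a competitor is \<open>n\<close> or
  \<open>- n\<close>, and the latter would squeeze \<open>K\<close> into the hyperplane of its own
  facet.\<close>

lemma outer_normal_eqI:
  assumes F: "F \<in> faces_of K" and n: "norm n = 1" "F = K \<inter> {x. n \<bullet> x = b}" "K \<subseteq> {x. n \<bullet> x \<le> b}"
  shows "outer_normal K F = n"
  unfolding outer_normal_def
proof (rule the_equality)
  show "norm n = 1 \<and> (\<forall>x\<in>F. \<forall>y\<in>F. (y - x) \<bullet> n = 0) \<and> (\<forall>x\<in>F. \<forall>y\<in>K. (y - x) \<bullet> n \<le> 0)"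
    using n by (auto simp: inner_diff_right inner_commute)
next
  fix n' :: "real^'d"
  assume n': "norm n' = 1 \<and> (\<forall>x\<in>F. \<forall>y\<in>F. (y - x) \<bullet> n' = 0) \<and> (\<forall>x\<in>F. \<forall>y\<in>K. (y - x) \<bullet> n' \<le> 0)"
  obtain x where x: "x \<in> F" using facet_nonempty[OF F] by auto
  have sub: "F \<subseteq> {y. n' \<bullet> y = n' \<bullet> x}" using n' x by (auto simp: inner_diff_right inner_commute)
  have "n \<noteq> 0" "n' \<noteq> 0" using n(1) n' by auto
  then have "{y. n \<bullet> y = b} = {y. n' \<bullet> y = n' \<bullet> x}"
    using hyperplane_is_affine_hull[OF F _ sub] hyperplane_is_affine_hull[OF F, of n b] n(2) by auto
  then consider "n' = n" | "n' = - n" using parallel_normals n(1) n' by blast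
  then show "n' = n"
  proof cases
    case 2
    have "K \<subseteq> {y. n \<bullet> y = b}"
    proof
      fix y assume y: "y \<in> K"
      then have "n \<bullet> y \<le> b" using n(3) by auto
      moreover have "(y - x) \<bullet> n' \<le> 0" using n' x y by blast
      then have "n \<bullet> y \<ge> b" using 2 x n(2) by (auto simp: inner_diff_right inner_commute)
      ultimately show "y \<in> {y. n \<bullet> y = b}" by simp
    qed
    with n(2) have "F = K" by auto
    then show ?thesis using facet_aff_dim[OF F] aff_dim by simp
  qed
qed

lemma facet_normal:
  assumes F: "F \<in> faces_of K"
  shows "norm (outer_normal K F) = 1"
    and "F = {x \<in> K. facet_dist K F x = 0}"
    and "x \<in> K \<Longrightarrow> 0 \<le> facet_dist K F x"
proof -
  obtain a b where ab: "a \<noteq> 0" "K \<subseteq> {x. a \<bullet> x \<le> b}" "F = K \<inter> {x. a \<bullet> x = b}"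
    using facet_of_polyhedron[OF polyhedron, of F] F by (auto simp: faces_of_def)
  define n where "n = inverse (norm a) *\<^sub>R a"
  define c where "c = inverse (norm a) * b"
  have na: "norm a > 0" using ab by simp
  have n1: "norm n = 1" using ab by (simp add: n_def)
  have le: "n \<bullet> x \<le> c \<longleftrightarrow> a \<bullet> x \<le> b" for x using na by (simp add: n_def c_def)
  have eq: "n \<bullet> x = c \<longleftrightarrow> a \<bullet> x = b" for x using na by (simp add: n_def c_def)
  have Feq: "F = K \<inter> {x. n \<bullet> x = c}" and sub: "K \<subseteq> {x. n \<bullet> x \<le> c}" using ab(2,3) by (auto simp: le eq)
  have o: "outer_normal K F = n" by (rule outer_normal_eqI[OF F n1 Feq sub])
  obtain y where "y \<in> F" using facet_nonempty[OF F] by auto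
  then have "(SOME y. y \<in> F) \<in> F" by (rule someI)
  then have "(SOME y. y \<in> F) \<bullet> n = c" using Feq by (auto simp: inner_commute)
  then have d: "facet_dist K F x = c - n \<bullet> x" for x
    unfolding facet_dist_def o by (simp add: inner_commute)
  show "norm (outer_normal K F) = 1" using o n1 by simp
  have "{x \<in> K. facet_dist K F x = 0} = K \<inter> {x. n \<bullet> x = c}" by (auto simp: d)
  with Feq show "F = {x \<in> K. facet_dist K F x = 0}" by simp
  show "x \<in> K \<Longrightarrow> 0 \<le> facet_dist K F x" using sub by (auto simp: d)
qed

text \<open>In a minimal representation by halfspaces every halfspace bounds a facet, so the
  constraints coming from the facets already imply all others.\<close>

lemma eq_halfspaces: "K = {x. \<forall>F\<in>faces_of K. 0 \<le> facet_dist K F x}"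
proof -
  obtain H where H: "finite H" and seq: "K = affine hull K \<inter> \<Inter>H"
             and "\<forall>h\<in>H. \<exists>a b. a \<noteq> 0 \<and> h = {x. a \<bullet> x \<le> b}"
             and min: "\<And>F'. F' \<subset> H \<Longrightarrow> K \<subset> (affine hull K) \<inter> \<Inter>F'"
    using polyhedron by (simp add: polyhedron_Int_affine_minimal) meson
  then obtain a b where ab: "\<And>h. h \<in> H \<Longrightarrow> a h \<noteq> 0 \<and> h = {x. a h \<bullet> x \<le> b h}"
    by metis
  have "x \<in> h" if h: "h \<in> H" and x: "\<forall>F\<in>faces_of K. 0 \<le> facet_dist K F x" for x h
  proof -
    let ?F = "K \<inter> {x. a h \<bullet> x = b h}"
    have F: "?F \<in> faces_of K"
      unfolding faces_of_def using facet_of_polyhedron_explicit[OF H seq ab min] h by auto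
    define n where "n = inverse (norm (a h)) *\<^sub>R a h"
    define c where "c = inverse (norm (a h)) * b h"
    have na: "norm (a h) > 0" using ab[OF h] by simp
    have n1: "norm n = 1" using na by (simp add: n_def)
    have le: "n \<bullet> x \<le> c \<longleftrightarrow> a h \<bullet> x \<le> b h" for x using na by (simp add: n_def c_def)
    have eq: "n \<bullet> x = c \<longleftrightarrow> a h \<bullet> x = b h" for x using na by (simp add: n_def c_def)
    have "K \<subseteq> h" using seq h by auto
    then have sub: "K \<subseteq> {x. n \<bullet> x \<le> c}" using ab[OF h] by (auto simp: le)
    have o: "outer_normal K ?F = n" by (rule outer_normal_eqI[OF F n1 _ sub]) (auto simp: eq)
    obtain y where "y \<in> ?F" using facet_nonempty[OF F] by auto
    then have "(SOME y. y \<in> ?F) \<in> ?F" by (rule someI)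
    then have "a h \<bullet> (SOME y. y \<in> ?F) = b h" by blast
    then have "(SOME y. y \<in> ?F) \<bullet> n = c" unfolding eq[symmetric] by (simp add: inner_commute)
    then have "facet_dist K ?F x = c - n \<bullet> x"
      unfolding facet_dist_def o by (simp add: inner_commute)
    with x F have "n \<bullet> x \<le> c" by force
    then show "x \<in> h" using ab[OF h] le by auto
  qed
  then have "x \<in> K" if "\<forall>F\<in>faces_of K. 0 \<le> facet_dist K F x" for x
    using that seq affine_hull by auto
  then show ?thesis using facet_normal(3) by auto
qed

text \<open>Strict constraints define an open subset of \<open>K\<close>. Conversely, moving an
  interior point by \<open>e\<close> along the outer normal stays in \<open>K\<close> and lowers the
  distance by \<open>e\<close>.\<close>

lemma interior_iff_facet_dist: "x \<in> interior K \<longleftrightarrow> (\<forall>F\<in>faces_of K. 0 < facet_dist K F x)"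
proof
  assume pos: "\<forall>F\<in>faces_of K. 0 < facet_dist K F x"
  have "open (\<Inter>F\<in>faces_of K. {y. 0 < facet_dist K F y})"
    unfolding facet_dist_def
    by (intro open_INT finite_faces ballI open_Collect_less continuous_intros)
  moreover have "(\<Inter>F\<in>faces_of K. {y. 0 < facet_dist K F y}) \<subseteq> K"
    using eq_halfspaces by force
  ultimately show "x \<in> interior K" using pos by (auto intro: interiorI[of "\<Inter>F\<in>faces_of K. {y. 0 < facet_dist K F y}"])
next
  assume x: "x \<in> interior K"
  show "\<forall>F\<in>faces_of K. 0 < facet_dist K F x"
  proof
    fix F assume F: "F \<in> faces_of K"
    let ?n = "outer_normal K F"
    obtain e where e: "e > 0" "cball x e \<subseteq> K" using x by (auto simp: mem_interior_cball)
    have "x + e *\<^sub>R ?n \<in> K" using e facet_normal(1)[OF F] by (intro subsetD[OF e(2)]) (simp add: dist_norm)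
    then have "0 \<le> facet_dist K F (x + e *\<^sub>R ?n)" by (rule facet_normal(3)[OF F])
    then have "e \<le> facet_dist K F x"
      using facet_normal(1)[OF F] by (simp add: facet_dist_def inner_add_left norm_eq_1)
    then show "0 < facet_dist K F x" using e by linarith
  qed
qed

text \<open>A face of \<open>K\<close> that meets the relative interior of \<open>F\<close> contains
  \<open>F\<close>, and distinct facets are not nested. This makes products of the other facet
  distances positive almost everywhere on \<open>F\<close>.\<close>

lemma facet_dist_pos_rel_interior:
  assumes F: "F \<in> faces_of K" and G: "G \<in> faces_of K" "G \<noteq> F" and x: "x \<in> rel_interior F"
  shows "0 < facet_dist K G x"
proof (rule ccontr)
  have xK: "x \<in> K" "x \<in> F" using x facet_subset[OF F] rel_interior_subset by blast+
  assume "\<not> 0 < facet_dist K G x"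
  then have "x \<in> G" using facet_normal(2,3)[OF G(1)] xK by force
  moreover have "G face_of K" using G by (simp add: faces_of_def facet_of_imp_face_of)
  ultimately have "F \<subseteq> G" using subset_of_face_of[of G K F] x facet_subset[OF F] by blast
  with facet_antimono[OF F G(1)] G(2) show False by simp
qed

lemma facet_affine_hull:
  assumes F: "F \<in> faces_of K"
  shows "affine hull F = {x. facet_dist K F x = 0}"
proof -
  have "outer_normal K F \<noteq> 0" using facet_normal(1)[OF F] by auto
  moreover have "{x. facet_dist K F x = 0} = {x. outer_normal K F \<bullet> x = outer_normal K F \<bullet> (SOME y. y \<in> F)}"
    by (auto simp: facet_dist_def inner_commute)
  moreover have "F \<subseteq> {x. facet_dist K F x = 0}" using facet_normal(2)[OF F] by auto
  ultimately show ?thesis using hyperplane_is_affine_hull[OF F] by simp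
qed

end

section \<open>Stretching in the direction of a unit vector\<close>

text \<open>Uniqueness of translation-invariant measures up to a factor. The product measure of the
  pairs with \<open>x \<in> A\<close> and \<open>y - x \<in> B\<close> is computed in both orders,
  using invariance once for Lebesgue measure in \<open>y\<close>, once for \<open>M\<close>, and
  once more for Lebesgue measure after swapping back.\<close>

lemma translation_invariant_eq_lborel:
  fixes M :: "(real^'d) measure"
  assumes sets: "sets M = sets borel" and sf: "sigma_finite_measure M"
    and inv: "\<And>t. distr M borel ((+) t) = M" and A: "A \<in> sets borel" and B: "B \<in> sets borel"
  shows "emeasure M A * emeasure lborel B = emeasure M (uminus ` B) * emeasure lborel A"
proof -
  interpret M: sigma_finite_measure M by (rule sf)
  interpret pair_sigma_finite M lborel by (rule pair_sigma_finite.intro) (use sf lborel.sigma_finite_measure_axioms in auto)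
  have [measurable_cong]: "sets M = sets borel" by (rule sets)
  note [measurable] = A B
  have uB: "uminus ` B = uminus -` B" by force
  have [measurable]: "uminus ` B \<in> sets borel"
    unfolding uB using measurable_sets[of uminus borel borel B] B by simp
  have "emeasure M A * emeasure lborel B = (\<integral>\<^sup>+x. indicator A x * emeasure lborel B \<partial>M)"
    by (simp add: nn_integral_multc sets A)
  also have "\<dots> = (\<integral>\<^sup>+x. \<integral>\<^sup>+y. indicator A x * indicator B (y - x) \<partial>lborel \<partial>M)"
  proof (rule nn_integral_cong)
    fix x
    have "(\<integral>\<^sup>+y. indicator B y \<partial>lborel) = (\<integral>\<^sup>+y. indicator B y \<partial>distr lborel borel ((+) (- x)))"
      by (simp add: lborel_distr_plus)
    also have "\<dots> = (\<integral>\<^sup>+y. indicator B (- x + y) \<partial>lborel)"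
      by (subst nn_integral_distr) auto
    finally have "emeasure lborel B = (\<integral>\<^sup>+y. indicator B (y - x) \<partial>lborel)" by simp
    then show "indicator A x * emeasure lborel B = (\<integral>\<^sup>+y. indicator A x * indicator B (y - x) \<partial>lborel)"
      by (simp add: nn_integral_cmult)
  qed
  also have "\<dots> = (\<integral>\<^sup>+y. \<integral>\<^sup>+x. indicator A x * indicator B (y - x) \<partial>M \<partial>lborel)"
    by (rule Fubini'[symmetric]) measurable
  also have "\<dots> = (\<integral>\<^sup>+y. \<integral>\<^sup>+x. indicator A (y + x) * indicator (uminus ` B) x \<partial>M \<partial>lborel)"
  proof (rule nn_integral_cong)
    fix y
    have "(\<integral>\<^sup>+x. indicator A x * indicator B (y - x) \<partial>M) = (\<integral>\<^sup>+x. indicator A x * indicator B (y - x) \<partial>distr M borel ((+) y))"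
      by (simp add: inv)
    also have "\<dots> = (\<integral>\<^sup>+x. indicator A (y + x) * indicator B (y - (y + x)) \<partial>M)"
      by (subst nn_integral_distr) auto
    finally show "(\<integral>\<^sup>+x. indicator A x * indicator B (y - x) \<partial>M) = (\<integral>\<^sup>+x. indicator A (y + x) * indicator (uminus ` B) x \<partial>M)"
      by (simp add: uB indicator_def)
  qed
  also have "\<dots> = (\<integral>\<^sup>+x. \<integral>\<^sup>+y. indicator A (y + x) * indicator (uminus ` B) x \<partial>lborel \<partial>M)"
    by (rule Fubini') measurable
  also have "\<dots> = (\<integral>\<^sup>+x. emeasure lborel A * indicator (uminus ` B) x \<partial>M)"
  proof (rule nn_integral_cong)
    fix x
    have "(\<integral>\<^sup>+y. indicator A y \<partial>lborel) = (\<integral>\<^sup>+y. indicator A y \<partial>distr lborel borel ((+) x))"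
      by (simp add: lborel_distr_plus)
    also have "\<dots> = (\<integral>\<^sup>+y. indicator A (x + y) \<partial>lborel)"
      by (subst nn_integral_distr) auto
    finally have "emeasure lborel A = (\<integral>\<^sup>+y. indicator A (y + x) \<partial>lborel)" by (simp add: add.commute)
    then show "(\<integral>\<^sup>+y. indicator A (y + x) * indicator (uminus ` B) x \<partial>lborel) = emeasure lborel A * indicator (uminus ` B) x"
      by (simp add: nn_integral_multc)
  qed
  also have "\<dots> = emeasure M (uminus ` B) * emeasure lborel A"
    by (simp add: nn_integral_cmult sets mult.commute)
  finally show ?thesis .
qed

text \<open>The image measure is translation invariant because \<open>Q\<close> is linear and onto,
  hence a multiple of Lebesgue measure. The factor is 1, since the unit ball is mapped to itself and
  has positive finite volume.\<close>

lemma lborel_distr_orthogonal: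
  fixes Q :: "real^'d \<Rightarrow> real^'d"
  assumes Q: "orthogonal_transformation Q"
  shows "distr lborel borel Q = lborel"
proof (rule measure_eqI)
  let ?M = "distr lborel borel Q"
  have lin: "linear Q" using Q by (rule orthogonal_transformation_linear)
  have [measurable]: "Q \<in> borel_measurable borel"
    using lin by (intro borel_measurable_continuous_onI linear_continuous_on linear_conv_bounded_linear[THEN iffD1])
  have nQ: "norm (Q x) = norm x" for x using Q by (simp add: orthogonal_transformation)
  have ball: "emeasure ?M (ball 0 r) = emeasure lborel (ball (0 :: real^'d) r)" for r
  proof -
    have "Q -` ball 0 r = ball 0 r" using nQ by auto
    then show ?thesis by (simp add: emeasure_distr)
  qed
  have sf: "sigma_finite_measure ?M"
  proof
    show "\<exists>A. countable A \<and> A \<subseteq> sets ?M \<and> \<Union>A = space ?M \<and> (\<forall>a\<in>A. emeasure ?M a \<noteq> \<infinity>)"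
    proof (intro exI[of _ "range (\<lambda>n::nat. ball (0 :: real^'d) (real n))"] conjI ballI)
      show "\<Union> (range (\<lambda>n. ball (0 :: real^'d) (real n))) = space ?M"
        using reals_Archimedean2 by auto
      show "emeasure ?M a \<noteq> \<infinity>" if "a \<in> range (\<lambda>n. ball (0 :: real^'d) (real n))" for a
        using that emeasure_lborel_ball_finite[of "0::real^'d"] by (auto simp: ball less_top simp del: emeasure_distr)
    qed auto
  qed
  have inv: "distr ?M borel ((+) t) = ?M" for t
  proof -
    obtain s where s: "t = Q s" using orthogonal_transformation_surj[OF Q] by (metis surjD)
    have "distr ?M borel ((+) t) = distr lborel borel (\<lambda>x. Q (s + x))"
      by (subst distr_distr) (auto simp: o_def s linear_add[OF lin])
    also have "\<dots> = distr (distr lborel borel ((+) s)) borel Q"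
      by (subst distr_distr) (auto simp: o_def)
    finally show ?thesis by (simp add: lborel_distr_plus)
  qed
  have u: "uminus ` ball 0 1 = (ball 0 1 :: (real^'d) set)" 
  proof (rule set_eqI)
    fix x :: "real^'d"
    show "x \<in> uminus ` ball 0 1 \<longleftrightarrow> x \<in> ball 0 1"
      by (auto simp: image_iff intro!: bexI[of _ "- x"])
  qed
  fix A assume "A \<in> sets ?M"
  then have "emeasure ?M A * emeasure lborel (ball 0 1 :: (real^'d) set) = emeasure lborel A * emeasure lborel (ball 0 1 :: (real^'d) set)"
    
    using translation_invariant_eq_lborel[OF _ sf inv, of A "ball 0 1"] unfolding u ball by (simp add: mult.commute)
  moreover have "emeasure lborel (ball 0 1 :: (real^'d) set) \<noteq> 0"
  proof -
    have "\<not> negligible (ball 0 1 :: (real^'d) set)" by (intro open_not_negligible) auto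
    then show ?thesis by (auto simp: negligible_iff_emeasure0 emeasure_completion)
  qed
  moreover have "emeasure lborel (ball 0 1 :: (real^'d) set) \<noteq> \<infinity>"
    using emeasure_lborel_ball_finite[of "0::real^'d" 1] by auto
  ultimately show "emeasure ?M A = emeasure lborel A"
    by (metis ennreal_mult_cancel_left infinity_ennreal_def mult.commute)
qed simp

text \<open>Stretching by \<open>c\<close> along \<open>n\<close>, with the hyperplane
  \<open>y \<bullet> n = b\<close> fixed. A rotation carries a coordinate axis to \<open>n\<close>;
  there the map is diagonal with determinant \<open>c\<close>, and a translation accounts for
  \<open>b\<close>.\<close>

lemma integral_stretch:
  fixes n :: "real^'d" and f :: "real^'d \<Rightarrow> real"
  assumes n: "norm n = 1" and c: "c \<noteq> 0" and f [measurable]: "f \<in> borel_measurable borel"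
  shows "(\<integral>x. f x \<partial>lborel) = \<bar>c\<bar> * (\<integral>y. f (y + ((c - 1) * (y \<bullet> n - b)) *\<^sub>R n) \<partial>lborel)"
proof -
  obtain i :: 'd where True by simp
  obtain Q :: "real^'d \<Rightarrow> real^'d" where Q: "orthogonal_transformation Q" "Q (axis i 1) = n"
    using orthogonal_transformation_exists_1[of "axis i 1" n] n by auto
  have linQ: "linear Q" using Q(1) by (rule orthogonal_transformation_linear)
  have Qm [measurable]: "Q \<in> borel_measurable borel"
    using linQ by (intro borel_measurable_continuous_onI linear_continuous_on linear_conv_bounded_linear[THEN iffD1])
  have Qi: "(\<integral>x. g x \<partial>lborel) = (\<integral>x. g (Q x) \<partial>lborel)" if "g \<in> borel_measurable borel" for g :: "real^'d \<Rightarrow> real"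
  proof -
    have "(\<integral>x. g x \<partial>lborel) = (\<integral>x. g x \<partial>distr lborel borel Q)" by (simp add: lborel_distr_orthogonal[OF Q(1)])
    also have "\<dots> = (\<integral>x. g (Q x) \<partial>lborel)" using that by (subst integral_distr) auto
    finally show ?thesis .
  qed
  let ?D = "\<lambda>y::real^'d. y + ((c - 1) * y $ i) *\<^sub>R axis i 1"
  let ?T = "\<lambda>y. y + ((c - 1) * (y \<bullet> n)) *\<^sub>R n"
  let ?t = "- ((c - 1) * b) *\<^sub>R n"
  let ?cc = "\<lambda>j::real^'d. if j = axis i 1 then c else 1"
  have axB: "axis i 1 \<in> (Basis :: (real^'d) set)" by (auto simp: Basis_vec_def)
  have Dform: "0 + (\<Sum>j\<in>Basis. (?cc j * (y \<bullet> j)) *\<^sub>R j) = ?D y" for y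
  proof -
    have "(\<Sum>j\<in>Basis. (?cc j * (y \<bullet> j)) *\<^sub>R j) =
        (\<Sum>j\<in>Basis. (y \<bullet> j) *\<^sub>R j + (if j = axis i 1 then ((c - 1) * (y \<bullet> j)) *\<^sub>R j else 0))"
      by (intro sum.cong) (auto simp: algebra_simps)
    also have "\<dots> = y + ((c - 1) * (y \<bullet> axis i 1)) *\<^sub>R axis i 1"
      by (simp add: sum.distrib euclidean_representation axB)
    finally show ?thesis by (simp add: cart_eq_inner_axis)
  qed
  have "(\<Prod>j\<in>Basis. \<bar>?cc j\<bar>) = (\<Prod>j\<in>(Basis :: (real^'d) set). if j = axis i 1 then \<bar>c\<bar> else 1)"
    by (rule prod.cong) auto
  also have "\<dots> = \<bar>c\<bar>" by (simp add: axB)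
  finally have pr: "(\<Prod>j\<in>Basis. \<bar>?cc j\<bar>) = \<bar>c\<bar>" .
  have lb: "lborel = density (distr lborel borel ?D) (\<lambda>_. ennreal \<bar>c\<bar>)"
    using lborel_affine_euclidean[of ?cc 0] c unfolding Dform pr by auto
  \<comment> \<open>Conjugation by the rotation turns the stretch of the \<open>i\<close>-th
    coordinate into the stretch along \<open>n\<close>.\<close>
  have TQ: "?T (Q y) = Q (?D y)" for y
  proof -
    have "Q y \<bullet> n = y $ i"
      using Q by (metis cart_eq_inner_axis orthogonal_transformation_def)
    then show ?thesis using Q(2) linQ by (simp add: linear_add linear_cmul)
  qed
  have Dm [measurable]: "?D \<in> borel_measurable borel"
    by (intro borel_measurable_continuous_onI continuous_intros)
  have "(\<integral>x. f x \<partial>lborel) = (\<integral>x. f x \<partial>distr lborel borel ((+) ?t))"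
    by (simp add: lborel_distr_plus)
  also have "\<dots> = (\<integral>x. f (?t + x) \<partial>lborel)" by (subst integral_distr) auto
  also have "\<dots> = (\<integral>x. f (?t + Q x) \<partial>lborel)" by (rule Qi) measurable
  also have "\<dots> = (\<integral>x. f (?t + Q x) \<partial>density (distr lborel borel ?D) (\<lambda>_. ennreal \<bar>c\<bar>))"
    using lb by simp
  also have "\<dots> = (\<integral>x. \<bar>c\<bar> * f (?t + Q x) \<partial>distr lborel borel ?D)"
    by (subst integral_density) auto
  also have "\<dots> = (\<integral>y. \<bar>c\<bar> * f (?t + Q (?D y)) \<partial>lborel)"
    by (rule integral_distr) measurable
  also have "\<dots> = (\<integral>y. \<bar>c\<bar> * f (?t + ?T (Q y)) \<partial>lborel)" by (simp add: TQ)
  also have "\<dots> = (\<integral>y. \<bar>c\<bar> * f (?t + ?T y) \<partial>lborel)" by (rule Qi[symmetric]) measurable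
  also have "\<dots> = \<bar>c\<bar> * (\<integral>y. f (?t + ?T y) \<partial>lborel)" by simp
  also have "(\<lambda>y. ?t + ?T y) = (\<lambda>y. y + ((c - 1) * (y \<bullet> n - b)) *\<^sub>R n)"
    by (auto simp: fun_eq_iff algebra_simps)
  finally show ?thesis by (simp add: fun_eq_iff)
qed

section \<open>The surface measure of a flat face\<close>

text \<open>Together with the next two definitions this splits a point into its foot on the
  hyperplane and its height above it. In these coordinates the prism is the product of the face and
  the unit interval.\<close>

definition face_proj :: "(real^'d) set \<Rightarrow> real^'d \<Rightarrow> real^'d" where
  "face_proj F y = y - ((y - (SOME a. a \<in> F)) \<bullet> face_normal F) *\<^sub>R face_normal F"

definition face_prism :: "(real^'d) set \<Rightarrow> (real^'d) set" where
  "face_prism F = {x + t *\<^sub>R face_normal F |x t. x \<in> F \<and> 0 \<le> t \<and> t \<le> 1}"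

definition face_height :: "(real^'d) set \<Rightarrow> real^'d \<Rightarrow> real" where
  "face_height F y = (y - (SOME a. a \<in> F)) \<bullet> face_normal F"

lemma face_measure_eq:
  "face_measure F = distr (lebesgue_on (face_prism F)) (restrict_space borel F) (face_proj F)"
  unfolding face_measure_def face_prism_def face_proj_def[abs_def] Let_def ..

locale flat_face =
  fixes F :: "(real^'d) set"
  assumes compact: "compact F" and nonempty: "F \<noteq> {}"
    and flat: "\<exists>n. norm n = 1 \<and> (\<forall>x\<in>F. \<forall>y\<in>F. (y - x) \<bullet> n = 0)"
begin

lemma normal: "norm (face_normal F) = 1" "x \<in> F \<Longrightarrow> y \<in> F \<Longrightarrow> (y - x) \<bullet> face_normal F = 0"
  using someI_ex[OF flat] unfolding face_normal_def by auto

lemma normal_inner: "face_normal F \<bullet> face_normal F = 1"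
  using normal(1) by (simp add: norm_eq_1)

lemma base_point: "(SOME a. a \<in> F) \<in> F"
  using nonempty by (auto intro: someI)

lemma face_proj_height: "face_proj F y = y - face_height F y *\<^sub>R face_normal F"
  by (simp add: face_proj_def face_height_def)

lemma height_add: "face_height F (x + t *\<^sub>R face_normal F) = face_height F x + t"
  by (simp add: face_height_def inner_diff_left inner_add_left normal_inner)

lemma height_zero: "x \<in> F \<Longrightarrow> face_height F x = 0"
  unfolding face_height_def using normal(2)[OF base_point] by blast

lemma proj_add: "x \<in> F \<Longrightarrow> face_proj F (x + t *\<^sub>R face_normal F) = x"
  by (simp add: face_proj_height height_add height_zero)

lemma proj_in_face: "x \<in> F \<Longrightarrow> face_proj F x = x"
  using proj_add[of x 0] by simp

lemma prism_iff: "y \<in> face_prism F \<longleftrightarrow> face_proj F y \<in> F \<and> 0 \<le> face_height F y \<and> face_height F y \<le> 1"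
proof
  assume "y \<in> face_prism F"
  then obtain x t where xt: "y = x + t *\<^sub>R face_normal F" "x \<in> F" "0 \<le> t" "t \<le> 1"
    unfolding face_prism_def by blast
  then show "face_proj F y \<in> F \<and> 0 \<le> face_height F y \<and> face_height F y \<le> 1"
    by (simp add: proj_add height_add height_zero)
next
  assume a: "face_proj F y \<in> F \<and> 0 \<le> face_height F y \<and> face_height F y \<le> 1"
  have "y = face_proj F y + face_height F y *\<^sub>R face_normal F" by (simp add: face_proj_height)
  then show "y \<in> face_prism F" using a unfolding face_prism_def by blast
qed

lemma continuous_proj: "continuous_on S (face_proj F)"
  unfolding face_proj_def by (intro continuous_intros)

lemma continuous_height: "continuous_on S (face_height F)"
  unfolding face_height_def by (intro continuous_intros)

lemma proj_measurable [measurable]: "face_proj F \<in> borel_measurable borel"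
  using continuous_proj by (rule borel_measurable_continuous_onI)

lemma height_measurable [measurable]: "face_height F \<in> borel_measurable borel"
  using continuous_height by (rule borel_measurable_continuous_onI)

lemma closed_prism: "closed (face_prism F)"
proof -
  have "face_prism F = (face_proj F -` F \<inter> UNIV) \<inter> {y. 0 \<le> face_height F y} \<inter> {y. face_height F y \<le> 1}"
    by (auto simp: prism_iff)
  moreover have "closed (face_proj F -` F \<inter> UNIV)"
    using continuous_closed_vimage[OF compact_imp_closed[OF compact], of "face_proj F"] continuous_proj[of UNIV]
    by (simp add: continuous_on_eq_continuous_at)
  moreover have "closed {y. 0 \<le> face_height F y}" "closed {y. face_height F y \<le> 1}"
    by (intro closed_Collect_le continuous_on_const continuous_height)+
  ultimately show ?thesis by (simp only: closed_Int)
qed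

lemma bounded_prism: "bounded (face_prism F)"
proof -
  from compact_imp_bounded[OF compact] obtain B where B: "\<And>x. x \<in> F \<Longrightarrow> norm x \<le> B"
    unfolding bounded_iff by blast
  have "norm y \<le> B + 1" if y: "y \<in> face_prism F" for y
  proof -
    obtain x t where xt: "y = x + t *\<^sub>R face_normal F" "x \<in> F" "0 \<le> t" "t \<le> 1"
      using y unfolding face_prism_def by blast
    have "norm y \<le> norm x + norm (t *\<^sub>R face_normal F)" unfolding xt(1) by (rule norm_triangle_ineq)
    also have "\<dots> \<le> B + 1" using B[OF xt(2)] xt(3,4) normal(1) by simp
    finally show ?thesis .
  qed
  then show ?thesis unfolding bounded_iff by blast
qed

lemma prism_borel [measurable]: "face_prism F \<in> sets borel"
  using closed_prism by (rule borel_closed)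

lemma prism_lebesgue [simp, measurable]: "face_prism F \<in> sets lebesgue"
  by (simp add: prism_borel)

lemma space_face_measure [simp]: "space (face_measure F) = F"
  by (simp add: face_measure_eq space_restrict_space)

lemma sets_face_measure: "sets (face_measure F) = sets (restrict_space borel F)"
  by (simp add: face_measure_eq)

lemma measurable_face_measure: "borel_measurable (face_measure F) = borel_measurable (restrict_space borel F)"
  by (rule measurable_cong_sets) (simp_all add: sets_face_measure)

lemma proj_measurable_prism: "face_proj F \<in> measurable (lebesgue_on (face_prism F)) (restrict_space borel F)"
proof (rule measurable_restrict_space2)
  show "face_proj F \<in> space (lebesgue_on (face_prism F)) \<rightarrow> F" by (auto simp: prism_iff)
  have "face_proj F \<in> borel_measurable lebesgue" by (rule measurable_completion) simp
  then show "face_proj F \<in> borel_measurable (lebesgue_on (face_prism F))"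
    by (rule measurable_restrict_space1)
qed

lemma finite_face_measure: "finite_measure (face_measure F)"
  unfolding face_measure_eq
  by (intro finite_measure.finite_measure_distr proj_measurable_prism
            finite_measure_lebesgue_on_bounded bounded_prism prism_lebesgue)

lemma borel_imp_face_measurable: "f \<in> borel_measurable borel \<Longrightarrow> f \<in> borel_measurable (face_measure F)"
  unfolding measurable_face_measure by (rule measurable_restrict_space1)

lemma AE_face_measureI:
  assumes "{x \<in> F. P x} \<in> sets borel" "AE y in lebesgue_on (face_prism F). P (face_proj F y)"
  shows "AE x in face_measure F. P x"
proof -
  have F: "F \<inter> space borel \<in> sets borel" using compact by (simp add: borel_closed compact_imp_closed)
  have "{x \<in> space (restrict_space borel F). P x} \<in> sets (restrict_space borel F)"
    using assms(1) F by (auto simp: sets_restrict_space_iff space_restrict_space)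
  then show ?thesis
    unfolding face_measure_eq using AE_distr_iff[OF proj_measurable_prism] assms(2) by blast
qed

text \<open>The surface integral becomes a Lebesgue integral over the prism of height one, the form
  in which limits of boundary layers appear.\<close>

lemma integral_face_measure:
  fixes f :: "real^'d \<Rightarrow> real"
  assumes "f \<in> borel_measurable borel"
  shows "(\<integral>x. f x \<partial>face_measure F) = (\<integral>y. indicator (face_prism F) y * f (face_proj F y) \<partial>lborel)"
proof -
  have "(\<integral>x. f x \<partial>face_measure F) = (\<integral>y. f (face_proj F y) \<partial>lebesgue_on (face_prism F))"
    unfolding face_measure_eq
    by (intro integral_distr proj_measurable_prism measurable_restrict_space1 assms)
  also have "\<dots> = (\<integral>y. indicator (face_prism F) y * f (face_proj F y) \<partial>lebesgue)"
    by (simp add: integral_restrict_space)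
  also have "\<dots> = (\<integral>y. indicator (face_prism F) y * f (face_proj F y) \<partial>lborel)"
  proof (rule integral_completion)
    have "(\<lambda>y. f (face_proj F y)) \<in> borel_measurable lborel"
      using measurable_compose[OF proj_measurable assms] by simp
    then show "(\<lambda>y. indicator (face_prism F) y * f (face_proj F y)) \<in> borel_measurable lborel"
      by measurable
  qed
  finally show ?thesis .
qed

lemma L2_face_measure_continuous:
  fixes f :: "real^'d \<Rightarrow> real"
  assumes "continuous_on UNIV f"
  shows "L2 (face_measure F) f"
proof -
  have "compact (f ` F)" using assms compact by (metis compact_continuous_image continuous_on_subset subset_UNIV)
  from compact_imp_bounded[OF this] obtain B where "\<And>x. x \<in> F \<Longrightarrow> norm (f x) \<le> B"
    unfolding bounded_iff by auto
  then show ?thesis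
    using borel_measurable_continuous_onI[OF assms] finite_face_measure
    by (intro L2_bounded[where B = B] borel_imp_face_measurable AE_I2) auto
qed

end

lemma (in solid_polytope) flat_facet: "F \<in> faces_of K \<Longrightarrow> flat_face F"
proof
  assume F: "F \<in> faces_of K"
  show "compact F" using facet_polytope[OF F] by (rule polytope_imp_compact)
  show "F \<noteq> {}" using facet_nonempty[OF F] .
  have "(y - x) \<bullet> outer_normal K F = 0" if "x \<in> F" "y \<in> F" for x y
  proof -
    have "facet_dist K F x = 0" "facet_dist K F y = 0" using facet_normal(2)[OF F] that by blast+
    then show ?thesis by (simp add: facet_dist_def inner_diff_left)
  qed
  then show "\<exists>n. norm n = 1 \<and> (\<forall>x\<in>F. \<forall>y\<in>F. (y - x) \<bullet> n = 0)"
    using facet_normal(1)[OF F] by blast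
qed

text \<open>\<open>face_normal\<close> is an arbitrary unit normal of the face, so it can point out
  of \<open>K\<close> or into it; \<sigma> records which.\<close>

lemma (in solid_polytope) facet_dist_stretch:
  assumes F: "F \<in> faces_of K"
  obtains \<sigma> :: real where "\<bar>\<sigma>\<bar> = 1" "face_normal F = \<sigma> *\<^sub>R outer_normal K F"
    "\<And>y. facet_dist K F y = - \<sigma> * face_height F y"
proof -
  interpret f: flat_face F by (rule flat_facet[OF F])
  let ?n = "outer_normal K F" and ?\<nu> = "face_normal F" and ?a = "SOME a. a \<in> F"
  have n0: "?n \<noteq> 0" "?\<nu> \<noteq> 0" using facet_normal(1)[OF F] f.normal(1) by auto
  have sub: "F \<subseteq> {x. ?n \<bullet> x = ?n \<bullet> ?a}"
  proof
    fix x assume "x \<in> F"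
    then have "facet_dist K F x = 0" using facet_normal(2)[OF F] by blast
    then show "x \<in> {x. ?n \<bullet> x = ?n \<bullet> ?a}" by (simp add: facet_dist_def inner_commute)
  qed
  have sub': "F \<subseteq> {x. ?\<nu> \<bullet> x = ?\<nu> \<bullet> ?a}"
    using f.normal(2)[OF f.base_point] by (auto simp: inner_diff_right inner_commute)
  have "{x. ?n \<bullet> x = ?n \<bullet> ?a} = {x. ?\<nu> \<bullet> x = ?\<nu> \<bullet> ?a}"
    using hyperplane_is_affine_hull[OF F n0(1) sub] hyperplane_is_affine_hull[OF F n0(2) sub'] by simp
  then have "?\<nu> = ?n \<or> ?\<nu> = - ?n"
    using parallel_normals facet_normal(1)[OF F] f.normal(1) by blast
  then obtain \<sigma> :: real where s: "\<bar>\<sigma>\<bar> = 1" "?\<nu> = \<sigma> *\<^sub>R ?n"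
    by (metis abs_1 abs_minus_cancel scaleR_minus1_left scaleR_one)
  have "?n = \<sigma> *\<^sub>R ?\<nu>" using s by (auto simp: abs_if split: if_splits)
  then have "facet_dist K F y = - \<sigma> * face_height F y" for y
    unfolding facet_dist_def face_height_def by (simp add: inner_diff_left algebra_simps)
  with s show ?thesis by (rule that)
qed

section \<open>The divergence theorem on polytopes\<close>

definition ramp :: "real \<Rightarrow> real" where
  "ramp t = max 0 (min 1 t)"

lemma ramp_bounds: "0 \<le> ramp t" "ramp t \<le> 1"
  by (auto simp: ramp_def)

lemma ramp_eq_0: "t \<le> 0 \<Longrightarrow> ramp t = 0"
  by (simp add: ramp_def)

lemma ramp_eq_1: "1 \<le> t \<Longrightarrow> ramp t = 1"
  by (simp add: ramp_def)

lemma ramp_measurable [measurable]: "ramp \<in> borel_measurable borel"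
  unfolding ramp_def[abs_def] by measurable

lemma ramp_lipschitz: "\<bar>ramp s - ramp t\<bar> \<le> \<bar>s - t\<bar>"
  by (auto simp: ramp_def max_def min_def)

lemma ramp_DERIV:
  assumes "t \<noteq> 0" "t \<noteq> 1"
  shows "(ramp has_real_derivative (if 0 < t \<and> t < 1 then 1 else 0)) (at t)"
proof -
  consider "t < 0" | "0 < t \<and> t < 1" | "t > 1" using assms by linarith
  then show ?thesis
  proof cases
    case 1
    have "((\<lambda>t. 0) has_real_derivative 0) (at t)" by simp
    then have "(ramp has_real_derivative 0) (at t)"
      by (rule has_field_derivative_transform_within_open[where S = "{..<0}"])
         (use 1 in \<open>auto simp: ramp_def\<close>)
    then show ?thesis using 1 by simp
  next
    case 2
    have "((\<lambda>t. t) has_real_derivative 1) (at t)" by simp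
    then have "(ramp has_real_derivative 1) (at t)"
      by (rule has_field_derivative_transform_within_open[where S = "{0<..<1}"])
         (use 2 in \<open>auto simp: ramp_def\<close>)
    then show ?thesis using 2 by simp
  next
    case 3
    have "((\<lambda>t. 1) has_real_derivative 0) (at t)" by simp
    then have "(ramp has_real_derivative 0) (at t)"
      by (rule has_field_derivative_transform_within_open[where S = "{1<..}"])
         (use 3 in \<open>auto simp: ramp_def\<close>)
    then show ?thesis using 3 by simp
  qed
qed

lemma lipschitz_on_times:
  fixes f g :: "'a::metric_space \<Rightarrow> real"
  assumes f: "L-lipschitz_on S f" and g: "M-lipschitz_on S g"
    and B: "\<And>x. x \<in> S \<Longrightarrow> \<bar>f x\<bar> \<le> B" and C: "\<And>x. x \<in> S \<Longrightarrow> \<bar>g x\<bar> \<le> C"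
    and nonneg: "0 \<le> B" "0 \<le> C"
  shows "(B * M + C * L)-lipschitz_on S (\<lambda>x. f x * g x)"
proof (rule lipschitz_onI)
  show "0 \<le> B * M + C * L" using nonneg lipschitz_on_nonneg[OF f] lipschitz_on_nonneg[OF g] by simp
  fix x y assume xy: "x \<in> S" "y \<in> S"
  have "f x * g x - f y * g y = f x * (g x - g y) + g y * (f x - f y)" by (simp add: algebra_simps)
  then have "\<bar>f x * g x - f y * g y\<bar> \<le> \<bar>f x\<bar> * \<bar>g x - g y\<bar> + \<bar>g y\<bar> * \<bar>f x - f y\<bar>"
    by (metis abs_mult abs_triangle_ineq)
  also have "\<dots> \<le> B * (M * dist x y) + C * (L * dist x y)"
    using B[OF xy(1)] C[OF xy(2)] lipschitz_onD[OF f xy] lipschitz_onD[OF g xy] nonneg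
    by (intro add_mono mult_mono) (auto simp: dist_real_def)
  finally show "dist (f x * g x) (f y * g y) \<le> (B * M + C * L) * dist x y"
    by (simp add: dist_real_def algebra_simps)
qed

lemma lipschitz_on_ramp_prod:
  fixes n :: "'i \<Rightarrow> real^'d"
  assumes "finite I" "\<epsilon> > 0"
  shows "\<exists>L. L-lipschitz_on S (\<lambda>x. \<Prod>i\<in>I. ramp ((c i - x \<bullet> n i) / \<epsilon>))"
  using assms(1)
proof (induction I rule: finite_induct)
  case empty
  then show ?case by (auto intro: lipschitz_on_constant)
next
  case (insert i I)
  then obtain L where L: "L-lipschitz_on S (\<lambda>x. \<Prod>i\<in>I. ramp ((c i - x \<bullet> n i) / \<epsilon>))" by blast
  have 1: "(norm (n i) / \<epsilon>)-lipschitz_on S (\<lambda>x. ramp ((c i - x \<bullet> n i) / \<epsilon>))"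
  proof (rule lipschitz_onI)
    fix x y
    have "\<bar>ramp ((c i - x \<bullet> n i) / \<epsilon>) - ramp ((c i - y \<bullet> n i) / \<epsilon>)\<bar>
        \<le> \<bar>(c i - x \<bullet> n i) / \<epsilon> - (c i - y \<bullet> n i) / \<epsilon>\<bar>" by (rule ramp_lipschitz)
    also have "\<dots> = \<bar>(y - x) \<bullet> n i\<bar> / \<epsilon>"
      using assms(2) by (simp add: diff_divide_distrib[symmetric] inner_diff_left)
    also have "\<dots> \<le> norm (y - x) * norm (n i) / \<epsilon>"
      using assms(2) by (intro divide_right_mono Cauchy_Schwarz_ineq2) auto
    finally show "dist (ramp ((c i - x \<bullet> n i) / \<epsilon>)) (ramp ((c i - y \<bullet> n i) / \<epsilon>)) \<le> norm (n i) / \<epsilon> * dist x y"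
      by (simp add: dist_real_def dist_norm norm_minus_commute mult.commute)
  qed (use assms(2) in auto)
  have "\<bar>\<Prod>i\<in>I. ramp ((c i - x \<bullet> n i) / \<epsilon>)\<bar> \<le> 1" for x
    using prod_le_1[of I "\<lambda>i. ramp ((c i - x \<bullet> n i) / \<epsilon>)"] ramp_bounds by (simp add: prod_nonneg)
  then have "(1 * L + 1 * (norm (n i) / \<epsilon>))-lipschitz_on S
      (\<lambda>x. ramp ((c i - x \<bullet> n i) / \<epsilon>) * (\<Prod>i\<in>I. ramp ((c i - x \<bullet> n i) / \<epsilon>)))"
    using ramp_bounds by (intro lipschitz_on_times[OF 1 L]) auto
  then show ?case using insert by auto
qed

lemma integrable_bounded_on_compact:
  fixes f :: "real^'d \<Rightarrow> real"
  assumes K: "compact K" and f: "f \<in> borel_measurable borel"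
    and "\<And>x. x \<in> K \<Longrightarrow> \<bar>f x\<bar> \<le> B" "\<And>x. x \<notin> K \<Longrightarrow> f x = 0"
  shows "integrable lborel f"
proof (rule Bochner_Integration.integrable_bound)
  have "emeasure lborel K < \<infinity>" using K by (rule emeasure_compact_finite)
  moreover have "K \<in> sets lborel" using K by (simp add: borel_closed compact_imp_closed)
  ultimately show "integrable lborel (\<lambda>x. B * indicator K x :: real)"
    by (intro integrable_mult_right integrable_real_indicator)
  have "\<bar>f x\<bar> \<le> \<bar>B * indicator K x\<bar>" for x
    using assms(3,4)[of x] by (cases "x \<in> K") auto
  then show "AE x in lborel. norm (f x) \<le> norm (B * indicator K x)" by simp
  show "f \<in> borel_measurable lborel" using f by simp
qed

lemma C1_bounded_on_compact:
  assumes "C1 v" "compact S"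
  obtains B where "B \<ge> 0" "\<And>x. x \<in> S \<Longrightarrow> \<bar>v x\<bar> \<le> B" "\<And>x. x \<in> S \<Longrightarrow> norm (gradient v x) \<le> B"
proof -
  have "bounded (v ` S)" "bounded (gradient v ` S)"
    using assms by (auto intro!: compact_imp_bounded compact_continuous_image C1_continuous C1_continuous_gradient)
  then obtain B C where B: "\<And>x. x \<in> S \<Longrightarrow> norm (v x) \<le> B" and C: "\<And>x. x \<in> S \<Longrightarrow> norm (gradient v x) \<le> C"
    unfolding bounded_iff by auto
  show ?thesis
    by (rule that[of "\<bar>B\<bar> + \<bar>C\<bar>"]) (use B C in force)+
qed

context solid_polytope
begin

text \<open>A Lipschitz substitute for the indicator of \<open>K\<close>, for positive \<epsilon>:
  it vanishes off the interior and equals 1 where every facet distance is at least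
  \<epsilon>.\<close>

definition cutoff :: "real \<Rightarrow> real^'d \<Rightarrow> real" where
  "cutoff \<epsilon> x = (\<Prod>F\<in>faces_of K. ramp (facet_dist K F x / \<epsilon>))"

text \<open>The contribution of \<open>F\<close> to the gradient of \<open>cutoff\<close>, stripped
  of its normal and of the factor \<open>- 1 / \<epsilon>\<close>: a slab of width \<epsilon> along
  \<open>F\<close>, trimmed at its rim by the ramps of the other facets.\<close>

definition layer :: "real \<Rightarrow> (real^'d) set \<Rightarrow> real^'d \<Rightarrow> real" where
  "layer \<epsilon> F x = (if 0 < facet_dist K F x \<and> facet_dist K F x < \<epsilon> then 1 else 0) *
     (\<Prod>G\<in>faces_of K - {F}. ramp (facet_dist K G x / \<epsilon>))"

lemma facet_dist_measurable [measurable]: "facet_dist K F \<in> borel_measurable borel"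
  unfolding facet_dist_def[abs_def] by measurable

lemma cutoff_measurable [measurable]: "cutoff \<epsilon> \<in> borel_measurable borel"
  unfolding cutoff_def[abs_def] by measurable

lemma layer_measurable [measurable]: "layer \<epsilon> F \<in> borel_measurable borel"
  unfolding layer_def[abs_def] by measurable

lemma cutoff_bounds: "0 \<le> cutoff \<epsilon> x" "cutoff \<epsilon> x \<le> 1"
  unfolding cutoff_def by (auto intro!: prod_nonneg prod_le_1 simp: ramp_bounds)

lemma layer_bounds: "0 \<le> layer \<epsilon> F x" "layer \<epsilon> F x \<le> 1"
  unfolding layer_def by (auto intro!: prod_nonneg prod_le_1 simp: ramp_bounds)

lemma cutoff_outside:
  assumes "\<epsilon> > 0" "x \<notin> interior K"
  shows "cutoff \<epsilon> x = 0"
proof -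
  obtain G where G: "G \<in> faces_of K" "facet_dist K G x \<le> 0"
    using assms(2) unfolding interior_iff_facet_dist by force
  then have "ramp (facet_dist K G x / \<epsilon>) = 0" using assms(1) by (intro ramp_eq_0) (simp add: divide_nonpos_pos)
  then show ?thesis unfolding cutoff_def using G finite_faces by (intro prod_zero) auto
qed

lemma layer_outside:
  assumes "\<epsilon> > 0" "F \<in> faces_of K" "x \<notin> interior K"
  shows "layer \<epsilon> F x = 0"
proof -
  obtain G where G: "G \<in> faces_of K" "facet_dist K G x \<le> 0"
    using assms(3) unfolding interior_iff_facet_dist by force
  show ?thesis
  proof (cases "G = F")
    case False
    have "ramp (facet_dist K G x / \<epsilon>) = 0" using G assms(1) by (intro ramp_eq_0) (simp add: divide_nonpos_pos)
    then have "(\<Prod>G\<in>faces_of K - {F}. ramp (facet_dist K G x / \<epsilon>)) = 0"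
      using G False finite_faces by (intro prod_zero) auto
    then show ?thesis by (simp add: layer_def)
  qed (use G in \<open>simp add: layer_def\<close>)
qed

lemma negligible_facet_dist:
  assumes "F \<in> faces_of K"
  shows "negligible {x. facet_dist K F x = t}"
proof -
  have "{x. facet_dist K F x = t} = {x. outer_normal K F \<bullet> x = (SOME y. y \<in> F) \<bullet> outer_normal K F - t}"
    by (auto simp: facet_dist_def inner_commute)
  moreover have "outer_normal K F \<noteq> 0" using facet_normal(1)[OF assms] by auto
  ultimately show ?thesis by (simp add: negligible_hyperplane)
qed

lemma gderiv_cutoff:
  assumes \<epsilon>: "\<epsilon> > 0" and x: "\<And>F. F \<in> faces_of K \<Longrightarrow> facet_dist K F x \<noteq> 0 \<and> facet_dist K F x \<noteq> \<epsilon>"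
  shows "gderiv (cutoff \<epsilon>) x (\<Sum>F\<in>faces_of K. - (layer \<epsilon> F x / \<epsilon>) *\<^sub>R outer_normal K F)"
proof -
  define g where "g F = (if 0 < facet_dist K F x \<and> facet_dist K F x < \<epsilon> then - (1 / \<epsilon>) else 0) *\<^sub>R outer_normal K F" for F
  have 1: "((\<lambda>x. ramp (facet_dist K F x / \<epsilon>)) has_derivative (\<lambda>h. h \<bullet> g F)) (at x)" if F: "F \<in> faces_of K" for F
  proof -
    let ?t = "facet_dist K F x / \<epsilon>"
    have "((\<lambda>x. facet_dist K F x / \<epsilon>) has_derivative (\<lambda>h. h \<bullet> (- (1 / \<epsilon>) *\<^sub>R outer_normal K F))) (at x)"
      unfolding facet_dist_def by (auto intro!: derivative_eq_intros simp: \<epsilon> divide_inverse)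
    then have d: "gderiv (\<lambda>x. facet_dist K F x / \<epsilon>) x (- (1 / \<epsilon>) *\<^sub>R outer_normal K F)"
      by (simp add: gderiv_def)
    have "?t \<noteq> 0" "?t \<noteq> 1" using x[OF F] \<epsilon> by auto
    from GDERIV_DERIV_compose[OF d ramp_DERIV[OF this]]
    have "gderiv (\<lambda>x. ramp (facet_dist K F x / \<epsilon>)) x ((if 0 < ?t \<and> ?t < 1 then 1 else 0) *\<^sub>R - (1 / \<epsilon>) *\<^sub>R outer_normal K F)" .
    moreover have "(if 0 < ?t \<and> ?t < 1 then 1 else 0) *\<^sub>R - (1 / \<epsilon>) *\<^sub>R outer_normal K F = g F"
      using \<epsilon> by (simp add: g_def zero_less_divide_iff)
    ultimately show ?thesis by (simp only: gderiv_def)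
  qed
  have "((\<lambda>x. \<Prod>F\<in>faces_of K. ramp (facet_dist K F x / \<epsilon>)) has_derivative
      (\<lambda>h. \<Sum>F\<in>faces_of K. h \<bullet> g F * (\<Prod>G\<in>faces_of K - {F}. ramp (facet_dist K G x / \<epsilon>)))) (at x)"
    by (rule has_derivative_prod) (rule 1)
  moreover have "(\<Sum>F\<in>faces_of K. h \<bullet> g F * (\<Prod>G\<in>faces_of K - {F}. ramp (facet_dist K G x / \<epsilon>)))
      = h \<bullet> (\<Sum>F\<in>faces_of K. - (layer \<epsilon> F x / \<epsilon>) *\<^sub>R outer_normal K F)" for h
    unfolding inner_sum_right by (intro sum.cong) (auto simp: g_def layer_def)
  ultimately show ?thesis unfolding gderiv_def cutoff_def[abs_def] by simp
qed

text \<open>The gradient of \<open>\<psi> * cutoff \<epsilon>\<close> integrates to zero, and the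
  product rule separates the volume term from the layers. The kinks of the ramps lie on finitely
  many hyperplanes, hence in a null set.\<close>

lemma cutoff_divergence:
  assumes \<psi>: "C1 \<psi>" and \<epsilon>: "\<epsilon> > 0" and e: "norm e = 1"
  shows "(\<integral>x. cutoff \<epsilon> x * (gradient \<psi> x \<bullet> e) \<partial>lborel) =
    (\<Sum>F\<in>faces_of K. (outer_normal K F \<bullet> e) * (1 / \<epsilon> * (\<integral>x. layer \<epsilon> F x * \<psi> x \<partial>lborel)))"
proof -
  note [measurable] = C1_measurable[OF \<psi>] C1_gradient_measurable[OF \<psi>]
  obtain r where r: "\<And>x. x \<in> K \<Longrightarrow> norm x \<le> r"
    using compact_imp_bounded[OF compact] unfolding bounded_iff by metis
  obtain B where B: "B \<ge> 0" "\<And>x. x \<in> K \<Longrightarrow> \<bar>\<psi> x\<bar> \<le> B" "\<And>x. x \<in> K \<Longrightarrow> norm (gradient \<psi> x) \<le> B"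
    using C1_bounded_on_compact[OF \<psi> compact] by metis
  define g where "g x = \<psi> x * cutoff \<epsilon> x" for x
  define G where "G x = \<psi> x *\<^sub>R (\<Sum>F\<in>faces_of K. - (layer \<epsilon> F x / \<epsilon>) *\<^sub>R outer_normal K F) + cutoff \<epsilon> x *\<^sub>R gradient \<psi> x" for x
  obtain L where L: "L-lipschitz_on (cball 0 (r + 1)) g"
  proof -
    obtain L1 where L1: "L1-lipschitz_on (cball 0 (r + 1)) \<psi>"
      using C1_lipschitz_on[OF \<psi>, of "cball 0 (r + 1)"] by auto
    obtain L2 where L2: "L2-lipschitz_on (cball 0 (r + 1)) (cutoff \<epsilon>)"
      using lipschitz_on_ramp_prod[OF finite_faces \<epsilon>, of "cball 0 (r + 1)" "\<lambda>F. (SOME y. y \<in> F) \<bullet> outer_normal K F" "outer_normal K"]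
      unfolding cutoff_def[abs_def] facet_dist_def by auto
    obtain C where "C \<ge> 0" "\<And>x. x \<in> cball 0 (r + 1) \<Longrightarrow> \<bar>\<psi> x\<bar> \<le> C"
      using C1_bounded_on_compact[OF \<psi> compact_cball] by metis
    then have "(C * L2 + 1 * L1)-lipschitz_on (cball 0 (r + 1)) g"
      unfolding g_def using cutoff_bounds by (intro lipschitz_on_times[OF L1 L2]) auto
    then show ?thesis by (rule that)
  qed
  have zero: "g x = 0" if "norm x > r" for x
  proof -
    have "x \<notin> K" using r[of x] that by auto
    then have "x \<notin> interior K" using interior_subset by blast
    then show ?thesis by (simp add: g_def cutoff_outside[OF \<epsilon>])
  qed
  have Gm: "G \<in> borel_measurable borel" unfolding G_def by measurable
  have "negligible (\<Union>F\<in>faces_of K. {x. facet_dist K F x = 0} \<union> {x. facet_dist K F x = \<epsilon>})"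
    using finite_faces negligible_facet_dist by (auto intro!: negligible_Union negligible_Un)
  then have "AE x in lebesgue. x \<notin> (\<Union>F\<in>faces_of K. {x. facet_dist K F x = 0} \<union> {x. facet_dist K F x = \<epsilon>})"
    unfolding negligible_iff_null_sets by (rule AE_not_in)
  then have "AE x in lborel. x \<notin> (\<Union>F\<in>faces_of K. {x. facet_dist K F x = 0} \<union> {x. facet_dist K F x = \<epsilon>})"
    unfolding AE_completion_iff .
  then have deriv: "AE x in lborel. gderiv g x (G x)"
  proof eventually_elim
    case (elim x)
    have "gderiv (cutoff \<epsilon>) x (\<Sum>F\<in>faces_of K. - (layer \<epsilon> F x / \<epsilon>) *\<^sub>R outer_normal K F)"
      by (rule gderiv_cutoff[OF \<epsilon>]) (use elim in auto)
    then show ?case unfolding g_def G_def by (intro GDERIV_mult C1_gderiv[OF \<psi>])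
  qed
  have "(\<integral>x. G x \<bullet> e \<partial>lborel) = 0" by (rule integral_gradient_zero(2)[OF L zero Gm deriv e])
  moreover have "(\<lambda>x. G x \<bullet> e) = (\<lambda>x. cutoff \<epsilon> x * (gradient \<psi> x \<bullet> e) -
      (\<Sum>F\<in>faces_of K. (outer_normal K F \<bullet> e) * (1 / \<epsilon> * (layer \<epsilon> F x * \<psi> x))))"
  proof
    fix x
    have "G x \<bullet> e = \<psi> x * (\<Sum>F\<in>faces_of K. - (layer \<epsilon> F x / \<epsilon>) * (outer_normal K F \<bullet> e)) + cutoff \<epsilon> x * (gradient \<psi> x \<bullet> e)"
      by (simp only: G_def inner_add_left inner_sum_left inner_scaleR_left)
    also have "\<psi> x * (\<Sum>F\<in>faces_of K. - (layer \<epsilon> F x / \<epsilon>) * (outer_normal K F \<bullet> e)) =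
        - (\<Sum>F\<in>faces_of K. (outer_normal K F \<bullet> e) * (1 / \<epsilon> * (layer \<epsilon> F x * \<psi> x)))"
      unfolding sum_distrib_left sum_negf[symmetric] by (intro sum.cong) auto
    finally show "G x \<bullet> e = cutoff \<epsilon> x * (gradient \<psi> x \<bullet> e) -
      (\<Sum>F\<in>faces_of K. (outer_normal K F \<bullet> e) * (1 / \<epsilon> * (layer \<epsilon> F x * \<psi> x)))" by simp
  qed
  moreover have "integrable lborel (\<lambda>x. cutoff \<epsilon> x * (gradient \<psi> x \<bullet> e))"
  proof (rule integrable_bounded_on_compact[OF compact])
    fix x assume "x \<in> K"
    have "\<bar>gradient \<psi> x \<bullet> e\<bar> \<le> norm (gradient \<psi> x) * norm e" by (rule Cauchy_Schwarz_ineq2)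
    then have "\<bar>gradient \<psi> x \<bullet> e\<bar> \<le> B" using B(3)[OF \<open>x \<in> K\<close>] e by simp
    then show "\<bar>cutoff \<epsilon> x * (gradient \<psi> x \<bullet> e)\<bar> \<le> B"
      using cutoff_bounds[of \<epsilon> x] by (simp add: abs_mult) (metis abs_ge_zero mult_left_le_one_le order_trans)
  next
    fix x assume "x \<notin> K"
    then show "cutoff \<epsilon> x * (gradient \<psi> x \<bullet> e) = 0" using cutoff_outside[OF \<epsilon>] interior_subset by auto
  next
    show "(\<lambda>x. cutoff \<epsilon> x * (gradient \<psi> x \<bullet> e)) \<in> borel_measurable borel" by measurable
  qed
  moreover have "integrable lborel (\<lambda>x. layer \<epsilon> F x * \<psi> x)" if F: "F \<in> faces_of K" for F
  proof (rule integrable_bounded_on_compact[OF compact])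
    fix x assume "x \<in> K"
    then show "\<bar>layer \<epsilon> F x * \<psi> x\<bar> \<le> B"
      using layer_bounds[of \<epsilon> F x] B(2) by (simp add: abs_mult) (metis abs_ge_zero mult_left_le_one_le order_trans)
  next
    fix x assume "x \<notin> K"
    then show "layer \<epsilon> F x * \<psi> x = 0" using layer_outside[OF \<epsilon> F] interior_subset by auto
  next
    show "(\<lambda>x. layer \<epsilon> F x * \<psi> x) \<in> borel_measurable borel" by measurable
  qed
  ultimately show ?thesis by (simp add: Bochner_Integration.integral_sum)
qed

text \<open>Stretching the layer to unit width absorbs the factor \<open>1 / \<epsilon>\<close>. The
  stretched layer tends to the prism over \<open>F\<close>, while the argument of \<psi> tends to
  the foot point; this is the definition of the surface integral.\<close>

lemma layer_limit:
  assumes \<psi>: "C1 \<psi>" and F: "F \<in> faces_of K"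
  shows "(\<lambda>m. 1 / inverse (real (Suc m)) * (\<integral>x. layer (inverse (real (Suc m))) F x * \<psi> x \<partial>lborel))
    \<longlonglongrightarrow> (\<integral>x. \<psi> x \<partial>face_measure F)"
proof -
  interpret f: flat_face F by (rule flat_facet[OF F])
  note [measurable] = C1_measurable[OF \<psi>]
  obtain r where r: "\<And>x. x \<in> K \<Longrightarrow> norm x \<le> r"
    using compact_imp_bounded[OF compact] unfolding bounded_iff by blast
  obtain B where B: "B \<ge> 0" "\<And>x. x \<in> K \<Longrightarrow> \<bar>\<psi> x\<bar> \<le> B"
    using C1_bounded_on_compact[OF \<psi> compact] by metis
  obtain \<sigma> where \<sigma>: "\<bar>\<sigma>\<bar> = 1" "face_normal F = \<sigma> *\<^sub>R outer_normal K F"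
      "\<And>y. facet_dist K F y = - \<sigma> * face_height F y"
    using facet_dist_stretch[OF F] by metis
  define \<epsilon> where "\<epsilon> m = inverse (real (Suc m))" for m
  have \<epsilon>: "\<epsilon> m > 0" "\<epsilon> m \<le> 1" for m by (auto simp: \<epsilon>_def field_simps)
  let ?\<nu> = "face_normal F"
  \<comment> \<open>Compresses heights by the factor \<open>\<epsilon> m\<close>. The sign
    \<open>- \<sigma>\<close> sends positive heights to the side of \<open>K\<close>, whichever
    orientation \<open>face_normal F\<close> has.\<close>
  define S where "S m y = y + ((- \<sigma> * \<epsilon> m - 1) * face_height F y) *\<^sub>R ?\<nu>" for m y
  have Sm [measurable]: "S m \<in> borel_measurable borel" for m unfolding S_def by measurable
  have height_S: "face_height F (S m y) = - \<sigma> * \<epsilon> m * face_height F y" for m y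
    unfolding S_def f.height_add by (simp add: algebra_simps)
  have \<sigma>2: "\<sigma> * \<sigma> = 1" using \<sigma>(1) by (metis abs_mult_self_eq mult_1)
  have dist_S: "facet_dist K F (S m y) = \<epsilon> m * face_height F y" for m y
    unfolding \<sigma>(3) height_S using \<sigma>2 by (simp add: algebra_simps)
  have S_proj: "(\<lambda>m. S m y) \<longlonglongrightarrow> face_proj F y" for y
  proof -
    have "\<epsilon> \<longlonglongrightarrow> 0" unfolding \<epsilon>_def by (rule LIMSEQ_inverse_real_of_nat)
    then have "(\<lambda>m. S m y) \<longlonglongrightarrow> y + ((- \<sigma> * 0 - 1) * face_height F y) *\<^sub>R ?\<nu>"
      unfolding S_def by (intro tendsto_intros)
    then show ?thesis by (simp add: f.face_proj_height)
  qed
  have scale: "1 / \<epsilon> m * (\<integral>x. layer (\<epsilon> m) F x * \<psi> x \<partial>lborel) = (\<integral>y. layer (\<epsilon> m) F (S m y) * \<psi> (S m y) \<partial>lborel)" for m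
  proof -
    have c: "- \<sigma> * \<epsilon> m \<noteq> 0" "\<bar>- \<sigma> * \<epsilon> m\<bar> = \<epsilon> m" using \<epsilon>[of m] \<sigma>(1) by (auto simp: abs_mult)
    have "(\<integral>x. layer (\<epsilon> m) F x * \<psi> x \<partial>lborel) = \<bar>- \<sigma> * \<epsilon> m\<bar> * (\<integral>y. layer (\<epsilon> m) F
        (y + ((- \<sigma> * \<epsilon> m - 1) * (y \<bullet> ?\<nu> - (SOME a. a \<in> F) \<bullet> ?\<nu>)) *\<^sub>R ?\<nu>) *
        \<psi> (y + ((- \<sigma> * \<epsilon> m - 1) * (y \<bullet> ?\<nu> - (SOME a. a \<in> F) \<bullet> ?\<nu>)) *\<^sub>R ?\<nu>) \<partial>lborel)"
      by (rule integral_stretch[OF f.normal(1) c(1)]) measurable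
    also have "\<dots> = \<epsilon> m * (\<integral>y. layer (\<epsilon> m) F (S m y) * \<psi> (S m y) \<partial>lborel)"
      unfolding c S_def face_height_def inner_diff_left ..
    finally show ?thesis using \<epsilon>[of m] by simp
  qed
  define lim where "lim y = indicator (face_prism F) y * \<psi> (face_proj F y)" for y
  have "(\<lambda>m. \<integral>y. layer (\<epsilon> m) F (S m y) * \<psi> (S m y) \<partial>lborel) \<longlonglongrightarrow> (\<integral>y. lim y \<partial>lborel)"
  \<comment> \<open>Where the layer is nonzero, \<open>S m y\<close> lies in \<open>K\<close> and
    the height of \<open>y\<close> is between 0 and 1. Then \<open>S m\<close> moves
    \<open>y\<close> by at most 2, whence the radius \<open>r + 2\<close>.\<close>
  proof (rule integral_dominated_convergence[where w = "\<lambda>y. B * indicator (cball 0 (r + 2)) y"])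
    show "lim \<in> borel_measurable lborel" unfolding lim_def by measurable
    show "(\<lambda>y. layer (\<epsilon> m) F (S m y) * \<psi> (S m y)) \<in> borel_measurable lborel" for m by measurable
    have "integrable lborel (indicator (cball 0 (r + 2)) :: real^'d \<Rightarrow> real)"
      by (rule integrable_real_indicator[OF _ emeasure_lborel_cball_finite]) simp
    then show "integrable lborel (\<lambda>y::real^'d. B * indicator (cball 0 (r + 2)) y)"
      by (rule integrable_mult_right)
    show "AE y in lborel. norm (layer (\<epsilon> m) F (S m y) * \<psi> (S m y)) \<le> B * indicator (cball 0 (r + 2)) y" for m
    proof (rule AE_I2)
      fix y
      show "norm (layer (\<epsilon> m) F (S m y) * \<psi> (S m y)) \<le> B * indicator (cball 0 (r + 2)) y"
      proof (cases "layer (\<epsilon> m) F (S m y) = 0")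
        case False
        then have inK: "S m y \<in> K" using layer_outside[OF \<epsilon>(1) F] interior_subset by blast
        have "0 < facet_dist K F (S m y)" "facet_dist K F (S m y) < \<epsilon> m"
          using False by (auto simp: layer_def split: if_splits)
        then have h: "0 < face_height F y" "face_height F y < 1"
          unfolding dist_S using \<epsilon>[of m] by (auto simp: zero_less_mult_iff)
        have "y = S m y - ((- \<sigma> * \<epsilon> m - 1) * face_height F y) *\<^sub>R ?\<nu>" by (simp add: S_def)
        then have "norm y \<le> norm (S m y) + norm (((- \<sigma> * \<epsilon> m - 1) * face_height F y) *\<^sub>R ?\<nu>)"
          by (metis norm_triangle_ineq4)
        also have "norm (((- \<sigma> * \<epsilon> m - 1) * face_height F y) *\<^sub>R ?\<nu>) = \<bar>- \<sigma> * \<epsilon> m - 1\<bar> * face_height F y"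
          using h f.normal(1) by (simp add: abs_mult)
        also have "\<dots> \<le> 2 * 1"
        proof (intro mult_mono)
          have "\<bar>- \<sigma> * \<epsilon> m\<bar> \<le> 1" using \<sigma>(1) \<epsilon>[of m] by (simp add: abs_mult)
          then show "\<bar>- \<sigma> * \<epsilon> m - 1\<bar> \<le> 2" by linarith
        qed (use h in auto)
        finally have "y \<in> cball 0 (r + 2)" using r[OF inK] by simp
        moreover have "\<bar>layer (\<epsilon> m) F (S m y)\<bar> * \<bar>\<psi> (S m y)\<bar> \<le> 1 * B"
          using B(2)[OF inK] layer_bounds[of "\<epsilon> m" F "S m y"] by (intro mult_mono) auto
        ultimately show ?thesis by (simp add: abs_mult)
      qed (use B(1) in auto)
    qed
    \<comment> \<open>Off this null set the limit is decided strictly: the height is neither 0 nor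
      1, and the foot point lies on no hyperplane of another facet.\<close>
    define N where "N = {y. face_height F y = 0} \<union> {y. face_height F y = 1} \<union>
        (\<Union>G\<in>faces_of K - {F}. {y. facet_dist K G (face_proj F y) = 0})"
    have "negligible N"
      unfolding N_def
    proof (intro negligible_Un negligible_Union)
      have "{y. face_height F y = t} = {y. ?\<nu> \<bullet> y = t + ?\<nu> \<bullet> (SOME a. a \<in> F)}" for t
        by (auto simp: face_height_def inner_diff_right inner_commute)
      moreover have "?\<nu> \<noteq> 0" using f.normal(1) by auto
      ultimately show "negligible {y. face_height F y = 0}" "negligible {y. face_height F y = 1}"
        by (simp_all add: negligible_hyperplane)
      show "finite ((\<lambda>G. {y. facet_dist K G (face_proj F y) = 0}) ` (faces_of K - {F}))"
        using finite_faces by simp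
      fix T assume "T \<in> (\<lambda>G. {y. facet_dist K G (face_proj F y) = 0}) ` (faces_of K - {F})"
      then obtain G where G: "G \<in> faces_of K - {F}" and T: "T = {y. facet_dist K G (face_proj F y) = 0}"
        by blast
      let ?n = "outer_normal K G" and ?c = "(SOME y. y \<in> G) \<bullet> outer_normal K G" and ?a = "SOME a. a \<in> F"
      let ?w = "?n - (?\<nu> \<bullet> ?n) *\<^sub>R ?\<nu>"
      have form: "facet_dist K G (face_proj F y) = ?c - (?a \<bullet> ?\<nu>) * (?\<nu> \<bullet> ?n) - ?w \<bullet> y" for y
        by (simp add: facet_dist_def face_proj_def inner_diff_left inner_diff_right algebra_simps inner_commute)
      have "negligible {y. facet_dist K G (face_proj F y) = 0}"
      \<comment> \<open>\<open>?w\<close> is the part of the normal of \<open>G\<close> that is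
        tangential to \<open>F\<close>. If it vanishes, the distance to \<open>G\<close> is constant
        on the hyperplane of \<open>F\<close>, and the value 0 would put \<open>F\<close> inside
        \<open>G\<close>.\<close>
      proof (cases "?w = 0")
        case False
        have "{y. facet_dist K G (face_proj F y) = 0} = {y. ?w \<bullet> y = ?c - (?a \<bullet> ?\<nu>) * (?\<nu> \<bullet> ?n)}"
          unfolding form by auto
        with False show ?thesis by (simp add: negligible_hyperplane)
      next
        case True
        have "facet_dist K G (face_proj F y) \<noteq> 0" for y
        proof
          assume "facet_dist K G (face_proj F y) = 0"
          then have z: "facet_dist K G (face_proj F y) = 0" for y using True unfolding form by simp
          have "F \<subseteq> G"
          proof
            fix x assume x: "x \<in> F"
            then have "facet_dist K G x = 0" using z[of x] f.proj_in_face by simp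
            moreover have "x \<in> K" using x facet_subset[OF F] by blast
            ultimately show "x \<in> G" using facet_normal(2)[of G] G by blast
          qed
          with facet_antimono[OF F, of G] G show False by auto
        qed
        then show ?thesis by simp
      qed
      then show "negligible T" unfolding T .
    qed
    then have "AE y in lebesgue. y \<notin> N" unfolding negligible_iff_null_sets by (rule AE_not_in)
    then have "AE y in lborel. y \<notin> N" unfolding AE_completion_iff .
    then show "AE y in lborel. (\<lambda>m. layer (\<epsilon> m) F (S m y) * \<psi> (S m y)) \<longlonglongrightarrow> lim y"
    proof eventually_elim
      case (elim y)
      have p\<psi>: "(\<lambda>m. \<psi> (S m y)) \<longlonglongrightarrow> \<psi> (face_proj F y)"
        using C1_continuous[OF \<psi>, of UNIV] S_proj[of y] by (intro isCont_tendsto_compose[of _ \<psi>]) (auto simp: continuous_on_eq_continuous_at)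
      have dlim: "(\<lambda>m. facet_dist K G (S m y)) \<longlonglongrightarrow> facet_dist K G (face_proj F y)" for G
        unfolding facet_dist_def by (intro tendsto_intros S_proj)
      have in01: "0 < facet_dist K F (S m y) \<and> facet_dist K F (S m y) < \<epsilon> m \<longleftrightarrow> 0 < face_height F y \<and> face_height F y < 1" for m
        unfolding dist_S using \<epsilon>[of m] by (auto simp: zero_less_mult_iff)
      show ?case
      proof (cases "0 < face_height F y \<and> face_height F y < 1")
        case False
        then have "layer (\<epsilon> m) F (S m y) = 0" for m unfolding layer_def in01 by auto
        moreover have "y \<notin> face_prism F" using False elim unfolding f.prism_iff N_def by force
        ultimately show ?thesis by (simp add: lim_def)
      next
        case True
        have lay: "layer (\<epsilon> m) F (S m y) = (\<Prod>G\<in>faces_of K - {F}. ramp (facet_dist K G (S m y) / \<epsilon> m))" for m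
          using True in01 by (simp add: layer_def)
        show ?thesis
        \<comment> \<open>If the foot point lies strictly within the other constraints, all ramps
          are eventually 1. Otherwise some distance is negative, since \<open>N\<close> excludes 0,
          and the layer eventually vanishes.\<close>
        proof (cases "\<forall>G\<in>faces_of K - {F}. facet_dist K G (face_proj F y) > 0")
          case pos: True
          have d0: "facet_dist K F (face_proj F y) = 0"
            unfolding \<sigma>(3) f.face_proj_height using f.height_add[of y "- face_height F y"] by simp
          have "0 \<le> facet_dist K G (face_proj F y)" if "G \<in> faces_of K" for G
            using pos d0 that by (cases "G = F") (auto simp: less_imp_le)
          then have "face_proj F y \<in> K" using eq_halfspaces by blast
          then have "face_proj F y \<in> F" using d0 facet_normal(2)[OF F] by blast
          then have "y \<in> face_prism F" using True by (simp add: f.prism_iff)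
          moreover have "(\<lambda>m. layer (\<epsilon> m) F (S m y)) \<longlonglongrightarrow> (\<Prod>G\<in>faces_of K - {F}. 1)"
            unfolding lay
          proof (rule tendsto_prod)
            fix G assume "G \<in> faces_of K - {F}"
            then have gp: "facet_dist K G (face_proj F y) > 0" using pos by blast
            let ?g = "facet_dist K G (face_proj F y)"
            have "\<forall>\<^sub>F m in sequentially. facet_dist K G (S m y) > ?g / 2"
              using gp by (intro order_tendstoD(1)[OF dlim]) simp
            moreover have "\<forall>\<^sub>F m in sequentially. \<epsilon> m < ?g / 2"
              unfolding \<epsilon>_def using gp by (intro order_tendstoD(2)[OF LIMSEQ_inverse_real_of_nat]) simp
            ultimately have "\<forall>\<^sub>F m in sequentially. ramp (facet_dist K G (S m y) / \<epsilon> m) = 1"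
            proof eventually_elim
              case (elim m)
              then show ?case using \<epsilon>(1)[of m] by (intro ramp_eq_1) (simp add: field_simps)
            qed
            then show "(\<lambda>m. ramp (facet_dist K G (S m y) / \<epsilon> m)) \<longlonglongrightarrow> 1" by (rule tendsto_eventually)
          qed
          ultimately show ?thesis using tendsto_mult[OF _ p\<psi>, of "\<lambda>m. layer (\<epsilon> m) F (S m y)" 1] by (simp add: lim_def)
        next
          case False
          then obtain G where G: "G \<in> faces_of K - {F}" "facet_dist K G (face_proj F y) \<le> 0" by force
          moreover have "facet_dist K G (face_proj F y) \<noteq> 0" using elim G(1) unfolding N_def by blast
          ultimately have neg: "facet_dist K G (face_proj F y) < 0" by simp
          then have "face_proj F y \<notin> K" using facet_normal(3)[of G] G(1) by force
          then have "y \<notin> face_prism F" using facet_subset[OF F] unfolding f.prism_iff by blast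
          moreover have "\<forall>\<^sub>F m in sequentially. layer (\<epsilon> m) F (S m y) * \<psi> (S m y) = 0"
            using order_tendstoD(2)[OF dlim neg]
          proof eventually_elim
            case (elim m)
            then have "ramp (facet_dist K G (S m y) / \<epsilon> m) = 0"
              using \<epsilon>(1)[of m] by (intro ramp_eq_0) (simp add: divide_nonpos_pos)
            then show ?case unfolding lay using G(1) finite_faces
              by (metis finite_Diff mult_zero_left prod_zero)
          qed
          ultimately show ?thesis by (simp add: lim_def tendsto_eventually)
        qed
      qed
    qed
  qed
  then show ?thesis
    unfolding f.integral_face_measure[OF C1_measurable[OF \<psi>]] lim_def scale[symmetric] unfolding \<epsilon>_def .
qed

text \<open>Two limits of \<open>cutoff_divergence\<close>: on the left the cut-off tends to the
  indicator of \<open>K\<close> off the null boundary, on the right \<open>layer_limit\<close>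
  applies to each facet.\<close>

theorem divergence_theorem:
  assumes \<psi>: "C1 \<psi>" and e: "norm e = 1"
  shows "(\<integral>x. gradient \<psi> x \<bullet> e \<partial>lebesgue_on K) = (\<Sum>F\<in>faces_of K. (outer_normal K F \<bullet> e) * (\<integral>x. \<psi> x \<partial>face_measure F))"
proof -
  note [measurable] = C1_gradient_measurable[OF \<psi>]
  obtain B where B: "B \<ge> 0" "\<And>x. x \<in> K \<Longrightarrow> norm (gradient \<psi> x) \<le> B"
    using C1_bounded_on_compact[OF \<psi> compact] by metis
  have Kb [measurable]: "K \<in> sets borel" using compact by (simp add: borel_closed compact_imp_closed)
  define \<epsilon> where "\<epsilon> m = inverse (real (Suc m))" for m
  have \<epsilon>: "\<epsilon> m > 0" for m by (auto simp: \<epsilon>_def)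
  have bd: "\<bar>gradient \<psi> x \<bullet> e\<bar> \<le> B" if "x \<in> K" for x
    using Cauchy_Schwarz_ineq2[of "gradient \<psi> x" e] B(2)[OF that] e by simp
  have "(\<lambda>m. \<integral>x. cutoff (\<epsilon> m) x * (gradient \<psi> x \<bullet> e) \<partial>lborel) \<longlonglongrightarrow> (\<integral>x. indicator K x * (gradient \<psi> x \<bullet> e) \<partial>lborel)"
  proof (rule integral_dominated_convergence[where w = "\<lambda>x. B * indicator K x"])
    show "integrable lborel (\<lambda>x. B * indicator K x)"
      by (rule integrable_bounded_on_compact[OF compact, of _ B]) (use B(1) in \<open>auto\<close>)
    show "AE x in lborel. norm (cutoff (\<epsilon> m) x * (gradient \<psi> x \<bullet> e)) \<le> B * indicator K x" for m
    proof (rule AE_I2)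
      fix x
      show "norm (cutoff (\<epsilon> m) x * (gradient \<psi> x \<bullet> e)) \<le> B * indicator K x"
      proof (cases "x \<in> K")
        case True
        have "\<bar>cutoff (\<epsilon> m) x\<bar> * \<bar>gradient \<psi> x \<bullet> e\<bar> \<le> 1 * B"
          using cutoff_bounds[of "\<epsilon> m" x] bd[OF True] by (intro mult_mono) auto
        with True show ?thesis by (simp add: abs_mult)
      next
        case False
        then have "cutoff (\<epsilon> m) x = 0" using cutoff_outside[OF \<epsilon>] interior_subset by blast
        with False show ?thesis by simp
      qed
    qed
    have "AE x in lebesgue. x \<notin> K - interior K"
      using negligible_boundary unfolding negligible_iff_null_sets by (rule AE_not_in)
    then have "AE x in lborel. x \<notin> K - interior K" unfolding AE_completion_iff .
    then show "AE x in lborel. (\<lambda>m. cutoff (\<epsilon> m) x * (gradient \<psi> x \<bullet> e)) \<longlonglongrightarrow> indicator K x * (gradient \<psi> x \<bullet> e)"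
    proof eventually_elim
      case (elim x)
      show ?case
      proof (cases "x \<in> interior K")
        case True
        have "(\<lambda>m. cutoff (\<epsilon> m) x) \<longlonglongrightarrow> (\<Prod>F\<in>faces_of K. 1)"
          unfolding cutoff_def
        proof (rule tendsto_prod)
          fix F assume "F \<in> faces_of K"
          then have gp: "facet_dist K F x > 0" using True interior_iff_facet_dist by blast
          have "\<forall>\<^sub>F m in sequentially. \<epsilon> m < facet_dist K F x"
            unfolding \<epsilon>_def using gp by (intro order_tendstoD(2)[OF LIMSEQ_inverse_real_of_nat]) simp
          then have "\<forall>\<^sub>F m in sequentially. ramp (facet_dist K F x / \<epsilon> m) = 1"
          proof eventually_elim
            case (elim m)
            then show ?case using \<epsilon>[of m] by (intro ramp_eq_1) (simp add: field_simps)
          qed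
          then show "(\<lambda>m. ramp (facet_dist K F x / \<epsilon> m)) \<longlonglongrightarrow> 1" by (rule tendsto_eventually)
        qed
        moreover have "x \<in> K" using True interior_subset by blast
        ultimately show ?thesis by (auto intro!: tendsto_mult_right[where c = "gradient \<psi> x \<bullet> e" and l = 1, simplified])
      next
        case False
        then have "x \<notin> K" using elim by blast
        then show ?thesis using cutoff_outside[OF \<epsilon> False] by simp
      qed
    qed
  next
    show "(\<lambda>x. cutoff (\<epsilon> m) x * (gradient \<psi> x \<bullet> e)) \<in> borel_measurable lborel" for m by measurable
    show "(\<lambda>x. indicator K x * (gradient \<psi> x \<bullet> e)) \<in> borel_measurable lborel" by measurable
  qed
  moreover have "(\<lambda>m. \<integral>x. cutoff (\<epsilon> m) x * (gradient \<psi> x \<bullet> e) \<partial>lborel) \<longlonglongrightarrow>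
      (\<Sum>F\<in>faces_of K. (outer_normal K F \<bullet> e) * (\<integral>x. \<psi> x \<partial>face_measure F))"
    unfolding cutoff_divergence[OF \<psi> \<epsilon> e] unfolding \<epsilon>_def
    by (intro tendsto_sum tendsto_mult tendsto_const layer_limit \<psi>)
  ultimately have "(\<integral>x. indicator K x * (gradient \<psi> x \<bullet> e) \<partial>lborel) =
      (\<Sum>F\<in>faces_of K. (outer_normal K F \<bullet> e) * (\<integral>x. \<psi> x \<partial>face_measure F))"
    by (rule LIMSEQ_unique)
  moreover have "(\<integral>x. gradient \<psi> x \<bullet> e \<partial>lebesgue_on K) = (\<integral>x. indicator K x * (gradient \<psi> x \<bullet> e) \<partial>lebesgue)"
    by (simp add: integral_restrict_space)
  moreover have "\<dots> = (\<integral>x. indicator K x * (gradient \<psi> x \<bullet> e) \<partial>lborel)"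
    by (rule integral_completion) measurable
  ultimately show ?thesis by simp
qed

end

section \<open>Sobolev functions and their traces\<close>

section \<open>Weak gradients\<close>

lemma L2_lebesgue_on_continuous:
  fixes f :: "'a::euclidean_space \<Rightarrow> 'b::euclidean_space"
  assumes S: "bounded S" "S \<in> sets lebesgue" and f: "continuous_on UNIV f"
  shows "L2 (lebesgue_on S) f"
proof -
  obtain r where r: "S \<subseteq> cball 0 r" using bounded_subset_ballD[OF S(1), of 0] ball_subset_cball by (metis subset_trans)
  have "compact (f ` cball 0 r)"
    using f by (intro compact_continuous_image) (auto intro: continuous_on_subset)
  from compact_imp_bounded[OF this] obtain B where "\<And>x. x \<in> cball 0 r \<Longrightarrow> norm (f x) \<le> B"
    unfolding bounded_iff by blast
  then show ?thesis
    using r f S by (intro L2_bounded[where B = B] finite_measure_lebesgue_on_bounded AE_I2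
        continuous_imp_measurable_on_sets_lebesgue) (auto intro: continuous_on_subset)
qed

lemma L2_lebesgue_on_cong_set:
  fixes f :: "'a::euclidean_space \<Rightarrow> 'b::euclidean_space"
  assumes S: "S \<in> sets lebesgue" and T: "T \<in> sets lebesgue" and neg: "negligible (sym_diff S T)"
    and f: "L2 (lebesgue_on S) f"
  shows "L2 (lebesgue_on T) f" "L2_norm (lebesgue_on T) f = L2_norm (lebesgue_on S) f"
proof -
  have ae: "AE x in lebesgue. x \<in> S \<longleftrightarrow> x \<in> T"
  proof -
    have "AE x in lebesgue. x \<notin> sym_diff S T"
      using neg unfolding negligible_iff_null_sets by (rule AE_not_in)
    then show ?thesis by eventually_elim auto
  qed
  have m: "(\<lambda>x. indicator S x *\<^sub>R f x) \<in> borel_measurable lebesgue"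
    using L2_measurable[OF f] S by (subst (asm) borel_measurable_restrict_space_iff) auto
  have "(\<lambda>x. indicator T x *\<^sub>R f x) \<in> borel_measurable lebesgue"
    by (rule borel_measurable_AE[OF m]) (use ae in \<open>eventually_elim, auto simp: indicator_def\<close>)
  then have mT: "f \<in> borel_measurable (lebesgue_on T)"
    using T by (subst borel_measurable_restrict_space_iff) auto
  have i: "integrable lebesgue (\<lambda>x. indicator S x *\<^sub>R (norm (f x))\<^sup>2)"
    using L2_integrable_sq[OF f] S by (simp add: integrable_restrict_space)
  have "(\<lambda>x. (norm (f x))\<^sup>2) \<in> borel_measurable (lebesgue_on T)" using mT by measurable
  then have m2: "(\<lambda>x. indicator T x *\<^sub>R (norm (f x))\<^sup>2) \<in> borel_measurable lebesgue"
    using T by (subst (asm) borel_measurable_restrict_space_iff) auto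
  have "integrable lebesgue (\<lambda>x. indicator T x *\<^sub>R (norm (f x))\<^sup>2)"
    by (rule integrable_cong_AE_imp[OF i m2]) (use ae in \<open>eventually_elim, auto simp: indicator_def\<close>)
  then show "L2 (lebesgue_on T) f"
    using mT T by (simp add: L2_def integrable_restrict_space)
  show "L2_norm (lebesgue_on T) f = L2_norm (lebesgue_on S) f"
    unfolding L2_norm_def integral_lebesgue_on_cong_set[OF S T neg] ..
qed

lemma test_function_C1: "\<phi> \<in> test_functions \<Omega> \<Longrightarrow> C1 \<phi>"
  unfolding test_functions_def using Ck_imp_C1 by blast

lemma test_function_support:
  assumes "\<phi> \<in> test_functions \<Omega>" "x \<notin> \<Omega>"
  shows "\<phi> x = 0" "gradient \<phi> x = 0"
proof -
  have x: "x \<notin> closure {x. \<phi> x \<noteq> 0}" using assms by (auto simp: test_functions_def)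
  then show "\<phi> x = 0" using closure_subset[of "{x. \<phi> x \<noteq> 0}"] by blast
  show "gradient \<phi> x = 0" using gradient_zero_outside[OF x] by (rule gradient_eq)
qed

lemma test_functions_mono: "A \<subseteq> B \<Longrightarrow> test_functions A \<subseteq> test_functions B"
  unfolding test_functions_def by auto

lemma test_functions_add:
  assumes "\<phi> \<in> test_functions \<Omega>" "\<psi> \<in> test_functions \<Omega>"
  shows "\<phi> + \<psi> \<in> test_functions \<Omega>"
proof -
  let ?S = "closure {x. \<phi> x \<noteq> 0} \<union> closure {x. \<psi> x \<noteq> 0}"
  have S: "compact ?S" "?S \<subseteq> \<Omega>" using assms by (auto simp: test_functions_def)
  have "{x. (\<phi> + \<psi>) x \<noteq> 0} \<subseteq> {x. \<phi> x \<noteq> 0} \<union> {x. \<psi> x \<noteq> 0}" by auto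
  then have sub: "closure {x. (\<phi> + \<psi>) x \<noteq> 0} \<subseteq> ?S"
    using closure_mono closure_Un by metis
  have "compact (?S \<inter> closure {x. (\<phi> + \<psi>) x \<noteq> 0})" using S(1) by (intro compact_Int_closed) auto
  moreover have "?S \<inter> closure {x. (\<phi> + \<psi>) x \<noteq> 0} = closure {x. (\<phi> + \<psi>) x \<noteq> 0}" using sub by auto
  ultimately have "compact (closure {x. (\<phi> + \<psi>) x \<noteq> 0})" by simp
  moreover have "\<forall>k. Ck k (\<phi> + \<psi>)"
    using assms unfolding test_functions_def plus_fun_def by (blast intro: Ck_add)
  ultimately show ?thesis using sub S(2) by (auto simp: test_functions_def)
qed

lemma test_functions_scale:
  assumes "\<phi> \<in> test_functions \<Omega>"
  shows "(\<lambda>x. c * \<phi> x) \<in> test_functions \<Omega>"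
proof -
  let ?S = "closure {x. \<phi> x \<noteq> 0}"
  have S: "compact ?S" "?S \<subseteq> \<Omega>" using assms by (auto simp: test_functions_def)
  have sub: "closure {x. c * \<phi> x \<noteq> 0} \<subseteq> ?S" by (intro closure_mono) auto
  have "compact (?S \<inter> closure {x. c * \<phi> x \<noteq> 0})" using S(1) by (intro compact_Int_closed) auto
  moreover have "?S \<inter> closure {x. c * \<phi> x \<noteq> 0} = closure {x. c * \<phi> x \<noteq> 0}" using sub by auto
  ultimately have "compact (closure {x. c * \<phi> x \<noteq> 0})" by simp
  moreover have "\<forall>k. Ck k (\<lambda>x. c * \<phi> x)"
    using assms Ck_mult[OF Ck_const] by (auto simp: test_functions_def)
  ultimately show ?thesis using sub S(2) by (auto simp: test_functions_def)
qed

lemma test_functions_zero: "(\<lambda>x. 0) \<in> test_functions \<Omega>"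
  by (simp add: test_functions_def Ck_const)

locale bounded_open =
  fixes A :: "(real^'d) set"
  assumes open_A: "open A" and bounded_A: "bounded A"
begin

lemma sets_A [simp, measurable]: "A \<in> sets lebesgue"
  using open_A by (simp add: borel_open)

lemma L2_test: "\<phi> \<in> test_functions B \<Longrightarrow> L2 (lebesgue_on A) \<phi>"
  and L2_grad_test: "\<phi> \<in> test_functions B \<Longrightarrow> L2 (lebesgue_on A) (gradient \<phi>)"
  by (auto intro!: L2_lebesgue_on_continuous bounded_A C1_continuous C1_continuous_gradient test_function_C1)

lemma weak_grad_pairing:
  assumes v: "L2 (lebesgue_on A) v" and \<phi>: "\<phi> \<in> test_functions A" and g: "is_weak_grad A v g"
  shows "(\<integral>x. v x * (gradient \<phi> x \<bullet> e) \<partial>lebesgue_on A) = - (\<integral>x. \<phi> x * (g x \<bullet> e) \<partial>lebesgue_on A)"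
proof -
  have gL: "L2 (lebesgue_on A) g" using g by (simp add: is_weak_grad_def)
  have "(\<integral>x. v x *\<^sub>R gradient \<phi> x \<partial>lebesgue_on A) \<bullet> e = - (\<integral>x. \<phi> x *\<^sub>R g x \<partial>lebesgue_on A) \<bullet> e"
    using g \<phi> by (simp add: is_weak_grad_def)
  moreover have "integrable (lebesgue_on A) (\<lambda>x. v x *\<^sub>R gradient \<phi> x)" "integrable (lebesgue_on A) (\<lambda>x. \<phi> x *\<^sub>R g x)"
    using L2_integrable_scaleR v gL L2_test[OF \<phi>] L2_grad_test[OF \<phi>] by blast+
  ultimately show ?thesis by (simp add: integral_inner_left[symmetric] del: integral_inner_left)
qed

lemma is_weak_gradI:
  assumes v: "L2 (lebesgue_on A) v" and g: "L2 (lebesgue_on A) g"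
    and eq: "\<And>\<phi> i. \<phi> \<in> test_functions A \<Longrightarrow>
      (\<integral>x. v x * gradient \<phi> x $ i \<partial>lebesgue_on A) = - (\<integral>x. \<phi> x * g x $ i \<partial>lebesgue_on A)"
  shows "is_weak_grad A v g"
  unfolding is_weak_grad_def
proof (intro conjI ballI g)
  fix \<phi> assume \<phi>: "\<phi> \<in> test_functions A"
  have i: "integrable (lebesgue_on A) (\<lambda>x. v x *\<^sub>R gradient \<phi> x)" "integrable (lebesgue_on A) (\<lambda>x. \<phi> x *\<^sub>R g x)"
    using L2_integrable_scaleR v g L2_test[OF \<phi>] L2_grad_test[OF \<phi>] by blast+
  show "(\<integral>x. v x *\<^sub>R gradient \<phi> x \<partial>lebesgue_on A) = - (\<integral>x. \<phi> x *\<^sub>R g x \<partial>lebesgue_on A)"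
  proof (rule vec_eq_iff[THEN iffD2], rule allI)
    fix j
    show "(\<integral>x. v x *\<^sub>R gradient \<phi> x \<partial>lebesgue_on A) $ j = (- (\<integral>x. \<phi> x *\<^sub>R g x \<partial>lebesgue_on A)) $ j"
      using eq[OF \<phi>, of j] i
      by (simp add: cart_eq_inner_axis integral_inner_left[symmetric] del: integral_inner_left)
  qed
qed

text \<open>Each component of the difference pairs to zero with every test function, so the
  fundamental lemma applies. This is what tames the choice hidden in
  \<open>weak_grad\<close>.\<close>

lemma is_weak_grad_unique:
  assumes v: "L2 (lebesgue_on A) v" and g: "is_weak_grad A v g" "is_weak_grad A v h"
  shows "AE x in lebesgue_on A. g x = h x"
proof -
  have L: "L2 (lebesgue_on A) g" "L2 (lebesgue_on A) h" using g by (auto simp: is_weak_grad_def)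
  have fin: "finite_measure (lebesgue_on A)" by (rule finite_measure_lebesgue_on_bounded[OF bounded_A]) simp
  have "AE x in lebesgue_on A. (g x - h x) \<bullet> axis i 1 = 0" for i
  proof (rule fundamental_lemma[OF open_A])
    have "L2 (lebesgue_on A) (\<lambda>x. (g x - h x) \<bullet> axis i 1)" by (intro L2_inner_const L2_diff L)
    then show "integrable (lebesgue_on A) (\<lambda>x. (g x - h x) \<bullet> axis i 1)" by (rule L2_integrable_finite[OF fin])
    fix \<phi> assume \<phi>: "\<phi> \<in> test_functions A"
    have "integrable (lebesgue_on A) (\<lambda>x. \<phi> x * (g x \<bullet> axis i 1))" "integrable (lebesgue_on A) (\<lambda>x. \<phi> x * (h x \<bullet> axis i 1))"
      by (intro L2_integrable_mult L2_test[OF \<phi>] L2_inner_const L)+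
    moreover have "(\<integral>x. \<phi> x * (g x \<bullet> axis i 1) \<partial>lebesgue_on A) = (\<integral>x. \<phi> x * (h x \<bullet> axis i 1) \<partial>lebesgue_on A)"
      using weak_grad_pairing[OF v \<phi> g(1)] weak_grad_pairing[OF v \<phi> g(2)] by simp
    ultimately show "(\<integral>x. \<phi> x * ((g x - h x) \<bullet> axis i 1) \<partial>lebesgue_on A) = 0"
      by (simp add: inner_diff_left right_diff_distrib)
  qed
  then have "AE x in lebesgue_on A. \<forall>i\<in>UNIV. (g x - h x) \<bullet> axis i 1 = 0"
    by (intro AE_finite_allI) auto
  then show ?thesis
    by eventually_elim (auto simp: vec_eq_iff cart_eq_inner_axis[symmetric])
qed

lemma weak_grad_is_weak_grad: "is_weak_grad A v g \<Longrightarrow> is_weak_grad A v (weak_grad A v)"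
  unfolding weak_grad_def by (rule someI[of "is_weak_grad A v"])

lemma weak_grad_AE:
  assumes "L2 (lebesgue_on A) v" "is_weak_grad A v g"
  shows "AE x in lebesgue_on A. weak_grad A v x = g x"
  using is_weak_grad_unique[OF assms(1) weak_grad_is_weak_grad[OF assms(2)] assms(2)] .

lemma is_weak_grad_add:
  assumes "L2 (lebesgue_on A) v" "L2 (lebesgue_on A) w" "is_weak_grad A v g" "is_weak_grad A w h"
  shows "is_weak_grad A (v + w) (\<lambda>x. g x + h x)"
proof (rule is_weak_gradI)
  have L: "L2 (lebesgue_on A) g" "L2 (lebesgue_on A) h" using assms by (auto simp: is_weak_grad_def)
  show "L2 (lebesgue_on A) (v + w)" using assms(1,2) by (rule L2_plus_fun)
  show "L2 (lebesgue_on A) (\<lambda>x. g x + h x)" using L by (rule L2_add)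
  fix \<phi> i assume \<phi>: "\<phi> \<in> test_functions A"
  have gi: "L2 (lebesgue_on A) (\<lambda>x. gradient \<phi> x \<bullet> axis i 1)" by (rule L2_inner_const[OF L2_grad_test[OF \<phi>]])
  show "(\<integral>x. (v + w) x * gradient \<phi> x $ i \<partial>lebesgue_on A) = - (\<integral>x. \<phi> x * (g x + h x) $ i \<partial>lebesgue_on A)"
    using weak_grad_pairing[OF assms(1) \<phi> assms(3), of "axis i 1"] weak_grad_pairing[OF assms(2) \<phi> assms(4), of "axis i 1"]
      L2_integrable_mult[OF assms(1) gi] L2_integrable_mult[OF assms(2) gi]
      L2_integrable_mult[OF L2_test[OF \<phi>] L2_inner_const[OF L(1), of "axis i 1"]]
      L2_integrable_mult[OF L2_test[OF \<phi>] L2_inner_const[OF L(2), of "axis i 1"]]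
    by (simp add: cart_eq_inner_axis inner_add_left distrib_left distrib_right)
qed

lemma is_weak_grad_scale:
  assumes "L2 (lebesgue_on A) v" "is_weak_grad A v g"
  shows "is_weak_grad A (\<lambda>x. c * v x) (\<lambda>x. c *\<^sub>R g x)"
proof (rule is_weak_gradI)
  show "L2 (lebesgue_on A) (\<lambda>x. c * v x)" using assms(1) by (rule L2_mult_left)
  show "L2 (lebesgue_on A) (\<lambda>x. c *\<^sub>R g x)" using assms(2) by (intro L2_scaleR) (simp add: is_weak_grad_def)
  fix \<phi> i assume \<phi>: "\<phi> \<in> test_functions A"
  have "(\<integral>x. (c * v x) * gradient \<phi> x $ i \<partial>lebesgue_on A) = c * (\<integral>x. v x * gradient \<phi> x $ i \<partial>lebesgue_on A)"
    by (simp add: mult.assoc)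
  moreover have "(\<integral>x. \<phi> x * (c *\<^sub>R g x) $ i \<partial>lebesgue_on A) = c * (\<integral>x. \<phi> x * g x $ i \<partial>lebesgue_on A)"
    by (simp add: mult.left_commute)
  ultimately show "(\<integral>x. (c * v x) * gradient \<phi> x $ i \<partial>lebesgue_on A) = - (\<integral>x. \<phi> x * (c *\<^sub>R g x) $ i \<partial>lebesgue_on A)"
    using weak_grad_pairing[OF assms(1) \<phi> assms(2), of "axis i 1"] by (simp add: cart_eq_inner_axis)
qed

lemma is_weak_grad_cong:
  assumes "L2 (lebesgue_on A) v" "AE x in lebesgue_on A. v x = w x" "is_weak_grad A v g"
  shows "is_weak_grad A w g"
proof (rule is_weak_gradI)
  show "L2 (lebesgue_on A) w" by (rule L2_lebesgue_on_cong_AE[OF _ assms(1,2)]) simp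
  show "L2 (lebesgue_on A) g" using assms(3) by (simp add: is_weak_grad_def)
  fix \<phi> i assume \<phi>: "\<phi> \<in> test_functions A"
  have "(\<integral>x. w x * gradient \<phi> x $ i \<partial>lebesgue_on A) = (\<integral>x. v x * gradient \<phi> x $ i \<partial>lebesgue_on A)"
    by (rule integral_lebesgue_on_cong_AE, simp, rule AE_mp[OF assms(2)]) simp
  then show "(\<integral>x. w x * gradient \<phi> x $ i \<partial>lebesgue_on A) = - (\<integral>x. \<phi> x * g x $ i \<partial>lebesgue_on A)"
    using weak_grad_pairing[OF assms(1) \<phi> assms(3), of "axis i 1"] by (simp add: cart_eq_inner_axis)
qed

text \<open>The product of \<open>v\<close> with a test function has compact support, so its
  gradient integrates to zero by \<open>integral_gradient_zero\<close>; the product rule is then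
  integration by parts, without any regularity of the boundary of \<open>A\<close>.\<close>

lemma C1_is_weak_grad:
  assumes v: "C1 v"
  shows "is_weak_grad A v (gradient v)"
proof (rule is_weak_gradI)
  show Lv: "L2 (lebesgue_on A) v" by (intro L2_lebesgue_on_continuous bounded_A sets_A C1_continuous v)
  show Lg: "L2 (lebesgue_on A) (gradient v)"
    by (intro L2_lebesgue_on_continuous bounded_A sets_A C1_continuous_gradient v)
  fix \<phi> i assume \<phi>: "\<phi> \<in> test_functions A"
  note c\<phi> = test_function_C1[OF \<phi>]
  define g where "g x = v x * \<phi> x" for x
  have cg: "C1 g" unfolding g_def by (intro C1_mult v c\<phi>)
  have Gg: "gradient g x = v x *\<^sub>R gradient \<phi> x + \<phi> x *\<^sub>R gradient v x" for x
    unfolding g_def by (rule gradient_mult[OF v c\<phi>])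
  obtain r where r: "A \<subseteq> cball 0 r" using bounded_subset_ballD[OF bounded_A, of 0] ball_subset_cball by (metis subset_trans)
  obtain L where L: "L-lipschitz_on (cball 0 (r + 1)) g"
    using C1_lipschitz_on[OF cg, of "cball 0 (r + 1)"] by auto
  have out: "g x = 0" if "norm x > r" for x
  proof -
    have "x \<notin> A" using r that by auto
    then show ?thesis using test_function_support(1)[OF \<phi>, of x] by (simp add: g_def)
  qed
  have "(\<integral>x. gradient g x \<bullet> axis i 1 \<partial>lborel) = 0"
    by (rule integral_gradient_zero(2)[OF L out C1_gradient_measurable[OF cg]])
       (use C1_gderiv[OF cg] in auto)
  moreover have "(\<integral>x. gradient g x \<bullet> axis i 1 \<partial>lborel) = (\<integral>x. gradient g x \<bullet> axis i 1 \<partial>lebesgue)"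
  proof (rule integral_completion[symmetric])
    note [measurable] = C1_gradient_measurable[OF cg]
    show "(\<lambda>x. gradient g x \<bullet> axis i 1) \<in> borel_measurable lborel" by measurable
  qed
  moreover have "\<dots> = (\<integral>x. indicator A x *\<^sub>R (gradient g x \<bullet> axis i 1) \<partial>lebesgue)"
    using test_function_support[OF \<phi>] by (intro Bochner_Integration.integral_cong) (auto simp: Gg indicator_def)
  moreover have "\<dots> = (\<integral>x. gradient g x \<bullet> axis i 1 \<partial>lebesgue_on A)"
    by (simp add: integral_restrict_space)
  moreover have "\<dots> = (\<integral>x. v x * (gradient \<phi> x \<bullet> axis i 1) \<partial>lebesgue_on A) + (\<integral>x. \<phi> x * (gradient v x \<bullet> axis i 1) \<partial>lebesgue_on A)"
    unfolding Gg inner_add_left inner_scaleR_left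
    by (intro Bochner_Integration.integral_add L2_integrable_mult L2_inner_const Lv Lg L2_test[OF \<phi>] L2_grad_test[OF \<phi>])
  ultimately show "(\<integral>x. v x * gradient \<phi> x $ i \<partial>lebesgue_on A) = - (\<integral>x. \<phi> x * gradient v x $ i \<partial>lebesgue_on A)"
    by (simp add: cart_eq_inner_axis)
qed

text \<open>Test functions on \<open>B\<close> are test functions on \<open>A\<close> that vanish,
  together with their gradients, off \<open>B\<close>.\<close>

lemma is_weak_grad_subset:
  assumes B: "open B" "B \<subseteq> A" and g: "is_weak_grad A v g"
  shows "is_weak_grad B v g"
  unfolding is_weak_grad_def
proof (intro conjI ballI)
  have Bl: "B \<in> sets lebesgue" using B(1) by (simp add: borel_open)
  show "L2 (lebesgue_on B) g"
    using g by (intro L2_lebesgue_on_subset[OF Bl sets_A B(2)]) (simp add: is_weak_grad_def)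
  fix \<phi> assume \<phi>: "\<phi> \<in> test_functions B"
  have "(\<integral>x. v x *\<^sub>R gradient \<phi> x \<partial>lebesgue_on A) = - (\<integral>x. \<phi> x *\<^sub>R g x \<partial>lebesgue_on A)"
    using g \<phi> test_functions_mono[OF B(2)] by (auto simp: is_weak_grad_def)
  moreover have "(\<lambda>x. indicator A x *\<^sub>R (v x *\<^sub>R gradient \<phi> x)) = (\<lambda>x. indicator B x *\<^sub>R (v x *\<^sub>R gradient \<phi> x))"
    "(\<lambda>x. indicator A x *\<^sub>R (\<phi> x *\<^sub>R g x)) = (\<lambda>x. indicator B x *\<^sub>R (\<phi> x *\<^sub>R g x))"
    using test_function_support[OF \<phi>] B(2) by (auto simp: fun_eq_iff indicator_def)
  ultimately show "(\<integral>x. v x *\<^sub>R gradient \<phi> x \<partial>lebesgue_on B) = - (\<integral>x. \<phi> x *\<^sub>R g x \<partial>lebesgue_on B)"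
    using Bl by (simp add: integral_restrict_space)
qed

section \<open>Approximation by test functions\<close>

text \<open>The approximating sequence is kept explicit because a trace has to be the limit of the
  very sequence that approximates the function.\<close>

definition approximable :: "(real^'d \<Rightarrow> real) \<Rightarrow> (nat \<Rightarrow> real^'d \<Rightarrow> real) \<Rightarrow> bool" where
  "approximable v \<phi> \<longleftrightarrow> (\<forall>n. \<phi> n \<in> test_functions A) \<and> (\<lambda>n. H1_norm A (v - \<phi> n)) \<longlonglongrightarrow> 0"

lemma H1_D:
  assumes "v \<in> H1 A"
  shows "L2 (lebesgue_on A) v" "is_weak_grad A v (weak_grad A v)" "L2 (lebesgue_on A) (weak_grad A v)"
proof -
  show "L2 (lebesgue_on A) v" using assms by (simp add: H1_def)
  obtain g where "is_weak_grad A v g" using assms by (auto simp: H1_def)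
  then show g: "is_weak_grad A v (weak_grad A v)" by (rule weak_grad_is_weak_grad)
  then show "L2 (lebesgue_on A) (weak_grad A v)" by (simp add: is_weak_grad_def)
qed

lemma H10_H1: "v \<in> H10 A \<Longrightarrow> v \<in> H1 A"
  by (simp add: H10_def)

lemma H1_I: "L2 (lebesgue_on A) v \<Longrightarrow> is_weak_grad A v g \<Longrightarrow> v \<in> H1 A"
  unfolding H1_def by auto

lemma H1_add:
  assumes "v \<in> H1 A" "w \<in> H1 A"
  shows "v + w \<in> H1 A"
    "AE x in lebesgue_on A. weak_grad A (v + w) x = weak_grad A v x + weak_grad A w x"
proof -
  note g = is_weak_grad_add[OF H1_D(1)[OF assms(1)] H1_D(1)[OF assms(2)] H1_D(2)[OF assms(1)] H1_D(2)[OF assms(2)]]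
  have L: "L2 (lebesgue_on A) (v + w)" using assms H1_D(1) by (intro L2_plus_fun) auto
  show "v + w \<in> H1 A" by (rule H1_I[OF L g])
  show "AE x in lebesgue_on A. weak_grad A (v + w) x = weak_grad A v x + weak_grad A w x"
    by (rule weak_grad_AE[OF L g])
qed

lemma H1_scale:
  assumes "v \<in> H1 A"
  shows "(\<lambda>x. c * v x) \<in> H1 A"
    "AE x in lebesgue_on A. weak_grad A (\<lambda>x. c * v x) x = c *\<^sub>R weak_grad A v x"
proof -
  note g = is_weak_grad_scale[OF H1_D(1)[OF assms] H1_D(2)[OF assms]]
  have L: "L2 (lebesgue_on A) (\<lambda>x. c * v x)" using H1_D(1)[OF assms] by (rule L2_mult_left)
  show "(\<lambda>x. c * v x) \<in> H1 A" by (rule H1_I[OF L g])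
  show "AE x in lebesgue_on A. weak_grad A (\<lambda>x. c * v x) x = c *\<^sub>R weak_grad A v x"
    by (rule weak_grad_AE[OF L g])
qed

lemma weak_grad_diff_test:
  assumes "v \<in> H1 A" "\<phi> \<in> test_functions A"
  shows "AE x in lebesgue_on A. weak_grad A (v - \<phi>) x = weak_grad A v x - gradient \<phi> x"
proof -
  have L: "L2 (lebesgue_on A) (\<lambda>x. - 1 * \<phi> x)" by (intro L2_mult_left L2_test[OF assms(2)])
  have g: "is_weak_grad A (\<lambda>x. - 1 * \<phi> x) (\<lambda>x. - 1 *\<^sub>R gradient \<phi> x)"
    by (intro is_weak_grad_scale L2_test[OF assms(2)] C1_is_weak_grad test_function_C1[OF assms(2)])
  have "v + (\<lambda>x. - 1 * \<phi> x) = v - \<phi>" by (simp add: fun_eq_iff)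
  then have "is_weak_grad A (v - \<phi>) (\<lambda>x. weak_grad A v x + - 1 *\<^sub>R gradient \<phi> x)"
    using is_weak_grad_add[OF H1_D(1)[OF assms(1)] L H1_D(2)[OF assms(1)] g] by simp
  from weak_grad_AE[OF L2_minus_fun[OF H1_D(1)[OF assms(1)] L2_test[OF assms(2)]] this] show ?thesis by simp
qed

lemma H1_norm_diff_test:
  assumes "v \<in> H1 A" "\<phi> \<in> test_functions A"
  shows "H1_norm A (v - \<phi>) = sqrt ((L2_norm (lebesgue_on A) (\<lambda>x. v x - \<phi> x))\<^sup>2 +
    (L2_norm (lebesgue_on A) (\<lambda>x. weak_grad A v x - gradient \<phi> x))\<^sup>2)"
proof -
  have "L2_norm (lebesgue_on A) (weak_grad A (v - \<phi>)) = L2_norm (lebesgue_on A) (\<lambda>x. weak_grad A v x - gradient \<phi> x)"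
    by (rule L2_norm_lebesgue_on_cong_AE[OF sets_A weak_grad_diff_test[OF assms]])
  then show ?thesis unfolding H1_norm_def by (simp add: fun_diff_def)
qed

text \<open>\<open>H1_norm\<close> of a difference involves a chosen weak gradient of that
  difference. Here it is replaced by the difference of gradients, which can be estimated term by
  term.\<close>

lemma approximable_iff:
  assumes v: "v \<in> H1 A"
  shows "approximable v \<phi> \<longleftrightarrow> (\<forall>n. \<phi> n \<in> test_functions A) \<and>
    (\<lambda>n. L2_norm (lebesgue_on A) (\<lambda>x. v x - \<phi> n x)) \<longlonglongrightarrow> 0 \<and>
    (\<lambda>n. L2_norm (lebesgue_on A) (\<lambda>x. weak_grad A v x - gradient (\<phi> n) x)) \<longlonglongrightarrow> 0"
proof -
  let ?a = "\<lambda>n. L2_norm (lebesgue_on A) (\<lambda>x. v x - \<phi> n x)"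
  let ?b = "\<lambda>n. L2_norm (lebesgue_on A) (\<lambda>x. weak_grad A v x - gradient (\<phi> n) x)"
  have "(\<lambda>n. H1_norm A (v - \<phi> n)) \<longlonglongrightarrow> 0 \<longleftrightarrow> ?a \<longlonglongrightarrow> 0 \<and> ?b \<longlonglongrightarrow> 0" if t: "\<forall>n. \<phi> n \<in> test_functions A"
  proof -
    have eq: "H1_norm A (v - \<phi> n) = sqrt ((?a n)\<^sup>2 + (?b n)\<^sup>2)" for n
      using H1_norm_diff_test[OF v] t by simp
    show ?thesis
    proof
      assume l: "(\<lambda>n. H1_norm A (v - \<phi> n)) \<longlonglongrightarrow> 0"
      have "\<bar>?a n\<bar> \<le> H1_norm A (v - \<phi> n)" "\<bar>?b n\<bar> \<le> H1_norm A (v - \<phi> n)" for n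
        unfolding eq by (rule real_sqrt_ge_abs1 real_sqrt_ge_abs2)+
      then have b: "norm (?a n) \<le> norm (H1_norm A (v - \<phi> n)) * 1" "norm (?b n) \<le> norm (H1_norm A (v - \<phi> n)) * 1" for n
        unfolding real_norm_def mult_1_right by (auto intro: order_trans[OF _ abs_ge_self] simp del: abs_of_nonneg)
      show "?a \<longlonglongrightarrow> 0 \<and> ?b \<longlonglongrightarrow> 0"
        using tendsto_0_le[OF l always_eventually, of ?a 1] tendsto_0_le[OF l always_eventually, of ?b 1] b by blast
    next
      assume l: "?a \<longlonglongrightarrow> 0 \<and> ?b \<longlonglongrightarrow> 0"
      have "(\<lambda>n. sqrt ((?a n)\<^sup>2 + (?b n)\<^sup>2)) \<longlonglongrightarrow> sqrt (0\<^sup>2 + 0\<^sup>2)"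
        using l by (intro tendsto_intros) auto
      then show "(\<lambda>n. H1_norm A (v - \<phi> n)) \<longlonglongrightarrow> 0" by (simp add: eq)
    qed
  qed
  then show ?thesis unfolding approximable_def by auto
qed

lemma H10_iff: "v \<in> H10 A \<longleftrightarrow> v \<in> H1 A \<and> (\<exists>\<phi>. approximable v \<phi>)"
  by (simp add: H10_def approximable_def)

lemma approximable_add:
  assumes v: "v \<in> H1 A" "approximable v \<phi>" and w: "w \<in> H1 A" "approximable w \<psi>"
  shows "approximable (v + w) (\<lambda>n. \<phi> n + \<psi> n)"
proof -
  have t: "\<phi> n \<in> test_functions A" "\<psi> n \<in> test_functions A" for n
    using v w by (auto simp: approximable_def)
  have lv: "(\<lambda>n. L2_norm (lebesgue_on A) (\<lambda>x. v x - \<phi> n x)) \<longlonglongrightarrow> 0"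
    "(\<lambda>n. L2_norm (lebesgue_on A) (\<lambda>x. weak_grad A v x - gradient (\<phi> n) x)) \<longlonglongrightarrow> 0"
    using v(2) unfolding approximable_iff[OF v(1)] by auto
  have lw: "(\<lambda>n. L2_norm (lebesgue_on A) (\<lambda>x. w x - \<psi> n x)) \<longlonglongrightarrow> 0"
    "(\<lambda>n. L2_norm (lebesgue_on A) (\<lambda>x. weak_grad A w x - gradient (\<psi> n) x)) \<longlonglongrightarrow> 0"
    using w(2) unfolding approximable_iff[OF w(1)] by auto
  have 1: "L2_norm (lebesgue_on A) (\<lambda>x. (v + w) x - (\<phi> n + \<psi> n) x) \<le>
    L2_norm (lebesgue_on A) (\<lambda>x. v x - \<phi> n x) + L2_norm (lebesgue_on A) (\<lambda>x. w x - \<psi> n x)" for n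
    using L2_norm_triangle[of "lebesgue_on A" "\<lambda>x. v x - \<phi> n x" "\<lambda>x. w x - \<psi> n x"]
      L2_diff[OF H1_D(1)[OF v(1)] L2_test[OF t(1)]] L2_diff[OF H1_D(1)[OF w(1)] L2_test[OF t(2)]]
    by (simp add: algebra_simps)
  have 2: "L2_norm (lebesgue_on A) (\<lambda>x. weak_grad A (v + w) x - gradient (\<phi> n + \<psi> n) x) \<le>
    L2_norm (lebesgue_on A) (\<lambda>x. weak_grad A v x - gradient (\<phi> n) x) + L2_norm (lebesgue_on A) (\<lambda>x. weak_grad A w x - gradient (\<psi> n) x)" for n
  proof -
    have "gradient (\<phi> n + \<psi> n) x = gradient (\<phi> n) x + gradient (\<psi> n) x" for x
      unfolding plus_fun_def by (intro gradient_add test_function_C1[OF t(1)] test_function_C1[OF t(2)])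
    then have "L2_norm (lebesgue_on A) (\<lambda>x. weak_grad A (v + w) x - gradient (\<phi> n + \<psi> n) x) =
        L2_norm (lebesgue_on A) (\<lambda>x. (weak_grad A v x - gradient (\<phi> n) x) + (weak_grad A w x - gradient (\<psi> n) x))"
      using H1_add(2)[OF v(1) w(1)]
      by (intro L2_norm_lebesgue_on_cong_AE[OF sets_A]) (elim AE_mp, simp)
    also have "\<dots> \<le> L2_norm (lebesgue_on A) (\<lambda>x. weak_grad A v x - gradient (\<phi> n) x) + L2_norm (lebesgue_on A) (\<lambda>x. weak_grad A w x - gradient (\<psi> n) x)"
      by (intro L2_norm_triangle L2_diff H1_D(3) v(1) w(1) L2_grad_test[OF t(1)] L2_grad_test[OF t(2)])
    finally show ?thesis .
  qed
  have "(\<lambda>n. L2_norm (lebesgue_on A) (\<lambda>x. (v + w) x - (\<phi> n + \<psi> n) x)) \<longlonglongrightarrow> 0"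
    by (rule tendsto_0_le[OF tendsto_add_zero[OF lv(1) lw(1)], where K = 1]) (use 1 in \<open>auto intro: always_eventually\<close>)
  moreover have "(\<lambda>n. L2_norm (lebesgue_on A) (\<lambda>x. weak_grad A (v + w) x - gradient (\<phi> n + \<psi> n) x)) \<longlonglongrightarrow> 0"
    by (rule tendsto_0_le[OF tendsto_add_zero[OF lv(2) lw(2)], where K = 1]) (use 2 in \<open>auto intro: always_eventually\<close>)
  ultimately show ?thesis
    unfolding approximable_iff[OF H1_add(1)[OF v(1) w(1)]] using test_functions_add[OF t] by blast
qed

lemma approximable_scale:
  assumes v: "v \<in> H1 A" "approximable v \<phi>"
  shows "approximable (\<lambda>x. c * v x) (\<lambda>n x. c * \<phi> n x)"
proof -
  have t: "\<phi> n \<in> test_functions A" for n using v by (auto simp: approximable_def)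
  have lv: "(\<lambda>n. L2_norm (lebesgue_on A) (\<lambda>x. v x - \<phi> n x)) \<longlonglongrightarrow> 0"
    "(\<lambda>n. L2_norm (lebesgue_on A) (\<lambda>x. weak_grad A v x - gradient (\<phi> n) x)) \<longlonglongrightarrow> 0"
    using v(2) unfolding approximable_iff[OF v(1)] by auto
  have 1: "L2_norm (lebesgue_on A) (\<lambda>x. c * v x - c * \<phi> n x) = \<bar>c\<bar> * L2_norm (lebesgue_on A) (\<lambda>x. v x - \<phi> n x)" for n
    using L2_norm_scaleR[of "lebesgue_on A" c "\<lambda>x. v x - \<phi> n x"] by (simp add: right_diff_distrib)
  have 2: "L2_norm (lebesgue_on A) (\<lambda>x. weak_grad A (\<lambda>x. c * v x) x - gradient (\<lambda>x. c * \<phi> n x) x) =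
    \<bar>c\<bar> * L2_norm (lebesgue_on A) (\<lambda>x. weak_grad A v x - gradient (\<phi> n) x)" for n
  proof -
    have "L2_norm (lebesgue_on A) (\<lambda>x. weak_grad A (\<lambda>x. c * v x) x - gradient (\<lambda>x. c * \<phi> n x) x) =
        L2_norm (lebesgue_on A) (\<lambda>x. c *\<^sub>R (weak_grad A v x - gradient (\<phi> n) x))"
      using H1_scale(2)[OF v(1), of c]
      by (intro L2_norm_lebesgue_on_cong_AE[OF sets_A])
         (elim AE_mp, simp add: gradient_cmult test_function_C1[OF t] scaleR_diff_right)
    then show ?thesis by (simp add: L2_norm_scaleR)
  qed
  show ?thesis
    unfolding approximable_iff[OF H1_scale(1)[OF v(1)]] 1 2
    using t test_functions_scale tendsto_mult_right_zero[OF lv(1)] tendsto_mult_right_zero[OF lv(2)] by auto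
qed

lemma approximable_zero: "approximable (\<lambda>x. 0) (\<lambda>n x. 0)" and zero_H1: "(\<lambda>x. 0) \<in> H1 A"
proof -
  show z: "(\<lambda>x. 0) \<in> H1 A" by (rule H1_I[OF _ C1_is_weak_grad]) auto
  have "H1_norm A ((\<lambda>x. 0) - (\<lambda>x. 0)) = H1_norm A ((\<lambda>x. 0))" unfolding fun_diff_def by simp
  moreover have "L2_norm (lebesgue_on A) (weak_grad A (\<lambda>x. 0)) = L2_norm (lebesgue_on A) (gradient (\<lambda>x. 0))"
    by (intro L2_norm_lebesgue_on_cong_AE sets_A weak_grad_AE C1_is_weak_grad) auto
  ultimately show "approximable (\<lambda>x. 0) (\<lambda>n x. 0)"
    by (simp add: approximable_def test_functions_zero H1_norm_def) (simp add: L2_norm_def)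
qed

lemma H10_add: "v \<in> H10 A \<Longrightarrow> w \<in> H10 A \<Longrightarrow> v + w \<in> H10 A"
  unfolding H10_iff using H1_add(1) approximable_add by blast

lemma H10_scale: "v \<in> H10 A \<Longrightarrow> (\<lambda>x. c * v x) \<in> H10 A"
  unfolding H10_iff using H1_scale(1) approximable_scale by blast

lemma H10_zero: "(\<lambda>x. 0) \<in> H10 A"
  unfolding H10_iff using zero_H1 approximable_zero by blast

end

section \<open>The trace inequality\<close>

context solid_polytope
begin

lemma L2_continuous:
  fixes f :: "real^'d \<Rightarrow> 'b::euclidean_space"
  shows "continuous_on UNIV f \<Longrightarrow> L2 (lebesgue_on K) f"
  by (intro L2_lebesgue_on_continuous compact_imp_bounded compact lebesgue_sets)

text \<open>The divergence theorem is applied to the field \<open>\<phi>\<^sup>2 (x - x0)\<close>, whose normal component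
  is a positive multiple of \<open>\<phi>\<^sup>2\<close> on every facet because \<open>x0\<close> is an interior point.\<close>

lemma trace_inequality:
  assumes F: "F \<in> faces_of K"
  obtains C where "C \<ge> 0" "\<And>\<phi>. C1 \<phi> \<Longrightarrow> (L2_norm (face_measure F) \<phi>)\<^sup>2 \<le>
    C * ((L2_norm (lebesgue_on K) \<phi>)\<^sup>2 + (L2_norm (lebesgue_on K) (gradient \<phi>))\<^sup>2)"
proof -
  obtain x0 where x0: "x0 \<in> interior K" using interior_nonempty by blast
  obtain R where R: "R \<ge> 0" "\<And>x. x \<in> K \<Longrightarrow> norm (x - x0) \<le> R"
  proof -
    have "bounded ((\<lambda>x. x - x0) ` K)"
      by (intro compact_imp_bounded compact_continuous_image compact continuous_intros)
    then obtain R where "\<And>x. x \<in> K \<Longrightarrow> norm (x - x0) \<le> R" unfolding bounded_iff by auto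
    moreover have "x0 \<in> K" using x0 interior_subset by blast
    ultimately have "R \<ge> 0" by (metis norm_ge_zero order_trans)
    then show ?thesis using that \<open>\<And>x. x \<in> K \<Longrightarrow> norm (x - x0) \<le> R\<close> by blast
  qed
  have h: "facet_dist K G x0 > 0" if "G \<in> faces_of K" for G
    using x0 that interior_iff_facet_dist by blast
  \<comment> \<open>The divergence of \<open>x - x0\<close> contributes \<open>CARD('d)\<close>; the
    Young inequality for the cross term contributes 1 and \<open>R\<^sup>2\<close>. The denominator
    is the constant value of \<open>(x - x0) \<bullet> outer_normal K F\<close> on
    \<open>F\<close>.\<close>
  define C where "C = (real CARD('d) + 1 + R\<^sup>2) / facet_dist K F x0"
  show ?thesis
  proof (rule that[of C])
    show "C \<ge> 0" unfolding C_def using h[OF F] by simp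
    fix \<phi> :: "real^'d \<Rightarrow> real"
    assume \<phi>: "C1 \<phi>"
    have c2: "C1 (\<lambda>x. \<phi> x * \<phi> x)" using \<phi> by auto
    have L\<phi>: "L2 (lebesgue_on K) \<phi>" by (intro L2_continuous C1_continuous \<phi>)
    have Lg: "L2 (lebesgue_on K) (gradient \<phi>)" by (intro L2_continuous C1_continuous_gradient \<phi>)
    have fint: "integrable (face_measure G) f" if G: "G \<in> faces_of K" and f: "C1 f" for G f
    proof -
      interpret g: flat_face G by (rule flat_facet[OF G])
      show ?thesis
        using C1_continuous[OF f] by (intro L2_integrable_finite g.finite_face_measure g.L2_face_measure_continuous)
    qed
    \<comment> \<open>The components of the vector field; each is treated by the divergence theorem
      in its own coordinate direction, and the results are summed.\<close>
    define \<psi> where "\<psi> i x = (\<phi> x * \<phi> x) * (x $ i - x0 $ i)" for i x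
    have c\<psi>: "C1 (\<psi> i)" for i unfolding \<psi>_def by (intro C1_mult \<phi> C1_diff C1_component C1_const)
    have g\<psi>: "gradient (\<psi> i) x \<bullet> axis i 1 = \<phi> x * \<phi> x + 2 * \<phi> x * (gradient \<phi> x $ i * (x $ i - x0 $ i))" for i x
    proof -
      have "gradient (\<lambda>x. x $ i - x0 $ i) x = axis i 1"
        by (simp add: gradient_diff[OF C1_component C1_const] gradient_component)
      then have "gradient (\<psi> i) x = (\<phi> x * \<phi> x) *\<^sub>R axis i 1 + (x $ i - x0 $ i) *\<^sub>R (\<phi> x *\<^sub>R gradient \<phi> x + \<phi> x *\<^sub>R gradient \<phi> x)"
        unfolding \<psi>_def by (subst gradient_mult[OF c2]) (auto simp: gradient_mult[OF \<phi> \<phi>])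
      show ?thesis unfolding \<open>gradient (\<psi> i) x = _\<close> by (simp add: inner_add_left inner_axis algebra_simps)
    qed
    have div: "(\<integral>x. gradient (\<psi> i) x \<bullet> axis i 1 \<partial>lebesgue_on K) =
        (\<Sum>G\<in>faces_of K. (outer_normal K G \<bullet> axis i 1) * (\<integral>x. \<psi> i x \<partial>face_measure G))" for i
      by (rule divergence_theorem[OF c\<psi>]) simp
    have rhs: "(\<Sum>i\<in>UNIV. \<Sum>G\<in>faces_of K. (outer_normal K G \<bullet> axis i 1) * (\<integral>x. \<psi> i x \<partial>face_measure G)) =
        (\<Sum>G\<in>faces_of K. facet_dist K G x0 * (L2_norm (face_measure G) \<phi>)\<^sup>2)"
    proof (subst sum.swap, rule sum.cong[OF refl])
      fix G assume G: "G \<in> faces_of K"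
      interpret g: flat_face G by (rule flat_facet[OF G])
      have "(\<Sum>i\<in>UNIV. (outer_normal K G \<bullet> axis i 1) * (\<integral>x. \<psi> i x \<partial>face_measure G)) =
          (\<integral>x. (\<Sum>i\<in>UNIV. (outer_normal K G \<bullet> axis i 1) * \<psi> i x) \<partial>face_measure G)"
        using fint[OF G c\<psi>] by (simp add: Bochner_Integration.integral_sum)
      also have "\<dots> = (\<integral>x. facet_dist K G x0 * (norm (\<phi> x))\<^sup>2 \<partial>face_measure G)"
      proof (rule Bochner_Integration.integral_cong[OF refl])
        fix x assume "x \<in> space (face_measure G)"
        then have "facet_dist K G x = 0" using facet_normal(2)[OF G] by (simp add: g.space_face_measure) blast
        then have "(x - x0) \<bullet> outer_normal K G = facet_dist K G x0"
          by (simp add: facet_dist_def inner_diff_left)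
        moreover have "(\<Sum>i\<in>UNIV. (outer_normal K G \<bullet> axis i 1) * \<psi> i x) = (\<phi> x * \<phi> x) * ((x - x0) \<bullet> outer_normal K G)"
          unfolding inner_vec_def[of "x - x0"] \<psi>_def sum_distrib_left by (intro sum.cong) (auto simp: inner_axis)
        ultimately show "(\<Sum>i\<in>UNIV. (outer_normal K G \<bullet> axis i 1) * \<psi> i x) = facet_dist K G x0 * (norm (\<phi> x))\<^sup>2"
          by (simp add: power2_eq_square)
      qed
      finally show "(\<Sum>i\<in>UNIV. (outer_normal K G \<bullet> axis i 1) * (\<integral>x. \<psi> i x \<partial>face_measure G)) =
          facet_dist K G x0 * (L2_norm (face_measure G) \<phi>)\<^sup>2" by (simp add: L2_norm_sq)
    qed
    have gi: "integrable (lebesgue_on K) (\<lambda>x. gradient (\<psi> i) x \<bullet> axis i 1)" for i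
      by (intro L2_integrable_finite[OF finite_measure_lebesgue_on_bounded] L2_inner_const L2_continuous
          C1_continuous_gradient c\<psi> compact_imp_bounded compact lebesgue_sets)
    have "(\<Sum>i\<in>UNIV. \<integral>x. gradient (\<psi> i) x \<bullet> axis i 1 \<partial>lebesgue_on K) =
        (\<integral>x. (\<Sum>i\<in>UNIV. gradient (\<psi> i) x \<bullet> axis i 1) \<partial>lebesgue_on K)"
      using gi by (simp add: Bochner_Integration.integral_sum)
    also have "\<dots> \<le> (\<integral>x. (real CARD('d) + 1 + R\<^sup>2) * ((norm (\<phi> x))\<^sup>2 + (norm (gradient \<phi> x))\<^sup>2) \<partial>lebesgue_on K)"
    proof (rule integral_mono)
      show "integrable (lebesgue_on K) (\<lambda>x. \<Sum>i\<in>UNIV. gradient (\<psi> i) x \<bullet> axis i 1)" using gi by auto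
      show "integrable (lebesgue_on K) (\<lambda>x. (real CARD('d) + 1 + R\<^sup>2) * ((norm (\<phi> x))\<^sup>2 + (norm (gradient \<phi> x))\<^sup>2))"
        using L2_integrable_sq[OF L\<phi>] L2_integrable_sq[OF Lg] by auto
      fix x assume "x \<in> space (lebesgue_on K)"
      then have xK: "x \<in> K" by simp
      have "(\<Sum>i\<in>UNIV. gradient (\<psi> i) x \<bullet> axis i 1) = real CARD('d) * (\<phi> x)\<^sup>2 + 2 * \<phi> x * (gradient \<phi> x \<bullet> (x - x0))"
        unfolding g\<psi> by (simp add: sum.distrib sum_distrib_left[symmetric] inner_vec_def power2_eq_square)
      also have "2 * \<phi> x * (gradient \<phi> x \<bullet> (x - x0)) \<le> (\<phi> x)\<^sup>2 + (gradient \<phi> x \<bullet> (x - x0))\<^sup>2"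
        by (rule sum_squares_bound)
      also have "(gradient \<phi> x \<bullet> (x - x0))\<^sup>2 \<le> (norm (gradient \<phi> x) * R)\<^sup>2"
      proof (rule power2_le_iff_abs_le[THEN iffD2])
        have "\<bar>gradient \<phi> x \<bullet> (x - x0)\<bar> \<le> norm (gradient \<phi> x) * norm (x - x0)" by (rule Cauchy_Schwarz_ineq2)
        also have "\<dots> \<le> norm (gradient \<phi> x) * R" using R(2)[OF xK] by (intro mult_left_mono) auto
        finally show "\<bar>gradient \<phi> x \<bullet> (x - x0)\<bar> \<le> norm (gradient \<phi> x) * R" .
      qed (use R(1) in simp)
      finally have "(\<Sum>i\<in>UNIV. gradient (\<psi> i) x \<bullet> axis i 1) \<le> (real CARD('d) + 1) * (\<phi> x)\<^sup>2 + R\<^sup>2 * (norm (gradient \<phi> x))\<^sup>2"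
        by (simp add: algebra_simps)
      also have "\<dots> \<le> (real CARD('d) + 1) * (\<phi> x)\<^sup>2 + R\<^sup>2 * (norm (gradient \<phi> x))\<^sup>2 + (R\<^sup>2 * (\<phi> x)\<^sup>2 + (real CARD('d) + 1) * (norm (gradient \<phi> x))\<^sup>2)"
        by simp
      also have "\<dots> = (real CARD('d) + 1 + R\<^sup>2) * ((norm (\<phi> x))\<^sup>2 + (norm (gradient \<phi> x))\<^sup>2)"
        by (simp add: algebra_simps)
      finally show "(\<Sum>i\<in>UNIV. gradient (\<psi> i) x \<bullet> axis i 1) \<le> (real CARD('d) + 1 + R\<^sup>2) * ((norm (\<phi> x))\<^sup>2 + (norm (gradient \<phi> x))\<^sup>2)" .
    qed
    also have "\<dots> = (real CARD('d) + 1 + R\<^sup>2) * ((L2_norm (lebesgue_on K) \<phi>)\<^sup>2 + (L2_norm (lebesgue_on K) (gradient \<phi>))\<^sup>2)"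
      using L2_integrable_sq[OF L\<phi>] L2_integrable_sq[OF Lg] by (simp add: L2_norm_sq)
    finally have "(\<Sum>G\<in>faces_of K. facet_dist K G x0 * (L2_norm (face_measure G) \<phi>)\<^sup>2) \<le>
        (real CARD('d) + 1 + R\<^sup>2) * ((L2_norm (lebesgue_on K) \<phi>)\<^sup>2 + (L2_norm (lebesgue_on K) (gradient \<phi>))\<^sup>2)"
      unfolding div rhs .
    moreover have "facet_dist K F x0 * (L2_norm (face_measure F) \<phi>)\<^sup>2 \<le>
        (\<Sum>G\<in>faces_of K. facet_dist K G x0 * (L2_norm (face_measure G) \<phi>)\<^sup>2)"
      using finite_faces h by (intro member_le_sum F) (auto simp: less_imp_le)
    ultimately have "facet_dist K F x0 * (L2_norm (face_measure F) \<phi>)\<^sup>2 \<le>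
        (real CARD('d) + 1 + R\<^sup>2) * ((L2_norm (lebesgue_on K) \<phi>)\<^sup>2 + (L2_norm (lebesgue_on K) (gradient \<phi>))\<^sup>2)"
      by (rule order_trans[rotated])
    then show "(L2_norm (face_measure F) \<phi>)\<^sup>2 \<le> C * ((L2_norm (lebesgue_on K) \<phi>)\<^sup>2 + (L2_norm (lebesgue_on K) (gradient \<phi>))\<^sup>2)"
      unfolding C_def using h[OF F] by (simp add: field_simps)
  qed
qed

end

section \<open>Traces on the skeleton\<close>

text \<open>Completeness with a geometric rate. On a finite measure space the increments are also
  summable in the mean, so the sequence converges almost everywhere, and the Fatou lemma bounds the
  distance to the limit. The limit is the pointwise \<open>lim\<close>, which does not mention
  \<open>N\<close>, so one function can serve for several measures at once.\<close>

lemma L2_fast_limit: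
  fixes f :: "nat \<Rightarrow> 'a \<Rightarrow> real"
  assumes N: "finite_measure N" and f: "\<And>n. L2 N (f n)"
    and fast: "\<And>n. L2_norm N (\<lambda>x. f (Suc n) x - f n x) \<le> C * (1 / 2) ^ n"
  shows "L2 N (\<lambda>x. lim (\<lambda>n. f n x))"
    and "(\<lambda>n. L2_norm N (\<lambda>x. lim (\<lambda>k. f k x) - f n x)) \<longlonglongrightarrow> 0"
proof -
  interpret finite_measure N by (rule N)
  note [measurable] = f[THEN L2_measurable]
  define g where "g x = lim (\<lambda>n. f n x)" for x
  have gm [measurable]: "g \<in> borel_measurable N" unfolding g_def by measurable
  have C0: "0 \<le> C" using order_trans[OF L2_norm_nonneg fast[of 0]] by simp
  define c where "c = L2_norm N (\<lambda>x. 1 :: real)"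
  define d where "d n x = \<bar>f (Suc n) x - f n x\<bar>" for n x
  have Ld: "L2 N (d n)" for n
  proof -
    have "d n \<in> borel_measurable N" unfolding d_def by measurable
    then show ?thesis using L2_diff[OF f[of "Suc n"] f[of n]] by (simp add: L2_def d_def)
  qed
  have d1: "(\<integral>\<^sup>+x. ennreal (d n x) \<partial>N) \<le> ennreal (c * C * (1 / 2) ^ n)" for n
  proof -
    have "(\<integral>x. d n x \<partial>N) \<le> L2_norm N (d n) * c"
      using L2_Cauchy_Schwarz[OF Ld[of n], of "\<lambda>x. 1"] by (simp add: c_def L2_def)
    also have "L2_norm N (d n) = L2_norm N (\<lambda>x. f (Suc n) x - f n x)" by (simp add: L2_norm_def d_def)
    also have "\<dots> * c \<le> C * (1 / 2) ^ n * c" using fast by (intro mult_right_mono) (auto simp: c_def)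
    finally have "(\<integral>x. d n x \<partial>N) \<le> c * C * (1 / 2) ^ n" by (simp add: mult_ac)
    moreover have "(\<integral>\<^sup>+x. ennreal (d n x) \<partial>N) = ennreal (\<integral>x. d n x \<partial>N)"
      by (intro nn_integral_eq_integral L2_integrable_finite[OF N Ld]) (simp add: d_def)
    ultimately show ?thesis by (simp add: ennreal_leI)
  qed
  have "(\<integral>\<^sup>+x. (\<Sum>n. ennreal (d n x)) \<partial>N) = (\<Sum>n. \<integral>\<^sup>+x. ennreal (d n x) \<partial>N)"
    by (intro nn_integral_suminf) (simp add: d_def)
  also have "\<dots> \<le> (\<Sum>n. ennreal (c * C * (1 / 2) ^ n))"
    by (intro suminf_le d1) auto
  also have "\<dots> < \<infinity>"
  proof -
    have "summable (\<lambda>n. c * C * (1 / 2 :: real) ^ n)" by (intro summable_mult summable_geometric) simp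
    then show ?thesis using C0 by (subst suminf_ennreal2) (auto simp: c_def)
  qed
  finally have "(\<integral>\<^sup>+x. (\<Sum>n. ennreal (d n x)) \<partial>N) \<noteq> \<infinity>" by simp
  then have "AE x in N. (\<Sum>n. ennreal (d n x)) \<noteq> \<infinity>"
    by (intro nn_integral_PInf_AE) (auto simp: d_def)
  then have conv: "AE x in N. (\<lambda>n. f n x) \<longlonglongrightarrow> g x"
  proof eventually_elim
    case (elim x)
    have "summable (\<lambda>n. d n x)"
      by (rule summable_suminf_not_top) (use elim in \<open>auto simp: d_def\<close>)
    then have "summable (\<lambda>n. f (Suc n) x - f n x)" unfolding d_def by (rule summable_rabs_cancel)
    then have "convergent (\<lambda>n. \<Sum>k<n. f (Suc k) x - f k x)" by (simp add: summable_iff_convergent)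
    moreover have "(\<Sum>k<n. f (Suc k) x - f k x) = f n x - f 0 x" for n by (rule sum_lessThan_telescope)
    ultimately have "convergent (\<lambda>n. f n x - f 0 x)" by simp
    then have "convergent (\<lambda>n. f n x)" using convergent_add[OF _ convergent_const, of "\<lambda>n. f n x - f 0 x" "f 0 x"] by simp
    then show ?case unfolding g_def by (simp add: convergent_LIMSEQ_iff)
  qed
  \<comment> \<open>The sharper bound with the factor \<open>1 - (1 / 2) ^ k\<close> is the exact
    geometric sum and lets the induction close.\<close>
  have far: "L2_norm N (\<lambda>x. f (n + k) x - f n x) \<le> 2 * C * (1 / 2) ^ n" for n k
  proof -
    have "L2_norm N (\<lambda>x. f (n + k) x - f n x) \<le> 2 * C * (1 / 2) ^ n * (1 - (1 / 2) ^ k)"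
    proof (induction k)
      case 0
      then show ?case by (simp add: L2_norm_def)
    next
      case (Suc k)
      have "L2_norm N (\<lambda>x. f (n + Suc k) x - f n x) \<le>
          L2_norm N (\<lambda>x. f (Suc (n + k)) x - f (n + k) x) + L2_norm N (\<lambda>x. f (n + k) x - f n x)"
        using L2_norm_triangle_diff[OF f[of "Suc (n + k)"] f[of "n + k"] f[of n]] by simp
      also have "\<dots> \<le> C * (1 / 2) ^ (n + k) + 2 * C * (1 / 2) ^ n * (1 - (1 / 2) ^ k)"
        by (intro add_mono fast Suc)
      also have "\<dots> = 2 * C * (1 / 2) ^ n * (1 - (1 / 2) ^ Suc k)"
        by (simp add: power_add algebra_simps)
      finally show ?case .
    qed
    also have "\<dots> \<le> 2 * C * (1 / 2) ^ n * 1" using C0 by (intro mult_left_mono) auto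
    finally show ?thesis by simp
  qed
  have lim: "L2 N (\<lambda>x. g x - f n x) \<and> L2_norm N (\<lambda>x. g x - f n x) \<le> 2 * C * (1 / 2) ^ n" for n
  proof -
    let ?b = "2 * C * (1 / 2) ^ n"
    have b0: "0 \<le> ?b" using C0 by simp
    have "(\<integral>\<^sup>+x. ennreal ((norm (g x - f n x))\<^sup>2) \<partial>N) = (\<integral>\<^sup>+x. liminf (\<lambda>k. ennreal ((norm (f (n + k) x - f n x))\<^sup>2)) \<partial>N)"
    proof (rule nn_integral_cong_AE, use conv in eventually_elim)
      case (elim x)
      have "(\<lambda>k. f (n + k) x) \<longlonglongrightarrow> g x" using LIMSEQ_ignore_initial_segment[OF elim, of n] by (simp add: add.commute)
      then have "(\<lambda>k. ennreal ((norm (f (n + k) x - f n x))\<^sup>2)) \<longlonglongrightarrow> ennreal ((norm (g x - f n x))\<^sup>2)"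
        by (intro tendsto_intros tendsto_ennrealI)
      then show ?case using lim_imp_Liminf[OF sequentially_bot] by metis
    qed
    also have "\<dots> \<le> liminf (\<lambda>k. \<integral>\<^sup>+x. ennreal ((norm (f (n + k) x - f n x))\<^sup>2) \<partial>N)"
      by (rule nn_integral_liminf) measurable
    also have "\<dots> \<le> liminf (\<lambda>k::nat. ennreal (?b\<^sup>2))"
    proof (intro Liminf_mono always_eventually allI)
      fix k
      have "(\<integral>\<^sup>+x. ennreal ((norm (f (n + k) x - f n x))\<^sup>2) \<partial>N) = ennreal (\<integral>x. (norm (f (n + k) x - f n x))\<^sup>2 \<partial>N)"
        by (intro nn_integral_eq_integral L2_integrable_sq L2_diff f) simp
      also have "\<dots> = ennreal ((L2_norm N (\<lambda>x. f (n + k) x - f n x))\<^sup>2)" by (simp add: L2_norm_sq)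
      also have "\<dots> \<le> ennreal (?b\<^sup>2)" by (intro ennreal_leI power_mono far) simp
      finally show "(\<integral>\<^sup>+x. ennreal ((norm (f (n + k) x - f n x))\<^sup>2) \<partial>N) \<le> ennreal (?b\<^sup>2)" .
    qed
    finally have nn: "(\<integral>\<^sup>+x. ennreal ((norm (g x - f n x))\<^sup>2) \<partial>N) \<le> ennreal (?b\<^sup>2)" by (simp add: Liminf_const)
    have i: "integrable N (\<lambda>x. (norm (g x - f n x))\<^sup>2)"
    proof (rule integrableI_bounded)
      show "(\<integral>\<^sup>+x. ennreal (norm ((norm (g x - f n x))\<^sup>2)) \<partial>N) < \<infinity>"
        using le_less_trans[OF nn ennreal_less_top] by simp
    qed measurable
    then have L: "L2 N (\<lambda>x. g x - f n x)" by (simp add: L2_def)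
    have "ennreal (\<integral>x. (norm (g x - f n x))\<^sup>2 \<partial>N) \<le> ennreal (?b\<^sup>2)"
      using nn nn_integral_eq_integral[OF i] by simp
    then have "(L2_norm N (\<lambda>x. g x - f n x))\<^sup>2 \<le> ?b\<^sup>2" by (simp add: L2_norm_sq)
    then have "L2_norm N (\<lambda>x. g x - f n x) \<le> ?b" using b0 by (rule power2_le_imp_le)
    with L show ?thesis by simp
  qed
  show "L2 N (\<lambda>x. lim (\<lambda>n. f n x))"
    using L2_add[OF conjunct1[OF lim[of 0]] f[of 0]] by (simp add: g_def)
  have "(\<lambda>n. 2 * C * (1 / 2 :: real) ^ n) \<longlonglongrightarrow> 0"
    by (intro tendsto_mult_right_zero LIMSEQ_power_zero) simp
  then show "(\<lambda>n. L2_norm N (\<lambda>x. lim (\<lambda>k. f k x) - f n x)) \<longlonglongrightarrow> 0"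
  proof (rule tendsto_sandwich[OF _ _ tendsto_const, rotated 2])
    show "\<forall>\<^sub>F n in sequentially. L2_norm N (\<lambda>x. lim (\<lambda>k. f k x) - f n x) \<le> 2 * C * (1 / 2) ^ n"
      using lim by (simp add: g_def)
  qed simp
qed

text \<open>Collects what the later arguments use of a mesh. \<open>faces_in\<close> carries the
  matching property: no facet of an element is left hanging, so traces are available on all of
  them.\<close>

locale polytopal_mesh = bounded_open \<Omega> for \<Omega> :: "(real^'d) set" +
  fixes M :: "(real^'d) set set"
  assumes finite_M: "finite M" and solid: "K \<in> M \<Longrightarrow> solid_polytope K"
    and interior_in: "K \<in> M \<Longrightarrow> interior K \<subseteq> \<Omega>"
    and disjoint: "K1 \<in> M \<Longrightarrow> K2 \<in> M \<Longrightarrow> K1 \<noteq> K2 \<Longrightarrow> interior K1 \<inter> interior K2 = {}"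
    and cover: "\<Omega> \<subseteq> \<Union>M"
    and faces_in: "K \<in> M \<Longrightarrow> faces_of K \<subseteq> mesh_faces \<Omega> M"
begin

lemma mesh_face_cases:
  assumes "F \<in> mesh_faces \<Omega> M"
  obtains K where "K \<in> M" "F \<in> faces_of K"
  using assms unfolding mesh_faces_def interfaces_def boundary_faces_def by blast

lemma mesh_face_flat: "F \<in> mesh_faces \<Omega> M \<Longrightarrow> flat_face F"
  using mesh_face_cases solid_polytope.flat_facet solid by metis

lemma finite_mesh_faces: "finite (mesh_faces \<Omega> M)"
proof (rule finite_subset)
  show "mesh_faces \<Omega> M \<subseteq> (\<Union>K\<in>M. faces_of K)" using mesh_face_cases by blast
  show "finite (\<Union>K\<in>M. faces_of K)"
    using finite_M solid_polytope.finite_faces[OF solid] by blast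
qed

lemma K_lebesgue [simp]: "K \<in> M \<Longrightarrow> K \<in> sets lebesgue"
  using solid_polytope.lebesgue_sets[OF solid] .

lemma interior_lebesgue [simp]: "interior K \<in> sets lebesgue"
  by (simp add: borel_open)

lemma negligible_K_interior: "K \<in> M \<Longrightarrow> negligible (sym_diff (interior K) K)"
  using solid_polytope.negligible_boundary[OF solid] interior_subset[of K]
  by (metis Diff_eq_empty_iff Un_empty_left)

lemma AE_on_K:
  assumes "K \<in> M" "AE x in lebesgue_on (interior K). P x"
  shows "AE x in lebesgue_on K. P x"
proof -
  have "AE x in lebesgue. x \<notin> K - interior K"
    using solid_polytope.negligible_boundary[OF solid[OF assms(1)]] unfolding negligible_iff_null_sets by (rule AE_not_in)
  moreover have "AE x in lebesgue. x \<in> interior K \<longrightarrow> P x" using assms(2) by (simp add: AE_restrict_space_iff)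
  ultimately have "AE x in lebesgue. x \<in> K \<longrightarrow> P x" by eventually_elim auto
  then show ?thesis using assms(1) by (simp add: AE_restrict_space_iff)
qed

lemma AE_\<Omega>_on_K:
  assumes "K \<in> M" "AE x in lebesgue_on \<Omega>. P x"
  shows "AE x in lebesgue_on K. P x"
  by (rule AE_on_K[OF assms(1) AE_lebesgue_on_mono[OF _ sets_A interior_in[OF assms(1)] assms(2)]]) simp

lemma AE_on_\<Omega>:
  assumes "\<And>K. K \<in> M \<Longrightarrow> AE x in lebesgue_on (interior K). P x"
  shows "AE x in lebesgue_on \<Omega>. P x"
proof -
  have "AE x in lebesgue. \<forall>K\<in>M. x \<in> K \<longrightarrow> P x"
    using AE_on_K[OF _ assms] finite_M by (intro AE_finite_allI) (auto simp: AE_restrict_space_iff)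
  then have "AE x in lebesgue. x \<in> \<Omega> \<longrightarrow> P x"
    by eventually_elim (use cover in blast)
  then show ?thesis by (simp add: AE_restrict_space_iff)
qed

lemma L2_on_K:
  assumes "K \<in> M" "L2 (lebesgue_on \<Omega>) f"
  shows "L2 (lebesgue_on K) f" "L2_norm (lebesgue_on K) f \<le> L2_norm (lebesgue_on \<Omega>) f"
proof -
  have 1: "L2 (lebesgue_on (interior K)) f"
    by (rule L2_lebesgue_on_subset[OF _ sets_A interior_in[OF assms(1)] assms(2)]) simp
  have 2: "L2_norm (lebesgue_on (interior K)) f \<le> L2_norm (lebesgue_on \<Omega>) f"
    by (rule L2_norm_lebesgue_on_subset[OF _ sets_A interior_in[OF assms(1)] assms(2)]) simp
  note 3 = L2_lebesgue_on_cong_set[OF interior_lebesgue K_lebesgue[OF assms(1)] negligible_K_interior[OF assms(1)] 1]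
  show "L2 (lebesgue_on K) f" by (rule 3)
  show "L2_norm (lebesgue_on K) f \<le> L2_norm (lebesgue_on \<Omega>) f" using 2 3(2) by simp
qed

lemma integral_split:
  fixes f :: "real^'d \<Rightarrow> real"
  assumes f: "integrable (lebesgue_on \<Omega>) f"
  shows "(\<integral>x. f x \<partial>lebesgue_on \<Omega>) = (\<Sum>K\<in>M. \<integral>x. f x \<partial>lebesgue_on K)"
proof -
  have i: "integrable lebesgue (\<lambda>x. indicator (interior K) x *\<^sub>R f x)" if "K \<in> M" for K
    using integrable_lebesgue_on_subset[OF _ sets_A interior_in[OF that] f] by (simp add: integrable_restrict_space)
  have "(\<Sum>K\<in>M. \<integral>x. f x \<partial>lebesgue_on K) = (\<Sum>K\<in>M. \<integral>x. f x \<partial>lebesgue_on (interior K))"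
    by (intro sum.cong refl integral_lebesgue_on_cong_set[symmetric] negligible_K_interior) auto
  also have "\<dots> = (\<Sum>K\<in>M. \<integral>x. indicator (interior K) x *\<^sub>R f x \<partial>lebesgue)"
    by (simp add: integral_restrict_space)
  also have "\<dots> = (\<integral>x. (\<Sum>K\<in>M. indicator (interior K) x *\<^sub>R f x) \<partial>lebesgue)"
    using i by (intro Bochner_Integration.integral_sum[symmetric])
  also have "\<dots> = (\<integral>x. indicator \<Omega> x *\<^sub>R f x \<partial>lebesgue)"
  proof (rule integral_cong_AE)
    have "AE x in lebesgue_on \<Omega>. \<exists>K\<in>M. x \<in> interior K"
      by (rule AE_on_\<Omega>) (auto simp: AE_restrict_space_iff)
    then have "AE x in lebesgue. x \<in> \<Omega> \<longrightarrow> (\<exists>K\<in>M. x \<in> interior K)"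
      by (simp add: AE_restrict_space_iff)
    then show "AE x in lebesgue. (\<Sum>K\<in>M. indicator (interior K) x *\<^sub>R f x) = indicator \<Omega> x *\<^sub>R f x"
    proof eventually_elim
      case (elim x)
      show ?case
      proof (cases "x \<in> \<Omega>")
        case True
        then obtain K where K: "K \<in> M" "x \<in> interior K" using elim by blast
        have "(\<Sum>L\<in>M. indicator (interior L) x *\<^sub>R f x) = (\<Sum>L\<in>M. if L = K then f x else 0)"
          using K disjoint by (intro sum.cong) (auto simp: indicator_def)
        then show ?thesis using K True finite_M by simp
      next
        case False
        then show ?thesis using interior_in by (intro trans[OF sum.neutral]) (auto simp: indicator_def)
      qed
    qed
    show "(\<lambda>x. \<Sum>K\<in>M. indicator (interior K) x *\<^sub>R f x) \<in> borel_measurable lebesgue"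
      using i by (intro borel_measurable_sum) auto
    have "integrable lebesgue (\<lambda>x. indicator \<Omega> x *\<^sub>R f x)" using f by (simp add: integrable_restrict_space)
    then show "(\<lambda>x. indicator \<Omega> x *\<^sub>R f x) \<in> borel_measurable lebesgue" by auto
  qed
  finally show ?thesis by (simp add: integral_restrict_space)
qed

lemma L2_C1: "C1 \<phi> \<Longrightarrow> L2 (lebesgue_on \<Omega>) \<phi>"
  and L2_grad_C1: "C1 \<phi> \<Longrightarrow> L2 (lebesgue_on \<Omega>) (gradient \<phi>)"
  by (auto intro!: L2_lebesgue_on_continuous bounded_A C1_continuous C1_continuous_gradient)

lemma L2_face_C1:
  assumes "F \<in> mesh_faces \<Omega> M" "C1 \<phi>"
  shows "L2 (face_measure F) \<phi>"
  using flat_face.L2_face_measure_continuous[OF mesh_face_flat[OF assms(1)]] C1_continuous[OF assms(2)] .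

lemma mesh_trace_inequality:
  assumes "F \<in> mesh_faces \<Omega> M"
  obtains C where "C \<ge> 0" "\<And>\<phi>. C1 \<phi> \<Longrightarrow> L2_norm (face_measure F) \<phi> \<le>
    C * (L2_norm (lebesgue_on \<Omega>) \<phi> + L2_norm (lebesgue_on \<Omega>) (gradient \<phi>))"
proof -
  obtain K where K: "K \<in> M" "F \<in> faces_of K" using mesh_face_cases[OF assms] .
  interpret k: solid_polytope K by (rule solid[OF K(1)])
  obtain C where C: "C \<ge> 0" "\<And>\<phi>. C1 \<phi> \<Longrightarrow> (L2_norm (face_measure F) \<phi>)\<^sup>2 \<le>
    C * ((L2_norm (lebesgue_on K) \<phi>)\<^sup>2 + (L2_norm (lebesgue_on K) (gradient \<phi>))\<^sup>2)"
    using k.trace_inequality[OF K(2)] by blast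
  show ?thesis
  proof (rule that[of "sqrt C"])
    fix \<phi> :: "real^'d \<Rightarrow> real" assume \<phi>: "C1 \<phi>"
    let ?a = "L2_norm (lebesgue_on K) \<phi>" and ?b = "L2_norm (lebesgue_on K) (gradient \<phi>)"
    have "?a\<^sup>2 + ?b\<^sup>2 \<le> (?a + ?b)\<^sup>2" by (simp add: power2_sum)
    then have "C * (?a\<^sup>2 + ?b\<^sup>2) \<le> C * (?a + ?b)\<^sup>2" using C(1) by (rule mult_left_mono)
    also have "\<dots> = (sqrt C * (?a + ?b))\<^sup>2" using C(1) by (simp add: power_mult_distrib)
    finally have "(L2_norm (face_measure F) \<phi>)\<^sup>2 \<le> (sqrt C * (?a + ?b))\<^sup>2" using C(2)[OF \<phi>] by linarith
    then have "L2_norm (face_measure F) \<phi> \<le> sqrt C * (?a + ?b)"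
      by (rule power2_le_imp_le) (use C(1) in auto)
    also have "\<dots> \<le> sqrt C * (L2_norm (lebesgue_on \<Omega>) \<phi> + L2_norm (lebesgue_on \<Omega>) (gradient \<phi>))"
      using C(1) L2_on_K(2)[OF K(1) L2_C1[OF \<phi>]] L2_on_K(2)[OF K(1) L2_grad_C1[OF \<phi>]]
      by (intro mult_left_mono add_mono) auto
    finally show "L2_norm (face_measure F) \<phi> \<le> sqrt C * (L2_norm (lebesgue_on \<Omega>) \<phi> + L2_norm (lebesgue_on \<Omega>) (gradient \<phi>))" .
  qed (use C(1) in simp)
qed

lemma is_trace_iff: "is_trace \<Omega> M v g \<longleftrightarrow> (\<forall>F\<in>mesh_faces \<Omega> M. L2 (face_measure F) g) \<and>
  (\<exists>\<phi>. approximable v \<phi> \<and>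
    (\<forall>F\<in>mesh_faces \<Omega> M. (\<lambda>n. L2_norm (face_measure F) (\<lambda>x. g x - \<phi> n x)) \<longlonglongrightarrow> 0))"
  unfolding is_trace_def approximable_def fun_diff_def by blast

text \<open>The triangle inequality through the common function, leaving only approximation errors
  on the right. With a single function it yields the Cauchy property of face values; with two it
  compares their approximating sequences.\<close>

lemma diff_norms:
  assumes v: "v \<in> H1 \<Omega>" and w: "w \<in> H1 \<Omega>" and eq: "AE x in lebesgue_on \<Omega>. v x = w x"
    and \<phi>: "\<phi> \<in> test_functions \<Omega>" and \<psi>: "\<psi> \<in> test_functions \<Omega>"
  shows "L2_norm (lebesgue_on \<Omega>) (\<lambda>x. \<phi> x - \<psi> x) + L2_norm (lebesgue_on \<Omega>) (gradient (\<lambda>x. \<phi> x - \<psi> x)) \<le>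
    (L2_norm (lebesgue_on \<Omega>) (\<lambda>x. v x - \<phi> x) + L2_norm (lebesgue_on \<Omega>) (\<lambda>x. weak_grad \<Omega> v x - gradient \<phi> x)) +
    (L2_norm (lebesgue_on \<Omega>) (\<lambda>x. w x - \<psi> x) + L2_norm (lebesgue_on \<Omega>) (\<lambda>x. weak_grad \<Omega> w x - gradient \<psi> x))"
proof -
  have "L2_norm (lebesgue_on \<Omega>) (\<lambda>x. \<phi> x - \<psi> x) \<le>
      L2_norm (lebesgue_on \<Omega>) (\<lambda>x. \<phi> x - v x) + L2_norm (lebesgue_on \<Omega>) (\<lambda>x. v x - \<psi> x)"
    by (intro L2_norm_triangle_diff L2_test[OF \<phi>] L2_test[OF \<psi>] H1_D(1)[OF v])
  also have "L2_norm (lebesgue_on \<Omega>) (\<lambda>x. v x - \<psi> x) = L2_norm (lebesgue_on \<Omega>) (\<lambda>x. w x - \<psi> x)"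
    using eq by (intro L2_norm_lebesgue_on_cong_AE[OF sets_A]) (elim AE_mp, simp)
  finally have 1: "L2_norm (lebesgue_on \<Omega>) (\<lambda>x. \<phi> x - \<psi> x) \<le>
      L2_norm (lebesgue_on \<Omega>) (\<lambda>x. v x - \<phi> x) + L2_norm (lebesgue_on \<Omega>) (\<lambda>x. w x - \<psi> x)"
    by (simp add: L2_norm_diff_commute[of _ \<phi>])
  have gw: "is_weak_grad \<Omega> w (weak_grad \<Omega> v)"
    by (rule is_weak_grad_cong[OF H1_D(1)[OF v] eq H1_D(2)[OF v]])
  note ae = weak_grad_AE[OF H1_D(1)[OF w] gw]
  have g: "gradient (\<lambda>x. \<phi> x - \<psi> x) x = gradient \<phi> x - gradient \<psi> x" for x
    by (intro gradient_diff test_function_C1[OF \<phi>] test_function_C1[OF \<psi>])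
  have "L2_norm (lebesgue_on \<Omega>) (\<lambda>x. gradient \<phi> x - gradient \<psi> x) \<le>
      L2_norm (lebesgue_on \<Omega>) (\<lambda>x. gradient \<phi> x - weak_grad \<Omega> v x) + L2_norm (lebesgue_on \<Omega>) (\<lambda>x. weak_grad \<Omega> v x - gradient \<psi> x)"
    by (intro L2_norm_triangle_diff L2_grad_test[OF \<phi>] L2_grad_test[OF \<psi>] H1_D(3)[OF v])
  also have "L2_norm (lebesgue_on \<Omega>) (\<lambda>x. weak_grad \<Omega> v x - gradient \<psi> x) = L2_norm (lebesgue_on \<Omega>) (\<lambda>x. weak_grad \<Omega> w x - gradient \<psi> x)"
    using ae by (intro L2_norm_lebesgue_on_cong_AE[OF sets_A]) (elim AE_mp, simp)
  finally have "L2_norm (lebesgue_on \<Omega>) (gradient (\<lambda>x. \<phi> x - \<psi> x)) \<le>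
      L2_norm (lebesgue_on \<Omega>) (\<lambda>x. weak_grad \<Omega> v x - gradient \<phi> x) + L2_norm (lebesgue_on \<Omega>) (\<lambda>x. weak_grad \<Omega> w x - gradient \<psi> x)"
    by (simp add: g[abs_def] L2_norm_diff_commute[of _ "gradient \<phi>"])
  with 1 show ?thesis by linarith
qed

text \<open>A subsequence with errors below powers of 1/2 is selected. The trace inequality carries
  the geometric rate over to every face, where \<open>L2_fast_limit\<close> applies.\<close>

lemma trace_exists:
  assumes v: "v \<in> H10 \<Omega>"
  shows "\<exists>g. is_trace \<Omega> M v g"
proof -
  have v1: "v \<in> H1 \<Omega>" using v by (rule H10_H1)
  obtain \<phi> where \<phi>: "approximable v \<phi>" using v unfolding H10_iff by blast
  then have t: "\<phi> n \<in> test_functions \<Omega>" for n by (simp add: approximable_def)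
  define e where "e \<phi> = L2_norm (lebesgue_on \<Omega>) (\<lambda>x. v x - \<phi> x) + L2_norm (lebesgue_on \<Omega>) (\<lambda>x. weak_grad \<Omega> v x - gradient \<phi> x)" for \<phi>
  have "(\<lambda>n. e (\<phi> n)) \<longlonglongrightarrow> 0"
    unfolding e_def using \<phi>[unfolded approximable_iff[OF v1]] by (intro tendsto_add_zero) auto
  then have "\<exists>k. e (\<phi> k) \<le> (1 / 2) ^ n" for n
    using order_tendstoD(2)[of "\<lambda>n. e (\<phi> n)" 0 sequentially "(1 / 2) ^ n"]
    by (auto simp: eventually_sequentially intro: less_imp_le)
  then obtain r where r: "\<And>n. e (\<phi> (r n)) \<le> (1 / 2) ^ n" by metis
  define \<psi> where "\<psi> n = \<phi> (r n)" for n
  have t\<psi>: "\<psi> n \<in> test_functions \<Omega>" for n by (simp add: \<psi>_def t)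
  have e\<psi>: "e (\<psi> n) \<le> (1 / 2) ^ n" for n by (simp add: \<psi>_def r)
  have half: "(\<lambda>n. (1 / 2 :: real) ^ n) \<longlonglongrightarrow> 0" by (intro LIMSEQ_power_zero) simp
  have "(\<lambda>n. L2_norm (lebesgue_on \<Omega>) (\<lambda>x. v x - \<psi> n x)) \<longlonglongrightarrow> 0"
    by (rule tendsto_sandwich[OF _ _ tendsto_const half])
       (auto intro!: always_eventually order_trans[OF _ e\<psi>] simp: e_def)
  moreover have "(\<lambda>n. L2_norm (lebesgue_on \<Omega>) (\<lambda>x. weak_grad \<Omega> v x - gradient (\<psi> n) x)) \<longlonglongrightarrow> 0"
    by (rule tendsto_sandwich[OF _ _ tendsto_const half])
       (auto intro!: always_eventually order_trans[OF _ e\<psi>] simp: e_def)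
  ultimately have app: "approximable v \<psi>" unfolding approximable_iff[OF v1] using t\<psi> by blast
  \<comment> \<open>A single pointwise limit, taken before any face is fixed, serves as trace on all
    faces together.\<close>
  define g where "g x = lim (\<lambda>n. \<psi> n x)" for x
  have "L2 (face_measure F) g \<and> (\<lambda>n. L2_norm (face_measure F) (\<lambda>x. g x - \<psi> n x)) \<longlonglongrightarrow> 0"
    if F: "F \<in> mesh_faces \<Omega> M" for F
  proof -
    interpret f: flat_face F by (rule mesh_face_flat[OF F])
    obtain C where C: "C \<ge> 0" "\<And>\<phi>. C1 \<phi> \<Longrightarrow> L2_norm (face_measure F) \<phi> \<le>
      C * (L2_norm (lebesgue_on \<Omega>) \<phi> + L2_norm (lebesgue_on \<Omega>) (gradient \<phi>))"
      using mesh_trace_inequality[OF F] by blast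
    have LF: "L2 (face_measure F) (\<psi> n)" for n by (rule L2_face_C1[OF F test_function_C1[OF t\<psi>]])
    have "L2_norm (face_measure F) (\<lambda>x. \<psi> (Suc n) x - \<psi> n x) \<le> (2 * C) * (1 / 2) ^ n" for n
    proof -
      have "L2_norm (face_measure F) (\<lambda>x. \<psi> (Suc n) x - \<psi> n x) \<le>
          C * (L2_norm (lebesgue_on \<Omega>) (\<lambda>x. \<psi> (Suc n) x - \<psi> n x) + L2_norm (lebesgue_on \<Omega>) (gradient (\<lambda>x. \<psi> (Suc n) x - \<psi> n x)))"
        by (intro C(2) C1_diff test_function_C1[OF t\<psi>])
      also have "\<dots> \<le> C * (e (\<psi> (Suc n)) + e (\<psi> n))"
        using diff_norms[OF v1 v1 _ t\<psi> t\<psi>] C(1) by (intro mult_left_mono) (auto simp: e_def)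
      also have "\<dots> \<le> C * ((1 / 2) ^ Suc n + (1 / 2) ^ n)"
        using C(1) by (intro mult_left_mono add_mono e\<psi>)
      also have "\<dots> \<le> C * (2 * (1 / 2) ^ n)" using C(1) by (intro mult_left_mono) auto
      finally show ?thesis by (simp add: mult_ac)
    qed
    from L2_fast_limit[OF f.finite_face_measure LF this] show ?thesis unfolding g_def by blast
  qed
  then have "is_trace \<Omega> M v g" unfolding is_trace_iff using app by blast
  then show ?thesis by blast
qed

lemma is_trace_skeleton_trace: "v \<in> H10 \<Omega> \<Longrightarrow> is_trace \<Omega> M v (skeleton_trace \<Omega> M v)"
  unfolding skeleton_trace_def using someI_ex[OF trace_exists] .

text \<open>Two approximating sequences differ on a face by at most a constant times the bound of
  \<open>diff_norms\<close>, which tends to zero. Agreement of \<open>v\<close> and \<open>w\<close>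
  up to null sets suffices.\<close>

lemma is_trace_unique:
  assumes v: "v \<in> H10 \<Omega>" and w: "w \<in> H10 \<Omega>" and eq: "AE x in lebesgue_on \<Omega>. v x = w x"
    and g: "is_trace \<Omega> M v g" and h: "is_trace \<Omega> M w h" and F: "F \<in> mesh_faces \<Omega> M"
  shows "AE x in face_measure F. g x = h x"
proof -
  have v1: "v \<in> H1 \<Omega>" and w1: "w \<in> H1 \<Omega>" using v w H10_H1 by auto
  obtain \<phi> where \<phi>: "approximable v \<phi>" "(\<lambda>n. L2_norm (face_measure F) (\<lambda>x. g x - \<phi> n x)) \<longlonglongrightarrow> 0"
    using g F unfolding is_trace_iff by blast
  obtain \<psi> where \<psi>: "approximable w \<psi>" "(\<lambda>n. L2_norm (face_measure F) (\<lambda>x. h x - \<psi> n x)) \<longlonglongrightarrow> 0"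
    using h F unfolding is_trace_iff by blast
  have t: "\<phi> n \<in> test_functions \<Omega>" "\<psi> n \<in> test_functions \<Omega>" for n
    using \<phi>(1) \<psi>(1) by (auto simp: approximable_def)
  have L: "L2 (face_measure F) g" "L2 (face_measure F) h" using g h F by (auto simp: is_trace_def)
  obtain C where C: "C \<ge> 0" "\<And>\<phi>. C1 \<phi> \<Longrightarrow> L2_norm (face_measure F) \<phi> \<le>
      C * (L2_norm (lebesgue_on \<Omega>) \<phi> + L2_norm (lebesgue_on \<Omega>) (gradient \<phi>))"
    using mesh_trace_inequality[OF F] by blast
  define b where "b n = C * ((L2_norm (lebesgue_on \<Omega>) (\<lambda>x. v x - \<phi> n x) + L2_norm (lebesgue_on \<Omega>) (\<lambda>x. weak_grad \<Omega> v x - gradient (\<phi> n) x)) +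
    (L2_norm (lebesgue_on \<Omega>) (\<lambda>x. w x - \<psi> n x) + L2_norm (lebesgue_on \<Omega>) (\<lambda>x. weak_grad \<Omega> w x - gradient (\<psi> n) x)))" for n
  have b0: "b \<longlonglongrightarrow> 0"
    unfolding b_def using \<phi>(1)[unfolded approximable_iff[OF v1]] \<psi>(1)[unfolded approximable_iff[OF w1]]
    by (intro tendsto_mult_right_zero tendsto_add_zero) auto
  have bd: "L2_norm (face_measure F) (\<lambda>x. g x - h x) \<le>
      L2_norm (face_measure F) (\<lambda>x. g x - \<phi> n x) + (b n + L2_norm (face_measure F) (\<lambda>x. h x - \<psi> n x))" for n
  proof -
    have LF: "L2 (face_measure F) (\<phi> n)" "L2 (face_measure F) (\<psi> n)"
      by (intro L2_face_C1[OF F] test_function_C1[OF t(1)] test_function_C1[OF t(2)])+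
    have "L2_norm (face_measure F) (\<lambda>x. g x - h x) \<le> L2_norm (face_measure F) (\<lambda>x. g x - \<phi> n x) + L2_norm (face_measure F) (\<lambda>x. \<phi> n x - h x)"
      by (intro L2_norm_triangle_diff L LF)
    also have "L2_norm (face_measure F) (\<lambda>x. \<phi> n x - h x) \<le> L2_norm (face_measure F) (\<lambda>x. \<phi> n x - \<psi> n x) + L2_norm (face_measure F) (\<lambda>x. \<psi> n x - h x)"
      by (intro L2_norm_triangle_diff L LF)
    also have "L2_norm (face_measure F) (\<lambda>x. \<phi> n x - \<psi> n x) \<le> b n"
      using C(2)[OF C1_diff[OF test_function_C1[OF t(1)] test_function_C1[OF t(2)]], of n n]
        mult_left_mono[OF diff_norms[OF v1 w1 eq t] C(1), of n n] unfolding b_def by linarith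
    finally show ?thesis by (simp add: L2_norm_diff_commute[of _ "\<psi> n"])
  qed
  have "(\<lambda>n. L2_norm (face_measure F) (\<lambda>x. g x - \<phi> n x) + (b n + L2_norm (face_measure F) (\<lambda>x. h x - \<psi> n x))) \<longlonglongrightarrow> 0"
    by (intro tendsto_add_zero \<phi> \<psi> b0)
  then have "L2_norm (face_measure F) (\<lambda>x. g x - h x) \<le> 0"
    by (rule LIMSEQ_le_const) (use bd in auto)
  then have "L2_norm (face_measure F) (\<lambda>x. g x - h x) = 0" by (simp add: antisym)
  from L2_norm_eq_0_AE[OF L2_diff[OF L] this] show ?thesis by simp
qed

lemma is_trace_add:
  assumes v: "v \<in> H10 \<Omega>" and w: "w \<in> H10 \<Omega>" and g: "is_trace \<Omega> M v g" and h: "is_trace \<Omega> M w h"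
  shows "is_trace \<Omega> M (v + w) (\<lambda>x. g x + h x)"
proof -
  obtain \<phi> where \<phi>: "approximable v \<phi>" "\<And>F. F \<in> mesh_faces \<Omega> M \<Longrightarrow> (\<lambda>n. L2_norm (face_measure F) (\<lambda>x. g x - \<phi> n x)) \<longlonglongrightarrow> 0"
    using g unfolding is_trace_iff by blast
  obtain \<psi> where \<psi>: "approximable w \<psi>" "\<And>F. F \<in> mesh_faces \<Omega> M \<Longrightarrow> (\<lambda>n. L2_norm (face_measure F) (\<lambda>x. h x - \<psi> n x)) \<longlonglongrightarrow> 0"
    using h unfolding is_trace_iff by blast
  have t: "\<phi> n \<in> test_functions \<Omega>" "\<psi> n \<in> test_functions \<Omega>" for n
    using \<phi>(1) \<psi>(1) by (auto simp: approximable_def)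
  have L: "L2 (face_measure F) g" "L2 (face_measure F) h" if "F \<in> mesh_faces \<Omega> M" for F
    using g h that by (auto simp: is_trace_def)
  have "approximable (v + w) (\<lambda>n. \<phi> n + \<psi> n)"
    using approximable_add H10_H1 v w \<phi>(1) \<psi>(1) by blast
  moreover have "(\<lambda>n. L2_norm (face_measure F) (\<lambda>x. (g x + h x) - (\<phi> n + \<psi> n) x)) \<longlonglongrightarrow> 0" if F: "F \<in> mesh_faces \<Omega> M" for F
  proof (rule tendsto_sandwich[OF _ _ tendsto_const tendsto_add_zero[OF \<phi>(2)[OF F] \<psi>(2)[OF F]]])
    have LF: "L2 (face_measure F) (\<phi> n)" "L2 (face_measure F) (\<psi> n)" for n
      by (intro L2_face_C1[OF F] test_function_C1[OF t(1)] test_function_C1[OF t(2)])+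
    have "L2_norm (face_measure F) (\<lambda>x. (g x + h x) - (\<phi> n + \<psi> n) x) \<le>
        L2_norm (face_measure F) (\<lambda>x. g x - \<phi> n x) + L2_norm (face_measure F) (\<lambda>x. h x - \<psi> n x)" for n
      using L2_norm_triangle[OF L2_diff[OF L(1)[OF F] LF(1)] L2_diff[OF L(2)[OF F] LF(2)], of n n]
      by (simp add: algebra_simps)
    then show "\<forall>\<^sub>F n in sequentially. L2_norm (face_measure F) (\<lambda>x. (g x + h x) - (\<phi> n + \<psi> n) x) \<le>
        L2_norm (face_measure F) (\<lambda>x. g x - \<phi> n x) + L2_norm (face_measure F) (\<lambda>x. h x - \<psi> n x)"
      by simp
  qed simp
  ultimately show ?thesis unfolding is_trace_iff using L2_add[OF L] by blast
qed

lemma is_trace_scale: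
  assumes v: "v \<in> H10 \<Omega>" and g: "is_trace \<Omega> M v g"
  shows "is_trace \<Omega> M (\<lambda>x. c * v x) (\<lambda>x. c * g x)"
proof -
  obtain \<phi> where \<phi>: "approximable v \<phi>" "\<And>F. F \<in> mesh_faces \<Omega> M \<Longrightarrow> (\<lambda>n. L2_norm (face_measure F) (\<lambda>x. g x - \<phi> n x)) \<longlonglongrightarrow> 0"
    using g unfolding is_trace_iff by blast
  have "approximable (\<lambda>x. c * v x) (\<lambda>n x. c * \<phi> n x)"
    using approximable_scale H10_H1 v \<phi>(1) by blast
  moreover have "(\<lambda>n. L2_norm (face_measure F) (\<lambda>x. c * g x - c * \<phi> n x)) \<longlonglongrightarrow> 0" if F: "F \<in> mesh_faces \<Omega> M" for F
  proof -
    have "L2_norm (face_measure F) (\<lambda>x. c * g x - c * \<phi> n x) = \<bar>c\<bar> * L2_norm (face_measure F) (\<lambda>x. g x - \<phi> n x)" for n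
      using L2_norm_scaleR[of "face_measure F" c "\<lambda>x. g x - \<phi> n x"] by (simp add: right_diff_distrib)
    then show ?thesis using tendsto_mult_right_zero[OF \<phi>(2)[OF F]] by simp
  qed
  ultimately show ?thesis unfolding is_trace_iff using g by (auto simp: is_trace_def)
qed

lemma is_trace_zero: "is_trace \<Omega> M (\<lambda>x. 0) (\<lambda>x. 0)"
  unfolding is_trace_iff using approximable_zero by (auto simp: L2_norm_def intro!: exI[of _ "\<lambda>n x. 0"])

text \<open>\<Omega> is open, so boundary faces miss it and every test function vanishes on
  them.\<close>

lemma is_trace_boundary:
  assumes g: "is_trace \<Omega> M v g" and F: "F \<in> boundary_faces \<Omega> M"
  shows "AE x in face_measure F. g x = 0"
proof -
  have F': "F \<in> mesh_faces \<Omega> M" using F by (simp add: mesh_faces_def)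
  interpret f: flat_face F by (rule mesh_face_flat[OF F'])
  obtain \<phi> where \<phi>: "approximable v \<phi>" "(\<lambda>n. L2_norm (face_measure F) (\<lambda>x. g x - \<phi> n x)) \<longlonglongrightarrow> 0"
    using g F' unfolding is_trace_iff by blast
  have L: "L2 (face_measure F) g" using g F' by (simp add: is_trace_def)
  have "F \<inter> \<Omega> = {}" using F open_A by (auto simp: boundary_faces_def frontier_def interior_open)
  then have "\<phi> n x = 0" if "x \<in> F" for n x
  proof -
    have "\<phi> n \<in> test_functions \<Omega>" "x \<notin> \<Omega>" using \<phi>(1) that \<open>F \<inter> \<Omega> = {}\<close> by (auto simp: approximable_def)
    then show ?thesis by (rule test_function_support(1))
  qed
  then have "L2_norm (face_measure F) (\<lambda>x. g x - \<phi> n x) = L2_norm (face_measure F) g" for n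
    unfolding L2_norm_def by (intro arg_cong[where f = sqrt] Bochner_Integration.integral_cong) auto
  then have "L2_norm (face_measure F) g = 0" using \<phi>(2) by (simp add: LIMSEQ_const_iff)
  then show ?thesis using L2_norm_eq_0_AE[OF L] by simp
qed

text \<open>For the approximating test functions this is the divergence theorem applied to their
  products with \<open>q\<close>. The volume terms converge in the Sobolev norm, the face terms by
  the definition of a trace.\<close>

lemma Green:
  assumes v: "v \<in> H10 \<Omega>" and g: "is_trace \<Omega> M v g" and K: "K \<in> M" and q: "C1 q" and e: "norm e = 1"
  shows "(\<integral>x. v x * (gradient q x \<bullet> e) \<partial>lebesgue_on K) + (\<integral>x. (weak_grad \<Omega> v x \<bullet> e) * q x \<partial>lebesgue_on K) =
    (\<Sum>F\<in>faces_of K. (outer_normal K F \<bullet> e) * (\<integral>x. g x * q x \<partial>face_measure F))"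
proof -
  interpret k: solid_polytope K by (rule solid[OF K])
  have v1: "v \<in> H1 \<Omega>" using v by (rule H10_H1)
  obtain \<phi> where \<phi>: "approximable v \<phi>" "\<And>F. F \<in> mesh_faces \<Omega> M \<Longrightarrow> (\<lambda>n. L2_norm (face_measure F) (\<lambda>x. g x - \<phi> n x)) \<longlonglongrightarrow> 0"
    using g unfolding is_trace_iff by blast
  have t: "\<phi> n \<in> test_functions \<Omega>" for n using \<phi>(1) by (auto simp: approximable_def)
  note c\<phi> = test_function_C1[OF t]
  have lv: "(\<lambda>n. L2_norm (lebesgue_on \<Omega>) (\<lambda>x. v x - \<phi> n x)) \<longlonglongrightarrow> 0"
    "(\<lambda>n. L2_norm (lebesgue_on \<Omega>) (\<lambda>x. weak_grad \<Omega> v x - gradient (\<phi> n) x)) \<longlonglongrightarrow> 0"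
    using \<phi>(1) unfolding approximable_iff[OF v1] by auto
  have Lq: "L2 (lebesgue_on K) q" "L2 (lebesgue_on K) (\<lambda>x. gradient q x \<bullet> e)"
    by (intro L2_inner_const k.L2_continuous C1_continuous C1_continuous_gradient q)+
  have Lv: "L2 (lebesgue_on K) v" "L2 (lebesgue_on K) (weak_grad \<Omega> v)"
    by (intro L2_on_K(1)[OF K] H1_D(1,3)[OF v1])+
  have L\<phi>: "L2 (lebesgue_on K) (\<phi> n)" "L2 (lebesgue_on K) (gradient (\<phi> n))" for n
    by (intro k.L2_continuous C1_continuous C1_continuous_gradient c\<phi>)+
  have lK: "(\<lambda>n. L2_norm (lebesgue_on K) (\<lambda>x. v x - \<phi> n x)) \<longlonglongrightarrow> 0"
    by (rule tendsto_sandwich[OF _ _ tendsto_const lv(1)])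
       (auto intro!: always_eventually L2_on_K(2)[OF K] L2_diff H1_D(1)[OF v1] L2_test[OF t])
  have lKg: "(\<lambda>n. L2_norm (lebesgue_on K) (\<lambda>x. weak_grad \<Omega> v x - gradient (\<phi> n) x)) \<longlonglongrightarrow> 0"
    by (rule tendsto_sandwich[OF _ _ tendsto_const lv(2)])
       (auto intro!: always_eventually L2_on_K(2)[OF K] L2_diff H1_D(3)[OF v1] L2_grad_test[OF t])
  have lhs1: "(\<lambda>n. \<integral>x. \<phi> n x * (gradient q x \<bullet> e) \<partial>lebesgue_on K) \<longlonglongrightarrow> (\<integral>x. v x * (gradient q x \<bullet> e) \<partial>lebesgue_on K)"
    by (rule tendsto_integral_mult[OF Lv(1) L\<phi>(1) Lq(2) lK])
  have Lqe: "L2 (lebesgue_on K) (\<lambda>x. q x *\<^sub>R e)"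
    by (intro k.L2_continuous continuous_intros C1_continuous q)
  have lhs2: "(\<lambda>n. \<integral>x. gradient (\<phi> n) x \<bullet> (q x *\<^sub>R e) \<partial>lebesgue_on K) \<longlonglongrightarrow> (\<integral>x. weak_grad \<Omega> v x \<bullet> (q x *\<^sub>R e) \<partial>lebesgue_on K)"
    by (rule tendsto_integral_inner[OF Lv(2) L\<phi>(2) Lqe lKg])
  have rhs: "(\<lambda>n. \<integral>x. \<phi> n x * q x \<partial>face_measure F) \<longlonglongrightarrow> (\<integral>x. g x * q x \<partial>face_measure F)" if F: "F \<in> faces_of K" for F
  proof -
    have F': "F \<in> mesh_faces \<Omega> M" using F faces_in[OF K] by blast
    show ?thesis
    proof (intro tendsto_integral_mult \<phi>(2)[OF F'])
      show "L2 (face_measure F) g" using g F' by (simp add: is_trace_def)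
    qed (intro L2_face_C1[OF F'] c\<phi> q)+
  qed
  have eq: "(\<integral>x. \<phi> n x * (gradient q x \<bullet> e) \<partial>lebesgue_on K) + (\<integral>x. gradient (\<phi> n) x \<bullet> (q x *\<^sub>R e) \<partial>lebesgue_on K) =
    (\<Sum>F\<in>faces_of K. (outer_normal K F \<bullet> e) * (\<integral>x. \<phi> n x * q x \<partial>face_measure F))" for n
  proof -
    have "(\<integral>x. gradient (\<lambda>x. \<phi> n x * q x) x \<bullet> e \<partial>lebesgue_on K) =
        (\<integral>x. \<phi> n x * (gradient q x \<bullet> e) \<partial>lebesgue_on K) + (\<integral>x. gradient (\<phi> n) x \<bullet> (q x *\<^sub>R e) \<partial>lebesgue_on K)"
      using L2_integrable_mult[OF L\<phi>(1) Lq(2)] L2_integrable_inner[OF L\<phi>(2) Lqe]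
      by (simp add: gradient_mult[OF c\<phi> q] inner_add_left)
    then show ?thesis using k.divergence_theorem[OF C1_mult[OF c\<phi> q] e] by simp
  qed
  have "(\<lambda>n. \<Sum>F\<in>faces_of K. (outer_normal K F \<bullet> e) * (\<integral>x. \<phi> n x * q x \<partial>face_measure F)) \<longlonglongrightarrow>
      (\<integral>x. v x * (gradient q x \<bullet> e) \<partial>lebesgue_on K) + (\<integral>x. weak_grad \<Omega> v x \<bullet> (q x *\<^sub>R e) \<partial>lebesgue_on K)"
    using tendsto_add[OF lhs1 lhs2] unfolding eq .
  moreover have "(\<lambda>n. \<Sum>F\<in>faces_of K. (outer_normal K F \<bullet> e) * (\<integral>x. \<phi> n x * q x \<partial>face_measure F)) \<longlonglongrightarrow>
      (\<Sum>F\<in>faces_of K. (outer_normal K F \<bullet> e) * (\<integral>x. g x * q x \<partial>face_measure F))"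
    by (intro tendsto_sum tendsto_mult tendsto_const rhs)
  ultimately show ?thesis by (simp add: LIMSEQ_unique mult.commute)
qed

end

section \<open>Surface measures have full support\<close>

context solid_polytope
begin

lemma facet_affine_hull_height:
  assumes F: "F \<in> faces_of K"
  shows "affine hull F = {x. face_height F x = 0}"
proof -
  obtain \<sigma> :: real where "\<bar>\<sigma>\<bar> = 1" "face_normal F = \<sigma> *\<^sub>R outer_normal K F"
    "\<And>y. facet_dist K F y = - \<sigma> * face_height F y"
    using facet_dist_stretch[OF F] by metis
  then show ?thesis unfolding facet_affine_hull[OF F] by auto
qed

lemma facet_convex: "F \<in> faces_of K \<Longrightarrow> convex F"
  using facet_polytope by (rule polytope_imp_convex)

lemma rel_interior_borel:
  assumes "F \<in> faces_of K"
  shows "rel_interior F \<in> sets borel"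
proof -
  have "rel_interior F = closure F - rel_frontier F"
    using rel_interior_subset[of F] closure_subset[of F] by (auto simp: rel_frontier_def)
  then show ?thesis by (simp add: borel_closed closed_rel_frontier)
qed

text \<open>The frontier of the convex prism is negligible, and its interior points project to
  relative interior points: a small ball around such a point, cut with the hyperplane, projects into
  the face.\<close>

lemma AE_rel_interior:
  assumes F: "F \<in> faces_of K"
  shows "AE x in face_measure F. x \<in> rel_interior F"
proof -
  interpret f: flat_face F by (rule flat_facet[OF F])
  have conv: "convex (face_prism F)"
  proof -
    \<comment> \<open>The prism as the Minkowski sum of the face and a segment, which makes its
      convexity evident.\<close>
    have eq: "face_prism F = (\<Union>x\<in>F. \<Union>y\<in>((\<lambda>t. t *\<^sub>R face_normal F) ` {0..1}). {x + y})"
    proof (rule set_eqI)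
      fix y
      have "(\<exists>x t. y = x + t *\<^sub>R face_normal F \<and> x \<in> F \<and> 0 \<le> t \<and> t \<le> 1) \<longleftrightarrow>
          (\<exists>x\<in>F. \<exists>t\<in>{0..1}. y = x + t *\<^sub>R face_normal F)"
        by (metis atLeastAtMost_iff)
      then show "y \<in> face_prism F \<longleftrightarrow> y \<in> (\<Union>x\<in>F. \<Union>y\<in>((\<lambda>t. t *\<^sub>R face_normal F) ` {0..1}). {x + y})"
        unfolding face_prism_def by simp
    qed
    have "convex ((\<lambda>t::real. t *\<^sub>R face_normal F) ` {0..1})"
      by (intro convex_linear_image linearI) (auto simp: algebra_simps)
    then show ?thesis unfolding eq by (rule convex_sums[OF facet_convex[OF F]])
  qed
  have inside: "face_proj F y \<in> rel_interior F" if y: "y \<in> interior (face_prism F)" for y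
  proof -
    have yP: "y \<in> face_prism F" using y interior_subset by blast
    obtain e where e: "e > 0" "ball y e \<subseteq> face_prism F" using y by (auto simp: mem_interior)
    have "ball (face_proj F y) e \<inter> affine hull F \<subseteq> F"
    proof
      fix z assume z: "z \<in> ball (face_proj F y) e \<inter> affine hull F"
      then have hz: "face_height F z = 0" using facet_affine_hull_height[OF F] by auto
      let ?w = "z + face_height F y *\<^sub>R face_normal F"
      have "dist y ?w = dist (face_proj F y) z"
        unfolding f.face_proj_height dist_norm by (simp add: algebra_simps)
      then have "?w \<in> face_prism F" using e(2) z by auto
      then have "face_proj F ?w \<in> F" by (simp add: f.prism_iff)
      moreover have "face_proj F ?w = z" unfolding f.face_proj_height f.height_add hz by simp
      ultimately show "z \<in> F" by simp
    qed
    then show ?thesis using yP e(1) unfolding mem_rel_interior_ball f.prism_iff by blast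
  qed
  have "AE y in lebesgue_on (face_prism F). face_proj F y \<in> rel_interior F"
  proof (rule AE_lebesgue_on_negligible[OF f.prism_lebesgue negligible_convex_frontier[OF conv]])
    fix y assume "y \<in> face_prism F" "y \<notin> frontier (face_prism F)"
    then have "y \<in> interior (face_prism F)" using closure_subset by (auto simp: frontier_def)
    then show "face_proj F y \<in> rel_interior F" by (rule inside)
  qed
  moreover have "{x \<in> F. x \<in> rel_interior F} = rel_interior F" using rel_interior_subset by auto
  ultimately show ?thesis using f.AE_face_measureI[of "\<lambda>x. x \<in> rel_interior F"] rel_interior_borel[OF F] by simp
qed

text \<open>A nonzero value at a relative interior point persists nearby. Above such a neighbourhood
  the prism contains a nonempty open set, which cannot be null. The remaining points of
  \<open>F\<close> are limits of relative interior points.\<close>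

lemma face_measure_full_support:
  fixes f :: "real^'d \<Rightarrow> real"
  assumes F: "F \<in> faces_of K" and f: "continuous_on UNIV f"
    and z: "AE x in face_measure F. f x = 0" and x: "x \<in> F"
  shows "f x = 0"
proof -
  interpret f: flat_face F by (rule flat_facet[OF F])
  have cl: "closed {x. f x = 0}" using f by (intro closed_Collect_eq continuous_on_const)
  have rel: "f y = 0" if y: "y \<in> rel_interior F" for y
  proof (rule ccontr)
    assume ny: "f y \<noteq> 0"
    have yF: "y \<in> F" using y rel_interior_subset by blast
    have "y \<in> - {x. f x = 0}" using ny by simp
    then obtain d where d: "d > 0" "ball y d \<subseteq> - {x. f x = 0}"
      using cl open_contains_ball[of "- {x. f x = 0}"] by (auto simp: open_Compl)
    obtain e where e: "e > 0" "ball y e \<inter> affine hull F \<subseteq> F" using y unfolding mem_rel_interior_ball by blast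
    define r where "r = min d e"
    have r: "r > 0" "r \<le> d" "r \<le> e" using d e by (auto simp: r_def)
    \<comment> \<open>The open cylinder above a relative neighbourhood of \<open>y\<close>; the
      strict height bounds keep it inside the prism.\<close>
    define Ob where "Ob = {z. dist y (face_proj F z) < r} \<inter> {z. 0 < face_height F z} \<inter> {z. face_height F z < 1}"
    have "open Ob"
      unfolding Ob_def by (intro open_Int open_Collect_less continuous_intros f.continuous_proj f.continuous_height)
    have inF: "face_proj F z \<in> F" if "z \<in> Ob" for z
    proof -
      have "face_height F (face_proj F z) = 0"
        unfolding f.face_proj_height using f.height_add[of z "- face_height F z"] by simp
      then show ?thesis using that e(2) r unfolding Ob_def facet_affine_hull_height[OF F] by auto
    qed
    have sub: "Ob \<subseteq> face_prism F" using inF by (auto simp: f.prism_iff Ob_def)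
    have nz: "f (face_proj F z) \<noteq> 0" if "z \<in> Ob" for z
    proof -
      have "face_proj F z \<in> ball y d" using that r by (auto simp: Ob_def)
      then show ?thesis using d(2) by auto
    qed
    have "AE z in lebesgue_on (face_prism F). f (face_proj F z) = 0"
      using AE_distrD[OF f.proj_measurable_prism z[unfolded face_measure_eq]] .
    then have "AE z in lebesgue. z \<in> face_prism F \<longrightarrow> f (face_proj F z) = 0"
      by (simp add: AE_restrict_space_iff)
    then have "AE z in lebesgue. z \<notin> Ob" by eventually_elim (use sub nz in blast)
    moreover have "Ob \<in> sets lebesgue" using \<open>open Ob\<close> by (simp add: borel_open)
    ultimately have "negligible Ob" using AE_iff_null_sets[of Ob lebesgue] by (simp add: negligible_iff_null_sets)
    moreover have "Ob \<noteq> {}"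
    proof -
      have "y + (1 / 2) *\<^sub>R face_normal F \<in> Ob"
        unfolding Ob_def using r f.proj_add[OF yF] f.height_zero[OF yF] by (simp add: f.height_add)
      then show ?thesis by blast
    qed
    ultimately show False using open_not_negligible[OF \<open>open Ob\<close>] by blast
  qed
  have "F \<subseteq> closure (rel_interior F)"
    using convex_closure_rel_interior[OF facet_convex[OF F]] closure_subset by blast
  also have "\<dots> \<subseteq> {x. f x = 0}" using rel cl by (intro closure_minimal) auto
  finally show ?thesis using x by blast
qed

lemma full_support:
  fixes f :: "real^'d \<Rightarrow> 'b::euclidean_space"
  assumes f: "continuous_on UNIV f" and z: "AE x in lebesgue_on K. f x = 0" and x: "x \<in> K"
  shows "f x = 0"
proof -
  have cl: "closed {x. f x = 0}" using f by (intro closed_Collect_eq continuous_on_const)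
  have Ob: "open (interior K - {x. f x = 0})" using cl by (intro open_Diff) auto
  have "AE x in lebesgue. x \<in> K \<longrightarrow> f x = 0" using z by (simp add: AE_restrict_space_iff)
  then have "AE x in lebesgue. x \<notin> interior K - {x. f x = 0}"
    by eventually_elim (use interior_subset in auto)
  moreover have "interior K - {x. f x = 0} \<in> sets lebesgue" using Ob by (simp add: borel_open)
  ultimately have "negligible (interior K - {x. f x = 0})"
    using AE_iff_null_sets[of "interior K - {x. f x = 0}" lebesgue] unfolding negligible_iff_null_sets by blast
  then have "interior K - {x. f x = 0} = {}" using open_not_negligible[OF Ob] by blast
  then have "closure (interior K) \<subseteq> {x. f x = 0}" using cl by (intro closure_minimal) auto
  then show ?thesis using x closure_interior by auto
qed

end

section \<open>From matching simplicial meshes to piecewise polynomial spaces\<close>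

section \<open>Matching simplicial meshes\<close>

lemma simplex_solid_polytope:
  fixes K :: "(real^'d) set"
  assumes "(int CARD('d)) simplex K"
  shows "solid_polytope K"
proof
  obtain C where C: "\<not> affine_dependent C" "int (card C) = int CARD('d) + 1" "K = convex hull C"
    using assms unfolding simplex_def by blast
  have "finite C" using C(1) by (rule aff_independent_finite)
  then show "polytope K" using C(3) unfolding polytope_def by blast
  have "aff_dim K = int CARD('d)"
    using aff_dim_affine_independent[OF C(1)] C(2,3) by (simp add: aff_dim_convex_hull)
  then have "affine hull K = UNIV" using aff_dim_eq_full[of K] by simp
  moreover have "K \<noteq> {}"
    using C by auto
  ultimately show "interior K \<noteq> {}"
    using rel_interior_interior[of K] rel_interior_eq_empty[of K] C(3) by auto
qed

text \<open>A Lipschitz boundary excludes slits: below the graph at a boundary point lies an open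
  set disjoint from \<Omega>, hence from its closure. As the mesh covers the closure, this places
  the interiors of the elements inside \<Omega>.\<close>

lemma lipschitz_boundary_interior_closure:
  fixes \<Omega> :: "(real^'d) set"
  assumes op: "open \<Omega>" and lip: "lipschitz_boundary \<Omega>"
  shows "interior (closure \<Omega>) = \<Omega>"
proof
  show "\<Omega> \<subseteq> interior (closure \<Omega>)" using op closure_subset by (intro interior_maximal) auto
  show "interior (closure \<Omega>) \<subseteq> \<Omega>"
  proof
    fix x assume x: "x \<in> interior (closure \<Omega>)"
    show "x \<in> \<Omega>"
    proof (rule ccontr)
      assume nx: "x \<notin> \<Omega>"
      have "x \<in> frontier \<Omega>" using x nx interior_subset op by (auto simp: frontier_def interior_open)
      with lip have "\<exists>U e L \<gamma>. open U \<and> x \<in> U \<and> norm e = 1 \<and> L-lipschitz_on UNIV \<gamma> \<and>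
        \<Omega> \<inter> U = {y\<in>U. \<gamma> (y - (y \<bullet> e) *\<^sub>R e) < y \<bullet> e}"
        unfolding lipschitz_boundary_def by (rule bspec)
      then obtain U e L \<gamma> where "open U \<and> x \<in> U \<and> norm e = 1 \<and> L-lipschitz_on UNIV \<gamma> \<and>
        \<Omega> \<inter> U = {y\<in>U. \<gamma> (y - (y \<bullet> e) *\<^sub>R e) < y \<bullet> e}" by (elim exE)
      then have U: "open U" "x \<in> U" and e: "norm e = 1" and l: "L-lipschitz_on UNIV \<gamma>"
        and eq: "\<Omega> \<inter> U = {y\<in>U. \<gamma> (y - (y \<bullet> e) *\<^sub>R e) < y \<bullet> e}"
        by simp_all
      have c\<gamma>: "continuous_on UNIV \<gamma>" using l by (rule lipschitz_on_continuous_on)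
      have ee: "e \<bullet> e = 1" using e by (simp add: norm_eq_1)
      define Ob where "Ob = U \<inter> {y. y \<bullet> e < \<gamma> (y - (y \<bullet> e) *\<^sub>R e)}"
      have "open {y. y \<bullet> e < \<gamma> (y - (y \<bullet> e) *\<^sub>R e)}"
        by (intro open_Collect_less continuous_intros continuous_on_compose2[OF c\<gamma>]) auto
      then have "open Ob" unfolding Ob_def using U(1) by auto
      have "Ob \<inter> \<Omega> = {}" using eq unfolding Ob_def by force
      then have Ob: "Ob \<inter> closure \<Omega> = {}" using \<open>open Ob\<close> open_Int_closure_eq_empty by blast
      have "open (U \<inter> interior (closure \<Omega>))" "x \<in> U \<inter> interior (closure \<Omega>)" using U x by auto
      then obtain r where r: "r > 0" "cball x r \<subseteq> U \<inter> interior (closure \<Omega>)"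
        using open_contains_cball by metis
      \<comment> \<open>Moving against \<open>e\<close> keeps the tangential coordinates and lowers
        the height; \<open>x\<close> was not above the graph, so \<open>?y\<close> is strictly below
        it.\<close>
      let ?y = "x - r *\<^sub>R e"
      have yin: "?y \<in> U \<inter> interior (closure \<Omega>)" using r e by (intro subsetD[OF r(2)]) (simp add: dist_norm)
      have "\<not> \<gamma> (x - (x \<bullet> e) *\<^sub>R e) < x \<bullet> e" using eq nx U(2) by blast
      moreover have "?y - (?y \<bullet> e) *\<^sub>R e = x - (x \<bullet> e) *\<^sub>R e" "?y \<bullet> e = x \<bullet> e - r"
        by (simp_all add: inner_diff_left ee algebra_simps)
      ultimately have "?y \<bullet> e < \<gamma> (?y - (?y \<bullet> e) *\<^sub>R e)" using r(1) by (simp only:)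
      then have "?y \<in> Ob" using yin unfolding Ob_def by blast
      then show False using Ob yin interior_subset by blast
    qed
  qed
qed

text \<open>The substance is that a facet \<open>F\<close> of \<open>K\<close> not contained in the
  boundary is an interface. A relative interior point \<open>y\<close> of \<open>F\<close> in
  \<Omega> is a limit of points outside \<open>K\<close>; these lie in the finitely many other
  closed elements, so some \<open>K'\<close> contains \<open>y\<close>. Then
  \<open>K \<inter> K'\<close> is a face of \<open>K\<close> through \<open>y\<close>, contains
  \<open>F\<close>, and equals \<open>F\<close> by dimension.\<close>

lemma matching_mesh_polytopal:
  fixes \<Omega> :: "(real^'d) set"
  assumes \<Omega>: "polyhedral_domain \<Omega>" and M: "matching_mesh \<Omega> M"
  shows "polytopal_mesh \<Omega> M"
proof -
  have op: "open \<Omega>" and bd: "bounded \<Omega>" and int_cl: "interior (closure \<Omega>) = \<Omega>"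
    using \<Omega> lipschitz_boundary_interior_closure unfolding polyhedral_domain_def by auto
  have fin: "finite M" and smp: "\<And>K. K \<in> M \<Longrightarrow> (int CARD('d)) simplex K" and cov: "\<Union>M = closure \<Omega>"
    using M unfolding matching_mesh_def by auto
  have solid: "solid_polytope K" if "K \<in> M" for K by (rule simplex_solid_polytope[OF smp[OF that]])
  have face: "(K1 \<inter> K2) face_of K1" if K: "K1 \<in> M" "K2 \<in> M" "K1 \<noteq> K2" "K1 \<inter> K2 \<noteq> {}" for K1 K2
  proof -
    obtain V where V: "V \<subseteq> {v. v extreme_point_of K1}" "K1 \<inter> K2 = convex hull V"
    proof -
      have "\<exists>V. V \<subseteq> {v. v extreme_point_of K1} \<inter> {v. v extreme_point_of K2} \<and> K1 \<inter> K2 = convex hull V"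
        using M K unfolding matching_mesh_def by blast
      then obtain V where "V \<subseteq> {v. v extreme_point_of K1}" "K1 \<inter> K2 = convex hull V" by blast
      then show ?thesis by (rule that)
    qed
    obtain C where C: "\<not> affine_dependent C" "K1 = convex hull C" using smp[OF K(1)] unfolding simplex_def by blast
    have "V \<subseteq> C"
    proof
      fix v assume "v \<in> V"
      then have "v extreme_point_of (convex hull C)" using V(1) C(2) by auto
      then show "v \<in> C" by (rule extreme_point_of_convex_hull)
    qed
    \<comment> \<open>The vertices of a simplex are affinely independent, so every subset of them
      spans a face.\<close>
    then have "convex hull V face_of convex hull C"
      using face_of_convex_hull_affine_independent[OF C(1), of "convex hull V"] by auto
    then show ?thesis using V(2) C(2) by simp
  qed
  \<comment> \<open>Elements are not nested: the smaller would be a proper face of the larger,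
    against their equal dimension.\<close>
  have proper: "K1 \<inter> K2 \<noteq> K1" if K: "K1 \<in> M" "K2 \<in> M" "K1 \<noteq> K2" for K1 K2
  proof
    assume eq: "K1 \<inter> K2 = K1"
    interpret a: solid_polytope K1 by (rule solid[OF K(1)])
    interpret b: solid_polytope K2 by (rule solid[OF K(2)])
    have "K2 \<inter> K1 \<noteq> {}" using eq a.nonempty by auto
    then have "K1 face_of K2" using face[OF K(2,1)] K(3) eq by (auto simp: Int_commute)
    then have "aff_dim K1 < aff_dim K2" using face_of_aff_dim_lt[OF b.convex] K(3) by blast
    then show False using a.aff_dim b.aff_dim by simp
  qed
  show ?thesis
  proof (intro polytopal_mesh.intro bounded_open.intro polytopal_mesh_axioms.intro)
    show "open \<Omega>" "bounded \<Omega>" "finite M" by fact+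
    show "solid_polytope K" if "K \<in> M" for K by (rule solid[OF that])
    show "interior K \<subseteq> \<Omega>" if "K \<in> M" for K
      using interior_mono[of K "closure \<Omega>"] cov that int_cl by blast
    show "\<Omega> \<subseteq> \<Union>M" using cov closure_subset by blast
    show "interior K1 \<inter> interior K2 = {}" if K: "K1 \<in> M" "K2 \<in> M" "K1 \<noteq> K2" for K1 K2
    proof (rule ccontr)
      interpret a: solid_polytope K1 by (rule solid[OF K(1)])
      assume ne: "interior K1 \<inter> interior K2 \<noteq> {}"
      then obtain x where x: "x \<in> interior K1" "x \<in> interior K2" by blast
      then have xx: "x \<in> K1 \<inter> K2" using interior_subset by blast
      then have "(K1 \<inter> K2) \<inter> rel_interior K1 = {}"
        using face_of_disjoint_rel_interior[OF face[OF K] proper[OF K]] by blast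
      moreover have "x \<in> rel_interior K1" using x(1) rel_interior_interior[OF a.affine_hull] by simp
      ultimately show False using xx by blast
    qed
    show "faces_of K \<subseteq> mesh_faces \<Omega> M" if K: "K \<in> M" for K
    proof
      fix F assume F: "F \<in> faces_of K"
      interpret k: solid_polytope K by (rule solid[OF K])
      show "F \<in> mesh_faces \<Omega> M"
      proof (cases "F \<subseteq> frontier \<Omega>")
        case True
        then show ?thesis using K F by (auto simp: mesh_faces_def boundary_faces_def)
      next
        case False
        have "F \<subseteq> closure \<Omega>" using k.facet_subset[OF F] K cov by blast
        then obtain x where "x \<in> F" "x \<in> \<Omega>" using False op by (auto simp: frontier_def interior_open)
        moreover have "F \<subseteq> closure (rel_interior F)"
          using convex_closure_rel_interior[OF k.facet_convex[OF F]] closure_subset by blast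
        ultimately obtain y where y: "y \<in> rel_interior F" "y \<in> \<Omega>"
          using open_Int_closure_eq_empty[OF op, of "rel_interior F"] by blast
        have yF: "y \<in> F" using y(1) rel_interior_subset by blast
        have yK: "y \<in> K" using yF k.facet_subset[OF F] by blast
        have "facet_dist K F y = 0" using yF k.facet_normal(2)[OF F] by blast
        then have "y \<notin> interior K" using k.interior_iff_facet_dist F by force
        then have "y \<in> closure (- K)" by (simp add: closure_complement)
        then have "y \<in> closure (\<Omega> \<inter> - K)" using y(2) open_Int_closure_subset[OF op] by blast
        also have "\<dots> \<subseteq> \<Union>(M - {K})"
        proof (rule closure_minimal)
          show "\<Omega> \<inter> - K \<subseteq> \<Union>(M - {K})" using cov closure_subset by blast
          show "closed (\<Union>(M - {K}))"
            using fin solid solid_polytope.compact by (intro closed_Union) (auto intro: compact_imp_closed)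
        qed
        finally obtain K' where K': "K' \<in> M" "K' \<noteq> K" "y \<in> K'" by blast
        interpret k': solid_polytope K' by (rule solid[OF K'(1)])
        let ?G = "K \<inter> K'"
        have G: "?G face_of K" "?G face_of K'"
          using face[OF K K'(1)] face[OF K'(1) K] K' yK by (auto simp: Int_commute)
        have FG: "F \<subseteq> ?G"
          using subset_of_face_of[OF G(1) k.facet_subset[OF F]] y(1) yF yK K'(3) by blast
        have "aff_dim ?G < aff_dim K"
          using face_of_aff_dim_lt[OF k.convex G(1)] proper[OF K K'(1)] K'(2) by blast
        then have le: "aff_dim ?G \<le> aff_dim F" using k.aff_dim k.facet_aff_dim[OF F] by simp
        have "F face_of ?G"
          using F face_of_subset[of F K ?G] FG by (simp add: faces_of_def facet_of_imp_face_of)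
        moreover have "convex ?G" using k.convex k'.convex by (rule convex_Int)
        ultimately have "F = ?G" using face_of_aff_dim_lt[of ?G F] le by force
        moreover have "F \<in> faces_of K'"
          using G(2) \<open>F = ?G\<close> yF k'.aff_dim k.facet_aff_dim[OF F] by (auto simp: faces_of_def facet_of_def)
        ultimately show ?thesis
          using K K' F by (auto simp: mesh_faces_def interfaces_def)
      qed
    qed
  qed
qed

section \<open>Riesz representation on finitely generated function spaces\<close>

text \<open>Gram-Schmidt, one spanning function at a time. \<open>B\<close> may be degenerate and
  the functions \<open>b\<close> dependent; solvability then rests on \<open>lf\<close> vanishing on
  the null vectors of \<open>B\<close>.\<close>

lemma finite_dim_riesz:
  fixes B :: "('a \<Rightarrow> real) \<Rightarrow> ('a \<Rightarrow> real) \<Rightarrow> real" and b :: "'i \<Rightarrow> 'a \<Rightarrow> real"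
  assumes I: "finite I" and b: "\<And>i. i \<in> I \<Longrightarrow> b i \<in> W"
    and zeroW: "(\<lambda>x. 0) \<in> W"
    and addW: "\<And>f g. f \<in> W \<Longrightarrow> g \<in> W \<Longrightarrow> (\<lambda>x. f x + g x) \<in> W"
    and scaleW: "\<And>f c. f \<in> W \<Longrightarrow> (\<lambda>x. c * f x) \<in> W"
    and Bsym: "\<And>f g. f \<in> W \<Longrightarrow> g \<in> W \<Longrightarrow> B f g = B g f"
    and Badd: "\<And>f g h. f \<in> W \<Longrightarrow> g \<in> W \<Longrightarrow> h \<in> W \<Longrightarrow> B (\<lambda>x. f x + g x) h = B f h + B g h"
    and Bscale: "\<And>f h c. f \<in> W \<Longrightarrow> h \<in> W \<Longrightarrow> B (\<lambda>x. c * f x) h = c * B f h"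
    and Bpos: "\<And>f. f \<in> W \<Longrightarrow> 0 \<le> B f f"
    and lf_add: "\<And>f g. f \<in> W \<Longrightarrow> g \<in> W \<Longrightarrow> lf (\<lambda>x. f x + g x) = lf f + lf g"
    and lf_scale: "\<And>f c. f \<in> W \<Longrightarrow> lf (\<lambda>x. c * f x) = c * lf f"
    and lf_null: "\<And>f. f \<in> W \<Longrightarrow> B f f = 0 \<Longrightarrow> lf f = 0"
  shows "\<exists>c. \<forall>c'. B (\<lambda>x. \<Sum>i\<in>I. c i * b i x) (\<lambda>x. \<Sum>i\<in>I. c' i * b i x) = lf (\<lambda>x. \<Sum>i\<in>I. c' i * b i x)"
proof -
  have spanW: "(\<lambda>x. \<Sum>i\<in>J. c i * b i x) \<in> W" if "finite J" "J \<subseteq> I" for J c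
    using that
  proof (induction J rule: finite_induct)
    case (insert j J)
    then show ?case using addW[OF scaleW[OF b]] by simp
  qed (simp add: zeroW)
  have CS: "(B f g)\<^sup>2 \<le> B f f * B g g" if fg: "f \<in> W" "g \<in> W" for f g
  proof (rule discriminant_nonpos)
    fix t
    have "B (\<lambda>x. f x + t * g x) (\<lambda>x. f x + t * g x) = B f f + 2 * t * B f g + t\<^sup>2 * B g g"
      using fg addW scaleW Badd[OF fg(1) scaleW[OF fg(2)]] Badd[OF scaleW[OF fg(2)] fg(1)] Bscale[OF fg(2)]
        Bsym[OF _ addW[OF fg(1) scaleW[OF fg(2)]]]
      by (simp add: Badd Bscale Bsym[OF fg(2,1)] power2_eq_square algebra_simps)
    then show "0 \<le> B f f + 2 * t * B f g + t\<^sup>2 * B g g" using Bpos[OF addW[OF fg(1) scaleW[OF fg(2)]], of t] by simp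
  qed
  \<comment> \<open>Generalised over the functional, since the induction hypothesis is used twice:
    for \<open>lf\<close>, and for \<open>B (b j)\<close>, whose representation is the projection of
    \<open>b j\<close> onto the earlier span. By \<open>CS\<close> the latter functional also
    vanishes on null vectors.\<close>
  have key: "\<exists>c. \<forall>c'. B (\<lambda>x. \<Sum>i\<in>J. c i * b i x) (\<lambda>x. \<Sum>i\<in>J. c' i * b i x) = lf (\<lambda>x. \<Sum>i\<in>J. c' i * b i x)"
    if "finite J" "J \<subseteq> I" "\<And>f g. f \<in> W \<Longrightarrow> g \<in> W \<Longrightarrow> lf (\<lambda>x. f x + g x) = lf f + lf g"
      "\<And>f c. f \<in> W \<Longrightarrow> lf (\<lambda>x. c * f x) = c * lf f"
      "\<And>f. f \<in> W \<Longrightarrow> B f f = 0 \<Longrightarrow> lf f = 0" for J lf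
    using that
  proof (induction J arbitrary: lf rule: finite_induct)
    case empty
    show ?case using empty(3)[OF zeroW, of 0] Bscale[OF zeroW zeroW, of 0] by simp
  next
    case (insert j J)
    note lf = insert.prems(2-4)
    have jW: "b j \<in> W" using b insert.prems(1) by blast
    have J: "J \<subseteq> I" using insert.prems(1) by blast
    let ?s = "\<lambda>c x. \<Sum>i\<in>J. c i * b i x"
    have sW: "?s c \<in> W" for c using spanW[OF insert.hyps(1) J] .
    obtain c0 where c0: "\<And>c'. B (?s c0) (?s c') = lf (?s c')"
    proof -
      have "\<exists>c. \<forall>c'. B (?s c) (?s c') = lf (?s c')"
      proof (rule insert.IH[OF J])
        show "lf (\<lambda>x. f x + g x) = lf f + lf g" if "f \<in> W" "g \<in> W" for f g by (rule lf(1)[OF that])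
        show "lf (\<lambda>x. c * f x) = c * lf f" if "f \<in> W" for f c by (rule lf(2)[OF that])
        show "lf f = 0" if "f \<in> W" "B f f = 0" for f by (rule lf(3)[OF that])
      qed
      then show ?thesis using that by blast
    qed
    have "\<exists>c. \<forall>c'. B (?s c) (?s c') = B (b j) (?s c')"
    proof (rule insert.IH[OF J])
      show "B (b j) (\<lambda>x. f x + g x) = B (b j) f + B (b j) g" if "f \<in> W" "g \<in> W" for f g
        using Badd[OF that jW] Bsym[OF jW] that addW by simp
      show "B (b j) (\<lambda>x. c * f x) = c * B (b j) f" if "f \<in> W" for f c
        using Bscale[OF that jW] Bsym[OF jW] that scaleW by simp
      show "B (b j) f = 0" if "f \<in> W" "B f f = 0" for f
        using CS[OF jW that(1)] that(2) by simp
    qed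
    then obtain c1 where c1: "\<And>c'. B (?s c1) (?s c') = B (b j) (?s c')" by blast
    \<comment> \<open>\<open>b j\<close> minus its projection, hence orthogonal to the span of the
      earlier functions.\<close>
    define e where "e x = b j x + (- 1) * ?s c1 x" for x
    have eW: "e \<in> W" unfolding e_def by (intro addW scaleW jW sW)
    have orth: "B e (?s c') = 0" for c'
      unfolding e_def using Badd[OF jW scaleW[OF sW] sW, of "-1" c1 c'] Bscale[OF sW sW, of "-1" c1 c'] c1[of c'] by simp
    \<comment> \<open>If \<open>B e e = 0\<close>, then \<open>lf e = 0\<close> as well and the
      coefficient 0 solves the equation.\<close>
    define \<alpha> where "\<alpha> = (if B e e = 0 then 0 else lf e / B e e)"
    have \<alpha>: "\<alpha> * B e e = lf e" using lf(3)[OF eW] by (auto simp: \<alpha>_def)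
    define c where "c i = (if i = j then \<alpha> else c0 i - \<alpha> * c1 i)" for i
    have cs: "(\<lambda>x. \<Sum>i\<in>insert j J. c i * b i x) = (\<lambda>x. ?s c0 x + \<alpha> * e x)"
    proof
      fix x
      have "(\<Sum>i\<in>J. c i * b i x) = (\<Sum>i\<in>J. c0 i * b i x - \<alpha> * (c1 i * b i x))"
        using insert.hyps(2) by (intro sum.cong) (auto simp: c_def algebra_simps)
      then show "(\<Sum>i\<in>insert j J. c i * b i x) = ?s c0 x + \<alpha> * e x"
        using insert.hyps(1,2) unfolding sum.insert[OF insert.hyps(1,2)]
        by (simp add: c_def[of j] e_def sum_subtractf sum_negf sum_distrib_left algebra_simps)
    qed
    show ?case
    proof (intro exI[of _ c] allI)
      fix c'
      \<comment> \<open>Replacing \<open>b j\<close> by \<open>e\<close> in an expansion costs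
        \<open>c' j * c1 i\<close> in each of the other coefficients.\<close>
      define c2 where "c2 i = c' i + c' j * c1 i" for i
      have c's: "(\<lambda>x. \<Sum>i\<in>insert j J. c' i * b i x) = (\<lambda>x. ?s c2 x + c' j * e x)"
      proof
        fix x
        show "(\<Sum>i\<in>insert j J. c' i * b i x) = ?s c2 x + c' j * e x"
          using insert.hyps by (simp add: c2_def e_def sum.distrib sum_negf sum_distrib_left algebra_simps)
      qed
      let ?q = "\<lambda>x. ?s c2 x + c' j * e x"
      have qW: "?q \<in> W" by (intro addW scaleW sW eW)
      have 1: "B (?s c0) ?q = lf (?s c2)"
        using Bsym[OF sW qW, of c0] Badd[OF sW scaleW[OF eW] sW, of c2 "c' j" c0] Bscale[OF eW sW, of "c' j" c0]
          orth[of c0] c0[of c2] Bsym[OF sW sW, of c2 c0] by simp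
      have 2: "B e ?q = c' j * B e e"
        using Bsym[OF eW qW] Badd[OF sW scaleW[OF eW] eW, of c2 "c' j"] Bscale[OF eW eW, of "c' j"]
          orth[of c2] Bsym[OF sW eW, of c2] by simp
      have "B (\<lambda>x. ?s c0 x + \<alpha> * e x) ?q = lf (?s c2) + \<alpha> * (c' j * B e e)"
        using Badd[OF sW scaleW[OF eW] qW, of c0 \<alpha>] Bscale[OF eW qW, of \<alpha>] 1 2 by simp
      also have "\<dots> = lf (?s c2) + c' j * lf e" using \<alpha> by (simp add: mult.left_commute)
      also have "\<dots> = lf ?q" using lf(1)[OF sW scaleW[OF eW], of c2 "c' j"] lf(2)[OF eW, of "c' j"] by simp
      finally show "B (\<lambda>x. \<Sum>i\<in>insert j J. c i * b i x) (\<lambda>x. \<Sum>i\<in>insert j J. c' i * b i x) =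
          lf (\<lambda>x. \<Sum>i\<in>insert j J. c' i * b i x)" unfolding cs c's .
    qed
  qed
  show ?thesis
  proof (rule key[OF I order_refl])
    show "lf (\<lambda>x. f x + g x) = lf f + lf g" if "f \<in> W" "g \<in> W" for f g by (rule lf_add[OF that])
    show "lf (\<lambda>x. c * f x) = c * lf f" if "f \<in> W" for f c by (rule lf_scale[OF that])
    show "lf f = 0" if "f \<in> W" "B f f = 0" for f by (rule lf_null[OF that])
  qed
qed

section \<open>Polynomials\<close>

definition degree_set :: "int \<Rightarrow> ('d::finite \<Rightarrow> nat) set" where
  "degree_set k = {\<alpha>. int (\<Sum>i\<in>UNIV. \<alpha> i) \<le> k}"

definition monomial :: "('d \<Rightarrow> nat) \<Rightarrow> real^'d \<Rightarrow> real" where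
  "monomial \<alpha> x = (\<Prod>i\<in>UNIV. x $ i ^ \<alpha> i)"

lemma poly_space_eq: "poly_space k = {q. \<exists>c. q = (\<lambda>x. \<Sum>\<alpha>\<in>degree_set k. c \<alpha> * monomial \<alpha> x)}"
  unfolding poly_space_def degree_set_def monomial_def ..

lemma finite_degree_set: "finite (degree_set k :: ('d::finite \<Rightarrow> nat) set)"
proof (rule finite_subset)
  show "(degree_set k :: ('d \<Rightarrow> nat) set) \<subseteq> PiE UNIV (\<lambda>_. {..nat k})"
  proof
    fix \<alpha> :: "'d \<Rightarrow> nat" assume a: "\<alpha> \<in> degree_set k"
    have "\<alpha> i \<le> nat k" for i
    proof -
      have "\<alpha> i \<le> (\<Sum>i\<in>UNIV. \<alpha> i)" by (intro member_le_sum) auto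
      then have "int (\<alpha> i) \<le> int (\<Sum>i\<in>UNIV. \<alpha> i)" by (simp only: of_nat_le_iff)
      also have "\<dots> \<le> k" using a by (simp only: degree_set_def mem_Collect_eq)
      finally show ?thesis using nat_mono by fastforce
    qed
    then show "\<alpha> \<in> PiE UNIV (\<lambda>_. {..nat k})" by auto
  qed
  show "finite (PiE (UNIV :: 'd set) (\<lambda>_. {..nat k}))" by (intro finite_PiE) auto
qed

lemma poly_zero: "(\<lambda>x. 0) \<in> poly_space k"
  unfolding poly_space_eq by (auto intro: exI[of _ "\<lambda>_. 0"])

lemma poly_add:
  assumes "f \<in> poly_space k" "g \<in> poly_space k"
  shows "(\<lambda>x. f x + g x) \<in> poly_space k"
proof -
  obtain c d where "f = (\<lambda>x. \<Sum>\<alpha>\<in>degree_set k. c \<alpha> * monomial \<alpha> x)" "g = (\<lambda>x. \<Sum>\<alpha>\<in>degree_set k. d \<alpha> * monomial \<alpha> x)"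
    using assms unfolding poly_space_eq by blast
  then show ?thesis unfolding poly_space_eq
    by (auto intro!: exI[of _ "\<lambda>\<alpha>. c \<alpha> + d \<alpha>"] simp: sum.distrib algebra_simps)
qed

lemma poly_scale:
  assumes "f \<in> poly_space k"
  shows "(\<lambda>x. a * f x) \<in> poly_space k"
proof -
  obtain c where "f = (\<lambda>x. \<Sum>\<alpha>\<in>degree_set k. c \<alpha> * monomial \<alpha> x)"
    using assms unfolding poly_space_eq by blast
  then show ?thesis unfolding poly_space_eq
    by (auto intro!: exI[of _ "\<lambda>\<alpha>. a * c \<alpha>"] simp: sum_distrib_left algebra_simps)
qed

lemma poly_diff:
  assumes "f \<in> poly_space k" "g \<in> poly_space k"
  shows "(\<lambda>x. f x - g x) \<in> poly_space k"
  using poly_add[OF assms(1) poly_scale[OF assms(2), of "-1"]] by simp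

lemma poly_sum:
  "(\<And>i. i \<in> I \<Longrightarrow> f i \<in> poly_space k) \<Longrightarrow> (\<lambda>x. \<Sum>i\<in>I. f i x) \<in> poly_space k"
  by (induction I rule: infinite_finite_induct) (auto intro: poly_zero poly_add)

lemma poly_monomial:
  assumes "\<alpha> \<in> degree_set k"
  shows "monomial \<alpha> \<in> poly_space k"
proof -
  have "monomial \<alpha> x = (\<Sum>\<beta>\<in>degree_set k. (if \<beta> = \<alpha> then 1 else 0) * monomial \<beta> x)" for x
  proof -
    have "(\<Sum>\<beta>\<in>degree_set k. (if \<beta> = \<alpha> then 1 else 0) * monomial \<beta> x) = (\<Sum>\<beta>\<in>degree_set k. if \<beta> = \<alpha> then monomial \<alpha> x else 0)"
      by (intro sum.cong) auto
    also have "\<dots> = monomial \<alpha> x" using assms by (subst sum.delta[OF finite_degree_set]) auto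
    finally show ?thesis by simp
  qed
  then show ?thesis unfolding poly_space_eq by (auto intro!: exI[of _ "\<lambda>\<beta>. if \<beta> = \<alpha> then 1 else 0"])
qed

lemma poly_mono:
  assumes "k \<le> l"
  shows "poly_space k \<subseteq> poly_space l"
proof
  fix q :: "real^'d \<Rightarrow> real" assume "q \<in> poly_space k"
  then obtain c where "q = (\<lambda>x. \<Sum>\<alpha>\<in>degree_set k. c \<alpha> * monomial \<alpha> x)" unfolding poly_space_eq by blast
  moreover have "\<alpha> \<in> degree_set l" if "\<alpha> \<in> degree_set k" for \<alpha> :: "'d \<Rightarrow> nat"
    using that assms by (simp add: degree_set_def)
  ultimately show "q \<in> poly_space l" by (auto intro!: poly_sum poly_scale poly_monomial)
qed

lemma poly_const:
  assumes "0 \<le> k"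
  shows "(\<lambda>x. c) \<in> poly_space k"
proof -
  have "(\<lambda>_. 0) \<in> degree_set k" using assms by (simp add: degree_set_def)
  from poly_scale[OF poly_monomial[OF this], of c] show ?thesis by (simp add: monomial_def)
qed

lemma C1_power_component: "C1 (\<lambda>x. x $ i ^ n)"
  by (induction n) auto

lemma C1_monomial: "C1 (monomial \<alpha>)"
  unfolding monomial_def[abs_def] by (intro C1_prod C1_power_component)

lemma poly_C1: "q \<in> poly_space k \<Longrightarrow> C1 q"
  unfolding poly_space_eq by (auto intro!: C1_sum C1_mult C1_monomial)

lemma gradient_power: "gradient (\<lambda>x. x $ i ^ n) x = (real n * x $ i ^ (n - 1)) *\<^sub>R axis i 1"
proof (induction n)
  case (Suc n)
  have "gradient (\<lambda>x. x $ i ^ Suc n) x = x $ i *\<^sub>R (real n * x $ i ^ (n - 1)) *\<^sub>R axis i 1 + x $ i ^ n *\<^sub>R axis i 1"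
    unfolding power_Suc gradient_mult[OF C1_component C1_power_component] gradient_component Suc ..
  moreover have "x $ i * (real n * x $ i ^ (n - 1)) = real n * x $ i ^ n" by (cases n) auto
  then have "x $ i *\<^sub>R (real n * x $ i ^ (n - 1)) *\<^sub>R (axis i 1 :: real^'a) = (real n * x $ i ^ n) *\<^sub>R axis i 1"
    by (simp only: scaleR_scaleR)
  ultimately show ?case by (simp add: distrib_right scaleR_add_left)
qed simp

lemma gradient_prod:
  fixes f :: "'i \<Rightarrow> real^'d \<Rightarrow> real"
  assumes "finite I" "\<And>i. i \<in> I \<Longrightarrow> C1 (f i)"
  shows "gradient (\<lambda>x. \<Prod>i\<in>I. f i x) x = (\<Sum>i\<in>I. (\<Prod>j\<in>I - {i}. f j x) *\<^sub>R gradient (f i) x)"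
  using assms
proof (induction I rule: finite_induct)
  case (insert a I)
  have "gradient (\<lambda>x. \<Prod>i\<in>insert a I. f i x) x = gradient (\<lambda>x. f a x * (\<Prod>i\<in>I. f i x)) x"
    using insert.hyps by simp
  also have "\<dots> = f a x *\<^sub>R gradient (\<lambda>x. \<Prod>i\<in>I. f i x) x + (\<Prod>i\<in>I. f i x) *\<^sub>R gradient (f a) x"
    using insert.prems by (intro gradient_mult C1_prod) auto
  also have "gradient (\<lambda>x. \<Prod>i\<in>I. f i x) x = (\<Sum>i\<in>I. (\<Prod>j\<in>I - {i}. f j x) *\<^sub>R gradient (f i) x)"
    using insert by simp
  also have "f a x *\<^sub>R \<dots> = (\<Sum>i\<in>I. (\<Prod>j\<in>insert a I - {i}. f j x) *\<^sub>R gradient (f i) x)"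
    unfolding scaleR_sum_right
  proof (rule sum.cong[OF refl])
    fix i assume i: "i \<in> I"
    have "insert a I - {i} = insert a (I - {i})" using i insert.hyps by auto
    then show "f a x *\<^sub>R (\<Prod>j\<in>I - {i}. f j x) *\<^sub>R gradient (f i) x = (\<Prod>j\<in>insert a I - {i}. f j x) *\<^sub>R gradient (f i) x"
      using insert.hyps by simp
  qed
  also have "(\<Prod>i\<in>I. f i x) *\<^sub>R gradient (f a) x = (\<Prod>j\<in>insert a I - {a}. f j x) *\<^sub>R gradient (f a) x"
    using insert.hyps by simp
  finally show ?case using insert.hyps by (simp add: add.commute)
qed simp

lemma poly_gradient:
  assumes "q \<in> poly_space k"
  shows "(\<lambda>x. gradient q x $ i) \<in> poly_space (k - 1)"
proof -
  have mono: "(\<lambda>x. gradient (monomial \<alpha>) x $ i) \<in> poly_space (k - 1)" if \<alpha>: "\<alpha> \<in> degree_set k" for \<alpha>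
  proof -
    have eq: "gradient (monomial \<alpha>) x $ i = real (\<alpha> i) * monomial (\<alpha>(i := \<alpha> i - 1)) x" for x
    proof -
      have "gradient (monomial \<alpha>) x $ i = (\<Sum>j\<in>UNIV. (\<Prod>l\<in>UNIV - {j}. x $ l ^ \<alpha> l) * (gradient (\<lambda>x. x $ j ^ \<alpha> j) x $ i))"
        unfolding monomial_def[abs_def] by (subst gradient_prod) (auto simp: C1_power_component)
      also have "\<dots> = (\<Sum>j\<in>UNIV. if j = i then (\<Prod>l\<in>UNIV - {i}. x $ l ^ \<alpha> l) * (real (\<alpha> i) * x $ i ^ (\<alpha> i - 1)) else 0)"
        by (intro sum.cong) (auto simp: gradient_power axis_def)
      also have "\<dots> = real (\<alpha> i) * (x $ i ^ (\<alpha> i - 1) * (\<Prod>l\<in>UNIV - {i}. x $ l ^ \<alpha> l))" by simp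
      also have "x $ i ^ (\<alpha> i - 1) * (\<Prod>l\<in>UNIV - {i}. x $ l ^ \<alpha> l) = monomial (\<alpha>(i := \<alpha> i - 1)) x"
        unfolding monomial_def by (subst prod.remove[of UNIV i]) (auto intro!: arg_cong2[where f = "(*)"] prod.cong)
      finally show ?thesis .
    qed
    show ?thesis
    \<comment> \<open>For \<open>\<alpha> i = 0\<close> the truncated exponent
      \<open>\<alpha> i - 1\<close> stays 0 and the degree does not drop, but then the coefficient
      \<open>real (\<alpha> i)\<close> vanishes.\<close>
    proof (cases "\<alpha> i = 0")
      case True
      then show ?thesis unfolding eq by (simp add: poly_zero)
    next
      case False
      have "(\<Sum>j\<in>UNIV. \<alpha> j) = Suc (\<Sum>j\<in>UNIV. (\<alpha>(i := \<alpha> i - 1)) j)"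
        using False by (simp add: sum.remove[of UNIV i])
      then have "int (\<Sum>j\<in>UNIV. \<alpha> j) = int (\<Sum>j\<in>UNIV. (\<alpha>(i := \<alpha> i - 1)) j) + 1" by (simp only: of_nat_Suc)
      then have "\<alpha>(i := \<alpha> i - 1) \<in> degree_set (k - 1)"
        using \<alpha> unfolding degree_set_def mem_Collect_eq by linarith
      then show ?thesis unfolding eq by (intro poly_scale poly_monomial)
    qed
  qed
  obtain a where a: "q = (\<lambda>x. \<Sum>\<alpha>\<in>degree_set k. a \<alpha> * monomial \<alpha> x)" using assms unfolding poly_space_eq by blast
  have "gradient q x $ i = (\<Sum>\<alpha>\<in>degree_set k. a \<alpha> * (gradient (monomial \<alpha>) x $ i))" for x
    unfolding a by (subst gradient_sum) (auto simp: gradient_cmult C1_monomial intro!: C1_mult)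
  then show ?thesis using mono by (auto intro!: poly_sum poly_scale)
qed

lemma poly_gradient_inner:
  assumes "q \<in> poly_space k"
  shows "(\<lambda>x. gradient q x \<bullet> n) \<in> poly_space (k - 1)"
  unfolding inner_vec_def inner_real_def mult.commute[of _ "n $ _"]
  by (intro poly_sum poly_scale poly_gradient assms)

lemma poly_laplacian:
  assumes "q \<in> poly_space k"
  shows "laplacian q \<in> poly_space (k - 2)"
proof -
  have "k - 1 - 1 = k - 2" by simp
  then show ?thesis
    unfolding laplacian_def[abs_def] using poly_gradient[OF poly_gradient[OF assms]] by (intro poly_sum) metis
qed

lemma poly_continuous: "q \<in> poly_space k \<Longrightarrow> continuous_on S q"
  using poly_C1 C1_continuous by blast

lemma poly_continuous_gradient: "q \<in> poly_space k \<Longrightarrow> continuous_on S (gradient q)"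
  using poly_C1 C1_continuous_gradient by blast

section \<open>Orthogonal projections\<close>

lemma L2_sum: "(\<And>i. i \<in> I \<Longrightarrow> L2 N (f i)) \<Longrightarrow> L2 N (\<lambda>x. \<Sum>i\<in>I. f i x)"
  by (induction I rule: infinite_finite_induct) (auto intro: L2_add)

lemma L2_cong_space: "(\<And>x. x \<in> space N \<Longrightarrow> f x = g x) \<Longrightarrow> L2 N f \<longleftrightarrow> L2 N g"
  unfolding L2_def using measurable_cong[of N f g borel]
  by (metis (no_types, lifting) Bochner_Integration.integrable_cong)

text \<open>The functions \<open>b\<close> need only span \<open>W\<close>, as monomials restricted
  to a face can be dependent. \<open>definite\<close> says that elements of \<open>W\<close> are
  normalised representatives, which makes the projection unique as a function and not just up to
  null sets.\<close>

locale L2_subspace =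
  fixes N :: "'a measure" and I :: "'i set" and b :: "'i \<Rightarrow> 'a \<Rightarrow> real" and W :: "('a \<Rightarrow> real) set"
  assumes finite_I: "finite I" and L2_b: "i \<in> I \<Longrightarrow> L2 N (b i)"
    and W_eq: "W = {f. \<exists>c. f = (\<lambda>x. \<Sum>i\<in>I. c i * b i x)}"
    and definite: "d \<in> W \<Longrightarrow> AE x in N. d x = 0 \<Longrightarrow> d = (\<lambda>x. 0)"
begin

lemma W_zero: "(\<lambda>x. 0) \<in> W"
  unfolding W_eq by (auto intro: exI[of _ "\<lambda>_. 0"])

lemma W_add: "f \<in> W \<Longrightarrow> g \<in> W \<Longrightarrow> (\<lambda>x. f x + g x) \<in> W"
  unfolding W_eq
proof clarify
  fix c d :: "'i \<Rightarrow> real"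
  show "\<exists>c'. (\<lambda>x. (\<Sum>i\<in>I. c i * b i x) + (\<Sum>i\<in>I. d i * b i x)) = (\<lambda>x. \<Sum>i\<in>I. c' i * b i x)"
    by (rule exI[of _ "\<lambda>i. c i + d i"]) (simp add: sum.distrib algebra_simps)
qed

lemma W_scale: "f \<in> W \<Longrightarrow> (\<lambda>x. a * f x) \<in> W"
  unfolding W_eq
proof clarify
  fix c :: "'i \<Rightarrow> real"
  show "\<exists>c'. (\<lambda>x. a * (\<Sum>i\<in>I. c i * b i x)) = (\<lambda>x. \<Sum>i\<in>I. c' i * b i x)"
    by (rule exI[of _ "\<lambda>i. a * c i"]) (simp add: sum_distrib_left algebra_simps)
qed

lemma W_L2: "f \<in> W \<Longrightarrow> L2 N f"
  unfolding W_eq using L2_b by (auto intro!: L2_sum L2_mult_left)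

lemma b_W: "i \<in> I \<Longrightarrow> b i \<in> W"
proof -
  assume i: "i \<in> I"
  have "b i x = (\<Sum>j\<in>I. (if j = i then 1 else 0) * b j x)" for x
  proof -
    have "(\<Sum>j\<in>I. (if j = i then 1 else 0) * b j x) = (\<Sum>j\<in>I. if j = i then b i x else 0)"
      by (intro sum.cong) auto
    then show ?thesis using i finite_I by simp
  qed
  then show ?thesis unfolding W_eq mem_Collect_eq by (intro exI[of _ "\<lambda>j. if j = i then 1 else 0"]) (rule ext)
qed

lemma riesz:
  assumes v: "L2 N v"
  obtains r where "r \<in> W" "\<And>q. q \<in> W \<Longrightarrow> (\<integral>x. (v x - r x) * q x \<partial>N) = 0"
proof -
  have "\<exists>c. \<forall>c'. (\<integral>x. (\<Sum>i\<in>I. c i * b i x) * (\<Sum>i\<in>I. c' i * b i x) \<partial>N) = (\<integral>x. v x * (\<Sum>i\<in>I. c' i * b i x) \<partial>N)"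
  proof (rule finite_dim_riesz[where W = W and B = "\<lambda>f g. \<integral>x. f x * g x \<partial>N" and lf = "\<lambda>f. \<integral>x. v x * f x \<partial>N"])
    show "(\<integral>x. v x * f x \<partial>N) = 0" if "f \<in> W" "(\<integral>x. f x * f x \<partial>N) = 0" for f
    proof -
      have "L2_norm N f = 0" using that(2) by (simp add: L2_norm_def power2_eq_square)
      from definite[OF that(1) L2_norm_eq_0_AE[OF W_L2[OF that(1)] this]] show ?thesis by simp
    qed
    show "(\<integral>x. (f x + g x) * h x \<partial>N) = (\<integral>x. f x * h x \<partial>N) + (\<integral>x. g x * h x \<partial>N)" if "f \<in> W" "g \<in> W" "h \<in> W" for f g h
      unfolding distrib_right by (intro Bochner_Integration.integral_add L2_integrable_mult W_L2 that)
    show "(\<integral>x. v x * (f x + g x) \<partial>N) = (\<integral>x. v x * f x \<partial>N) + (\<integral>x. v x * g x \<partial>N)" if "f \<in> W" "g \<in> W" for f g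
      unfolding distrib_left by (intro Bochner_Integration.integral_add L2_integrable_mult v W_L2 that)
  qed (auto simp: finite_I b_W W_zero W_add W_scale mult.commute mult.left_commute)
  then obtain c where c: "\<And>c'. (\<integral>x. (\<Sum>i\<in>I. c i * b i x) * (\<Sum>i\<in>I. c' i * b i x) \<partial>N) = (\<integral>x. v x * (\<Sum>i\<in>I. c' i * b i x) \<partial>N)"
    by blast
  define r where "r x = (\<Sum>i\<in>I. c i * b i x)" for x
  have r: "r \<in> W" unfolding W_eq r_def by blast
  show ?thesis
  proof (rule that[OF r])
    fix q assume q: "q \<in> W"
    then obtain c' where "q = (\<lambda>x. \<Sum>i\<in>I. c' i * b i x)" unfolding W_eq by blast
    then have "(\<integral>x. r x * q x \<partial>N) = (\<integral>x. v x * q x \<partial>N)" using c[of c'] by (simp add: r_def)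
    then show "(\<integral>x. (v x - r x) * q x \<partial>N) = 0"
      using L2_integrable_mult[OF v W_L2[OF q]] L2_integrable_mult[OF W_L2[OF r] W_L2[OF q]]
      by (simp add: left_diff_distrib)
  qed
qed

lemma proj_unique:
  assumes v: "L2 N v" and r: "r \<in> W" "\<And>q. q \<in> W \<Longrightarrow> (\<integral>x. (v x - r x) * q x \<partial>N) = 0"
    and s: "s \<in> W" "\<And>q. q \<in> W \<Longrightarrow> (\<integral>x. (v x - s x) * q x \<partial>N) = 0"
  shows "r = s"
proof -
  define d where "d x = r x + (- 1) * s x" for x
  have d: "d \<in> W" unfolding d_def by (intro W_add W_scale r s)
  have "(\<integral>x. d x * d x \<partial>N) = (\<integral>x. (v x - s x) * d x - (v x - r x) * d x \<partial>N)"
    by (intro Bochner_Integration.integral_cong) (auto simp: d_def algebra_simps)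
  also have "\<dots> = 0"
    using r(2)[OF d] s(2)[OF d] L2_integrable_mult[OF L2_diff[OF v W_L2[OF r(1)]] W_L2[OF d]]
      L2_integrable_mult[OF L2_diff[OF v W_L2[OF s(1)]] W_L2[OF d]] by simp
  finally have "L2_norm N d = 0" by (simp add: L2_norm_def power2_eq_square)
  from definite[OF d L2_norm_eq_0_AE[OF W_L2[OF d] this]] show ?thesis
    by (auto simp: d_def fun_eq_iff)
qed

lemma proj_eqI:
  assumes "L2 N v" "r \<in> W" "\<And>q. q \<in> W \<Longrightarrow> (\<integral>x. (v x - r x) * q x \<partial>N) = 0"
  shows "L2_proj N W v = r"
  unfolding L2_proj_def using proj_unique[OF assms(1)] assms(2,3) by (intro the_equality) blast+

lemma proj:
  assumes "L2 N v"
  shows "L2_proj N W v \<in> W" "q \<in> W \<Longrightarrow> (\<integral>x. (v x - L2_proj N W v x) * q x \<partial>N) = 0"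
proof -
  obtain r where r: "r \<in> W" "\<And>q. q \<in> W \<Longrightarrow> (\<integral>x. (v x - r x) * q x \<partial>N) = 0"
    using riesz[OF assms] by metis
  from proj_eqI[OF assms r] r show "L2_proj N W v \<in> W" "q \<in> W \<Longrightarrow> (\<integral>x. (v x - L2_proj N W v x) * q x \<partial>N) = 0"
    by auto
qed

lemma proj_id: "v \<in> W \<Longrightarrow> L2_proj N W v = v"
  by (rule proj_eqI) (auto simp: W_L2)

lemma proj_cong_AE:
  assumes "L2 N v" "L2 N w" "AE x in N. v x = w x"
  shows "L2_proj N W v = L2_proj N W w"
proof (rule proj_eqI[OF assms(1) proj(1)[OF assms(2)]])
  fix q assume q: "q \<in> W"
  note P = W_L2[OF proj(1)[OF assms(2)]]
  have "(\<integral>x. (v x - L2_proj N W w x) * q x \<partial>N) = (\<integral>x. (w x - L2_proj N W w x) * q x \<partial>N)"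
    using assms(3) borel_measurable_integrable[OF L2_integrable_mult[OF L2_diff[OF assms(1) P] W_L2[OF q]]]
      borel_measurable_integrable[OF L2_integrable_mult[OF L2_diff[OF assms(2) P] W_L2[OF q]]]
    by (intro integral_cong_AE) (auto elim: AE_mp)
  then show "(\<integral>x. (v x - L2_proj N W w x) * q x \<partial>N) = 0" using proj(2)[OF assms(2) q] by simp
qed

lemma proj_add:
  assumes "L2 N v" "L2 N w"
  shows "L2_proj N W (\<lambda>x. v x + w x) = (\<lambda>x. L2_proj N W v x + L2_proj N W w x)"
proof (rule proj_eqI[OF L2_add[OF assms] W_add[OF proj(1)[OF assms(1)] proj(1)[OF assms(2)]]])
  fix q assume q: "q \<in> W"
  have "(\<integral>x. ((v x + w x) - (L2_proj N W v x + L2_proj N W w x)) * q x \<partial>N) =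
      (\<integral>x. (v x - L2_proj N W v x) * q x + (w x - L2_proj N W w x) * q x \<partial>N)"
    by (intro Bochner_Integration.integral_cong) (auto simp: algebra_simps)
  also have "\<dots> = 0"
    using proj(2)[OF assms(1) q] proj(2)[OF assms(2) q]
      L2_integrable_mult[OF L2_diff[OF assms(1) W_L2[OF proj(1)[OF assms(1)]]] W_L2[OF q]]
      L2_integrable_mult[OF L2_diff[OF assms(2) W_L2[OF proj(1)[OF assms(2)]]] W_L2[OF q]] by simp
  finally show "(\<integral>x. ((v x + w x) - (L2_proj N W v x + L2_proj N W w x)) * q x \<partial>N) = 0" .
qed

lemma proj_scale:
  assumes "L2 N v"
  shows "L2_proj N W (\<lambda>x. a * v x) = (\<lambda>x. a * L2_proj N W v x)"
proof (rule proj_eqI[OF L2_mult_left[OF assms] W_scale[OF proj(1)[OF assms]]])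
  fix q assume q: "q \<in> W"
  have "(\<integral>x. (a * v x - a * L2_proj N W v x) * q x \<partial>N) = (\<integral>x. a * ((v x - L2_proj N W v x) * q x) \<partial>N)"
    by (intro Bochner_Integration.integral_cong) (auto simp: algebra_simps)
  then show "(\<integral>x. (a * v x - a * L2_proj N W v x) * q x \<partial>N) = 0" using proj(2)[OF assms q] by simp
qed

end

text \<open>By continuity and full support the gradient vanishes on all of \<open>K\<close>;
  convexity makes the function constant, and the constant has zero mean. The second conclusion is
  the definiteness behind uniqueness of the reconstruction.\<close>

lemma (in solid_polytope) zero_gradient_zero_mean:
  assumes f: "C1 f" and g: "(\<integral>x. gradient f x \<bullet> gradient f x \<partial>lebesgue_on K) = 0" and m: "(\<integral>x. f x \<partial>lebesgue_on K) = 0"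
  shows "x \<in> K \<Longrightarrow> gradient f x = 0" "x \<in> K \<Longrightarrow> f x = 0"
proof -
  have "L2_norm (lebesgue_on K) (gradient f) = 0" using g by (simp add: L2_norm_def power2_norm_eq_inner)
  from L2_norm_eq_0_AE[OF L2_continuous[OF C1_continuous_gradient[OF f]] this]
  show g0: "x \<in> K \<Longrightarrow> gradient f x = 0" for x by (rule full_support[OF C1_continuous_gradient[OF f]])
  have "(f has_derivative (\<lambda>h. 0)) (at x within K)" if "x \<in> K" for x
    using C1_gderiv[OF f, of x] g0[OF that] by (auto simp: gderiv_def intro: has_derivative_at_withinI)
  then obtain c where c: "\<And>x. x \<in> K \<Longrightarrow> f x = c" using has_derivative_zero_constant[OF convex] by metis
  have "(\<integral>x. (norm c)\<^sup>2 \<partial>lebesgue_on K) = c * (\<integral>x. c \<partial>lebesgue_on K)" by (simp add: power2_eq_square)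
  also have "(\<integral>x. c \<partial>lebesgue_on K) = (\<integral>x. f x \<partial>lebesgue_on K)"
    using c by (intro Bochner_Integration.integral_cong) auto
  finally have "L2_norm (lebesgue_on K) (\<lambda>x. c) = 0" using m by (simp add: L2_norm_def)
  from L2_norm_eq_0_AE[OF L2_continuous this] have ae: "AE x in lebesgue_on K. c = 0" by simp
  obtain y where "y \<in> K" using nonempty by auto
  from full_support[OF _ ae this] have "c = 0" by simp
  with c show "x \<in> K \<Longrightarrow> f x = 0" by simp
qed

lemma gradient_cong_open:
  assumes "open S" "x \<in> S" "\<And>y. y \<in> S \<Longrightarrow> v y = q y" "C1 q"
  shows "gradient v x = gradient q x"
proof (rule gradient_eq)
  have "(q has_derivative (\<lambda>h. h \<bullet> gradient q x)) (at x)" using C1_gderiv[OF assms(4), of x] by (simp add: gderiv_def)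
  then show "gderiv v x (gradient q x)"
    unfolding gderiv_def by (rule has_derivative_transform_within_open[OF _ assms(1,2)]) (simp add: assms(3))
qed

lemma (in bounded_open) is_weak_grad_cong_grad:
  assumes "L2 (lebesgue_on A) v" "is_weak_grad A v g" "AE x in lebesgue_on A. g x = h x"
  shows "is_weak_grad A v h"
proof (rule is_weak_gradI[OF assms(1)])
  have "L2 (lebesgue_on A) g" using assms(2) by (simp add: is_weak_grad_def)
  then show "L2 (lebesgue_on A) h" by (rule L2_lebesgue_on_cong_AE[OF sets_A _ assms(3)])
  fix \<phi> i assume \<phi>: "\<phi> \<in> test_functions A"
  have "(\<integral>x. \<phi> x * h x $ i \<partial>lebesgue_on A) = (\<integral>x. \<phi> x * g x $ i \<partial>lebesgue_on A)"
    by (rule integral_lebesgue_on_cong_AE[OF sets_A], rule AE_mp[OF assms(3)]) simp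
  then show "(\<integral>x. v x * gradient \<phi> x $ i \<partial>lebesgue_on A) = - (\<integral>x. \<phi> x * h x $ i \<partial>lebesgue_on A)"
    using weak_grad_pairing[OF assms(1) \<phi> assms(2), of "axis i 1"] by (simp add: cart_eq_inner_axis)
qed

section \<open>Piecewise polynomials\<close>

context polytopal_mesh
begin

lemma bounded_open_interior: "K \<in> M \<Longrightarrow> bounded_open (interior K)"
  using interior_in bounded_subset[OF bounded_A] by (intro bounded_open.intro) auto

lemma broken_rep:
  assumes "v \<in> broken_poly M k" "K \<in> M"
  obtains q where "q \<in> poly_space k" "\<And>x. x \<in> interior K \<Longrightarrow> v x = q x"
  using assms unfolding broken_poly_def by blast

lemma broken_outside: "v \<in> broken_poly M k \<Longrightarrow> x \<notin> (\<Union>K\<in>M. interior K) \<Longrightarrow> v x = 0"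
  unfolding broken_poly_def by blast

lemma broken_zero: "(\<lambda>x. 0) \<in> broken_poly M k"
  unfolding broken_poly_def using poly_zero by fastforce

lemma broken_add:
  assumes "v \<in> broken_poly M k" "w \<in> broken_poly M k"
  shows "(\<lambda>x. v x + w x) \<in> broken_poly M k"
  unfolding broken_poly_def mem_Collect_eq
proof (intro conjI ballI allI impI)
  fix K assume K: "K \<in> M"
  obtain q where q: "q \<in> poly_space k" "\<And>x. x \<in> interior K \<Longrightarrow> v x = q x" using broken_rep[OF assms(1) K] by blast
  obtain r where r: "r \<in> poly_space k" "\<And>x. x \<in> interior K \<Longrightarrow> w x = r x" using broken_rep[OF assms(2) K] by blast
  show "\<exists>q\<in>poly_space k. \<forall>x\<in>interior K. v x + w x = q x"
    using poly_add[OF q(1) r(1)] q(2) r(2) by (intro bexI[of _ "\<lambda>x. q x + r x"]) auto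
qed (use broken_outside[OF assms(1)] broken_outside[OF assms(2)] in auto)

lemma broken_scale:
  assumes "v \<in> broken_poly M k"
  shows "(\<lambda>x. c * v x) \<in> broken_poly M k"
  unfolding broken_poly_def mem_Collect_eq
proof (intro conjI ballI allI impI)
  fix K assume K: "K \<in> M"
  obtain q where q: "q \<in> poly_space k" "\<And>x. x \<in> interior K \<Longrightarrow> v x = q x" using broken_rep[OF assms(1) K] by blast
  show "\<exists>q\<in>poly_space k. \<forall>x\<in>interior K. c * v x = q x"
    using poly_scale[OF q(1)] q(2) by (intro bexI[of _ "\<lambda>x. c * q x"]) auto
qed (use broken_outside[OF assms] in auto)

lemma broken_diff:
  assumes "v \<in> broken_poly M k" "w \<in> broken_poly M k"
  shows "(\<lambda>x. v x - w x) \<in> broken_poly M k"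
  using broken_add[OF assms(1) broken_scale[OF assms(2), of "- 1"]] by simp

lemma broken_mono: "k \<le> l \<Longrightarrow> broken_poly M k \<subseteq> broken_poly M l"
  using poly_mono[of k l] unfolding broken_poly_def by blast

lemma broken_sum: "(\<And>i. i \<in> I \<Longrightarrow> f i \<in> broken_poly M k) \<Longrightarrow> (\<lambda>x. \<Sum>i\<in>I. f i x) \<in> broken_poly M k"
  by (induction I rule: infinite_finite_induct) (auto intro: broken_zero broken_add)

lemma indicator_interior_unique:
  assumes "K \<in> M" "x \<in> interior K"
  shows "(\<Sum>L\<in>M. indicator (interior L) x * f L) = (f K :: real)"
proof -
  have "(\<Sum>L\<in>M. indicator (interior L) x * f L) = (\<Sum>L\<in>M. if L = K then f K else 0)"
    using assms disjoint by (intro sum.cong) (auto simp: indicator_def)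
  then show ?thesis using finite_M assms by simp
qed

lemma broken_glue:
  assumes "\<And>K. K \<in> M \<Longrightarrow> q K \<in> poly_space k"
  shows "(\<lambda>x. \<Sum>K\<in>M. indicator (interior K) x * q K x) \<in> broken_poly M k"
  unfolding broken_poly_def mem_Collect_eq
proof (intro conjI ballI allI impI)
  fix K assume K: "K \<in> M"
  show "\<exists>r\<in>poly_space k. \<forall>x\<in>interior K. (\<Sum>K\<in>M. indicator (interior K) x * q K x) = r x"
    using assms[OF K] indicator_interior_unique[OF K, of _ "\<lambda>L. q L _"] by (intro bexI[of _ "q K"]) auto
next
  fix x assume "x \<notin> (\<Union>K\<in>M. interior K)"
  then show "(\<Sum>K\<in>M. indicator (interior K) x * q K x) = 0" by (intro sum.neutral) auto
qed

lemma broken_decomp: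
  assumes "v \<in> broken_poly M k"
  shows "\<exists>q. (\<forall>K\<in>M. q K \<in> poly_space k) \<and> (\<forall>K\<in>M. \<forall>x\<in>interior K. v x = q K x) \<and>
    v = (\<lambda>x. \<Sum>K\<in>M. indicator (interior K) x * q K x)"
proof -
  have "\<forall>K. \<exists>q. K \<in> M \<longrightarrow> q \<in> poly_space k \<and> (\<forall>x\<in>interior K. v x = q x)"
    using assms unfolding broken_poly_def by blast
  then obtain q where q: "\<And>K. K \<in> M \<Longrightarrow> q K \<in> poly_space k" "\<And>K x. K \<in> M \<Longrightarrow> x \<in> interior K \<Longrightarrow> v x = q K x"
    by metis
  have "v x = (\<Sum>K\<in>M. indicator (interior K) x * q K x)" for x
  proof (cases "x \<in> (\<Union>K\<in>M. interior K)")
    case True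
    then obtain K where K: "K \<in> M" "x \<in> interior K" by blast
    then show ?thesis using q(2)[OF K] indicator_interior_unique[OF K, of "\<lambda>K. q K x"] by simp
  next
    case False
    then have "(\<Sum>K\<in>M. indicator (interior K) x * q K x) = 0" by (intro sum.neutral) auto
    then show ?thesis using broken_outside[OF assms False] by simp
  qed
  then have "v = (\<lambda>x. \<Sum>K\<in>M. indicator (interior K) x * q K x)" by (rule ext)
  with q show ?thesis by blast
qed

lemma broken_L2:
  assumes "v \<in> broken_poly M k"
  shows "L2 (lebesgue_on \<Omega>) v"
proof -
  from broken_decomp[OF assms] obtain q where Q: "(\<forall>K\<in>M. q K \<in> poly_space k) \<and> (\<forall>K\<in>M. \<forall>x\<in>interior K. v x = q K x) \<and>
    v = (\<lambda>x. \<Sum>K\<in>M. indicator (interior K) x * q K x)" by (elim exE)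
  have q: "\<And>K. K \<in> M \<Longrightarrow> q K \<in> poly_space k" "\<And>K x. K \<in> M \<Longrightarrow> x \<in> interior K \<Longrightarrow> v x = q K x"
    "v = (\<lambda>x. \<Sum>K\<in>M. indicator (interior K) x * q K x)"
    using Q by blast+
  have "L2 (lebesgue_on \<Omega>) (\<lambda>x. indicator (interior K) x *\<^sub>R q K x)" if K: "K \<in> M" for K
    using L2_C1[OF poly_C1[OF q(1)[OF K]]]
    by (intro L2_bounded_mult[where B = 1] measurable_restrict_space1 borel_measurable_indicator AE_I2)
       (auto simp: indicator_def)
  then show ?thesis unfolding q(3) by (intro L2_sum) auto
qed

lemma broken_gradient:
  assumes "K \<in> M" "q \<in> poly_space k" "\<And>x. x \<in> interior K \<Longrightarrow> v x = q x" "x \<in> interior K"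
  shows "gradient v x = gradient q x"
  by (rule gradient_cong_open[OF open_interior assms(4,3) poly_C1[OF assms(2)]])

lemma broken_gradient_L2:
  assumes "v \<in> broken_poly M k"
  shows "L2 (lebesgue_on \<Omega>) (gradient v)"
proof -
  from broken_decomp[OF assms] obtain q where Q: "(\<forall>K\<in>M. q K \<in> poly_space k) \<and> (\<forall>K\<in>M. \<forall>x\<in>interior K. v x = q K x) \<and>
    v = (\<lambda>x. \<Sum>K\<in>M. indicator (interior K) x * q K x)" by (elim exE)
  have q: "\<And>K. K \<in> M \<Longrightarrow> q K \<in> poly_space k" "\<And>K x. K \<in> M \<Longrightarrow> x \<in> interior K \<Longrightarrow> v x = q K x"
    "v = (\<lambda>x. \<Sum>K\<in>M. indicator (interior K) x * q K x)"
    using Q by blast+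
  have 1: "L2 (lebesgue_on \<Omega>) (\<lambda>x. indicator (interior K) x *\<^sub>R gradient (q K) x)" if K: "K \<in> M" for K
    using L2_grad_C1[OF poly_C1[OF q(1)[OF K]]]
    by (intro L2_bounded_mult[where B = 1] measurable_restrict_space1 borel_measurable_indicator AE_I2)
       (auto simp: indicator_def)
  have "L2 (lebesgue_on \<Omega>) (\<lambda>x. \<Sum>K\<in>M. indicator (interior K) x *\<^sub>R gradient (q K) x)"
    using 1 by (intro L2_sum) auto
  then show ?thesis
  proof (rule L2_lebesgue_on_cong_AE[OF sets_A], intro AE_on_\<Omega>)
    fix K assume K: "K \<in> M"
    have "(\<Sum>K\<in>M. indicator (interior K) x *\<^sub>R gradient (q K) x) = gradient v x" if x: "x \<in> interior K" for x
    proof -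
      have "(\<Sum>L\<in>M. indicator (interior L) x *\<^sub>R gradient (q L) x) = (\<Sum>L\<in>M. if L = K then gradient (q K) x else 0)"
        using K x disjoint by (intro sum.cong) (auto simp: indicator_def)
      then show ?thesis using finite_M K broken_gradient[OF K q(1)[OF K] q(2)[OF K] x] by simp
    qed
    then show "AE x in lebesgue_on (interior K). (\<Sum>K\<in>M. indicator (interior K) x *\<^sub>R gradient (q K) x) = gradient v x"
      by (intro AE_I2) simp
  qed
qed

lemma broken_AE_poly:
  assumes "K \<in> M" "q \<in> poly_space k" "\<And>x. x \<in> interior K \<Longrightarrow> v x = q x"
  shows "AE x in lebesgue_on K. v x = q x" "AE x in lebesgue_on K. gradient v x = gradient q x"
  using assms(3) broken_gradient[OF assms] by (auto intro!: AE_on_K[OF assms(1)])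

lemma broken_is_weak_grad:
  assumes v: "v \<in> broken_poly M k" and K: "K \<in> M"
  shows "is_weak_grad (interior K) v (gradient v)"
proof -
  interpret i: bounded_open "interior K" by (rule bounded_open_interior[OF K])
  obtain q where q: "q \<in> poly_space k" "\<And>x. x \<in> interior K \<Longrightarrow> v x = q x" using broken_rep[OF v K] by blast
  have Lq: "L2 (lebesgue_on (interior K)) q"
    by (intro L2_lebesgue_on_continuous i.bounded_A poly_continuous[OF q(1)]) simp
  have Lv: "L2 (lebesgue_on (interior K)) v"
    by (rule L2_lebesgue_on_subset[OF _ sets_A interior_in[OF K] broken_L2[OF v]]) simp
  have "is_weak_grad (interior K) v (gradient q)"
    by (rule i.is_weak_grad_cong[OF Lq _ i.C1_is_weak_grad[OF poly_C1[OF q(1)]]]) (auto simp: q(2))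
  then show ?thesis
    by (rule i.is_weak_grad_cong_grad[OF Lv]) (use broken_gradient[OF K q] in auto)
qed

lemma broken_eqI:
  assumes v: "v \<in> broken_poly M k" and w: "w \<in> broken_poly M k"
    and eq: "\<And>K x. K \<in> M \<Longrightarrow> x \<in> interior K \<Longrightarrow> v x = w x"
  shows "v = w"
proof
  fix x
  show "v x = w x"
    using eq broken_outside[OF v, of x] broken_outside[OF w, of x] by (cases "x \<in> (\<Union>K\<in>M. interior K)") auto
qed

text \<open>Definiteness is the point: a polynomial vanishing almost everywhere on an element
  vanishes there by full support, and the representatives are zero off the interiors.\<close>

lemma broken_L2_subspace:
  "L2_subspace (lebesgue_on \<Omega>) (M \<times> degree_set k) (\<lambda>(K, \<alpha>) x. indicator (interior K) x * monomial \<alpha> x) (broken_poly M k)"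
proof
  show "finite (M \<times> degree_set k)" using finite_M finite_degree_set by (rule finite_cartesian_product)
  have b: "(\<lambda>x. indicator (interior K) x * monomial \<alpha> x) \<in> broken_poly M k" if "K \<in> M" "\<alpha> \<in> degree_set k" for K \<alpha>
  proof -
    have "(\<lambda>x. \<Sum>L\<in>M. indicator (interior L) x * (if L = K then monomial \<alpha> x else 0)) \<in> broken_poly M k"
    proof (rule broken_glue)
      fix L
      show "(\<lambda>x. if L = K then monomial \<alpha> x else 0) \<in> poly_space k"
        using poly_monomial[OF that(2)] poly_zero[of k] by (cases "L = K") auto
    qed
    moreover have "(\<Sum>L\<in>M. indicator (interior L) x * (if L = K then monomial \<alpha> x else 0)) = indicator (interior K) x * monomial \<alpha> x" for x
    proof -
      have "(\<Sum>L\<in>M. indicator (interior L) x * (if L = K then monomial \<alpha> x else 0)) = (\<Sum>L\<in>M. if L = K then indicator (interior K) x * monomial \<alpha> x else 0)"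
        by (intro sum.cong) auto
      then show ?thesis using finite_M that(1) by simp
    qed
    ultimately show ?thesis by simp
  qed
  show "L2 (lebesgue_on \<Omega>) ((\<lambda>(K, \<alpha>) x. indicator (interior K) x * monomial \<alpha> x) i)" if "i \<in> M \<times> degree_set k" for i
    using that broken_L2[OF b] by auto
  show "broken_poly M k = {f. \<exists>c. f = (\<lambda>x. \<Sum>i\<in>M \<times> degree_set k. c i * (\<lambda>(K, \<alpha>) x. indicator (interior K) x * monomial \<alpha> x) i x)}"
  proof (intro equalityI subsetI)
    fix v assume v: "v \<in> broken_poly M k"
    from broken_decomp[OF v] obtain q where Q: "(\<forall>K\<in>M. q K \<in> poly_space k) \<and> (\<forall>K\<in>M. \<forall>x\<in>interior K. v x = q K x) \<and>
    v = (\<lambda>x. \<Sum>K\<in>M. indicator (interior K) x * q K x)" by (elim exE)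
    have q: "\<And>K. K \<in> M \<Longrightarrow> q K \<in> poly_space k" "\<And>K x. K \<in> M \<Longrightarrow> x \<in> interior K \<Longrightarrow> v x = q K x"
      "v = (\<lambda>x. \<Sum>K\<in>M. indicator (interior K) x * q K x)"
      using Q by blast+
    have "\<forall>K. \<exists>c. K \<in> M \<longrightarrow> q K = (\<lambda>x. \<Sum>\<alpha>\<in>degree_set k. c \<alpha> * monomial \<alpha> x)"
      using q(1) unfolding poly_space_eq by blast
    then obtain c where c: "\<And>K. K \<in> M \<Longrightarrow> q K = (\<lambda>x. \<Sum>\<alpha>\<in>degree_set k. c K \<alpha> * monomial \<alpha> x)" by metis
    have "v x = (\<Sum>i\<in>M \<times> degree_set k. (\<lambda>(K, \<alpha>). c K \<alpha>) i * (\<lambda>(K, \<alpha>) x. indicator (interior K) x * monomial \<alpha> x) i x)" for x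
    proof -
      have "v x = (\<Sum>K\<in>M. \<Sum>\<alpha>\<in>degree_set k. c K \<alpha> * (indicator (interior K) x * monomial \<alpha> x))"
        unfolding q(3) by (intro sum.cong refl) (simp add: c sum_distrib_left mult_ac)
      then show ?thesis unfolding sum.cartesian_product' by simp
    qed
    then show "v \<in> {f. \<exists>c. f = (\<lambda>x. \<Sum>i\<in>M \<times> degree_set k. c i * (\<lambda>(K, \<alpha>) x. indicator (interior K) x * monomial \<alpha> x) i x)}"
      by blast
  next
    fix v assume "v \<in> {f. \<exists>c. f = (\<lambda>x. \<Sum>i\<in>M \<times> degree_set k. c i * (\<lambda>(K, \<alpha>) x. indicator (interior K) x * monomial \<alpha> x) i x)}"
    then obtain c where c: "v = (\<lambda>x. \<Sum>i\<in>M \<times> degree_set k. c i * (\<lambda>(K, \<alpha>) x. indicator (interior K) x * monomial \<alpha> x) i x)" by blast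
    show "v \<in> broken_poly M k" unfolding c by (intro broken_sum broken_scale) (use b in auto)
  qed
  fix d assume d: "d \<in> broken_poly M k" and z: "AE x in lebesgue_on \<Omega>. d x = 0"
  show "d = (\<lambda>x. 0)"
  proof (rule broken_eqI[OF d broken_zero])
    fix K x assume K: "K \<in> M" and x: "x \<in> interior K"
    interpret k: solid_polytope K by (rule solid[OF K])
    obtain q where q: "q \<in> poly_space k" "\<And>x. x \<in> interior K \<Longrightarrow> d x = q x" using broken_rep[OF d K] by blast
    have "AE x in lebesgue_on K. d x = q x" by (rule broken_AE_poly(1)[OF K q])
    with AE_\<Omega>_on_K[OF K z] have "AE x in lebesgue_on K. q x = 0" by eventually_elim simp
    then show "d x = 0" using k.full_support[OF poly_continuous[OF q(1)], of x] q(2)[OF x] x interior_subset by auto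
  qed
qed

text \<open>Every point of \<open>K\<close> is a limit of interior points, so the one-sided limit is
  nontrivial and equals the value of the continuous polynomial.\<close>

lemma trace_from_eq:
  assumes K: "K \<in> M" and q: "q \<in> poly_space k" "\<And>x. x \<in> interior K \<Longrightarrow> v x = q x" and x: "x \<in> K"
  shows "trace_from K v x = q x"
  unfolding trace_from_def
proof (rule tendsto_Lim)
  interpret k: solid_polytope K by (rule solid[OF K])
  have "x islimpt interior K"
  proof -
    have "x \<in> closure (interior K)" using k.closure_interior x by simp
    then show ?thesis using interior_limit_point[of x "interior K"] by (auto simp: closure_def)
  qed
  then show "at x within interior K \<noteq> bot" using trivial_limit_within by blast
  have "(q \<longlongrightarrow> q x) (at x within interior K)"
    using poly_continuous[OF q(1), of UNIV] by (auto simp: continuous_on_eq_continuous_at isCont_def intro: tendsto_within_subset)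
  then show "(v \<longlongrightarrow> q x) (at x within interior K)"
    by (rule Lim_transform_eventually) (auto simp: eventually_at_filter q(2))
qed

section \<open>Piecewise polynomials on the skeleton and polynomials on a face\<close>

lemma skeleton_rep:
  assumes "v \<in> skeleton_poly \<Omega> M k" "F \<in> mesh_faces \<Omega> M"
  obtains q where "q \<in> poly_space k" "\<And>x. x \<in> rel_interior F \<Longrightarrow> v x = q x"
  using assms unfolding skeleton_poly_def by blast

lemma skeleton_zero: "(\<lambda>x. 0) \<in> skeleton_poly \<Omega> M k"
  unfolding skeleton_poly_def using poly_zero by fastforce

lemma skeleton_add:
  assumes "v \<in> skeleton_poly \<Omega> M k" "w \<in> skeleton_poly \<Omega> M k"
  shows "(\<lambda>x. v x + w x) \<in> skeleton_poly \<Omega> M k"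
  unfolding skeleton_poly_def mem_Collect_eq
proof (intro conjI ballI allI impI)
  fix F assume F: "F \<in> mesh_faces \<Omega> M"
  obtain q where q: "q \<in> poly_space k" "\<And>x. x \<in> rel_interior F \<Longrightarrow> v x = q x" using skeleton_rep[OF assms(1) F] by blast
  obtain r where r: "r \<in> poly_space k" "\<And>x. x \<in> rel_interior F \<Longrightarrow> w x = r x" using skeleton_rep[OF assms(2) F] by blast
  show "\<exists>q\<in>poly_space k. \<forall>x\<in>rel_interior F. v x + w x = q x"
    using poly_add[OF q(1) r(1)] q(2) r(2) by (intro bexI[of _ "\<lambda>x. q x + r x"]) auto
qed (use assms in \<open>auto simp: skeleton_poly_def\<close>)

lemma skeleton_scale:
  assumes "v \<in> skeleton_poly \<Omega> M k"
  shows "(\<lambda>x. c * v x) \<in> skeleton_poly \<Omega> M k"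
  unfolding skeleton_poly_def mem_Collect_eq
proof (intro conjI ballI allI impI)
  fix F assume F: "F \<in> mesh_faces \<Omega> M"
  obtain q where q: "q \<in> poly_space k" "\<And>x. x \<in> rel_interior F \<Longrightarrow> v x = q x" using skeleton_rep[OF assms(1) F] by blast
  show "\<exists>q\<in>poly_space k. \<forall>x\<in>rel_interior F. c * v x = q x"
    using poly_scale[OF q(1)] q(2) by (intro bexI[of _ "\<lambda>x. c * q x"]) auto
qed (use assms in \<open>auto simp: skeleton_poly_def\<close>)

lemma face_AE_rel_interior: "F \<in> mesh_faces \<Omega> M \<Longrightarrow> AE x in face_measure F. x \<in> rel_interior F"
  using mesh_face_cases solid solid_polytope.AE_rel_interior by metis

lemma rel_interior_face_borel: "F \<in> mesh_faces \<Omega> M \<Longrightarrow> rel_interior F \<in> sets borel"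
  using mesh_face_cases solid solid_polytope.rel_interior_borel by metis

text \<open>\<open>face_measure\<close> lives on Borel sets without completion, so almost everywhere
  equality with a polynomial gives no measurability; it is read off from the finitely many relative
  interiors instead.\<close>

lemma skeleton_measurable:
  assumes v: "v \<in> skeleton_poly \<Omega> M k"
  shows "v \<in> borel_measurable borel"
proof (rule measurableI)
  fix B :: "real set" assume B: "B \<in> sets borel"
  have "\<forall>F. \<exists>q. F \<in> mesh_faces \<Omega> M \<longrightarrow> q \<in> poly_space k \<and> (\<forall>x\<in>rel_interior F. v x = q x)"
    using v unfolding skeleton_poly_def by blast
  then obtain q where q: "\<And>F. F \<in> mesh_faces \<Omega> M \<Longrightarrow> q F \<in> poly_space k"
    "\<And>F x. F \<in> mesh_faces \<Omega> M \<Longrightarrow> x \<in> rel_interior F \<Longrightarrow> v x = q F x" by metis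
  let ?U = "\<Union>F\<in>mesh_faces \<Omega> M. rel_interior F"
  have out: "v x = 0" if "x \<notin> ?U" for x using v that unfolding skeleton_poly_def by blast
  have U: "?U \<in> sets borel" using finite_mesh_faces rel_interior_face_borel by (intro sets.finite_UN) auto
  have eq: "v -` B = (\<Union>F\<in>mesh_faces \<Omega> M. rel_interior F \<inter> (q F -` B)) \<union> (if 0 \<in> B then - ?U else {})"
    using q(2) out by (auto split: if_splits) metis+
  have "q F -` B \<in> sets borel" if "F \<in> mesh_faces \<Omega> M" for F
    using measurable_sets[OF C1_measurable[OF poly_C1[OF q(1)[OF that]]] B] by simp
  then have "(\<Union>F\<in>mesh_faces \<Omega> M. rel_interior F \<inter> (q F -` B)) \<in> sets borel"
    using finite_mesh_faces rel_interior_face_borel by (intro sets.finite_UN) auto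
  moreover have "(if 0 \<in> B then - ?U else {}) \<in> sets borel" using U using borel_comp[OF U] by (cases "0 \<in> B") simp_all
  ultimately show "v -` B \<inter> space borel \<in> sets borel" using eq by auto
qed simp

lemma skeleton_AE_poly:
  assumes "F \<in> mesh_faces \<Omega> M" "\<And>x. x \<in> rel_interior F \<Longrightarrow> v x = q x"
  shows "AE x in face_measure F. v x = q x"
  using face_AE_rel_interior[OF assms(1)] by eventually_elim (rule assms(2))

lemma skeleton_L2:
  assumes v: "v \<in> skeleton_poly \<Omega> M k" and F: "F \<in> mesh_faces \<Omega> M"
  shows "L2 (face_measure F) v"
proof -
  interpret f: flat_face F by (rule mesh_face_flat[OF F])
  obtain q where q: "q \<in> poly_space k" "\<And>x. x \<in> rel_interior F \<Longrightarrow> v x = q x" using skeleton_rep[OF v F] by blast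
  have "AE x in face_measure F. v x = q x" by (rule skeleton_AE_poly[OF F q(2)])
  then have "AE x in face_measure F. q x = v x" by eventually_elim simp
  then show ?thesis
    by (intro L2_cong_AE[OF L2_face_C1[OF F poly_C1[OF q(1)]]] f.borel_imp_face_measurable skeleton_measurable[OF v])
qed

text \<open>Definiteness comes from the full support of the surface measure. Distinct polynomials
  may agree on the face, which is why the space consists of their truncations to
  \<open>F\<close>.\<close>

lemma poly_on_L2_subspace:
  assumes F: "F \<in> mesh_faces \<Omega> M"
  shows "L2_subspace (face_measure F) (degree_set k) (\<lambda>\<alpha> x. if x \<in> F then monomial \<alpha> x else 0) (poly_on F k)"
proof
  interpret f: flat_face F by (rule mesh_face_flat[OF F])
  obtain K where K: "K \<in> M" "F \<in> faces_of K" using mesh_face_cases[OF F] by blast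
  interpret k: solid_polytope K by (rule solid[OF K(1)])
  show "finite (degree_set k :: ('d \<Rightarrow> nat) set)" by (rule finite_degree_set)
  show "L2 (face_measure F) (\<lambda>x. if x \<in> F then monomial \<alpha> x else 0)" if "\<alpha> \<in> degree_set k" for \<alpha>
    using L2_face_C1[OF F C1_monomial, of \<alpha>] by (subst L2_cong_space[of _ _ "monomial \<alpha>"]) auto
  show "poly_on F k = {f. \<exists>c. f = (\<lambda>x. \<Sum>\<alpha>\<in>degree_set k. c \<alpha> * (if x \<in> F then monomial \<alpha> x else 0))}"
    (is "_ = ?R")
  proof -
    have "(\<Sum>\<alpha>\<in>degree_set k. c \<alpha> * (if x \<in> F then monomial \<alpha> x else 0)) = (if x \<in> F then \<Sum>\<alpha>\<in>degree_set k. c \<alpha> * monomial \<alpha> x else 0)"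
      for c :: "('d \<Rightarrow> nat) \<Rightarrow> real" and x by simp
    then show ?thesis unfolding poly_on_def poly_space_eq by auto
  qed
  fix d assume d: "d \<in> poly_on F k" and z: "AE x in face_measure F. d x = 0"
  obtain q where q: "q \<in> poly_space k" "d = (\<lambda>x. if x \<in> F then q x else 0)" using d unfolding poly_on_def by blast
  have "AE x in face_measure F. x \<in> F" by (intro AE_I2) simp
  then have "AE x in face_measure F. q x = 0" using z unfolding q(2) by eventually_elim simp
  then have "q x = 0" if "x \<in> F" for x
    by (rule k.face_measure_full_support[OF K(2) poly_continuous[OF q(1)] _ that])
  then show "d = (\<lambda>x. 0)" unfolding q(2) by auto
qed

text \<open>\<open>Green\<close> in the \<open>i\<close>-th coordinate direction, tested with the
  \<open>i\<close>-th partial derivative of \<open>q\<close>, summed over \<open>i\<close>.\<close>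

lemma Green_laplacian:
  assumes v: "v \<in> H10 \<Omega>" and g: "is_trace \<Omega> M v g" and K: "K \<in> M" and q: "q \<in> poly_space k"
  shows "(\<integral>x. weak_grad \<Omega> v x \<bullet> gradient q x \<partial>lebesgue_on K) = - (\<integral>x. v x * laplacian q x \<partial>lebesgue_on K) +
    (\<Sum>F\<in>faces_of K. \<integral>x. g x * (gradient q x \<bullet> outer_normal K F) \<partial>face_measure F)"
proof -
  interpret k: solid_polytope K by (rule solid[OF K])
  let ?q = "\<lambda>i x. gradient q x $ i"
  have pq: "?q i \<in> poly_space (k - 1)" for i by (rule poly_gradient[OF q])
  have v1: "v \<in> H1 \<Omega>" using v by (rule H10_H1)
  have Lv: "L2 (lebesgue_on K) v" "L2 (lebesgue_on K) (weak_grad \<Omega> v)"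
    by (intro L2_on_K(1)[OF K] H1_D(1,3)[OF v1])+
  have i1: "integrable (lebesgue_on K) (\<lambda>x. v x * (gradient (?q i) x \<bullet> axis i 1))" for i
    by (intro L2_integrable_mult Lv L2_inner_const k.L2_continuous poly_continuous_gradient[OF pq])
  have i2: "integrable (lebesgue_on K) (\<lambda>x. (weak_grad \<Omega> v x \<bullet> axis i 1) * ?q i x)" for i
    by (intro L2_integrable_mult Lv L2_inner_const k.L2_continuous poly_continuous[OF pq])
  have Green_i: "(\<integral>x. v x * (gradient (?q i) x \<bullet> axis i 1) \<partial>lebesgue_on K) + (\<integral>x. (weak_grad \<Omega> v x \<bullet> axis i 1) * ?q i x \<partial>lebesgue_on K) =
      (\<Sum>F\<in>faces_of K. (outer_normal K F \<bullet> axis i 1) * (\<integral>x. g x * ?q i x \<partial>face_measure F))" for i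
    by (rule Green[OF v g K poly_C1[OF pq]]) simp
  have "(\<integral>x. v x * laplacian q x \<partial>lebesgue_on K) = (\<Sum>i\<in>UNIV. \<integral>x. v x * (gradient (?q i) x \<bullet> axis i 1) \<partial>lebesgue_on K)"
  proof -
    have "v x * laplacian q x = (\<Sum>i\<in>UNIV. v x * (gradient (?q i) x \<bullet> axis i 1))" for x
      unfolding laplacian_def sum_distrib_left by (simp add: inner_axis)
    then show ?thesis using i1 by (simp add: Bochner_Integration.integral_sum)
  qed
  moreover have "(\<integral>x. weak_grad \<Omega> v x \<bullet> gradient q x \<partial>lebesgue_on K) = (\<Sum>i\<in>UNIV. \<integral>x. (weak_grad \<Omega> v x \<bullet> axis i 1) * ?q i x \<partial>lebesgue_on K)"
  proof -
    have "weak_grad \<Omega> v x \<bullet> gradient q x = (\<Sum>i\<in>UNIV. (weak_grad \<Omega> v x \<bullet> axis i 1) * ?q i x)" for x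
      unfolding inner_axis by (simp add: inner_vec_def)
    then show ?thesis using i2 by (simp add: Bochner_Integration.integral_sum)
  qed
  moreover have "(\<Sum>F\<in>faces_of K. \<integral>x. g x * (gradient q x \<bullet> outer_normal K F) \<partial>face_measure F) =
      (\<Sum>i\<in>UNIV. \<Sum>F\<in>faces_of K. (outer_normal K F \<bullet> axis i 1) * (\<integral>x. g x * ?q i x \<partial>face_measure F))"
  proof (subst sum.swap, rule sum.cong[OF refl])
    fix F assume "F \<in> faces_of K"
    then have F: "F \<in> mesh_faces \<Omega> M" using faces_in[OF K] by blast
    have Lg: "L2 (face_measure F) g" using g F by (simp add: is_trace_def)
    have "integrable (face_measure F) (\<lambda>x. (outer_normal K F \<bullet> axis i 1) * (g x * ?q i x))" for i
      by (intro integrable_mult_right L2_integrable_mult Lg L2_face_C1[OF F poly_C1[OF pq]])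
    then have "(\<Sum>i\<in>UNIV. \<integral>x. (outer_normal K F \<bullet> axis i 1) * (g x * ?q i x) \<partial>face_measure F) =
        (\<integral>x. (\<Sum>i\<in>UNIV. (outer_normal K F \<bullet> axis i 1) * (g x * ?q i x)) \<partial>face_measure F)"
      by (intro Bochner_Integration.integral_sum[symmetric])
    moreover have "(\<Sum>i\<in>UNIV. (outer_normal K F \<bullet> axis i 1) * (g x * ?q i x)) = g x * (gradient q x \<bullet> outer_normal K F)" for x
      by (simp add: inner_vec_def[of "gradient q x"] inner_axis sum_distrib_left mult_ac)
    ultimately show "(\<integral>x. g x * (gradient q x \<bullet> outer_normal K F) \<partial>face_measure F) =
        (\<Sum>i\<in>UNIV. (outer_normal K F \<bullet> axis i 1) * (\<integral>x. g x * ?q i x \<partial>face_measure F))" by simp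
  qed
  moreover have "(\<Sum>i\<in>UNIV. \<integral>x. v x * (gradient (?q i) x \<bullet> axis i 1) \<partial>lebesgue_on K) + (\<Sum>i\<in>UNIV. \<integral>x. (weak_grad \<Omega> v x \<bullet> axis i 1) * ?q i x \<partial>lebesgue_on K) =
      (\<Sum>i\<in>UNIV. \<Sum>F\<in>faces_of K. (outer_normal K F \<bullet> axis i 1) * (\<integral>x. g x * ?q i x \<partial>face_measure F))"
    unfolding sum.distrib[symmetric] Green_i ..
  ultimately show ?thesis by linarith
qed

end

section \<open>The hybrid high-order method\<close>

section \<open>The reconstruction\<close>

lemma laplacian_add:
  assumes "f \<in> poly_space k" "g \<in> poly_space k"
  shows "laplacian (\<lambda>x. f x + g x) x = laplacian f x + laplacian g x"
proof -
  have "gradient (\<lambda>x. f x + g x) y = gradient f y + gradient g y" for y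
    by (intro gradient_add poly_C1[OF assms(1)] poly_C1[OF assms(2)])
  then show ?thesis
    unfolding laplacian_def
    by (simp add: gradient_add poly_C1[OF poly_gradient[OF assms(1)]] poly_C1[OF poly_gradient[OF assms(2)]] sum.distrib)
qed

lemma laplacian_scale:
  assumes "f \<in> poly_space k"
  shows "laplacian (\<lambda>x. c * f x) x = c * laplacian f x"
proof -
  have "gradient (\<lambda>x. c * f x) y = c *\<^sub>R gradient f y" for y
    by (intro gradient_cmult poly_C1[OF assms(1)])
  then show ?thesis
    unfolding laplacian_def
    by (simp add: gradient_cmult poly_C1[OF poly_gradient[OF assms(1)]] sum_distrib_left)
qed

locale hho_method = polytopal_mesh \<Omega> M for \<Omega> :: "(real^'d) set" and M +
  fixes p :: nat
begin

abbreviation S\<^sub>H :: "'d hybrid set" where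
  "S\<^sub>H \<equiv> hho_space \<Omega> M p"

abbreviation R :: "'d hybrid \<Rightarrow> real^'d \<Rightarrow> real" where
  "R \<equiv> hho_reconstruction M p"

lemma S\<^sub>H_D: "s \<in> S\<^sub>H \<Longrightarrow> fst s \<in> broken_poly M (int p)" "s \<in> S\<^sub>H \<Longrightarrow> snd s \<in> skeleton_poly \<Omega> M (int p)"
  unfolding hho_space_def by auto

lemma S\<^sub>H_add:
  assumes "s \<in> S\<^sub>H" "t \<in> S\<^sub>H"
  shows "s + t \<in> S\<^sub>H"
proof -
  have "fst (s + t) = (\<lambda>x. fst s x + fst t x)" "snd (s + t) = (\<lambda>x. snd s x + snd t x)"
    by (simp_all add: fun_eq_iff)
  then show ?thesis
    unfolding hho_space_def mem_Times_iff
    using broken_add[OF S\<^sub>H_D(1)[OF assms(1)] S\<^sub>H_D(1)[OF assms(2)]]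
      skeleton_add[OF S\<^sub>H_D(2)[OF assms(1)] S\<^sub>H_D(2)[OF assms(2)]] by simp
qed

lemma S\<^sub>H_scale: "s \<in> S\<^sub>H \<Longrightarrow> hscale c s \<in> S\<^sub>H"
  unfolding hho_space_def hscale_def using broken_scale skeleton_scale by auto

lemma hscale_minus: "- s = hscale (- 1) s" "s - t = s + hscale (- 1) t"
  by (auto simp: hscale_def prod_eq_iff fun_eq_iff)

lemma S\<^sub>H_diff: "s \<in> S\<^sub>H \<Longrightarrow> t \<in> S\<^sub>H \<Longrightarrow> s - t \<in> S\<^sub>H"
  unfolding hscale_minus by (intro S\<^sub>H_add S\<^sub>H_scale)

lemma S\<^sub>H_minus: "s \<in> S\<^sub>H \<Longrightarrow> - s \<in> S\<^sub>H"
  unfolding hscale_minus by (intro S\<^sub>H_scale)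

lemma S\<^sub>H_zero: "0 \<in> S\<^sub>H"
  unfolding hho_space_def using broken_zero[of "int p"] skeleton_zero[of "int p"] by (simp add: zero_prod_def zero_fun_def)

text \<open>The right-hand side of the equation that defines the reconstruction, as a functional of
  the test polynomial.\<close>

definition moment :: "'d hybrid \<Rightarrow> (real^'d) set \<Rightarrow> (real^'d \<Rightarrow> real) \<Rightarrow> real" where
  "moment s K q = - (\<integral>x. fst s x * laplacian q x \<partial>lebesgue_on K)
     + (\<Sum>F\<in>faces_of K. \<integral>x. snd s x * (gradient q x \<bullet> outer_normal K F) \<partial>face_measure F)"

lemma fst_L2: "s \<in> S\<^sub>H \<Longrightarrow> K \<in> M \<Longrightarrow> L2 (lebesgue_on K) (fst s)"
  using L2_on_K(1)[OF _ broken_L2[OF S\<^sub>H_D(1)]] .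

lemma poly_L2: "K \<in> M \<Longrightarrow> q \<in> poly_space k \<Longrightarrow> L2 (lebesgue_on K) q"
  using solid_polytope.L2_continuous[OF solid] poly_continuous by blast

lemma poly_gradient_L2: "K \<in> M \<Longrightarrow> q \<in> poly_space k \<Longrightarrow> L2 (lebesgue_on K) (gradient q)"
  using solid_polytope.L2_continuous[OF solid] poly_continuous_gradient by blast

lemma poly_L2_face: "F \<in> mesh_faces \<Omega> M \<Longrightarrow> q \<in> poly_space k \<Longrightarrow> L2 (face_measure F) q"
  using L2_face_C1 poly_C1 by blast

lemma moment_integrable:
  assumes "s \<in> S\<^sub>H" "K \<in> M" "q \<in> poly_space k"
  shows "integrable (lebesgue_on K) (\<lambda>x. fst s x * laplacian q x)"
    "F \<in> faces_of K \<Longrightarrow> integrable (face_measure F) (\<lambda>x. snd s x * (gradient q x \<bullet> n))"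
proof -
  show "integrable (lebesgue_on K) (\<lambda>x. fst s x * laplacian q x)"
    by (rule L2_integrable_mult[OF fst_L2[OF assms(1,2)] poly_L2[OF assms(2) poly_laplacian[OF assms(3)]]])
  assume "F \<in> faces_of K"
  then have F: "F \<in> mesh_faces \<Omega> M" using faces_in[OF assms(2)] by blast
  show "integrable (face_measure F) (\<lambda>x. snd s x * (gradient q x \<bullet> n))"
    by (rule L2_integrable_mult[OF skeleton_L2[OF S\<^sub>H_D(2)[OF assms(1)] F] poly_L2_face[OF F poly_gradient_inner[OF assms(3), of n]]])
qed

lemma moment_add:
  assumes "s \<in> S\<^sub>H" "t \<in> S\<^sub>H" "K \<in> M" "q \<in> poly_space k"
  shows "moment (s + t) K q = moment s K q + moment t K q"
proof -
  have "(\<integral>x. fst (s + t) x * laplacian q x \<partial>lebesgue_on K) =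
      (\<integral>x. fst s x * laplacian q x \<partial>lebesgue_on K) + (\<integral>x. fst t x * laplacian q x \<partial>lebesgue_on K)"
    using moment_integrable(1)[OF assms(1,3,4)] moment_integrable(1)[OF assms(2,3,4)] by (simp add: distrib_right)
  moreover have "(\<integral>x. snd (s + t) x * (gradient q x \<bullet> outer_normal K F) \<partial>face_measure F) =
      (\<integral>x. snd s x * (gradient q x \<bullet> outer_normal K F) \<partial>face_measure F) + (\<integral>x. snd t x * (gradient q x \<bullet> outer_normal K F) \<partial>face_measure F)"
    if "F \<in> faces_of K" for F
    using moment_integrable(2)[OF assms(1,3,4) that] moment_integrable(2)[OF assms(2,3,4) that] by (simp add: distrib_right)
  ultimately show ?thesis unfolding moment_def by (simp add: sum.distrib)
qed

lemma moment_scale: "moment (hscale c s) K q = c * moment s K q"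
  unfolding moment_def by (simp add: hscale_def mult.assoc sum_distrib_left right_diff_distrib)

lemma moment_add_poly:
  assumes "s \<in> S\<^sub>H" "K \<in> M" "q \<in> poly_space k" "r \<in> poly_space k"
  shows "moment s K (\<lambda>x. q x + r x) = moment s K q + moment s K r"
proof -
  have "gradient (\<lambda>x. q x + r x) x = gradient q x + gradient r x" for x
    by (intro gradient_add poly_C1[OF assms(3)] poly_C1[OF assms(4)])
  moreover have "(\<integral>x. snd s x * ((gradient q x + gradient r x) \<bullet> outer_normal K F) \<partial>face_measure F) =
      (\<integral>x. snd s x * (gradient q x \<bullet> outer_normal K F) \<partial>face_measure F) + (\<integral>x. snd s x * (gradient r x \<bullet> outer_normal K F) \<partial>face_measure F)"
    if "F \<in> faces_of K" for F
    using moment_integrable(2)[OF assms(1-3) that] moment_integrable(2)[OF assms(1,2,4) that] by (simp add: inner_add_left distrib_left)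
  moreover have "(\<integral>x. fst s x * (laplacian q x + laplacian r x) \<partial>lebesgue_on K) =
      (\<integral>x. fst s x * laplacian q x \<partial>lebesgue_on K) + (\<integral>x. fst s x * laplacian r x \<partial>lebesgue_on K)"
    using moment_integrable(1)[OF assms(1-3)] moment_integrable(1)[OF assms(1,2,4)] by (simp add: distrib_left)
  ultimately show ?thesis
    unfolding moment_def by (simp add: laplacian_add[OF assms(3,4)] sum.distrib)
qed

lemma moment_scale_poly:
  assumes "q \<in> poly_space k"
  shows "moment s K (\<lambda>x. c * q x) = c * moment s K q"
proof -
  have "gradient (\<lambda>x. c * q x) x = c *\<^sub>R gradient q x" for x
    by (intro gradient_cmult poly_C1[OF assms])
  then show ?thesis
    unfolding moment_def by (simp add: laplacian_scale[OF assms] mult.left_commute sum_distrib_left right_diff_distrib)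
qed

text \<open>The compatibility condition of the local Neumann problem. A gradient vanishing on
  \<open>K\<close> forces the Laplacian to vanish in the interior and the normal derivatives to
  vanish on the faces.\<close>

lemma moment_zero_gradient:
  assumes K: "K \<in> M" and q: "q \<in> poly_space k" and z: "\<And>x. x \<in> K \<Longrightarrow> gradient q x = 0"
  shows "moment s K q = 0"
proof -
  interpret k: solid_polytope K by (rule solid[OF K])
  have "laplacian q x = 0" if x: "x \<in> interior K" for x
  proof -
    have "gradient (\<lambda>y. gradient q y $ i) x = 0" for i
    proof -
      have "gradient (\<lambda>y. gradient q y $ i) x = gradient (\<lambda>x. 0) x"
      proof (rule gradient_cong_open[OF open_interior x _ C1_const])
        fix y assume "y \<in> interior K"
        then have "y \<in> K" using interior_subset by blast
        then show "gradient q y $ i = 0" by (simp add: z)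
      qed
      then show ?thesis by simp
    qed
    then show ?thesis by (simp add: laplacian_def)
  qed
  then have "AE x in lebesgue_on K. fst s x * laplacian q x = 0"
    by (intro AE_on_K[OF K] AE_I2) simp
  then have 1: "(\<integral>x. fst s x * laplacian q x \<partial>lebesgue_on K) = 0" by (rule integral_eq_zero_AE)
  have "(\<integral>x. snd s x * (gradient q x \<bullet> outer_normal K F) \<partial>face_measure F) = 0" if F: "F \<in> faces_of K" for F
  proof -
    interpret f: flat_face F by (rule k.flat_facet[OF F])
    show ?thesis
      by (intro integral_eq_zero_AE AE_I2) (use z k.facet_subset[OF F] in auto)
  qed
  with 1 show ?thesis by (simp add: moment_def)
qed

definition reconstructs :: "'d hybrid \<Rightarrow> (real^'d \<Rightarrow> real) \<Rightarrow> bool" where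
  "reconstructs s r \<longleftrightarrow> r \<in> broken_poly M (int p + 1) \<and> (\<forall>K\<in>M.
     (\<forall>q\<in>poly_space (int p + 1). (\<integral>x. gradient r x \<bullet> gradient q x \<partial>lebesgue_on K) = moment s K q) \<and>
     (\<integral>x. r x \<partial>lebesgue_on K) = (\<integral>x. fst s x \<partial>lebesgue_on K))"

lemma R_eq_The: "R s = (THE r. reconstructs s r)"
  unfolding hho_reconstruction_def reconstructs_def moment_def ..

lemma broken_integral_gradient:
  assumes "K \<in> M" "q \<in> poly_space k" "\<And>x. x \<in> interior K \<Longrightarrow> v x = q x"
  shows "(\<integral>x. gradient v x \<bullet> g x \<partial>lebesgue_on K) = (\<integral>x. gradient q x \<bullet> g x \<partial>lebesgue_on K)"
    "(\<integral>x. v x \<partial>lebesgue_on K) = (\<integral>x. q x \<partial>lebesgue_on K)"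
proof -
  have "AE x in lebesgue_on K. gradient v x = gradient q x" by (rule broken_AE_poly(2)[OF assms])
  then have "AE x in lebesgue_on K. gradient v x \<bullet> g x = gradient q x \<bullet> g x" by eventually_elim simp
  then show "(\<integral>x. gradient v x \<bullet> g x \<partial>lebesgue_on K) = (\<integral>x. gradient q x \<bullet> g x \<partial>lebesgue_on K)"
    by (rule integral_lebesgue_on_cong_AE[OF K_lebesgue[OF assms(1)]])
  have "AE x in lebesgue_on K. v x = q x" by (rule broken_AE_poly(1)[OF assms])
  then show "(\<integral>x. v x \<partial>lebesgue_on K) = (\<integral>x. q x \<partial>lebesgue_on K)"
    by (rule integral_lebesgue_on_cong_AE[OF K_lebesgue[OF assms(1)]])
qed

lemma L2_integrable_K: "K \<in> M \<Longrightarrow> L2 (lebesgue_on K) f \<Longrightarrow> integrable (lebesgue_on K) f" for f :: "real^'d \<Rightarrow> real"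
  by (intro L2_integrable_finite finite_measure_lebesgue_on_bounded K_lebesgue)
     (auto intro: compact_imp_bounded solid_polytope.compact solid)

lemma reconstructs_unique:
  assumes r: "reconstructs s r" and r': "reconstructs s r'"
  shows "r = r'"
proof (rule broken_eqI)
  show b: "r \<in> broken_poly M (int p + 1)" "r' \<in> broken_poly M (int p + 1)"
    using r r' by (auto simp: reconstructs_def)
  fix K x assume K: "K \<in> M" and x: "x \<in> interior K"
  interpret k: solid_polytope K by (rule solid[OF K])
  obtain q where q: "q \<in> poly_space (int p + 1)" "\<And>x. x \<in> interior K \<Longrightarrow> r x = q x" using broken_rep[OF b(1) K] by blast
  obtain q' where q': "q' \<in> poly_space (int p + 1)" "\<And>x. x \<in> interior K \<Longrightarrow> r' x = q' x" using broken_rep[OF b(2) K] by blast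
  define d where "d x = q x - q' x" for x
  have d: "d \<in> poly_space (int p + 1)" unfolding d_def by (rule poly_diff[OF q(1) q'(1)])
  have g: "gradient d x = gradient q x - gradient q' x" for x
    unfolding d_def by (intro gradient_diff poly_C1[OF q(1)] poly_C1[OF q'(1)])
  have "(\<integral>x. gradient q x \<bullet> gradient d x \<partial>lebesgue_on K) = (\<integral>x. gradient q' x \<bullet> gradient d x \<partial>lebesgue_on K)"
  proof -
    have "(\<integral>x. gradient r x \<bullet> gradient d x \<partial>lebesgue_on K) = moment s K d"
      "(\<integral>x. gradient r' x \<bullet> gradient d x \<partial>lebesgue_on K) = moment s K d"
      using r r' K d unfolding reconstructs_def by blast+
    then show ?thesis
      using broken_integral_gradient(1)[OF K q, of "gradient d"] broken_integral_gradient(1)[OF K q', of "gradient d"] by simp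
  qed
  then have 1: "(\<integral>x. gradient d x \<bullet> gradient d x \<partial>lebesgue_on K) = 0"
    using L2_integrable_inner[OF poly_gradient_L2[OF K q(1)] poly_gradient_L2[OF K d]]
      L2_integrable_inner[OF poly_gradient_L2[OF K q'(1)] poly_gradient_L2[OF K d]]
    by (simp add: g inner_diff_left)
  have "(\<integral>x. q x \<partial>lebesgue_on K) = (\<integral>x. q' x \<partial>lebesgue_on K)"
    using r r' K broken_integral_gradient(2)[OF K q] broken_integral_gradient(2)[OF K q'] by (simp add: reconstructs_def)
  then have 2: "(\<integral>x. d x \<partial>lebesgue_on K) = 0"
    using L2_integrable_K[OF K poly_L2[OF K q(1)]] L2_integrable_K[OF K poly_L2[OF K q'(1)]] by (simp add: d_def)
  have "x \<in> K" using x interior_subset by blast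
  then have "d x = 0" by (rule k.zero_gradient_zero_mean(2)[OF poly_C1[OF d] 1 2])
  then show "r x = r' x" using q(2)[OF x] q'(2)[OF x] by (simp add: d_def)
qed

text \<open>The gradient and mean value conditions are combined into one positive definite form; testing
  with constants separates them again.\<close>

lemma reconstruction_on_element:
  assumes s: "s \<in> S\<^sub>H" and K: "K \<in> M"
  shows "\<exists>r\<in>poly_space (int p + 1).
    (\<forall>q\<in>poly_space (int p + 1). (\<integral>x. gradient r x \<bullet> gradient q x \<partial>lebesgue_on K) = moment s K q) \<and>
    (\<integral>x. r x \<partial>lebesgue_on K) = (\<integral>x. fst s x \<partial>lebesgue_on K)"
proof -
  interpret k: solid_polytope K by (rule solid[OF K])
  let ?W = "poly_space (int p + 1) :: (real^'d \<Rightarrow> real) set"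
  define B where "B f g = (\<integral>x. gradient f x \<bullet> gradient g x \<partial>lebesgue_on K) + (\<integral>x. f x \<partial>lebesgue_on K) * (\<integral>x. g x \<partial>lebesgue_on K)"
    for f g :: "real^'d \<Rightarrow> real"
  define lf where "lf q = moment s K q + (\<integral>x. fst s x \<partial>lebesgue_on K) * (\<integral>x. q x \<partial>lebesgue_on K)" for q
  have ig: "integrable (lebesgue_on K) (\<lambda>x. gradient f x \<bullet> gradient g x)" if "f \<in> ?W" "g \<in> ?W" for f g
    by (rule L2_integrable_inner[OF poly_gradient_L2[OF K that(1)] poly_gradient_L2[OF K that(2)]])
  have ii: "integrable (lebesgue_on K) f" if "f \<in> ?W" for f
    by (rule L2_integrable_K[OF K poly_L2[OF K that]])
  have pos: "0 \<le> (\<integral>x. gradient f x \<bullet> gradient f x \<partial>lebesgue_on K)" for f :: "real^'d \<Rightarrow> real"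
    by (intro Bochner_Integration.integral_nonneg) simp
  have "\<exists>c. \<forall>c'. B (\<lambda>x. \<Sum>\<alpha>\<in>degree_set (int p + 1). c \<alpha> * monomial \<alpha> x) (\<lambda>x. \<Sum>\<alpha>\<in>degree_set (int p + 1). c' \<alpha> * monomial \<alpha> x)
      = lf (\<lambda>x. \<Sum>\<alpha>\<in>degree_set (int p + 1). c' \<alpha> * monomial \<alpha> x)"
  proof (rule finite_dim_riesz[where W = ?W])
    show "finite (degree_set (int p + 1) :: ('d \<Rightarrow> nat) set)" by (rule finite_degree_set)
    show "monomial \<alpha> \<in> ?W" if "\<alpha> \<in> degree_set (int p + 1)" for \<alpha> by (rule poly_monomial[OF that])
    show "(\<lambda>x. 0) \<in> ?W" by (rule poly_zero)
    show "(\<lambda>x. f x + g x) \<in> ?W" if "f \<in> ?W" "g \<in> ?W" for f g by (rule poly_add[OF that])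
    show "(\<lambda>x. c * f x) \<in> ?W" if "f \<in> ?W" for f c by (rule poly_scale[OF that])
    show "B f g = B g f" for f g unfolding B_def by (simp add: inner_commute mult.commute)
    show "B (\<lambda>x. f x + g x) h = B f h + B g h" if "f \<in> ?W" "g \<in> ?W" "h \<in> ?W" for f g h
    proof -
      have "gradient (\<lambda>x. f x + g x) x = gradient f x + gradient g x" for x
        by (intro gradient_add poly_C1[OF that(1)] poly_C1[OF that(2)])
      then show ?thesis unfolding B_def using ig[OF that(1,3)] ig[OF that(2,3)] ii[OF that(1)] ii[OF that(2)]
        by (simp add: inner_add_left algebra_simps)
    qed
    show "B (\<lambda>x. c * f x) h = c * B f h" if "f \<in> ?W" for f h c
      unfolding B_def by (simp add: gradient_cmult[OF poly_C1[OF that]] distrib_left)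
    show "0 \<le> B f f" for f unfolding B_def using pos[of f] by simp
    show "lf (\<lambda>x. f x + g x) = lf f + lf g" if "f \<in> ?W" "g \<in> ?W" for f g
      unfolding lf_def using moment_add_poly[OF s K that] ii[OF that(1)] ii[OF that(2)] by (simp add: algebra_simps)
    show "lf (\<lambda>x. c * f x) = c * lf f" if "f \<in> ?W" for f c
      unfolding lf_def using moment_scale_poly[OF that] by (simp add: algebra_simps)
    show "lf f = 0" if f: "f \<in> ?W" and z: "B f f = 0" for f
    proof -
      have g: "(\<integral>x. gradient f x \<bullet> gradient f x \<partial>lebesgue_on K) = 0" and m: "(\<integral>x. f x \<partial>lebesgue_on K) = 0"
        using z pos[of f] unfolding B_def by (auto simp: add_nonneg_eq_0_iff)
      have "moment s K f = 0"
        by (rule moment_zero_gradient[OF K f]) (rule k.zero_gradient_zero_mean(1)[OF poly_C1[OF f] g m])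
      with m show ?thesis by (simp add: lf_def)
    qed
  qed
  then obtain c where c: "\<And>c'. B (\<lambda>x. \<Sum>\<alpha>\<in>degree_set (int p + 1). c \<alpha> * monomial \<alpha> x) (\<lambda>x. \<Sum>\<alpha>\<in>degree_set (int p + 1). c' \<alpha> * monomial \<alpha> x)
      = lf (\<lambda>x. \<Sum>\<alpha>\<in>degree_set (int p + 1). c' \<alpha> * monomial \<alpha> x)" by blast
  define r where "r x = (\<Sum>\<alpha>\<in>degree_set (int p + 1). c \<alpha> * monomial \<alpha> x)" for x
  have r: "r \<in> ?W" unfolding poly_space_eq r_def by blast
  have Bq: "B r q = lf q" if q: "q \<in> ?W" for q
  proof -
    obtain c' where "q = (\<lambda>x. \<Sum>\<alpha>\<in>degree_set (int p + 1). c' \<alpha> * monomial \<alpha> x)" using q unfolding poly_space_eq by blast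
    then show ?thesis using c[of c'] by (simp add: r_def[abs_def])
  qed
  have one: "(\<lambda>x. 1) \<in> ?W" by (rule poly_const) simp
  \<comment> \<open>The constant 1 has zero gradient, so by \<open>zero_gradient_zero_mean\<close>
    its mean cannot be zero as well.\<close>
  have vol: "(\<integral>x. 1 \<partial>lebesgue_on K) \<noteq> (0::real)"
  proof
    assume z: "(\<integral>x. 1 \<partial>lebesgue_on K) = (0::real)"
    obtain y where "y \<in> K" using k.nonempty by blast
    from k.zero_gradient_zero_mean(2)[OF C1_const _ z this] show False by simp
  qed
  have "moment s K (\<lambda>x. 1) = 0" by (rule moment_zero_gradient[OF K one]) simp
  then have mean: "(\<integral>x. r x \<partial>lebesgue_on K) = (\<integral>x. fst s x \<partial>lebesgue_on K)"
    using Bq[OF one] vol by (simp add: B_def lf_def)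
  then have "(\<integral>x. gradient r x \<bullet> gradient q x \<partial>lebesgue_on K) = moment s K q" if "q \<in> ?W" for q
    using Bq[OF that] by (simp add: B_def lf_def)
  with r mean show ?thesis by blast
qed

lemma reconstructs_exists:
  assumes s: "s \<in> S\<^sub>H"
  shows "\<exists>r. reconstructs s r"
proof -
  have "\<forall>K. \<exists>r. K \<in> M \<longrightarrow> r \<in> poly_space (int p + 1) \<and>
    (\<forall>q\<in>poly_space (int p + 1). (\<integral>x. gradient r x \<bullet> gradient q x \<partial>lebesgue_on K) = moment s K q) \<and>
    (\<integral>x. r x \<partial>lebesgue_on K) = (\<integral>x. fst s x \<partial>lebesgue_on K)"
    using reconstruction_on_element[OF s] by blast
  from choice[OF this] obtain r where Q: "\<forall>K. K \<in> M \<longrightarrow> r K \<in> poly_space (int p + 1) \<and>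
    (\<forall>q\<in>poly_space (int p + 1). (\<integral>x. gradient (r K) x \<bullet> gradient q x \<partial>lebesgue_on K) = moment s K q) \<and>
    (\<integral>x. r K x \<partial>lebesgue_on K) = (\<integral>x. fst s x \<partial>lebesgue_on K)" by (elim exE)
  have r: "\<And>K. K \<in> M \<Longrightarrow> r K \<in> poly_space (int p + 1)"
    "\<And>K q. K \<in> M \<Longrightarrow> q \<in> poly_space (int p + 1) \<Longrightarrow> (\<integral>x. gradient (r K) x \<bullet> gradient q x \<partial>lebesgue_on K) = moment s K q"
    "\<And>K. K \<in> M \<Longrightarrow> (\<integral>x. r K x \<partial>lebesgue_on K) = (\<integral>x. fst s x \<partial>lebesgue_on K)"
    using Q by blast+
  define v where "v x = (\<Sum>K\<in>M. indicator (interior K) x * r K x)" for x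
  have v: "v \<in> broken_poly M (int p + 1)" unfolding v_def by (rule broken_glue[OF r(1)])
  have vK: "v x = r K x" if "K \<in> M" "x \<in> interior K" for K x
    unfolding v_def by (rule indicator_interior_unique[OF that])
  have "reconstructs s v"
    unfolding reconstructs_def
  proof (intro conjI ballI v)
    fix K assume K: "K \<in> M"
    note vq = broken_integral_gradient[OF K r(1)[OF K] vK[OF K]]
    show "(\<integral>x. v x \<partial>lebesgue_on K) = (\<integral>x. fst s x \<partial>lebesgue_on K)" using vq(2) r(3)[OF K] by simp
    show "(\<integral>x. gradient v x \<bullet> gradient q x \<partial>lebesgue_on K) = moment s K q" if "q \<in> poly_space (int p + 1)" for q
      using vq(1)[of "gradient q"] r(2)[OF K that] by simp
  qed
  then show ?thesis by blast
qed

lemma R_reconstructs: "s \<in> S\<^sub>H \<Longrightarrow> reconstructs s (R s)"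
  unfolding R_eq_The using reconstructs_exists reconstructs_unique by (metis the_equality)

lemma R_eqI: "reconstructs s r \<Longrightarrow> R s = r"
  unfolding R_eq_The using reconstructs_unique by (intro the_equality) auto

lemma R_broken: "s \<in> S\<^sub>H \<Longrightarrow> R s \<in> broken_poly M (int p + 1)"
  using R_reconstructs by (simp add: reconstructs_def)

section \<open>Linearity of the reconstruction\<close>

lemma broken_gradient_add:
  assumes "v \<in> broken_poly M k" "w \<in> broken_poly M k" "K \<in> M" "x \<in> interior K"
  shows "gradient (\<lambda>x. v x + w x) x = gradient v x + gradient w x"
proof -
  obtain q where q: "q \<in> poly_space k" "\<And>x. x \<in> interior K \<Longrightarrow> v x = q x" using broken_rep[OF assms(1,3)] by blast
  obtain r where r: "r \<in> poly_space k" "\<And>x. x \<in> interior K \<Longrightarrow> w x = r x" using broken_rep[OF assms(2,3)] by blast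
  have "gradient (\<lambda>x. v x + w x) x = gradient (\<lambda>x. q x + r x) x"
    by (rule broken_gradient[OF assms(3) poly_add[OF q(1) r(1)] _ assms(4)]) (simp add: q(2) r(2))
  also have "\<dots> = gradient q x + gradient r x" by (intro gradient_add poly_C1[OF q(1)] poly_C1[OF r(1)])
  finally show ?thesis
    using broken_gradient[OF assms(3) q assms(4)] broken_gradient[OF assms(3) r assms(4)] by simp
qed

lemma broken_gradient_scale:
  assumes "v \<in> broken_poly M k" "K \<in> M" "x \<in> interior K"
  shows "gradient (\<lambda>x. c * v x) x = c *\<^sub>R gradient v x"
proof -
  obtain q where q: "q \<in> poly_space k" "\<And>x. x \<in> interior K \<Longrightarrow> v x = q x" using broken_rep[OF assms(1,2)] by blast
  have "gradient (\<lambda>x. c * v x) x = gradient (\<lambda>x. c * q x) x"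
    by (rule broken_gradient[OF assms(2) poly_scale[OF q(1)] _ assms(3)]) (simp add: q(2))
  also have "\<dots> = c *\<^sub>R gradient q x" by (intro gradient_cmult poly_C1[OF q(1)])
  finally show ?thesis using broken_gradient[OF assms(2) q assms(3)] by simp
qed

lemma R_add:
  assumes s: "s \<in> S\<^sub>H" and t: "t \<in> S\<^sub>H"
  shows "R (s + t) = (\<lambda>x. R s x + R t x)"
proof (rule R_eqI)
  note b = R_broken[OF s] R_broken[OF t]
  show "reconstructs (s + t) (\<lambda>x. R s x + R t x)"
    unfolding reconstructs_def
  proof (intro conjI ballI)
    show "(\<lambda>x. R s x + R t x) \<in> broken_poly M (int p + 1)" by (rule broken_add[OF b])
    fix K assume K: "K \<in> M"
    note L = L2_on_K(1)[OF K broken_gradient_L2[OF b(1)]] L2_on_K(1)[OF K broken_gradient_L2[OF b(2)]]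
    note L' = L2_integrable_K[OF K L2_on_K(1)[OF K broken_L2[OF b(1)]]] L2_integrable_K[OF K L2_on_K(1)[OF K broken_L2[OF b(2)]]]
      L2_integrable_K[OF K fst_L2[OF s K]] L2_integrable_K[OF K fst_L2[OF t K]]
    show "(\<integral>x. R s x + R t x \<partial>lebesgue_on K) = (\<integral>x. fst (s + t) x \<partial>lebesgue_on K)"
      using R_reconstructs[OF s] R_reconstructs[OF t] K L' by (simp add: reconstructs_def)
    fix q :: "real^'d \<Rightarrow> real" assume q: "q \<in> poly_space (int p + 1)"
    have "AE x in lebesgue_on K. gradient (\<lambda>x. R s x + R t x) x \<bullet> gradient q x = gradient (R s) x \<bullet> gradient q x + gradient (R t) x \<bullet> gradient q x"
      by (intro AE_on_K[OF K] AE_I2) (simp add: broken_gradient_add[OF b K] inner_add_left)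
    then have "(\<integral>x. gradient (\<lambda>x. R s x + R t x) x \<bullet> gradient q x \<partial>lebesgue_on K) =
        (\<integral>x. gradient (R s) x \<bullet> gradient q x + gradient (R t) x \<bullet> gradient q x \<partial>lebesgue_on K)"
      by (rule integral_lebesgue_on_cong_AE[OF K_lebesgue[OF K]])
    also have "\<dots> = moment s K q + moment t K q"
      using R_reconstructs[OF s] R_reconstructs[OF t] K q
        L2_integrable_inner[OF L(1) poly_gradient_L2[OF K q]] L2_integrable_inner[OF L(2) poly_gradient_L2[OF K q]]
      by (simp add: reconstructs_def)
    finally show "(\<integral>x. gradient (\<lambda>x. R s x + R t x) x \<bullet> gradient q x \<partial>lebesgue_on K) = moment (s + t) K q"
      by (simp add: moment_add[OF s t K q])
  qed
qed

lemma R_scale: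
  assumes s: "s \<in> S\<^sub>H"
  shows "R (hscale c s) = (\<lambda>x. c * R s x)"
proof (rule R_eqI)
  note b = R_broken[OF s]
  show "reconstructs (hscale c s) (\<lambda>x. c * R s x)"
    unfolding reconstructs_def
  proof (intro conjI ballI)
    show "(\<lambda>x. c * R s x) \<in> broken_poly M (int p + 1)" by (rule broken_scale[OF b])
    fix K assume K: "K \<in> M"
    show "(\<integral>x. c * R s x \<partial>lebesgue_on K) = (\<integral>x. fst (hscale c s) x \<partial>lebesgue_on K)"
      using R_reconstructs[OF s] K by (simp add: reconstructs_def hscale_def)
    fix q :: "real^'d \<Rightarrow> real" assume q: "q \<in> poly_space (int p + 1)"
    have "AE x in lebesgue_on K. gradient (\<lambda>x. c * R s x) x \<bullet> gradient q x = c * (gradient (R s) x \<bullet> gradient q x)"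
      by (intro AE_on_K[OF K] AE_I2) (simp add: broken_gradient_scale[OF b K])
    then have "(\<integral>x. gradient (\<lambda>x. c * R s x) x \<bullet> gradient q x \<partial>lebesgue_on K) =
        (\<integral>x. c * (gradient (R s) x \<bullet> gradient q x) \<partial>lebesgue_on K)"
      by (rule integral_lebesgue_on_cong_AE[OF K_lebesgue[OF K]])
    then show "(\<integral>x. gradient (\<lambda>x. c * R s x) x \<bullet> gradient q x \<partial>lebesgue_on K) = moment (hscale c s) K q"
      using R_reconstructs[OF s] K q by (simp add: reconstructs_def moment_scale)
  qed
qed

section \<open>The stabilization\<close>

abbreviation P\<^sub>M :: "(real^'d \<Rightarrow> real) \<Rightarrow> real^'d \<Rightarrow> real" where
  "P\<^sub>M \<equiv> L2_proj (lebesgue_on \<Omega>) (broken_poly M (int p))"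

abbreviation P\<^sub>F :: "(real^'d) set \<Rightarrow> (real^'d \<Rightarrow> real) \<Rightarrow> real^'d \<Rightarrow> real" where
  "P\<^sub>F F \<equiv> L2_proj (face_measure F) (poly_on F (int p))"

abbreviation residual :: "(real^'d) set \<Rightarrow> (real^'d) set \<Rightarrow> 'd hybrid \<Rightarrow> real^'d \<Rightarrow> real" where
  "residual \<equiv> hho_residual \<Omega> M p"

lemma S_eq: "hho_S \<Omega> M p s = (\<lambda>x. fst s x + (R s x - P\<^sub>M (R s) x))"
  by (simp add: hho_S_def Let_def fun_eq_iff)

lemma S_broken:
  assumes "s \<in> S\<^sub>H"
  shows "hho_S \<Omega> M p s \<in> broken_poly M (int p + 1)"
proof -
  interpret b: L2_subspace "lebesgue_on \<Omega>" "M \<times> degree_set (int p)" "\<lambda>(K, \<alpha>) x. indicator (interior K) x * monomial \<alpha> x" "broken_poly M (int p)"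
    by (rule broken_L2_subspace)
  have "fst s \<in> broken_poly M (int p + 1)" "P\<^sub>M (R s) \<in> broken_poly M (int p + 1)"
    using S\<^sub>H_D(1)[OF assms] b.proj(1)[OF broken_L2[OF R_broken[OF assms]]] broken_mono[of "int p" "int p + 1"] by auto
  then show ?thesis unfolding S_eq by (intro broken_add broken_diff R_broken assms)
qed

lemma S_add:
  assumes s: "s \<in> S\<^sub>H" and t: "t \<in> S\<^sub>H"
  shows "hho_S \<Omega> M p (s + t) x = hho_S \<Omega> M p s x + hho_S \<Omega> M p t x"
proof -
  interpret b: L2_subspace "lebesgue_on \<Omega>" "M \<times> degree_set (int p)" "\<lambda>(K, \<alpha>) x. indicator (interior K) x * monomial \<alpha> x" "broken_poly M (int p)"
    by (rule broken_L2_subspace)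
  show ?thesis
    unfolding S_eq R_add[OF s t] b.proj_add[OF broken_L2[OF R_broken[OF s]] broken_L2[OF R_broken[OF t]]] by simp
qed

lemma S_scale:
  assumes s: "s \<in> S\<^sub>H"
  shows "hho_S \<Omega> M p (hscale c s) x = c * hho_S \<Omega> M p s x"
proof -
  interpret b: L2_subspace "lebesgue_on \<Omega>" "M \<times> degree_set (int p)" "\<lambda>(K, \<alpha>) x. indicator (interior K) x * monomial \<alpha> x" "broken_poly M (int p)"
    by (rule broken_L2_subspace)
  show ?thesis
    unfolding S_eq R_scale[OF s] b.proj_scale[OF broken_L2[OF R_broken[OF s]]] by (simp add: hscale_def algebra_simps)
qed

section \<open>One-sided traces and the face residuals\<close>

lemma trace_from_broken:
  assumes K: "K \<in> M" and F: "F \<in> faces_of K" and v: "v \<in> broken_poly M k"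
  obtains q where "q \<in> poly_space k" "\<And>x. x \<in> interior K \<Longrightarrow> v x = q x" "\<And>x. x \<in> F \<Longrightarrow> trace_from K v x = q x"
proof -
  obtain q where q: "q \<in> poly_space k" "\<And>x. x \<in> interior K \<Longrightarrow> v x = q x" using broken_rep[OF v K] by blast
  have "trace_from K v x = q x" if "x \<in> F" for x
    using trace_from_eq[OF K q] that solid_polytope.facet_subset[OF solid[OF K] F] by blast
  with q show ?thesis by (rule that)
qed

lemma trace_from_L2:
  assumes K: "K \<in> M" and F: "F \<in> faces_of K" and v: "v \<in> broken_poly M k"
  shows "L2 (face_measure F) (trace_from K v)"
proof -
  have F': "F \<in> mesh_faces \<Omega> M" using F faces_in[OF K] by blast
  interpret f: flat_face F by (rule mesh_face_flat[OF F'])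
  obtain q where q: "q \<in> poly_space k" "\<And>x. x \<in> F \<Longrightarrow> trace_from K v x = q x"
    using trace_from_broken[OF K F v] by metis
  show ?thesis using poly_L2_face[OF F' q(1)] q(2) by (subst L2_cong_space[of _ _ q]) auto
qed

lemma trace_from_add:
  assumes K: "K \<in> M" and x: "x \<in> K" and v: "v \<in> broken_poly M k" and w: "w \<in> broken_poly M k"
  shows "trace_from K (\<lambda>x. v x + w x) x = trace_from K v x + trace_from K w x"
proof -
  obtain q where q: "q \<in> poly_space k" "\<And>x. x \<in> interior K \<Longrightarrow> v x = q x" using broken_rep[OF v K] by blast
  obtain r where r: "r \<in> poly_space k" "\<And>x. x \<in> interior K \<Longrightarrow> w x = r x" using broken_rep[OF w K] by blast
  have "trace_from K (\<lambda>x. v x + w x) x = q x + r x"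
    by (rule trace_from_eq[OF K poly_add[OF q(1) r(1)] _ x]) (simp add: q(2) r(2))
  then show ?thesis using trace_from_eq[OF K q x] trace_from_eq[OF K r x] by simp
qed

lemma trace_from_scale:
  assumes K: "K \<in> M" and x: "x \<in> K" and v: "v \<in> broken_poly M k"
  shows "trace_from K (\<lambda>x. c * v x) x = c * trace_from K v x"
proof -
  obtain q where q: "q \<in> poly_space k" "\<And>x. x \<in> interior K \<Longrightarrow> v x = q x" using broken_rep[OF v K] by blast
  have "trace_from K (\<lambda>x. c * v x) x = c * q x"
    by (rule trace_from_eq[OF K poly_scale[OF q(1)] _ x]) (simp add: q(2))
  then show ?thesis using trace_from_eq[OF K q x] by simp
qed

lemma residual_eq: "residual K F s = P\<^sub>F F (\<lambda>x. snd s x - trace_from K (hho_S \<Omega> M p s) x)"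
  unfolding hho_residual_def by (simp add: fun_diff_def)

lemma mismatch_L2:
  assumes K: "K \<in> M" and F: "F \<in> faces_of K" and s: "s \<in> S\<^sub>H"
  shows "L2 (face_measure F) (\<lambda>x. snd s x - trace_from K (hho_S \<Omega> M p s) x)"
proof -
  have F': "F \<in> mesh_faces \<Omega> M" using F faces_in[OF K] by blast
  show ?thesis by (intro L2_diff skeleton_L2[OF S\<^sub>H_D(2)[OF s] F'] trace_from_L2[OF K F S_broken[OF s]])
qed

lemma residual_L2:
  assumes K: "K \<in> M" and F: "F \<in> faces_of K" and s: "s \<in> S\<^sub>H"
  shows "L2 (face_measure F) (residual K F s)"
proof -
  have F': "F \<in> mesh_faces \<Omega> M" using F faces_in[OF K] by blast
  interpret q: L2_subspace "face_measure F" "degree_set (int p)" "\<lambda>\<alpha> x. if x \<in> F then monomial \<alpha> x else 0" "poly_on F (int p)"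
    by (rule poly_on_L2_subspace[OF F'])
  show ?thesis unfolding residual_eq by (intro q.W_L2 q.proj(1) mismatch_L2[OF K F s])
qed

lemma residual_add:
  assumes K: "K \<in> M" and F: "F \<in> faces_of K" and s: "s \<in> S\<^sub>H" and t: "t \<in> S\<^sub>H"
  shows "residual K F (s + t) = (\<lambda>x. residual K F s x + residual K F t x)"
proof -
  have F': "F \<in> mesh_faces \<Omega> M" using F faces_in[OF K] by blast
  interpret f: flat_face F by (rule mesh_face_flat[OF F'])
  interpret q: L2_subspace "face_measure F" "degree_set (int p)" "\<lambda>\<alpha> x. if x \<in> F then monomial \<alpha> x else 0" "poly_on F (int p)"
    by (rule poly_on_L2_subspace[OF F'])
  let ?m = "\<lambda>s x. snd s x - trace_from K (hho_S \<Omega> M p s) x"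
  have "?m (s + t) x = ?m s x + ?m t x" if "x \<in> F" for x
  proof -
    have xK: "x \<in> K" using that solid_polytope.facet_subset[OF solid[OF K] F] by blast
    have "hho_S \<Omega> M p (s + t) = (\<lambda>x. hho_S \<Omega> M p s x + hho_S \<Omega> M p t x)" using S_add[OF s t] by blast
    then show ?thesis using trace_from_add[OF K xK S_broken[OF s] S_broken[OF t]] by simp
  qed
  then have "AE x in face_measure F. ?m (s + t) x = ?m s x + ?m t x" by (intro AE_I2) simp
  from q.proj_cong_AE[OF mismatch_L2[OF K F S\<^sub>H_add[OF s t]] L2_add[OF mismatch_L2[OF K F s] mismatch_L2[OF K F t]] this]
  show ?thesis unfolding residual_eq using q.proj_add[OF mismatch_L2[OF K F s] mismatch_L2[OF K F t]] by simp
qed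

lemma residual_scale:
  assumes K: "K \<in> M" and F: "F \<in> faces_of K" and s: "s \<in> S\<^sub>H"
  shows "residual K F (hscale c s) = (\<lambda>x. c * residual K F s x)"
proof -
  have F': "F \<in> mesh_faces \<Omega> M" using F faces_in[OF K] by blast
  interpret f: flat_face F by (rule mesh_face_flat[OF F'])
  interpret q: L2_subspace "face_measure F" "degree_set (int p)" "\<lambda>\<alpha> x. if x \<in> F then monomial \<alpha> x else 0" "poly_on F (int p)"
    by (rule poly_on_L2_subspace[OF F'])
  let ?m = "\<lambda>s x. snd s x - trace_from K (hho_S \<Omega> M p s) x"
  have "?m (hscale c s) x = c * ?m s x" if "x \<in> F" for x
  proof -
    have xK: "x \<in> K" using that solid_polytope.facet_subset[OF solid[OF K] F] by blast
    have "hho_S \<Omega> M p (hscale c s) = (\<lambda>x. c * hho_S \<Omega> M p s x)" using S_scale[OF s] by blast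
    then show ?thesis using trace_from_scale[OF K xK S_broken[OF s]] by (simp add: hscale_def algebra_simps)
  qed
  then have "AE x in face_measure F. ?m (hscale c s) x = c * ?m s x" by (intro AE_I2) simp
  from q.proj_cong_AE[OF mismatch_L2[OF K F S\<^sub>H_scale[OF s]] L2_mult_left[OF mismatch_L2[OF K F s]] this]
  show ?thesis unfolding residual_eq using q.proj_scale[OF mismatch_L2[OF K F s]] by simp
qed

section \<open>The stabilization as a symmetric positive semidefinite form\<close>

abbreviation \<theta> :: "'d hybrid \<Rightarrow> 'd hybrid \<Rightarrow> real" where
  "\<theta> \<equiv> hho_theta \<Omega> M p"

lemma theta_commute: "\<theta> s t = \<theta> t s"
  unfolding hho_theta_def by (simp add: mult.commute)

lemma theta_add:
  assumes "s \<in> S\<^sub>H" "t \<in> S\<^sub>H" "w \<in> S\<^sub>H"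
  shows "\<theta> (s + t) w = \<theta> s w + \<theta> t w"
proof -
  have "(\<integral>x. residual K F (s + t) x * residual K F w x \<partial>face_measure F) =
      (\<integral>x. residual K F s x * residual K F w x \<partial>face_measure F) + (\<integral>x. residual K F t x * residual K F w x \<partial>face_measure F)"
    if "K \<in> M" "F \<in> faces_of K" for K F
    unfolding residual_add[OF that assms(1,2)] distrib_right
    by (intro Bochner_Integration.integral_add L2_integrable_mult residual_L2 that assms)
  then show ?thesis unfolding hho_theta_def by (simp add: sum.distrib distrib_left)
qed

lemma theta_scale:
  assumes "s \<in> S\<^sub>H"
  shows "\<theta> (hscale c s) w = c * \<theta> s w"
  unfolding hho_theta_def sum_distrib_left
  by (intro sum.cong refl) (simp add: residual_scale[OF _ _ assms] mult.assoc)

lemma theta_nonneg: "0 \<le> \<theta> s s"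
proof -
  have d: "0 \<le> diameter F" if "K \<in> M" "F \<in> faces_of K" for K F :: "(real^'d) set"
    using solid_polytope.flat_facet[OF solid[OF that(1)] that(2)]
    by (intro diameter_ge_0 compact_imp_bounded flat_face.compact)
  show ?thesis
    unfolding hho_theta_def
  proof (intro sum_nonneg mult_nonneg_nonneg)
    fix K F assume "K \<in> M" "F \<in> faces_of K"
    then show "0 \<le> inverse (diameter F)" using d by simp
    show "0 \<le> (\<integral>x. residual K F s x * residual K F s x \<partial>face_measure F)"
      by (rule Bochner_Integration.integral_nonneg) simp
  qed
qed

lemma theta_zero:
  assumes "\<And>K F. K \<in> M \<Longrightarrow> F \<in> faces_of K \<Longrightarrow> residual K F s = (\<lambda>x. 0)"
  shows "\<theta> s t = 0"
  unfolding hho_theta_def using assms by (intro sum.neutral ballI) simp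

end

section \<open>Conforming elements of the HHO space\<close>

text \<open>On each element both the restricted weak gradient of \<open>v\<close> and the classical
  gradient of the polynomial are weak gradients of the same function.\<close>

lemma (in polytopal_mesh) conforming_gradient:
  assumes v: "v \<in> H10 \<Omega>" and r: "r \<in> broken_poly M k" and eq: "AE x in lebesgue_on \<Omega>. v x = r x"
  shows "AE x in lebesgue_on \<Omega>. weak_grad \<Omega> v x = gradient r x"
proof (rule AE_on_\<Omega>)
  fix K assume K: "K \<in> M"
  interpret i: bounded_open "interior K" by (rule bounded_open_interior[OF K])
  note v1 = H1_D[OF H10_H1[OF v]]
  have L: "L2 (lebesgue_on (interior K)) v" "L2 (lebesgue_on (interior K)) r"
    by (rule L2_lebesgue_on_subset[OF i.sets_A sets_A interior_in[OF K]], rule v1 broken_L2[OF r])+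
  have e: "AE x in lebesgue_on (interior K). v x = r x"
    by (rule AE_lebesgue_on_mono[OF i.sets_A sets_A interior_in[OF K] eq])
  have "is_weak_grad (interior K) v (weak_grad \<Omega> v)"
    by (rule is_weak_grad_subset[OF open_interior interior_in[OF K] v1(2)])
  then have "is_weak_grad (interior K) r (weak_grad \<Omega> v)" by (rule i.is_weak_grad_cong[OF L(1) e])
  then show "AE x in lebesgue_on (interior K). weak_grad \<Omega> v x = gradient r x"
    by (rule i.is_weak_grad_unique[OF L(2) _ broken_is_weak_grad[OF r K]])
qed

context hho_method
begin

text \<open>For a conforming function and its trace, Green's formula is exactly the system defining
  the reconstruction, with \<open>fst s\<close> as a solution; uniqueness does the rest.\<close>

lemma conforming_R:
  assumes v: "v \<in> H10 \<Omega>" and g: "is_trace \<Omega> M v g" and s: "s \<in> S\<^sub>H"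
    and eq: "AE x in lebesgue_on \<Omega>. v x = fst s x"
    and eqF: "\<And>F. F \<in> mesh_faces \<Omega> M \<Longrightarrow> AE x in face_measure F. g x = snd s x"
  shows "R s = fst s"
proof (rule R_eqI)
  note b = S\<^sub>H_D(1)[OF s]
  show "reconstructs s (fst s)"
    unfolding reconstructs_def
  proof (intro conjI ballI)
    show "fst s \<in> broken_poly M (int p + 1)" using broken_mono[of "int p" "int p + 1"] b by auto
    fix K :: "(real^'d) set" and q :: "real^'d \<Rightarrow> real" assume K: "K \<in> M" and q: "q \<in> poly_space (int p + 1)"
    have "AE x in lebesgue_on K. gradient (fst s) x \<bullet> gradient q x = weak_grad \<Omega> v x \<bullet> gradient q x"
      using AE_\<Omega>_on_K[OF K conforming_gradient[OF v b eq]] by eventually_elim simp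
    then have "(\<integral>x. gradient (fst s) x \<bullet> gradient q x \<partial>lebesgue_on K) = (\<integral>x. weak_grad \<Omega> v x \<bullet> gradient q x \<partial>lebesgue_on K)"
      by (rule integral_lebesgue_on_cong_AE[OF K_lebesgue[OF K]])
    also have "\<dots> = - (\<integral>x. v x * laplacian q x \<partial>lebesgue_on K) +
        (\<Sum>F\<in>faces_of K. \<integral>x. g x * (gradient q x \<bullet> outer_normal K F) \<partial>face_measure F)"
      by (rule Green_laplacian[OF v g K q])
    also have "(\<integral>x. v x * laplacian q x \<partial>lebesgue_on K) = (\<integral>x. fst s x * laplacian q x \<partial>lebesgue_on K)"
    proof (rule integral_lebesgue_on_cong_AE[OF K_lebesgue[OF K]])
      show "AE x in lebesgue_on K. v x * laplacian q x = fst s x * laplacian q x"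
        using AE_\<Omega>_on_K[OF K eq] by eventually_elim simp
    qed
    also have "(\<Sum>F\<in>faces_of K. \<integral>x. g x * (gradient q x \<bullet> outer_normal K F) \<partial>face_measure F) =
        (\<Sum>F\<in>faces_of K. \<integral>x. snd s x * (gradient q x \<bullet> outer_normal K F) \<partial>face_measure F)"
    proof (rule sum.cong[OF refl])
      fix F assume "F \<in> faces_of K"
      then have F: "F \<in> mesh_faces \<Omega> M" using faces_in[OF K] by blast
      note L = poly_L2_face[OF F poly_gradient_inner[OF q, of "outer_normal K F"]]
      have g2: "L2 (face_measure F) g" using g F by (simp add: is_trace_def)
      show "(\<integral>x. g x * (gradient q x \<bullet> outer_normal K F) \<partial>face_measure F) =
          (\<integral>x. snd s x * (gradient q x \<bullet> outer_normal K F) \<partial>face_measure F)"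
      proof (rule integral_cong_AE)
        show "AE x in face_measure F. g x * (gradient q x \<bullet> outer_normal K F) = snd s x * (gradient q x \<bullet> outer_normal K F)"
          using eqF[OF F] by eventually_elim simp
      qed (intro borel_measurable_integrable L2_integrable_mult L g2 skeleton_L2[OF S\<^sub>H_D(2)[OF s] F])+
    qed
    finally show "(\<integral>x. gradient (fst s) x \<bullet> gradient q x \<partial>lebesgue_on K) = moment s K q" by (simp add: moment_def)
  qed simp
qed

text \<open>The trace \<open>g\<close> and the polynomial \<open>q\<close> are compared by testing Green's formula and the divergence
  theorem with \<open>(q\<^sub>F - q) b\<close>, where the bubble \<open>b\<close> vanishes on all facets except \<open>F\<close>.\<close>

lemma conforming_trace:
  assumes v: "v \<in> H10 \<Omega>" and g: "is_trace \<Omega> M v g" and K: "K \<in> M" and F: "F \<in> faces_of K"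
    and q: "C1 q" and eq: "AE x in lebesgue_on K. v x = q x"
    and eqg: "AE x in lebesgue_on K. weak_grad \<Omega> v x = gradient q x"
    and qF: "C1 qF" and eqF: "AE x in face_measure F. g x = qF x"
  shows "AE x in face_measure F. qF x = q x"
proof -
  interpret k: solid_polytope K by (rule solid[OF K])
  interpret f: flat_face F by (rule k.flat_facet[OF F])
  have F': "F \<in> mesh_faces \<Omega> M" using F faces_in[OF K] by blast
  have Lg: "L2 (face_measure G) g" if "G \<in> faces_of K" for G
    using that g faces_in[OF K] by (auto simp: is_trace_def)
  have LF: "L2 (face_measure G) h" if "G \<in> faces_of K" "C1 h" for G h
    using that faces_in[OF K] L2_face_C1 by blast
  define b where "b x = (\<Prod>G\<in>faces_of K - {F}. facet_dist K G x)" for x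
  define \<phi> where "\<phi> x = (qF x - q x) * b x" for x
  \<comment> \<open>In the direction of the normal of \<open>F\<close> the coefficient of the only
    surviving facet is 1.\<close>
  define e where "e = outer_normal K F"
  have e: "norm e = 1" unfolding e_def by (rule k.facet_normal(1)[OF F])
  have b: "C1 b" unfolding b_def facet_dist_def by (intro C1_prod C1_diff C1_const C1_inner)
  have \<phi>: "C1 \<phi>" unfolding \<phi>_def by (intro C1_mult C1_diff b q qF)
  have \<phi>0: "\<phi> x = 0" if "G \<in> faces_of K" "G \<noteq> F" "x \<in> G" for G x
  proof -
    have "facet_dist K G x = 0" using k.facet_normal(2)[OF that(1)] that(3) by blast
    then have "b x = 0" unfolding b_def using that(1,2) k.finite_faces by (intro prod_zero) auto
    then show ?thesis by (simp add: \<phi>_def)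
  qed
  have "(\<integral>x. v x * (gradient \<phi> x \<bullet> e) \<partial>lebesgue_on K) = (\<integral>x. q x * (gradient \<phi> x \<bullet> e) \<partial>lebesgue_on K)"
    by (rule integral_lebesgue_on_cong_AE[OF K_lebesgue[OF K]]) (use eq in eventually_elim, simp)
  moreover have "(\<integral>x. (weak_grad \<Omega> v x \<bullet> e) * \<phi> x \<partial>lebesgue_on K) = (\<integral>x. (gradient q x \<bullet> e) * \<phi> x \<partial>lebesgue_on K)"
    by (rule integral_lebesgue_on_cong_AE[OF K_lebesgue[OF K]]) (use eqg in eventually_elim, simp)
  moreover have "(\<integral>x. q x * (gradient \<phi> x \<bullet> e) \<partial>lebesgue_on K) + (\<integral>x. (gradient q x \<bullet> e) * \<phi> x \<partial>lebesgue_on K) =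
      (\<integral>x. gradient (\<lambda>x. q x * \<phi> x) x \<bullet> e \<partial>lebesgue_on K)"
  proof -
    have "integrable (lebesgue_on K) (\<lambda>x. q x * (gradient \<phi> x \<bullet> e))" "integrable (lebesgue_on K) (\<lambda>x. (gradient q x \<bullet> e) * \<phi> x)"
      by (intro L2_integrable_mult L2_inner_const k.L2_continuous C1_continuous C1_continuous_gradient q \<phi>)+
    moreover have "gradient (\<lambda>x. q x * \<phi> x) x \<bullet> e = q x * (gradient \<phi> x \<bullet> e) + (gradient q x \<bullet> e) * \<phi> x" for x
      by (simp add: gradient_mult[OF q \<phi>] inner_add_left)
    ultimately show ?thesis by simp
  qed
  ultimately have "(\<Sum>G\<in>faces_of K. (outer_normal K G \<bullet> e) * (\<integral>x. g x * \<phi> x \<partial>face_measure G)) =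
      (\<Sum>G\<in>faces_of K. (outer_normal K G \<bullet> e) * (\<integral>x. q x * \<phi> x \<partial>face_measure G))"
    using Green[OF v g K \<phi> e] k.divergence_theorem[OF C1_mult[OF q \<phi>] e] by simp
  moreover have single: "(\<Sum>G\<in>faces_of K. (outer_normal K G \<bullet> e) * (\<integral>x. h x * \<phi> x \<partial>face_measure G)) = (\<integral>x. h x * \<phi> x \<partial>face_measure F)"
    for h :: "real^'d \<Rightarrow> real"
  proof -
    have "(outer_normal K G \<bullet> e) * (\<integral>x. h x * \<phi> x \<partial>face_measure G) = (if G = F then \<integral>x. h x * \<phi> x \<partial>face_measure F else 0)"
      if G: "G \<in> faces_of K" for G
    proof (cases "G = F")
      case True
      then show ?thesis using e by (simp add: e_def dot_square_norm)
    next
      case False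
      interpret g: flat_face G by (rule k.flat_facet[OF G])
      have "(\<integral>x. h x * \<phi> x \<partial>face_measure G) = (\<integral>x. 0 \<partial>face_measure G)"
        by (intro Bochner_Integration.integral_cong refl) (simp add: \<phi>0[OF G False])
      then show ?thesis using False by simp
    qed
    then have "(\<Sum>G\<in>faces_of K. (outer_normal K G \<bullet> e) * (\<integral>x. h x * \<phi> x \<partial>face_measure G)) =
        (\<Sum>G\<in>faces_of K. if G = F then \<integral>x. h x * \<phi> x \<partial>face_measure F else 0)"
      by (rule sum.cong[OF refl])
    also have "\<dots> = (\<integral>x. h x * \<phi> x \<partial>face_measure F)" using F k.finite_faces by simp
    finally show ?thesis .
  qed
  ultimately have "(\<integral>x. g x * \<phi> x \<partial>face_measure F) = (\<integral>x. q x * \<phi> x \<partial>face_measure F)" by simp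
  moreover have "(\<integral>x. g x * \<phi> x \<partial>face_measure F) = (\<integral>x. qF x * \<phi> x \<partial>face_measure F)"
  proof (rule integral_cong_AE)
    show "AE x in face_measure F. g x * \<phi> x = qF x * \<phi> x" using eqF by eventually_elim simp
  qed (intro borel_measurable_integrable L2_integrable_mult Lg LF F \<phi> qF)+
  moreover have i: "integrable (face_measure F) (\<lambda>x. qF x * \<phi> x)" "integrable (face_measure F) (\<lambda>x. q x * \<phi> x)"
    by (intro L2_integrable_mult LF F \<phi> q qF)+
  ultimately have z: "(\<integral>x. (qF x - q x) * \<phi> x \<partial>face_measure F) = 0" by (simp add: left_diff_distrib)
  \<comment> \<open>The bubble becomes a positive weight, so that the vanishing integral of
    \<open>(qF - q)\<^sup>2 * b\<close> forces \<open>qF = q\<close>.\<close>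
  have bpos: "AE x in face_measure F. 0 < b x"
    using face_AE_rel_interior[OF F']
  proof eventually_elim
    case (elim x)
    show ?case unfolding b_def by (intro prod_pos) (use k.facet_dist_pos_rel_interior[OF F _ _ elim] in auto)
  qed
  have nn: "AE x in face_measure F. 0 \<le> (qF x - q x) * \<phi> x"
    using bpos
  proof eventually_elim
    case (elim x)
    have "(qF x - q x) * \<phi> x = (qF x - q x)\<^sup>2 * b x" by (simp add: \<phi>_def power2_eq_square)
    then show ?case using elim by simp
  qed
  have "integrable (face_measure F) (\<lambda>x. (qF x - q x) * \<phi> x)"
    using i by (simp add: left_diff_distrib)
  from integral_nonneg_eq_0_iff_AE[OF this nn] z have "AE x in face_measure F. (qF x - q x) * \<phi> x = 0" by simp
  with bpos show ?thesis
  proof eventually_elim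
    case (elim x)
    then show ?case by (auto simp: \<phi>_def)
  qed
qed

text \<open>Since \<open>R s = fst s\<close> and the projection fixes \<open>fst s\<close>, the
  correction in \<open>hho_S\<close> cancels. The mismatch is then the face value minus the trace
  from inside, which agree by \<open>conforming_trace\<close>.\<close>

lemma conforming_residual:
  assumes v: "v \<in> H10 \<Omega>" and g: "is_trace \<Omega> M v g" and s: "s \<in> S\<^sub>H"
    and eq: "AE x in lebesgue_on \<Omega>. v x = fst s x"
    and eqF: "\<And>F. F \<in> mesh_faces \<Omega> M \<Longrightarrow> AE x in face_measure F. g x = snd s x"
    and K: "K \<in> M" and F: "F \<in> faces_of K"
  shows "residual K F s = (\<lambda>x. 0)"
proof -
  note b = S\<^sub>H_D(1)[OF s]
  have F': "F \<in> mesh_faces \<Omega> M" using F faces_in[OF K] by blast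
  interpret f: flat_face F by (rule mesh_face_flat[OF F'])
  interpret b: L2_subspace "lebesgue_on \<Omega>" "M \<times> degree_set (int p)" "\<lambda>(K, \<alpha>) x. indicator (interior K) x * monomial \<alpha> x" "broken_poly M (int p)"
    by (rule broken_L2_subspace)
  interpret P: L2_subspace "face_measure F" "degree_set (int p)" "\<lambda>\<alpha> x. if x \<in> F then monomial \<alpha> x else 0" "poly_on F (int p)"
    by (rule poly_on_L2_subspace[OF F'])
  have "R s = fst s" by (rule conforming_R[OF v g s eq eqF])
  then have S: "hho_S \<Omega> M p s = fst s" unfolding S_eq using b.proj_id[OF b] by simp
  obtain q where q: "q \<in> poly_space (int p)" "\<And>x. x \<in> interior K \<Longrightarrow> fst s x = q x" "\<And>x. x \<in> F \<Longrightarrow> trace_from K (fst s) x = q x"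
    using trace_from_broken[OF K F b] by metis
  obtain qF where qF: "qF \<in> poly_space (int p)" "\<And>x. x \<in> rel_interior F \<Longrightarrow> snd s x = qF x"
    using skeleton_rep[OF S\<^sub>H_D(2)[OF s] F'] by blast
  have qK: "AE x in lebesgue_on K. fst s x = q x" "AE x in lebesgue_on K. gradient (fst s) x = gradient q x"
    by (rule broken_AE_poly[OF K q(1,2)], assumption)+
  have 1: "AE x in lebesgue_on K. v x = q x"
    using AE_\<Omega>_on_K[OF K eq] qK(1) by eventually_elim simp
  have 2: "AE x in lebesgue_on K. weak_grad \<Omega> v x = gradient q x"
    using AE_\<Omega>_on_K[OF K conforming_gradient[OF v b eq]] qK(2) by eventually_elim simp
  have sF: "AE x in face_measure F. snd s x = qF x" by (rule skeleton_AE_poly[OF F' qF(2)])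
  have 3: "AE x in face_measure F. g x = qF x" using eqF[OF F'] sF by eventually_elim simp
  have inF: "AE x in face_measure F. x \<in> F" by (intro AE_I2) simp
  have "AE x in face_measure F. snd s x - trace_from K (hho_S \<Omega> M p s) x = 0"
    using conforming_trace[OF v g K F poly_C1[OF q(1)] 1 2 poly_C1[OF qF(1)] 3] sF inF
    by eventually_elim (simp add: S q(3))
  from P.proj_cong_AE[OF mismatch_L2[OF K F s] L2_zero this] show ?thesis
    unfolding residual_eq using P.proj_id[OF P.W_zero] by simp
qed

section \<open>The extended form\<close>

text \<open>The free factor \<open>c\<close> covers all uses: 1 for the extended form, -1 for the
  consistency error, 0 for purely discrete functions.\<close>

lemma broken_grad_AE:
  assumes v: "v \<in> H10 \<Omega>" and r: "r \<in> broken_poly M k"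
  shows "AE x in lebesgue_on \<Omega>. broken_grad M (\<lambda>x. c * v x + r x) x = c *\<^sub>R weak_grad \<Omega> v x + gradient r x"
proof (rule AE_on_\<Omega>)
  fix K assume K: "K \<in> M"
  interpret i: bounded_open "interior K" by (rule bounded_open_interior[OF K])
  note v1 = H1_D[OF H10_H1[OF v]]
  let ?w = "\<lambda>x. c * v x + r x"
  have L: "L2 (lebesgue_on (interior K)) v" "L2 (lebesgue_on (interior K)) r"
    by (rule L2_lebesgue_on_subset[OF i.sets_A sets_A interior_in[OF K]], rule v1 broken_L2[OF r])+
  have "is_weak_grad (interior K) v (weak_grad \<Omega> v)"
    by (rule is_weak_grad_subset[OF open_interior interior_in[OF K] v1(2)])
  from i.is_weak_grad_add[OF L2_mult_left[OF L(1)] L(2) i.is_weak_grad_scale[OF L(1) this] broken_is_weak_grad[OF r K], of c]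
  have "is_weak_grad (interior K) ?w (\<lambda>x. c *\<^sub>R weak_grad \<Omega> v x + gradient r x)" by (simp add: plus_fun_def)
  from i.weak_grad_AE[OF L2_add[OF L2_mult_left[OF L(1)] L(2)] this]
  have 1: "AE x in lebesgue_on (interior K). weak_grad (interior K) ?w x = c *\<^sub>R weak_grad \<Omega> v x + gradient r x" .
  have 2: "AE x in lebesgue_on (interior K). x \<in> interior K" by (intro AE_I2) simp
  have 3: "broken_grad M ?w x = weak_grad (interior K) ?w x" if x: "x \<in> interior K" for x
  proof -
    have "(THE K. K \<in> M \<and> x \<in> interior K) = K"
      by (rule the_equality) (use K x disjoint in blast)+
    then show ?thesis unfolding broken_grad_def using K x by auto
  qed
  from 1 2 show "AE x in lebesgue_on (interior K). broken_grad M ?w x = c *\<^sub>R weak_grad \<Omega> v x + gradient r x"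
    by eventually_elim (simp add: 3)
qed

definition ext_grad :: "(real^'d \<Rightarrow> real) \<Rightarrow> 'd hybrid \<Rightarrow> real^'d \<Rightarrow> real^'d" where
  "ext_grad v s x = weak_grad \<Omega> v x + gradient (R s) x"

lemma ext_grad_L2: "v \<in> H10 \<Omega> \<Longrightarrow> s \<in> S\<^sub>H \<Longrightarrow> L2 (lebesgue_on \<Omega>) (ext_grad v s)"
  unfolding ext_grad_def[abs_def]
  using H1_D(3)[OF H10_H1] broken_gradient_L2[OF R_broken] by (intro L2_add) auto

lemma gradient_R_add:
  assumes "s \<in> S\<^sub>H" "t \<in> S\<^sub>H"
  shows "AE x in lebesgue_on \<Omega>. gradient (R (s + t)) x = gradient (R s) x + gradient (R t) x"
  by (intro AE_on_\<Omega> AE_I2) (simp add: R_add[OF assms] broken_gradient_add[OF R_broken[OF assms(1)] R_broken[OF assms(2)]])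

lemma gradient_R_minus:
  assumes "s \<in> S\<^sub>H"
  shows "AE x in lebesgue_on \<Omega>. gradient (R (- s)) x = - gradient (R s) x"
  by (intro AE_on_\<Omega> AE_I2) (use broken_gradient_scale[OF R_broken[OF assms], of _ _ "- 1"] in \<open>simp add: hscale_minus(1) R_scale[OF assms]\<close>)

text \<open>The two decompositions differ by \<open>v - w\<close> on the conforming side and by
  \<open>t - s\<close> on the discrete side, which represent one element of both spaces.
  \<open>conforming_R\<close> matches the gradients and \<open>conforming_residual\<close> removes
  the stabilization.\<close>

lemma ext_grad_well_defined:
  assumes v: "v \<in> H10 \<Omega>" "w \<in> H10 \<Omega>" and s: "s \<in> S\<^sub>H" "t \<in> S\<^sub>H"
    and eq: "hybrid_eq \<Omega> M ((v, skeleton_trace \<Omega> M v) + s) ((w, skeleton_trace \<Omega> M w) + t)"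
  shows "AE x in lebesgue_on \<Omega>. ext_grad v s x = ext_grad w t x" "r \<in> S\<^sub>H \<Longrightarrow> \<theta> s r = \<theta> t r"
proof -
  define d where "d = v + (\<lambda>x. (- 1) * w x)"
  define g where "g x = skeleton_trace \<Omega> M v x + (- 1) * skeleton_trace \<Omega> M w x" for x
  define \<delta> where "\<delta> = t - s"
  have \<delta>: "\<delta> \<in> S\<^sub>H" unfolding \<delta>_def by (rule S\<^sub>H_diff[OF s(2,1)])
  have t: "t = s + \<delta>" unfolding \<delta>_def by simp
  note w' = H10_scale[OF v(2), of "- 1"]
  have d: "d \<in> H10 \<Omega>" unfolding d_def by (rule H10_add[OF v(1) w'])
  have g: "is_trace \<Omega> M d g"
    unfolding d_def g_def
    by (intro is_trace_add v w' is_trace_scale is_trace_skeleton_trace)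
  have 1: "AE x in lebesgue_on \<Omega>. d x = fst \<delta> x"
    using eq unfolding hybrid_eq_def by (auto simp: d_def \<delta>_def algebra_simps elim!: AE_mp)
  have 2: "AE x in face_measure F. g x = snd \<delta> x" if "F \<in> mesh_faces \<Omega> M" for F
    using eq that unfolding hybrid_eq_def by (auto simp: g_def \<delta>_def algebra_simps elim!: AE_mp)
  have "AE x in lebesgue_on \<Omega>. weak_grad \<Omega> d x = gradient (R \<delta>) x"
    using conforming_gradient[OF d S\<^sub>H_D(1)[OF \<delta>] 1] conforming_R[OF d g \<delta> 1 2] by simp
  moreover have "AE x in lebesgue_on \<Omega>. weak_grad \<Omega> d x = weak_grad \<Omega> v x + (- 1) *\<^sub>R weak_grad \<Omega> w x"
    unfolding d_def
    using H1_D[OF H10_H1[OF v(1)]] H1_D[OF H10_H1[OF v(2)]]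
    by (intro weak_grad_AE H1_D(1) H10_H1 H10_add v w' is_weak_grad_add is_weak_grad_scale L2_mult_left)
  moreover note gradient_R_add[OF s(1) \<delta>]
  ultimately show "AE x in lebesgue_on \<Omega>. ext_grad v s x = ext_grad w t x"
    unfolding ext_grad_def t by eventually_elim (simp add: algebra_simps)
  have "\<theta> \<delta> r = 0" by (rule theta_zero[OF conforming_residual[OF d g \<delta> 1 2]])
  then show "\<theta> s r = \<theta> t r" if "r \<in> S\<^sub>H" unfolding t theta_add[OF s(1) \<delta> that] by simp
qed

lemma hybrid_eq_refl: "hybrid_eq \<Omega> M x x"
  by (simp add: hybrid_eq_def)

lemma hybrid_eq_trans_sym:
  assumes "hybrid_eq \<Omega> M x y" "hybrid_eq \<Omega> M x z"
  shows "hybrid_eq \<Omega> M y z"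
  unfolding hybrid_eq_def
proof (intro conjI ballI)
  show "AE a in lebesgue_on \<Omega>. fst y a = fst z a"
    using assms[unfolded hybrid_eq_def, THEN conjunct1] by eventually_elim simp
  show "AE a in face_measure F. snd y a = snd z a" if "F \<in> mesh_faces \<Omega> M" for F
    using assms[unfolded hybrid_eq_def, THEN conjunct2, THEN bspec, OF that] by eventually_elim simp
qed

text \<open>Evaluates the definite description at one decomposition of each argument. Independence
  is applied to the first argument and, through the symmetry of \<theta>, to the second.\<close>

lemma ext_form_eq:
  assumes v: "v \<in> H10 \<Omega>" "w \<in> H10 \<Omega>" and s: "s \<in> S\<^sub>H" "t \<in> S\<^sub>H"
    and x: "hybrid_eq \<Omega> M x ((v, skeleton_trace \<Omega> M v) + s)" and y: "hybrid_eq \<Omega> M y ((w, skeleton_trace \<Omega> M w) + t)"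
  shows "ext_form \<Omega> M p x y = (\<integral>z. ext_grad v s z \<bullet> ext_grad w t z \<partial>lebesgue_on \<Omega>) + \<theta> s t"
proof -
  have V: "(v, skeleton_trace \<Omega> M v) \<in> V_hat \<Omega> M" if "v \<in> H10 \<Omega>" for v using that by (auto simp: V_hat_def)
  have bg: "AE z in lebesgue_on \<Omega>. broken_grad M (v + R s) z = ext_grad v s z" if "v \<in> H10 \<Omega>" "s \<in> S\<^sub>H" for v s
    using broken_grad_AE[OF that(1) R_broken[OF that(2)], of 1] by (simp add: ext_grad_def plus_fun_def)
  have int: "(\<integral>z. broken_grad M (v + R s) z \<bullet> broken_grad M (w + R t) z \<partial>lebesgue_on \<Omega>) =
      (\<integral>z. ext_grad v s z \<bullet> ext_grad w t z \<partial>lebesgue_on \<Omega>)"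
    if "v \<in> H10 \<Omega>" "s \<in> S\<^sub>H" "w \<in> H10 \<Omega>" "t \<in> S\<^sub>H" for v w s t
    by (rule integral_lebesgue_on_cong_AE[OF sets_A]) (use bg[OF that(1,2)] bg[OF that(3,4)] in eventually_elim, simp)
  show ?thesis
    unfolding ext_form_def
  proof (rule the_equality)
    show "\<exists>v'\<in>V_hat \<Omega> M. \<exists>s'\<in>S\<^sub>H. \<exists>w'\<in>V_hat \<Omega> M. \<exists>t'\<in>S\<^sub>H. hybrid_eq \<Omega> M x (v' + s') \<and> hybrid_eq \<Omega> M y (w' + t') \<and>
        (\<integral>z. ext_grad v s z \<bullet> ext_grad w t z \<partial>lebesgue_on \<Omega>) + \<theta> s t =
        (\<integral>z. broken_grad M (fst v' + R s') z \<bullet> broken_grad M (fst w' + R t') z \<partial>lebesgue_on \<Omega>) + \<theta> s' t'"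
      by (intro bexI[OF _ V[OF v(1)]] bexI[OF _ s(1)] bexI[OF _ V[OF v(2)]] bexI[OF _ s(2)] conjI x y)
         (simp add: int[OF v(1) s(1) v(2) s(2)])
  next
    fix c assume "\<exists>v'\<in>V_hat \<Omega> M. \<exists>s'\<in>S\<^sub>H. \<exists>w'\<in>V_hat \<Omega> M. \<exists>t'\<in>S\<^sub>H. hybrid_eq \<Omega> M x (v' + s') \<and> hybrid_eq \<Omega> M y (w' + t') \<and>
        c = (\<integral>z. broken_grad M (fst v' + R s') z \<bullet> broken_grad M (fst w' + R t') z \<partial>lebesgue_on \<Omega>) + \<theta> s' t'"
    then obtain v' w' s' t' where h: "v' \<in> H10 \<Omega>" "s' \<in> S\<^sub>H" "w' \<in> H10 \<Omega>" "t' \<in> S\<^sub>H"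
      "hybrid_eq \<Omega> M x ((v', skeleton_trace \<Omega> M v') + s')" "hybrid_eq \<Omega> M y ((w', skeleton_trace \<Omega> M w') + t')"
      and c: "c = (\<integral>z. broken_grad M (v' + R s') z \<bullet> broken_grad M (w' + R t') z \<partial>lebesgue_on \<Omega>) + \<theta> s' t'"
      unfolding V_hat_def by auto
    note X = ext_grad_well_defined[OF h(1) v(1) h(2) s(1) hybrid_eq_trans_sym[OF h(5) x]]
    note Y = ext_grad_well_defined[OF h(3) v(2) h(4) s(2) hybrid_eq_trans_sym[OF h(6) y]]
    have "(\<integral>z. ext_grad v' s' z \<bullet> ext_grad w' t' z \<partial>lebesgue_on \<Omega>) = (\<integral>z. ext_grad v s z \<bullet> ext_grad w t z \<partial>lebesgue_on \<Omega>)"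
      by (rule integral_lebesgue_on_cong_AE[OF sets_A]) (use X(1) Y(1) in eventually_elim, simp)
    moreover have "\<theta> s' t' = \<theta> s t" using X(2)[OF h(4)] Y(2)[OF s(1)] by (simp add: theta_commute)
    ultimately show "c = (\<integral>z. ext_grad v s z \<bullet> ext_grad w t z \<partial>lebesgue_on \<Omega>) + \<theta> s t"
      using c int[OF h(1-4)] by simp
  qed
qed

lemma ext_norm_sq:
  assumes "v \<in> H10 \<Omega>" "s \<in> S\<^sub>H" "hybrid_eq \<Omega> M x ((v, skeleton_trace \<Omega> M v) + s)"
  shows "(ext_norm \<Omega> M p x)\<^sup>2 = (L2_norm (lebesgue_on \<Omega>) (ext_grad v s))\<^sup>2 + \<theta> s s" "0 \<le> ext_norm \<Omega> M p x"
proof -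
  have "ext_form \<Omega> M p x x = (L2_norm (lebesgue_on \<Omega>) (ext_grad v s))\<^sup>2 + \<theta> s s"
    unfolding ext_form_eq[OF assms(1,1,2,2,3,3)] L2_norm_sq by (simp add: dot_square_norm)
  then show "(ext_norm \<Omega> M p x)\<^sup>2 = (L2_norm (lebesgue_on \<Omega>) (ext_grad v s))\<^sup>2 + \<theta> s s" "0 \<le> ext_norm \<Omega> M p x"
    using theta_nonneg by (simp_all add: ext_norm_def)
qed

section \<open>Quasi-optimality\<close>

text \<open>For \<open>q\<close> of degree \<open>p + 1\<close> the Laplacian has degree
  \<open>p - 1\<close> and the normal derivatives on flat faces have degree \<open>p\<close>:
  exactly the moments shared by \<open>w\<close> and \<open>s\<close>. On boundary faces both face
  values vanish almost everywhere.\<close>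

lemma R_elliptic_projection:
  assumes w: "w \<in> H10 \<Omega>" and s: "s \<in> S\<^sub>H" and r: "r \<in> broken_poly M (int p + 1)"
    and mK: "\<And>K q. K \<in> M \<Longrightarrow> q \<in> poly_space (int p - 1) \<Longrightarrow>
      (\<integral>x. q x * w x \<partial>lebesgue_on K) = (\<integral>x. q x * fst s x \<partial>lebesgue_on K)"
    and mF: "\<And>F q. F \<in> interfaces M \<Longrightarrow> q \<in> poly_on F (int p) \<Longrightarrow>
      (\<integral>x. q x * skeleton_trace \<Omega> M w x \<partial>face_measure F) = (\<integral>x. q x * snd s x \<partial>face_measure F)"
  shows "(\<integral>x. gradient r x \<bullet> (gradient (R s) x - weak_grad \<Omega> w x) \<partial>lebesgue_on \<Omega>) = 0"
proof -
  note tr = is_trace_skeleton_trace[OF w]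
  have LR: "L2 (lebesgue_on \<Omega>) (gradient (R s))" by (rule broken_gradient_L2[OF R_broken[OF s]])
  have Lw: "L2 (lebesgue_on \<Omega>) (weak_grad \<Omega> w)" by (rule H1_D(3)[OF H10_H1[OF w]])
  have "(\<integral>x. gradient r x \<bullet> (gradient (R s) x - weak_grad \<Omega> w x) \<partial>lebesgue_on K) = 0" if K: "K \<in> M" for K
  proof -
    obtain q where q: "q \<in> poly_space (int p + 1)" "\<And>x. x \<in> interior K \<Longrightarrow> r x = q x" using broken_rep[OF r K] by blast
    have "(\<integral>x. gradient r x \<bullet> (gradient (R s) x - weak_grad \<Omega> w x) \<partial>lebesgue_on K) =
        (\<integral>x. gradient q x \<bullet> (gradient (R s) x - weak_grad \<Omega> w x) \<partial>lebesgue_on K)"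
      by (rule broken_integral_gradient(1)[OF K q])
    also have "\<dots> = (\<integral>x. gradient (R s) x \<bullet> gradient q x - weak_grad \<Omega> w x \<bullet> gradient q x \<partial>lebesgue_on K)"
      by (intro Bochner_Integration.integral_cong refl) (simp add: inner_diff_right inner_commute)
    also have "\<dots> = (\<integral>x. gradient (R s) x \<bullet> gradient q x \<partial>lebesgue_on K) - (\<integral>x. weak_grad \<Omega> w x \<bullet> gradient q x \<partial>lebesgue_on K)"
      by (intro Bochner_Integration.integral_diff L2_integrable_inner poly_gradient_L2[OF K q(1)] L2_on_K(1)[OF K LR] L2_on_K(1)[OF K Lw])
    also have "(\<integral>x. gradient (R s) x \<bullet> gradient q x \<partial>lebesgue_on K) = moment s K q"
      using R_reconstructs[OF s] K q(1) by (simp add: reconstructs_def)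
    also have "(\<integral>x. weak_grad \<Omega> w x \<bullet> gradient q x \<partial>lebesgue_on K) = moment s K q"
    proof -
      have "(\<integral>x. w x * laplacian q x \<partial>lebesgue_on K) = (\<integral>x. fst s x * laplacian q x \<partial>lebesgue_on K)"
        using mK[OF K, of "laplacian q"] poly_laplacian[OF q(1)] by (simp add: mult.commute)
      moreover have "(\<integral>x. skeleton_trace \<Omega> M w x * (gradient q x \<bullet> outer_normal K F) \<partial>face_measure F) =
          (\<integral>x. snd s x * (gradient q x \<bullet> outer_normal K F) \<partial>face_measure F)" if "F \<in> faces_of K" for F
      proof -
        have F: "F \<in> mesh_faces \<Omega> M" using that faces_in[OF K] by blast
        interpret f: flat_face F by (rule mesh_face_flat[OF F])
        let ?n = "\<lambda>x. gradient q x \<bullet> outer_normal K F"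
        have n: "?n \<in> poly_space (int p)" using poly_gradient_inner[OF q(1)] by simp
        show ?thesis
        proof (cases "F \<in> interfaces M")
          case True
          \<comment> \<open>Test polynomials on a face are truncated to it, so the normal derivative
            is truncated as well; under the integral over \<open>F\<close> this changes
            nothing.\<close>
          let ?q = "\<lambda>x. if x \<in> F then ?n x else 0"
          have "?q \<in> poly_on F (int p)" unfolding poly_on_def mem_Collect_eq by (rule bexI[OF refl n])
          from mF[OF True this]
          have "(\<integral>x. ?q x * skeleton_trace \<Omega> M w x \<partial>face_measure F) = (\<integral>x. ?q x * snd s x \<partial>face_measure F)" .
          moreover have "(\<integral>x. ?q x * h x \<partial>face_measure F) = (\<integral>x. h x * ?n x \<partial>face_measure F)" for h :: "real^'d \<Rightarrow> real"
            by (intro Bochner_Integration.integral_cong refl) simp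
          ultimately show ?thesis by simp
        next
          case False
          then have B: "F \<in> boundary_faces \<Omega> M" using F by (simp add: mesh_faces_def)
          have "AE x in face_measure F. snd s x = 0"
            using S\<^sub>H_D(2)[OF s] B by (intro skeleton_AE_poly[OF F]) (auto simp: skeleton_poly_def)
          then have "AE x in face_measure F. snd s x * ?n x = 0" by eventually_elim simp
          moreover have "AE x in face_measure F. skeleton_trace \<Omega> M w x * ?n x = 0"
            using is_trace_boundary[OF tr B] by eventually_elim simp
          ultimately show ?thesis by (simp add: integral_eq_zero_AE)
        qed
      qed
      ultimately show ?thesis unfolding Green_laplacian[OF w tr K q(1)] moment_def by simp
    qed
    finally show ?thesis by simp
  qed
  moreover have "integrable (lebesgue_on \<Omega>) (\<lambda>x. gradient r x \<bullet> (gradient (R s) x - weak_grad \<Omega> w x))"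
    by (intro L2_integrable_inner L2_diff LR Lw broken_gradient_L2[OF r])
  ultimately show ?thesis by (simp add: integral_split)
qed

text \<open>Places a discrete element in the sum with conforming part 0. The chosen trace of 0 need
  not be the zero function, but it vanishes almost everywhere by uniqueness of traces.\<close>

lemma ext_grad_zero:
  assumes s: "s \<in> S\<^sub>H"
  shows "AE x in lebesgue_on \<Omega>. ext_grad (\<lambda>x. 0) s x = gradient (R s) x"
    "hybrid_eq \<Omega> M s ((\<lambda>x. 0, skeleton_trace \<Omega> M (\<lambda>x. 0)) + s)"
proof -
  have "is_weak_grad \<Omega> (\<lambda>x. 0) (gradient (\<lambda>x. 0))" by (rule C1_is_weak_grad[OF C1_const])
  from weak_grad_AE[OF L2_zero this]
  show "AE x in lebesgue_on \<Omega>. ext_grad (\<lambda>x. 0) s x = gradient (R s) x"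
    by eventually_elim (simp add: ext_grad_def)
  have "AE x in face_measure F. skeleton_trace \<Omega> M (\<lambda>x. 0) x = 0" if "F \<in> mesh_faces \<Omega> M" for F
    by (rule is_trace_unique[OF H10_zero H10_zero _ is_trace_skeleton_trace[OF H10_zero] is_trace_zero that]) simp
  then show "hybrid_eq \<Omega> M s ((\<lambda>x. 0, skeleton_trace \<Omega> M (\<lambda>x. 0)) + s)"
    unfolding hybrid_eq_def by (auto elim!: AE_mp)
qed

lemma broken_grad_R:
  assumes s: "s \<in> S\<^sub>H"
  shows "AE x in lebesgue_on \<Omega>. broken_grad M (R s) x = gradient (R s) x"
  using broken_grad_AE[OF H10_zero R_broken[OF s], of 0] by simp

text \<open>The bound for a single discrete competitor \<open>s\<close> and any admissible constant;
  the infimum is taken only afterwards.\<close>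

theorem quasi_optimality:
  assumes E: "linear_smoother \<Omega> M p E" and Em: "preserves_moments \<Omega> M p E"
    and u: "u \<in> H10 \<Omega>"
    and uf: "\<forall>w\<in>H10 \<Omega>. (\<integral>x. weak_grad \<Omega> u x \<bullet> weak_grad \<Omega> w x \<partial>lebesgue_on \<Omega>) = f w"
    and U: "U \<in> S\<^sub>H" and Uf: "\<forall>s\<in>S\<^sub>H. hho_form \<Omega> M p U s = f (E s)"
    and C: "C \<in> consistency_bounds \<Omega> M p E" and s: "s \<in> S\<^sub>H"
  shows "ext_norm \<Omega> M p ((u, skeleton_trace \<Omega> M u) - U) \<le> sqrt (1 + C\<^sup>2) * ext_norm \<Omega> M p ((u, skeleton_trace \<Omega> M u) - s)"
proof -
  let ?L = "lebesgue_on \<Omega>"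
  define \<sigma> where "\<sigma> = s - U"
  have \<sigma>: "\<sigma> \<in> S\<^sub>H" unfolding \<sigma>_def by (rule S\<^sub>H_diff[OF s U])
  note ms = S\<^sub>H_minus[OF s] and mU = S\<^sub>H_minus[OF U]
  \<comment> \<open>The first form splits the error as \<open>(u - s) + \<sigma>\<close>; the second
    expands the stabilization at \<open>s\<close> around \<open>U\<close>.\<close>
  have U\<sigma>: "- U = - s + \<sigma>" and sU: "s = U + \<sigma>" unfolding \<sigma>_def by simp_all
  have w: "E \<sigma> \<in> H10 \<Omega>" using E \<sigma> unfolding linear_smoother_def by blast
  have he: "hybrid_eq \<Omega> M ((u, skeleton_trace \<Omega> M u) - t) ((u, skeleton_trace \<Omega> M u) + - t)" for t
    using hybrid_eq_refl by simp
  define G where "G t = ext_grad u (- t)" for t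
  define D where "D x = gradient (R \<sigma>) x - weak_grad \<Omega> (E \<sigma>) x" for x
  have LG: "L2 ?L (G t)" if "t \<in> S\<^sub>H" for t unfolding G_def by (rule ext_grad_L2[OF u S\<^sub>H_minus[OF that]])
  have Lu: "L2 ?L (weak_grad \<Omega> u)" and Lw: "L2 ?L (weak_grad \<Omega> (E \<sigma>))" by (rule H1_D(3)[OF H10_H1], fact)+
  have LR: "L2 ?L (gradient (R t))" if "t \<in> S\<^sub>H" for t by (rule broken_gradient_L2[OF R_broken[OF that]])
  have LD: "L2 ?L D" unfolding D_def by (intro L2_diff LR \<sigma> Lw)
  have \<theta>mm: "\<theta> (- t) (- t) = \<theta> t t" if "t \<in> S\<^sub>H" for t
    using theta_scale[OF that, of "- 1" "- t"] theta_scale[OF that, of "- 1" t] theta_commute[of t "- t"]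
    by (simp add: hscale_minus(1)[symmetric])
  have GAE: "AE x in ?L. G t x = weak_grad \<Omega> u x - gradient (R t) x" if "t \<in> S\<^sub>H" for t
    using gradient_R_minus[OF that] unfolding G_def ext_grad_def by eventually_elim simp

  define a where "a = ext_norm \<Omega> M p ((u, skeleton_trace \<Omega> M u) - U)"
  define m where "m = ext_norm \<Omega> M p ((u, skeleton_trace \<Omega> M u) - s)"
  define c where "c = ext_norm \<Omega> M p \<sigma>"
  have a: "a\<^sup>2 = (L2_norm ?L (G U))\<^sup>2 + \<theta> U U" "0 \<le> a"
    using ext_norm_sq[OF u mU he] unfolding a_def G_def \<theta>mm[OF U] by blast+
  have m: "m\<^sup>2 = (L2_norm ?L (G s))\<^sup>2 + \<theta> s s" "0 \<le> m"
    using ext_norm_sq[OF u ms he] unfolding m_def G_def \<theta>mm[OF s] by blast+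
  have c: "c\<^sup>2 = (L2_norm ?L (gradient (R \<sigma>)))\<^sup>2 + \<theta> \<sigma> \<sigma>" "0 \<le> c"
    using ext_norm_sq[OF H10_zero \<sigma> ext_grad_zero(2)[OF \<sigma>]]
      L2_norm_lebesgue_on_cong_AE[OF sets_A ext_grad_zero(1)[OF \<sigma>]] by (simp_all add: c_def)

  have "L2_norm ?L (G U) = L2_norm ?L (\<lambda>x. G s x + gradient (R \<sigma>) x)"
  proof (rule L2_norm_lebesgue_on_cong_AE[OF sets_A])
    show "AE x in ?L. G U x = G s x + gradient (R \<sigma>) x"
      using gradient_R_add[OF ms \<sigma>] unfolding G_def ext_grad_def U\<sigma> by eventually_elim simp
  qed
  then have GU: "(L2_norm ?L (G U))\<^sup>2 = (L2_norm ?L (G s))\<^sup>2 + 2 * (\<integral>x. G s x \<bullet> gradient (R \<sigma>) x \<partial>?L) + (L2_norm ?L (gradient (R \<sigma>)))\<^sup>2"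
    using L2_norm_sq_add[OF LG[OF s] LR[OF \<sigma>]] by simp
  have \<theta>: "\<theta> s s = \<theta> U U + 2 * \<theta> U \<sigma> + \<theta> \<sigma> \<sigma>" "\<theta> s \<sigma> = \<theta> U \<sigma> + \<theta> \<sigma> \<sigma>"
    using theta_add[OF U \<sigma> U] theta_add[OF U \<sigma> \<sigma>] theta_add[OF U \<sigma> s] theta_commute[of U s] theta_commute[of \<sigma> s] theta_commute[of \<sigma> U]
    unfolding sU[symmetric] by simp_all

  have "hho_form \<Omega> M p U \<sigma> = (\<integral>x. gradient (R U) x \<bullet> gradient (R \<sigma>) x \<partial>?L) + \<theta> U \<sigma>"
  proof -
    have "(\<integral>x. broken_grad M (R U) x \<bullet> broken_grad M (R \<sigma>) x \<partial>?L) = (\<integral>x. gradient (R U) x \<bullet> gradient (R \<sigma>) x \<partial>?L)"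
      by (rule integral_lebesgue_on_cong_AE[OF sets_A]) (use broken_grad_R[OF U] broken_grad_R[OF \<sigma>] in eventually_elim, simp)
    then show ?thesis by (simp add: hho_form_def)
  qed
  moreover have "hho_form \<Omega> M p U \<sigma> = (\<integral>x. weak_grad \<Omega> u x \<bullet> weak_grad \<Omega> (E \<sigma>) x \<partial>?L)"
    using Uf uf \<sigma> w by simp
  ultimately have eqU: "(\<integral>x. gradient (R U) x \<bullet> gradient (R \<sigma>) x \<partial>?L) + \<theta> U \<sigma> = (\<integral>x. weak_grad \<Omega> u x \<bullet> weak_grad \<Omega> (E \<sigma>) x \<partial>?L)"
    by simp
  have uD: "(\<integral>x. weak_grad \<Omega> u x \<bullet> D x \<partial>?L) = (\<integral>x. weak_grad \<Omega> u x \<bullet> gradient (R \<sigma>) x \<partial>?L) - (\<integral>x. weak_grad \<Omega> u x \<bullet> weak_grad \<Omega> (E \<sigma>) x \<partial>?L)"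
    unfolding D_def inner_diff_right by (intro Bochner_Integration.integral_diff L2_integrable_inner Lu Lw LR \<sigma>)
  \<comment> \<open>\<open>R s\<close> is a broken polynomial of degree \<open>p + 1\<close> and
    hence an admissible test function for the elliptic projection.\<close>
  have orth: "(\<integral>x. gradient (R s) x \<bullet> D x \<partial>?L) = 0"
    unfolding D_def
    by (rule R_elliptic_projection[OF w \<sigma> R_broken[OF s]])
       (use Em \<sigma> in \<open>simp_all add: preserves_moments_def\<close>)
  have "(\<integral>x. G s x \<bullet> D x \<partial>?L) = (\<integral>x. weak_grad \<Omega> u x \<bullet> D x - gradient (R s) x \<bullet> D x \<partial>?L)"
    by (rule integral_lebesgue_on_cong_AE[OF sets_A]) (use GAE[OF s] in eventually_elim, simp add: inner_diff_left)
  also have "\<dots> = (\<integral>x. weak_grad \<Omega> u x \<bullet> D x \<partial>?L)"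
    using orth L2_integrable_inner[OF Lu LD] L2_integrable_inner[OF LR[OF s] LD] by simp
  finally have GsD: "(\<integral>x. G s x \<bullet> D x \<partial>?L) = (\<integral>x. weak_grad \<Omega> u x \<bullet> D x \<partial>?L)" .

  have Gs: "(\<integral>x. G s x \<bullet> gradient (R \<sigma>) x \<partial>?L) = (\<integral>x. weak_grad \<Omega> u x \<bullet> gradient (R \<sigma>) x \<partial>?L)
      - (\<integral>x. gradient (R U) x \<bullet> gradient (R \<sigma>) x \<partial>?L) - (L2_norm ?L (gradient (R \<sigma>)))\<^sup>2"
  proof -
    have "AE x in ?L. G s x \<bullet> gradient (R \<sigma>) x = weak_grad \<Omega> u x \<bullet> gradient (R \<sigma>) x
        - gradient (R U) x \<bullet> gradient (R \<sigma>) x - gradient (R \<sigma>) x \<bullet> gradient (R \<sigma>) x"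
      using GAE[OF s] gradient_R_add[OF U \<sigma>] unfolding sU[symmetric]
      by eventually_elim (simp add: inner_diff_left inner_add_left)
    then have "(\<integral>x. G s x \<bullet> gradient (R \<sigma>) x \<partial>?L) = (\<integral>x. weak_grad \<Omega> u x \<bullet> gradient (R \<sigma>) x
        - gradient (R U) x \<bullet> gradient (R \<sigma>) x - gradient (R \<sigma>) x \<bullet> gradient (R \<sigma>) x \<partial>?L)"
      by (rule integral_lebesgue_on_cong_AE[OF sets_A])
    also have "\<dots> = (\<integral>x. weak_grad \<Omega> u x \<bullet> gradient (R \<sigma>) x \<partial>?L)
      - (\<integral>x. gradient (R U) x \<bullet> gradient (R \<sigma>) x \<partial>?L) - (\<integral>x. gradient (R \<sigma>) x \<bullet> gradient (R \<sigma>) x \<partial>?L)"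
      using L2_integrable_inner[OF Lu LR[OF \<sigma>]] L2_integrable_inner[OF LR[OF U] LR[OF \<sigma>]] L2_integrable_inner[OF LR[OF \<sigma>] LR[OF \<sigma>]]
      by simp
    also have "(\<integral>x. gradient (R \<sigma>) x \<bullet> gradient (R \<sigma>) x \<partial>?L) = (L2_norm ?L (gradient (R \<sigma>)))\<^sup>2"
      unfolding L2_norm_sq by (simp add: dot_square_norm)
    finally show ?thesis .
  qed
  \<comment> \<open>Expanding both stabilization terms around \<open>U\<close> leaves
    \<open>- 2 * \<theta> U \<sigma> - \<theta> \<sigma> \<sigma>\<close>. The first joins the
    gradient pairing of \<open>R U\<close> and \<open>R \<sigma>\<close>, and \<open>eqU\<close>
    trades the pair for the pairing with \<open>E \<sigma>\<close>; the second completes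
    \<open>- c\<^sup>2\<close>.\<close>
  have key: "a\<^sup>2 = m\<^sup>2 + 2 * (\<integral>x. G s x \<bullet> D x \<partial>?L) - c\<^sup>2"
    unfolding a(1) m(1) c(1) GU GsD uD Gs \<theta>(1) using eqU by simp

  have C0: "0 \<le> C" and CD: "L2_norm ?L (broken_grad M (R \<sigma> - E \<sigma>)) \<le> C * c"
    using C \<sigma> unfolding consistency_bounds_def c_def by blast+
  have "AE x in ?L. broken_grad M (R \<sigma> - E \<sigma>) x = D x"
    using broken_grad_AE[OF w R_broken[OF \<sigma>], of "- 1"] by (simp add: D_def fun_diff_def)
  then have "L2_norm ?L D \<le> C * c" using CD L2_norm_lebesgue_on_cong_AE[OF sets_A] by metis
  moreover have "L2_norm ?L (G s) \<le> m"
    by (rule power2_le_imp_le) (use m theta_nonneg[of s] in auto)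
  ultimately have "(\<integral>x. G s x \<bullet> D x \<partial>?L) \<le> m * (C * c)"
    using L2_Cauchy_Schwarz[OF LG[OF s] LD] mult_mono[of "L2_norm ?L (G s)" m "L2_norm ?L D" "C * c"] m(2) by simp
  then have "a\<^sup>2 \<le> m\<^sup>2 + 2 * (C * m) * c - c\<^sup>2" unfolding key by (simp add: mult_ac)
  \<comment> \<open>The difference of the two sides is \<open>(C * m - c)\<^sup>2\<close>.\<close>
  also have "\<dots> \<le> (1 + C\<^sup>2) * m\<^sup>2"
    using zero_le_power2[of "C * m - c"] by (simp add: power2_eq_square algebra_simps)
  finally have "a\<^sup>2 \<le> (sqrt (1 + C\<^sup>2) * m)\<^sup>2" by (simp add: power_mult_distrib)
  then show ?thesis
    unfolding a_def[symmetric] m_def[symmetric] by (rule power2_le_imp_le) (use m(2) in simp)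
qed

end

theorem proposition4p5:
  fixes \<Omega> :: "(real^'d) set" and M :: "(real^'d) set set" and p :: nat
    and E :: "'d hybrid \<Rightarrow> real^'d \<Rightarrow> real"
    and f :: "(real^'d \<Rightarrow> real) \<Rightarrow> real"
    and u :: "real^'d \<Rightarrow> real" and U :: "'d hybrid" and C\<^sub>H :: real
  assumes "CARD('d) = 2 \<or> CARD('d) = 3"
    and "polyhedral_domain \<Omega>"
    and "matching_mesh \<Omega> M"
    and "linear_smoother \<Omega> M p E"
    and "preserves_moments \<Omega> M p E"
    and "f \<in> Hm1 \<Omega>"
    and "u \<in> H10 \<Omega>"
    and "\<forall>w\<in>H10 \<Omega>. (\<integral>x. weak_grad \<Omega> u x \<bullet> weak_grad \<Omega> w x \<partial>lebesgue_on \<Omega>) = f w"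
    and "U \<in> hho_space \<Omega> M p"
    and "\<forall>s\<in>hho_space \<Omega> M p. hho_form \<Omega> M p U s = f (E s)"
    and "C\<^sub>H \<in> consistency_bounds \<Omega> M p E"
    and "\<forall>C\<in>consistency_bounds \<Omega> M p E. C\<^sub>H \<le> C"
  shows "ext_norm \<Omega> M p ((u, skeleton_trace \<Omega> M u) - U)
           \<le> sqrt (1 + C\<^sub>H\<^sup>2) * (INF s\<in>hho_space \<Omega> M p. ext_norm \<Omega> M p ((u, skeleton_trace \<Omega> M u) - s))"
proof -
  interpret polytopal_mesh \<Omega> M by (rule matching_mesh_polytopal[OF assms(2,3)])
  interpret hho_method \<Omega> M p ..
  have pos: "0 < sqrt (1 + C\<^sub>H\<^sup>2)" by (simp add: add_pos_nonneg)
  \<comment> \<open>Dividing by the positive factor turns the estimate for each \<open>s\<close>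
    into a lower bound of the set whose infimum is taken.\<close>
  have "ext_norm \<Omega> M p ((u, skeleton_trace \<Omega> M u) - U) / sqrt (1 + C\<^sub>H\<^sup>2)
      \<le> (INF s\<in>hho_space \<Omega> M p. ext_norm \<Omega> M p ((u, skeleton_trace \<Omega> M u) - s))"
  proof (rule cINF_greatest)
    show "hho_space \<Omega> M p \<noteq> {}" using S\<^sub>H_zero by blast
    fix s assume "s \<in> hho_space \<Omega> M p"
    then show "ext_norm \<Omega> M p ((u, skeleton_trace \<Omega> M u) - U) / sqrt (1 + C\<^sub>H\<^sup>2) \<le> ext_norm \<Omega> M p ((u, skeleton_trace \<Omega> M u) - s)"
      using quasi_optimality[OF assms(4,5,7,8,9,10,11)] pos by (simp add: pos_divide_le_eq mult.commute)
  qed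
  then show ?thesis using pos by (simp add: pos_divide_le_eq mult.commute)
qed

end
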